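(* Let $E$ and $E'$ be real vector bundles of even rank over a complex manifold $(M,I)$, equipped respectively with fiberwise metrics $g$ and $g'$ and with connections $\nabla$ and $\nabla'$ satisfying $\nabla g=0$, $\nabla'g'=0$, whose curvatures are $(1,1)$ with respect to $I$. Let $A:(E_{\mathbb{C}},\nabla^{0,1})\to(E'_{\mathbb{C}},\nabla'^{0,1})$ be an isomorphism of holomorphic vector bundles that is orthogonal with respect to (the $\mathbb{C}$-bilinear extensions of) $g$ and $g'$. Then $A$ induces, by sending $J$ to the element $J'$ with $E'^{0,1}_{J'}=A(E^{0,1}_J)$, a fiber preserving biholomorphism between $(\mathcal{T}(E,g),\mathcal{J}^{(\nabla,I)})$ and $(\mathcal{T}(E',g'),\mathcal{J}^{(\nabla',I)})$.
   Context: Fiberwise metrics are positive definite. The curvature of $\nabla$ is $(1,1)$ if $R^\nabla(Iv,Iw)=R^\nabla(v,w)$ for all $v,w$. $E_{\mathbb{C}}=E\otimes_{\mathbb{R}}\mathbb{C}$, with $\nabla$ extended $\mathbb{C}$-linearly; when the curvature is $(1,1)$, $\nabla^{0,1}$ is a $\overline{\partial}$-operator, so $(E_{\mathbb{C}},\nabla^{0,1})$ is a holomorphic bundle. $A$ is not assumed to be the extension of a real bundle map. $\mathcal{T}=\mathcal{T}(E,g)=\{J\in\mathrm{End}\,E:J^2=-1,\ g(J\cdot,J\cdot)=g(\cdot,\cdot)\}$ with projection $\pi$ to $M$, and $E^{0,1}_J$ is the $-i$ eigenspace of $J$ in $(E_{\pi(J)})\otimes\mathbb{C}$ (a maximal isotropic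 subspace; every maximal isotropic subspace arises from a unique $J$). $T_J\mathcal{T}=V_J\mathcal{T}\oplus H^\nabla_J\mathcal{T}$, where $V_J\mathcal{T}=\{B\in\mathfrak{o}(E_{\pi(J)},g):BJ+JB=0\}$ is the vertical space and $H^\nabla_J\mathcal{T}$ is the set of velocities at $t=0$ of $\nabla$-parallel translates of $J$ along curves in $M$ starting at $\pi(J)$; $v^\nabla$ denotes the horizontal lift of $v\in T_{\pi(J)}M$. $\mathcal{J}^{(\nabla,I)}$ is defined by $\mathcal{J}^{(\nabla,I)}B=JB$ for $B\in V_J\mathcal{T}$ and $\mathcal{J}^{(\nabla,I)}v^\nabla=(Iv)^\nabla$; it is an integrable complex structure because the curvature is $(1,1)$. *)

theory Defs
  imports "HOL-Analysis.Analysis"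
begin

section \<open>Smooth and holomorphic maps between open subsets of vector spaces\<close>

primrec Ck_on :: "nat \<Rightarrow> 'a::real_normed_vector set \<Rightarrow> ('a \<Rightarrow> 'b::real_normed_vector) \<Rightarrow> bool" where
  "Ck_on 0 S f \<longleftrightarrow> continuous_on S f"
| "Ck_on (Suc k) S f \<longleftrightarrow>
     (\<forall>x\<in>S. f differentiable (at x)) \<and> (\<forall>v. Ck_on k S (\<lambda>x. frechet_derivative f (at x) v))"

text \<open>Only used for open \<open>S\<close>, because of the two-sided \<open>at x\<close>.\<close>
definition smooth_on :: "'a::real_normed_vector set \<Rightarrow> ('a \<Rightarrow> 'b::real_normed_vector) \<Rightarrow> bool" where
  "smooth_on S f \<longleftrightarrow> (\<forall>k. Ck_on k S f)"

text \<open>Smooth maps satisfying the Cauchy--Riemann equations.\<close>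
definition holomorphic_map_on ::
    "(complex ^ 'n::finite) set \<Rightarrow> (complex ^ 'n \<Rightarrow> complex ^ 'n) \<Rightarrow> bool" where
  "holomorphic_map_on W \<tau> \<longleftrightarrow> smooth_on W \<tau> \<and>
     (\<forall>x\<in>W. \<forall>v. frechet_derivative \<tau> (at x) (\<i> *s v) = \<i> *s frechet_derivative \<tau> (at x) v)"


section \<open>Germs, velocities, differentials\<close>

text \<open>
  A space \<open>X\<close> is equipped with a predicate \<open>sm x f\<close>: the real function \<open>f\<close> is smooth near \<open>x\<close>.
  A tangent vector at \<open>x\<close> is the directional derivative along a smooth curve through \<open>x\<close>,
  acting on functions that are smooth near \<open>x\<close> and set to \<open>0\<close> on all other functions.
  The vector space operations are the pointwise ones.
\<close>

type_synonym 'x tvec = "('x \<Rightarrow> real) \<Rightarrow> real"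

definition tadd :: "'x tvec \<Rightarrow> 'x tvec \<Rightarrow> 'x tvec" where
  "tadd v w = (\<lambda>f. v f + w f)"

definition tscale :: "real \<Rightarrow> 'x tvec \<Rightarrow> 'x tvec" where
  "tscale a v = (\<lambda>f. a * v f)"

definition velocity :: "('x \<Rightarrow> ('x \<Rightarrow> real) \<Rightarrow> bool) \<Rightarrow> (real \<Rightarrow> 'x) \<Rightarrow> real \<Rightarrow> 'x tvec" where
  "velocity sm \<gamma> t = (\<lambda>f. if sm (\<gamma> t) f then deriv (\<lambda>s. f (\<gamma> s)) t else 0)"

text \<open>The differential of \<open>F\<close> at \<open>x\<close>; \<open>sm'\<close> belongs to the target of \<open>F\<close>.\<close>
definition pushforward :: "('y \<Rightarrow> ('y \<Rightarrow> real) \<Rightarrow> bool) \<Rightarrow> ('x \<Rightarrow> 'y) \<Rightarrow> 'x \<Rightarrow> 'x tvec \<Rightarrow> 'y tvec" where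
  "pushforward sm' F x v = (\<lambda>f. if sm' (F x) f then v (f \<circ> F) else 0)"

text \<open>
  Smoothness by pulling back germs. Continuity of \<open>F\<close> is implied, since a function that is
  smooth near \<open>F x\<close> is unconstrained away from \<open>F x\<close>.
\<close>
definition smooth_map ::
    "'x set \<Rightarrow> ('x \<Rightarrow> ('x \<Rightarrow> real) \<Rightarrow> bool) \<Rightarrow> 'y set \<Rightarrow> ('y \<Rightarrow> ('y \<Rightarrow> real) \<Rightarrow> bool) \<Rightarrow> ('x \<Rightarrow> 'y) \<Rightarrow> bool" where
  "smooth_map X sm Y sm' F \<longleftrightarrow>
     F ` X \<subseteq> Y \<and> (\<forall>x\<in>X. \<forall>f. sm' (F x) f \<longrightarrow> sm x (f \<circ> F))"

text \<open>
  A biholomorphism between \<open>(X, \<J>)\<close> and \<open>(Y, \<J>')\<close>, where \<open>T x\<close> is the tangent space at \<open>x\<close>: a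
  diffeomorphism whose differential intertwines the complex structures.
\<close>
definition biholomorphism ::
    "'x set \<Rightarrow> ('x \<Rightarrow> ('x \<Rightarrow> real) \<Rightarrow> bool) \<Rightarrow> ('x \<Rightarrow> 'x tvec set) \<Rightarrow> ('x \<Rightarrow> 'x tvec \<Rightarrow> 'x tvec) \<Rightarrow>
     'y set \<Rightarrow> ('y \<Rightarrow> ('y \<Rightarrow> real) \<Rightarrow> bool) \<Rightarrow> ('y \<Rightarrow> 'y tvec \<Rightarrow> 'y tvec) \<Rightarrow> ('x \<Rightarrow> 'y) \<Rightarrow> bool" where
  "biholomorphism X sm T \<J> Y sm' \<J>' F \<longleftrightarrow>
     bij_betw F X Y \<and> smooth_map X sm Y sm' F \<and> smooth_map Y sm' X sm (inv_into X F) \<and>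
     (\<forall>x\<in>X. \<forall>v\<in>T x. pushforward sm' F x (\<J> x v) = \<J>' (F x) (pushforward sm' F x v))"


section \<open>Complex manifolds\<close>

text \<open>
  The points of the manifold are all the elements of the type \<open>'m\<close>. The model is the coordinate
  subspace of \<open>complex ^ 'n\<close> on the index set \<open>cindex\<close>; it is all of \<open>complex ^ 'n\<close> for
  \<open>cindex = UNIV\<close>, and an empty \<open>cindex\<close> admits complex dimension \<open>0\<close>.
\<close>
record ('m, 'n) cmanifold =
  cindex :: "'n set"
  atlas :: "('m set \<times> ('m \<Rightarrow> complex ^ 'n)) set"

definition cmodel :: "('m, 'n::finite) cmanifold \<Rightarrow> (complex ^ 'n) set" where
  "cmodel M = {x. \<forall>k. k \<notin> cindex M \<longrightarrow> x $ k = 0}"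

definition complex_manifold ::
    "('m::{t2_space,second_countable_topology}, 'n::finite) cmanifold \<Rightarrow> bool" where
  "complex_manifold M \<longleftrightarrow>
     (\<Union>(U, z)\<in>atlas M. U) = UNIV \<and>
     (\<forall>(U, z)\<in>atlas M. open U \<and> openin (top_of_set (cmodel M)) (z ` U) \<and>
        homeomorphism U (z ` U) z (inv_into U z)) \<and>
     (\<forall>(U, z)\<in>atlas M. \<forall>(V, w)\<in>atlas M. \<forall>p\<in>U \<inter> V. \<exists>W \<tau>. open W \<and> z p \<in> W \<and>
        holomorphic_map_on W \<tau> \<and> (\<forall>\<^sub>F q in nhds p. w q = \<tau> (z q)))"

definition smooth_near ::
    "('m::topological_space, 'n::finite) cmanifold \<Rightarrow> 'm \<Rightarrow> ('m \<Rightarrow> real) \<Rightarrow> bool" where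
  "smooth_near M p f \<longleftrightarrow> (\<exists>(U, z)\<in>atlas M. p \<in> U \<and>
     (\<exists>W G. open W \<and> z p \<in> W \<and> smooth_on W G \<and> (\<forall>\<^sub>F q in nhds p. f q = G (z q))))"

definition smooth_curve ::
    "('m::topological_space, 'n::finite) cmanifold \<Rightarrow> real set \<Rightarrow> (real \<Rightarrow> 'm) \<Rightarrow> bool" where
  "smooth_curve M S \<gamma> \<longleftrightarrow> continuous_on S \<gamma> \<and>
     (\<forall>(U, z)\<in>atlas M. smooth_on {t\<in>S. \<gamma> t \<in> U} (\<lambda>t. z (\<gamma> t)))"

definition tangent ::
    "('m::topological_space, 'n::finite) cmanifold \<Rightarrow> 'm \<Rightarrow> 'm tvec set" where
  "tangent M p = {velocity (smooth_near M) \<gamma> 0 | \<gamma> \<epsilon>.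
     \<epsilon> > 0 \<and> smooth_curve M {-\<epsilon><..<\<epsilon>} \<gamma> \<and> \<gamma> 0 = p}"

text \<open>The components of a tangent vector in the complex coordinates \<open>z\<close>.\<close>
definition dcoord :: "('m \<Rightarrow> complex ^ 'n::finite) \<Rightarrow> 'm tvec \<Rightarrow> complex ^ 'n" where
  "dcoord z v = (\<chi> k. Complex (v (\<lambda>q. Re (z q $ k))) (v (\<lambda>q. Im (z q $ k))))"

text \<open>The complex structure \<open>I\<close>: multiplication by \<open>\<i>\<close> in holomorphic coordinates.\<close>
definition cstruct ::
    "('m::topological_space, 'n::finite) cmanifold \<Rightarrow> 'm \<Rightarrow> 'm tvec \<Rightarrow> 'm tvec" where
  "cstruct M p v = (THE w. w \<in> tangent M p \<and>
     (\<forall>(U, z)\<in>atlas M. p \<in> U \<longrightarrow> dcoord z w = \<i> *s dcoord z v))"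

definition smooth_field_near ::
    "('m::topological_space, 'n::finite) cmanifold \<Rightarrow> 'm \<Rightarrow> ('m \<Rightarrow> 'm tvec) \<Rightarrow> bool" where
  "smooth_field_near M p X \<longleftrightarrow> (\<forall>\<^sub>F q in nhds p. X q \<in> tangent M q) \<and>
     (\<forall>f. smooth_near M p f \<longrightarrow> smooth_near M p (\<lambda>q. X q f))"

definition lie_bracket ::
    "('m::topological_space, 'n::finite) cmanifold \<Rightarrow> ('m \<Rightarrow> 'm tvec) \<Rightarrow> ('m \<Rightarrow> 'm tvec) \<Rightarrow> 'm \<Rightarrow> 'm tvec" where
  "lie_bracket M X Y p = (\<lambda>f. if smooth_near M p f
     then X p (\<lambda>q. Y q f) - Y p (\<lambda>q. X q f) else 0)"


section \<open>Real vector bundles with metric and connection\<close>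

text \<open>
  The fibres are arbitrary finite-dimensional real vector spaces, carried by subspaces of a type
  \<open>'v::real_vector\<close>; nothing relates the fibres over different points inside \<open>'v\<close>, which has no
  topology, so this is no restriction (any family of vector spaces embeds in its direct sum).
  The bundle structure is given by a family of local frames with smooth transition matrices. The
  frames are indexed by a subset \<open>bindex\<close> of \<open>'k\<close>, so that rank \<open>0\<close> is included.
\<close>
record ('m, 'v, 'k) vbundle =
  bindex :: "'k set"
  fibre :: "'m \<Rightarrow> 'v set"
  frames :: "('m set \<times> ('k \<Rightarrow> 'm \<Rightarrow> 'v)) set"

definition bundle_rank :: "('m, 'v, 'k::finite) vbundle \<Rightarrow> nat" where
  "bundle_rank E = card (bindex E)"

definition coef :: "('m, 'v::real_vector, 'k) vbundle \<Rightarrow> ('k \<Rightarrow> 'm \<Rightarrow> 'v) \<Rightarrow> 'm \<Rightarrow> 'v \<Rightarrow> 'k \<Rightarrow> real" where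
  "coef E s p e i = representation ((\<lambda>i. s i p) ` bindex E) e (s i p)"

definition vector_bundle ::
    "('m::topological_space, 'n::finite) cmanifold \<Rightarrow> ('m, 'v::real_vector, 'k::finite) vbundle \<Rightarrow> bool" where
  "vector_bundle M E \<longleftrightarrow>
     (\<forall>p. subspace (fibre E p)) \<and>
     (\<Union>(V, s)\<in>frames E. V) = UNIV \<and>
     (\<forall>(V, s)\<in>frames E. open V \<and>
        (\<forall>p\<in>V. inj_on (\<lambda>i. s i p) (bindex E) \<and> independent ((\<lambda>i. s i p) ` bindex E) \<and>
               span ((\<lambda>i. s i p) ` bindex E) = fibre E p)) \<and>
     (\<forall>(V, s)\<in>frames E. \<forall>(V', s')\<in>frames E. \<forall>p\<in>V \<inter> V'. \<forall>i\<in>bindex E. \<forall>j\<in>bindex E.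
        smooth_near M p (\<lambda>q. coef E s' q (s j q) i))"

definition smooth_section_near ::
    "('m::topological_space, 'n::finite) cmanifold \<Rightarrow> ('m, 'v::real_vector, 'k::finite) vbundle \<Rightarrow>
     'm \<Rightarrow> ('m \<Rightarrow> 'v) \<Rightarrow> bool" where
  "smooth_section_near M E p \<sigma> \<longleftrightarrow> (\<forall>\<^sub>F q in nhds p. \<sigma> q \<in> fibre E q) \<and>
     (\<forall>(V, s)\<in>frames E. p \<in> V \<longrightarrow> (\<forall>i\<in>bindex E. smooth_near M p (\<lambda>q. coef E s q (\<sigma> q) i)))"

definition fibre_metric ::
    "('m::topological_space, 'n::finite) cmanifold \<Rightarrow> ('m, 'v::real_vector, 'k::finite) vbundle \<Rightarrow>
     ('m \<Rightarrow> 'v \<Rightarrow> 'v \<Rightarrow> real) \<Rightarrow> bool" where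
  "fibre_metric M E g \<longleftrightarrow>
     (\<forall>p. \<forall>x\<in>fibre E p. \<forall>y\<in>fibre E p. \<forall>z\<in>fibre E p. \<forall>a.
        g p x y = g p y x \<and> g p (x + y) z = g p x z + g p y z \<and>
        g p (a *\<^sub>R x) y = a * g p x y \<and> (x \<noteq> 0 \<longrightarrow> g p x x > 0)) \<and>
     (\<forall>p \<sigma> \<tau>. smooth_section_near M E p \<sigma> \<and> smooth_section_near M E p \<tau> \<longrightarrow>
        smooth_near M p (\<lambda>q. g q (\<sigma> q) (\<tau> q)))"

text \<open>\<open>D p v \<sigma>\<close> is \<open>\<nabla>\<^sub>v \<sigma>\<close> for \<open>v\<close> tangent at \<open>p\<close> and a section \<open>\<sigma>\<close> that is smooth near \<open>p\<close>.\<close>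
type_synonym ('m, 'v) connection = "'m \<Rightarrow> 'm tvec \<Rightarrow> ('m \<Rightarrow> 'v) \<Rightarrow> 'v"

definition is_connection ::
    "('m::topological_space, 'n::finite) cmanifold \<Rightarrow> ('m, 'v::real_vector, 'k::finite) vbundle \<Rightarrow>
     ('m, 'v) connection \<Rightarrow> bool" where
  "is_connection M E D \<longleftrightarrow>
     (\<forall>p. \<forall>v\<in>tangent M p. \<forall>w\<in>tangent M p. \<forall>a. \<forall>\<sigma> \<tau> f.
        smooth_section_near M E p \<sigma> \<and> smooth_section_near M E p \<tau> \<and> smooth_near M p f \<longrightarrow>
        D p v \<sigma> \<in> fibre E p \<and>
        ((\<forall>\<^sub>F q in nhds p. \<sigma> q = \<tau> q) \<longrightarrow> D p v \<sigma> = D p v \<tau>) \<and>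
        D p (tadd v w) \<sigma> = D p v \<sigma> + D p w \<sigma> \<and>
        D p (tscale a v) \<sigma> = a *\<^sub>R D p v \<sigma> \<and>
        D p v (\<lambda>q. \<sigma> q + \<tau> q) = D p v \<sigma> + D p v \<tau> \<and>
        D p v (\<lambda>q. f q *\<^sub>R \<sigma> q) = v f *\<^sub>R \<sigma> p + f p *\<^sub>R D p v \<sigma>) \<and>
     (\<forall>p X \<sigma>. smooth_field_near M p X \<and> smooth_section_near M E p \<sigma> \<longrightarrow>
        smooth_section_near M E p (\<lambda>q. D q (X q) \<sigma>))"

text \<open>\<open>\<nabla>g = 0\<close>\<close>
definition metric_connection ::
    "('m::topological_space, 'n::finite) cmanifold \<Rightarrow> ('m, 'v::real_vector, 'k::finite) vbundle \<Rightarrow>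
     ('m \<Rightarrow> 'v \<Rightarrow> 'v \<Rightarrow> real) \<Rightarrow> ('m, 'v) connection \<Rightarrow> bool" where
  "metric_connection M E g D \<longleftrightarrow>
     (\<forall>p. \<forall>v\<in>tangent M p. \<forall>\<sigma> \<tau>. smooth_section_near M E p \<sigma> \<and> smooth_section_near M E p \<tau> \<longrightarrow>
        v (\<lambda>q. g q (\<sigma> q) (\<tau> q)) = g p (D p v \<sigma>) (\<tau> p) + g p (\<sigma> p) (D p v \<tau>))"

definition curvature ::
    "('m::topological_space, 'n::finite) cmanifold \<Rightarrow> ('m, 'v::real_vector) connection \<Rightarrow>
     ('m \<Rightarrow> 'm tvec) \<Rightarrow> ('m \<Rightarrow> 'm tvec) \<Rightarrow> ('m \<Rightarrow> 'v) \<Rightarrow> 'm \<Rightarrow> 'v" where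
  "curvature M D X Y \<sigma> p =
     D p (X p) (\<lambda>q. D q (Y q) \<sigma>) - D p (Y p) (\<lambda>q. D q (X q) \<sigma>) - D p (lie_bracket M X Y p) \<sigma>"

definition curvature_11 ::
    "('m::topological_space, 'n::finite) cmanifold \<Rightarrow> ('m, 'v::real_vector, 'k::finite) vbundle \<Rightarrow>
     ('m, 'v) connection \<Rightarrow> bool" where
  "curvature_11 M E D \<longleftrightarrow>
     (\<forall>p X Y \<sigma>. smooth_field_near M p X \<and> smooth_field_near M p Y \<and> smooth_section_near M E p \<sigma> \<longrightarrow>
        curvature M D (\<lambda>q. cstruct M q (X q)) (\<lambda>q. cstruct M q (Y q)) \<sigma> p = curvature M D X Y \<sigma> p)"


section \<open>The complexified bundle\<close>

text \<open>\<open>(a, b)\<close> stands for \<open>a \<otimes> 1 + b \<otimes> \<i>\<close>; \<open>imul\<close> is multiplication by \<open>\<i>\<close>.\<close>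

definition cfibre :: "('m, 'v, 'k) vbundle \<Rightarrow> 'm \<Rightarrow> ('v \<times> 'v) set" where
  "cfibre E p = fibre E p \<times> fibre E p"

definition imul :: "'v::real_vector \<times> 'v \<Rightarrow> 'v \<times> 'v" where
  "imul x = (- snd x, fst x)"

definition cbilinear :: "('v \<Rightarrow> 'v \<Rightarrow> real) \<Rightarrow> 'v \<times> 'v \<Rightarrow> 'v \<times> 'v \<Rightarrow> complex" where
  "cbilinear b x y = Complex (b (fst x) (fst y) - b (snd x) (snd y))
                             (b (fst x) (snd y) + b (snd x) (fst y))"

definition smooth_csection_near ::
    "('m::topological_space, 'n::finite) cmanifold \<Rightarrow> ('m, 'v::real_vector, 'k::finite) vbundle \<Rightarrow>
     'm \<Rightarrow> ('m \<Rightarrow> 'v \<times> 'v) \<Rightarrow> bool" where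
  "smooth_csection_near M E p \<sigma> \<longleftrightarrow>
     smooth_section_near M E p (\<lambda>q. fst (\<sigma> q)) \<and> smooth_section_near M E p (\<lambda>q. snd (\<sigma> q))"

definition cconn :: "('m, 'v) connection \<Rightarrow> 'm \<Rightarrow> 'm tvec \<Rightarrow> ('m \<Rightarrow> 'v \<times> 'v) \<Rightarrow> 'v \<times> 'v" where
  "cconn D p v \<sigma> = (D p v (\<lambda>q. fst (\<sigma> q)), D p v (\<lambda>q. snd (\<sigma> q)))"

definition conn01 ::
    "('m::topological_space, 'n::finite) cmanifold \<Rightarrow> ('m, 'v::real_vector) connection \<Rightarrow>
     'm \<Rightarrow> 'm tvec \<Rightarrow> ('m \<Rightarrow> 'v \<times> 'v) \<Rightarrow> 'v \<times> 'v" where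
  "conn01 M D p v \<sigma> = (1/2) *\<^sub>R (cconn D p v \<sigma> + imul (cconn D p (cstruct M p v) \<sigma>))"

text \<open>
  Isomorphisms \<open>(E\<^sub>\<complex>, \<nabla>\<^sup>0\<^sup>,\<^sup>1) \<rightarrow> (E'\<^sub>\<complex>, \<nabla>'\<^sup>0\<^sup>,\<^sup>1)\<close> of holomorphic bundles, the holomorphic structures being given
  by their Dolbeault operators: smooth complex bundle isomorphisms intertwining these operators.
\<close>
definition holomorphic_bundle_iso ::
    "('m::topological_space, 'n::finite) cmanifold \<Rightarrow>
     ('m, 'v::real_vector, 'k::finite) vbundle \<Rightarrow> ('m, 'v) connection \<Rightarrow>
     ('m, 'w::real_vector, 'l::finite) vbundle \<Rightarrow> ('m, 'w) connection \<Rightarrow>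
     ('m \<Rightarrow> 'v \<times> 'v \<Rightarrow> 'w \<times> 'w) \<Rightarrow> bool" where
  "holomorphic_bundle_iso M E D E' D' A \<longleftrightarrow>
     (\<forall>p. bij_betw (A p) (cfibre E p) (cfibre E' p)) \<and>
     (\<forall>p. \<forall>x\<in>cfibre E p. \<forall>y\<in>cfibre E p. \<forall>a.
        A p (x + y) = A p x + A p y \<and> A p (a *\<^sub>R x) = a *\<^sub>R A p x \<and> A p (imul x) = imul (A p x)) \<and>
     (\<forall>p \<sigma>. smooth_csection_near M E p \<sigma> \<longrightarrow> smooth_csection_near M E' p (\<lambda>q. A q (\<sigma> q))) \<and>
     (\<forall>p. \<forall>v\<in>tangent M p. \<forall>\<sigma>. smooth_csection_near M E p \<sigma> \<longrightarrow>
        conn01 M D' p v (\<lambda>q. A q (\<sigma> q)) = A p (conn01 M D p v \<sigma>))"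

definition complex_orthogonal ::
    "('m, 'v, 'k) vbundle \<Rightarrow> ('m \<Rightarrow> 'v \<Rightarrow> 'v \<Rightarrow> real) \<Rightarrow> ('m \<Rightarrow> 'w \<Rightarrow> 'w \<Rightarrow> real) \<Rightarrow>
     ('m \<Rightarrow> 'v \<times> 'v \<Rightarrow> 'w \<times> 'w) \<Rightarrow> bool" where
  "complex_orthogonal E g g' A \<longleftrightarrow>
     (\<forall>p. \<forall>x\<in>cfibre E p. \<forall>y\<in>cfibre E p. cbilinear (g' p) (A p x) (A p y) = cbilinear (g p) x y)"


section \<open>The twistor space\<close>

text \<open>Endomorphisms of a fibre are represented by functions vanishing off that fibre.\<close>
definition End_fibre :: "('m, 'v::real_vector, 'k) vbundle \<Rightarrow> 'm \<Rightarrow> ('v \<Rightarrow> 'v) set" where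
  "End_fibre E p = {J. (\<forall>x\<in>fibre E p. J x \<in> fibre E p) \<and> (\<forall>x. x \<notin> fibre E p \<longrightarrow> J x = 0) \<and>
     (\<forall>x\<in>fibre E p. \<forall>y\<in>fibre E p. \<forall>a. J (x + y) = J x + J y \<and> J (a *\<^sub>R x) = a *\<^sub>R J x)}"

definition twistor ::
    "('m, 'v::real_vector, 'k) vbundle \<Rightarrow> ('m \<Rightarrow> 'v \<Rightarrow> 'v \<Rightarrow> real) \<Rightarrow> ('m \<times> ('v \<Rightarrow> 'v)) set" where
  "twistor E g = {(p, J). J \<in> End_fibre E p \<and> (\<forall>x\<in>fibre E p. J (J x) = - x) \<and>
     (\<forall>x\<in>fibre E p. \<forall>y\<in>fibre E p. g p (J x) (J y) = g p x y)}"

definition E01 :: "('m, 'v::real_vector, 'k) vbundle \<Rightarrow> 'm \<times> ('v \<Rightarrow> 'v) \<Rightarrow> ('v \<times> 'v) set" where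
  "E01 E = (\<lambda>(p, J). {x\<in>cfibre E p. (J (fst x), J (snd x)) = - imul x})"

definition frame_matrix ::
    "('m, 'v::real_vector, 'k::finite) vbundle \<Rightarrow> ('k \<Rightarrow> 'm \<Rightarrow> 'v) \<Rightarrow> 'm \<Rightarrow> ('v \<Rightarrow> 'v) \<Rightarrow> real ^ 'k ^ 'k" where
  "frame_matrix E s p J =
     (\<chi> i j. if i \<in> bindex E \<and> j \<in> bindex E then coef E s p (J (s j p)) i else 0)"

text \<open>
  The twistor space is an embedded submanifold of the total space of \<open>End E\<close>: a function on it is
  smooth if locally it is the restriction of a smooth function of the coordinates on \<open>M\<close> and the
  matrix entries in a local frame.
\<close>
definition twistor_smooth_near ::
    "('m::topological_space, 'n::finite) cmanifold \<Rightarrow> ('m, 'v::real_vector, 'k::finite) vbundle \<Rightarrow>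
     ('m \<Rightarrow> 'v \<Rightarrow> 'v \<Rightarrow> real) \<Rightarrow> 'm \<times> ('v \<Rightarrow> 'v) \<Rightarrow> ('m \<times> ('v \<Rightarrow> 'v) \<Rightarrow> real) \<Rightarrow> bool" where
  "twistor_smooth_near M E g x f \<longleftrightarrow> (\<exists>(U, z)\<in>atlas M. \<exists>(V, s)\<in>frames E. fst x \<in> U \<inter> V \<and>
     (\<exists>W G. open W \<and> (z (fst x), frame_matrix E s (fst x) (snd x)) \<in> W \<and> smooth_on W G \<and>
        (\<forall>(q, J)\<in>twistor E g. q \<in> U \<inter> V \<and> (z q, frame_matrix E s q J) \<in> W \<longrightarrow>
           f (q, J) = G (z q, frame_matrix E s q J))))"

definition twistor_curve ::
    "('m::topological_space, 'n::finite) cmanifold \<Rightarrow> ('m, 'v::real_vector, 'k::finite) vbundle \<Rightarrow>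
     ('m \<Rightarrow> 'v \<Rightarrow> 'v \<Rightarrow> real) \<Rightarrow> real set \<Rightarrow> (real \<Rightarrow> 'm \<times> ('v \<Rightarrow> 'v)) \<Rightarrow> bool" where
  "twistor_curve M E g S \<Gamma> \<longleftrightarrow>
     (\<forall>t\<in>S. \<Gamma> t \<in> twistor E g) \<and> smooth_curve M S (\<lambda>t. fst (\<Gamma> t)) \<and>
     (\<forall>(V, s)\<in>frames E. smooth_on {t\<in>S. fst (\<Gamma> t) \<in> V}
        (\<lambda>t. frame_matrix E s (fst (\<Gamma> t)) (snd (\<Gamma> t))))"

definition twistor_tangent ::
    "('m::topological_space, 'n::finite) cmanifold \<Rightarrow> ('m, 'v::real_vector, 'k::finite) vbundle \<Rightarrow>
     ('m \<Rightarrow> 'v \<Rightarrow> 'v \<Rightarrow> real) \<Rightarrow> 'm \<times> ('v \<Rightarrow> 'v) \<Rightarrow> ('m \<times> ('v \<Rightarrow> 'v)) tvec set" where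
  "twistor_tangent M E g x = {velocity (twistor_smooth_near M E g) \<Gamma> 0 | \<Gamma> \<epsilon>.
     \<epsilon> > 0 \<and> twistor_curve M E g {-\<epsilon><..<\<epsilon>} \<Gamma> \<and> \<Gamma> 0 = x}"

definition vertical ::
    "('m, 'v::real_vector, 'k) vbundle \<Rightarrow> ('m \<Rightarrow> 'v \<Rightarrow> 'v \<Rightarrow> real) \<Rightarrow> 'm \<times> ('v \<Rightarrow> 'v) \<Rightarrow> ('v \<Rightarrow> 'v) set" where
  "vertical E g = (\<lambda>(p, J). {B\<in>End_fibre E p.
     (\<forall>x\<in>fibre E p. \<forall>y\<in>fibre E p. g p (B x) y + g p x (B y) = 0) \<and>
     (\<forall>x\<in>fibre E p. B (J x) + J (B x) = 0)})"

text \<open>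
  The tangent vector given by \<open>B \<in> V\<^sub>J\<close>: the velocity of any curve in the fibre through \<open>J\<close> whose
  derivative at \<open>0\<close>, as a curve of endomorphisms, is \<open>B\<close>.
\<close>
definition vertical_vector ::
    "('m::topological_space, 'n::finite) cmanifold \<Rightarrow> ('m, 'v::real_vector, 'k::finite) vbundle \<Rightarrow>
     ('m \<Rightarrow> 'v \<Rightarrow> 'v \<Rightarrow> real) \<Rightarrow> 'm \<times> ('v \<Rightarrow> 'v) \<Rightarrow> ('v \<Rightarrow> 'v) \<Rightarrow> ('m \<times> ('v \<Rightarrow> 'v)) tvec" where
  "vertical_vector M E g x B = (THE v. \<exists>\<Gamma> \<epsilon>. \<epsilon> > 0 \<and>
     twistor_curve M E g {-\<epsilon><..<\<epsilon>} \<Gamma> \<and> \<Gamma> 0 = x \<and> (\<forall>t\<in>{-\<epsilon><..<\<epsilon>}. fst (\<Gamma> t) = fst x) \<and>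
     (\<forall>e\<in>fibre E (fst x). \<forall>e'\<in>fibre E (fst x).
        ((\<lambda>t. g (fst x) (snd (\<Gamma> t) e) e') has_real_derivative g (fst x) (B e) e') (at 0)) \<and>
     v = velocity (twistor_smooth_near M E g) \<Gamma> 0)"

definition smooth_section_along ::
    "('m::topological_space, 'v::real_vector, 'k::finite) vbundle \<Rightarrow> real set \<Rightarrow> (real \<Rightarrow> 'm) \<Rightarrow>
     (real \<Rightarrow> 'v) \<Rightarrow> bool" where
  "smooth_section_along E S \<gamma> e \<longleftrightarrow> (\<forall>t\<in>S. e t \<in> fibre E (\<gamma> t)) \<and>
     (\<forall>(V, s)\<in>frames E. \<forall>i\<in>bindex E. smooth_on {t\<in>S. \<gamma> t \<in> V} (\<lambda>t. coef E s (\<gamma> t) (e t) i))"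

text \<open>The covariant derivative along \<open>\<gamma>\<close> of \<open>e = (\<Sum>i. a\<^sub>i s\<^sub>i)\<close>, i.e. \<open>\<Sum>i. a\<^sub>i' s\<^sub>i + a\<^sub>i \<nabla>\<^bsub>\<gamma>'\<^esub> s\<^sub>i\<close>.\<close>
definition cov_deriv_along ::
    "('m::topological_space, 'n::finite) cmanifold \<Rightarrow> ('m, 'v::real_vector, 'k::finite) vbundle \<Rightarrow>
     ('m, 'v) connection \<Rightarrow> ('k \<Rightarrow> 'm \<Rightarrow> 'v) \<Rightarrow> (real \<Rightarrow> 'm) \<Rightarrow> (real \<Rightarrow> 'v) \<Rightarrow> real \<Rightarrow> 'v" where
  "cov_deriv_along M E D s \<gamma> e t = (\<Sum>i\<in>bindex E.
     deriv (\<lambda>r. coef E s (\<gamma> r) (e r) i) t *\<^sub>R s i (\<gamma> t) +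
     coef E s (\<gamma> t) (e t) i *\<^sub>R D (\<gamma> t) (velocity (smooth_near M) \<gamma> t) (s i))"

text \<open>
  \<open>\<Gamma>\<close> is parallel for the connection induced on \<open>End E\<close>: its covariant derivative
  \<open>e \<mapsto> \<nabla>(J e) - J (\<nabla>e)\<close> along the base curve vanishes.
\<close>
definition parallel_along ::
    "('m::topological_space, 'n::finite) cmanifold \<Rightarrow> ('m, 'v::real_vector, 'k::finite) vbundle \<Rightarrow>
     ('m, 'v) connection \<Rightarrow> real set \<Rightarrow> (real \<Rightarrow> 'm \<times> ('v \<Rightarrow> 'v)) \<Rightarrow> bool" where
  "parallel_along M E D S \<Gamma> \<longleftrightarrow> (let \<gamma> = (\<lambda>t. fst (\<Gamma> t)) in
     \<forall>e. smooth_section_along E S \<gamma> e \<longrightarrow>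
       (\<forall>t\<in>S. \<forall>(V, s)\<in>frames E. \<gamma> t \<in> V \<longrightarrow>
          cov_deriv_along M E D s \<gamma> (\<lambda>r. snd (\<Gamma> r) (e r)) t
            = snd (\<Gamma> t) (cov_deriv_along M E D s \<gamma> e t)))"

text \<open>The horizontal lift to \<open>x = (p, J)\<close> of a tangent vector of \<open>M\<close> at \<open>p\<close>.\<close>
definition horizontal_lift ::
    "('m::topological_space, 'n::finite) cmanifold \<Rightarrow> ('m, 'v::real_vector, 'k::finite) vbundle \<Rightarrow>
     ('m \<Rightarrow> 'v \<Rightarrow> 'v \<Rightarrow> real) \<Rightarrow> ('m, 'v) connection \<Rightarrow> 'm \<times> ('v \<Rightarrow> 'v) \<Rightarrow> 'm tvec \<Rightarrow>
     ('m \<times> ('v \<Rightarrow> 'v)) tvec" where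
  "horizontal_lift M E g D x w = (THE v. \<exists>\<Gamma> \<epsilon>. \<epsilon> > 0 \<and>
     twistor_curve M E g {-\<epsilon><..<\<epsilon>} \<Gamma> \<and> \<Gamma> 0 = x \<and> parallel_along M E D {-\<epsilon><..<\<epsilon>} \<Gamma> \<and>
     velocity (smooth_near M) (\<lambda>t. fst (\<Gamma> t)) 0 = w \<and>
     v = velocity (twistor_smooth_near M E g) \<Gamma> 0)"

text \<open>\<open>\<J>(B + w\<^sup>\<nabla>) = J B + (I w)\<^sup>\<nabla>\<close>\<close>
definition twistor_cstruct ::
    "('m::topological_space, 'n::finite) cmanifold \<Rightarrow> ('m, 'v::real_vector, 'k::finite) vbundle \<Rightarrow>
     ('m \<Rightarrow> 'v \<Rightarrow> 'v \<Rightarrow> real) \<Rightarrow> ('m, 'v) connection \<Rightarrow> 'm \<times> ('v \<Rightarrow> 'v) \<Rightarrow>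
     ('m \<times> ('v \<Rightarrow> 'v)) tvec \<Rightarrow> ('m \<times> ('v \<Rightarrow> 'v)) tvec" where
  "twistor_cstruct M E g D x v = (THE v'. \<exists>B\<in>vertical E g x. \<exists>w\<in>tangent M (fst x).
     v = tadd (vertical_vector M E g x B) (horizontal_lift M E g D x w) \<and>
     v' = tadd (vertical_vector M E g x (snd x \<circ> B))
               (horizontal_lift M E g D x (cstruct M (fst x) w)))"

text \<open>The point \<open>(p, J')\<close> of the second twistor space with \<open>E'\<^sup>0\<^sup>,\<^sup>1\<^bsub>J'\<^esub> = A(E\<^sup>0\<^sup>,\<^sup>1\<^bsub>J\<^esub>)\<close>.\<close>
definition induced_twistor_map ::
    "('m, 'v::real_vector, 'k) vbundle \<Rightarrow> ('m, 'w::real_vector, 'l) vbundle \<Rightarrow>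
     ('m \<Rightarrow> 'w \<Rightarrow> 'w \<Rightarrow> real) \<Rightarrow> ('m \<Rightarrow> 'v \<times> 'v \<Rightarrow> 'w \<times> 'w) \<Rightarrow>
     'm \<times> ('v \<Rightarrow> 'v) \<Rightarrow> 'm \<times> ('w \<Rightarrow> 'w)" where
  "induced_twistor_map E E' g' A x =
     (THE x'. x' \<in> twistor E' g' \<and> fst x' = fst x \<and> E01 E' x' = A (fst x) ` E01 E x)"

end

theory Submission
  imports Defs
begin

text \<open>
  A complex structure \<open>J\<close> on a fibre is recorded by \<open>E\<^sup>0\<^sup>,\<^sup>1\<close>, the graph of all \<open>a + \<i> J a\<close> with \<open>a\<close> real, which is a
  maximal isotropic complex subspace. A complex orthogonal map \<open>A\<close> sends it to a maximal isotropic subspace, and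
  since \<open>g'\<close> is positive definite, taking real parts is bijective there; so the image is the graph of
  a complex structure \<open>J'\<close>. With \<open>re a\<close> the real part of \<open>A (a + \<i> J a)\<close>, one has \<open>J' (re a) = re (J a)\<close>
  (lemmas \<open>re_inj\<close>, \<open>re_surj\<close>, \<open>induced_map_re\<close>). This relation determines \<open>J'\<close> from \<open>J\<close>, and conversely, by
  injective linear systems, so Cramer's rule shows that the induced map \<open>F\<close> is a diffeomorphism
  (\<open>germ_smooth_solve\<close>, \<open>induced_entry_smooth\<close>, \<open>inverse_entry_smooth\<close>).

  A tangent vector of the twistor space at \<open>J\<close> is determined by its projection \<open>w\<close> to the base and the
  vertical part \<open>B = \<nabla>\<^sub>w J\<close>; the complex structure sends \<open>(w, B)\<close> to \<open>(I w, J B)\<close>. That every pair arises rests on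
  curves \<open>J(t)\<close> solving a linear differential equation (\<open>twistor_transport\<close>), and that the vertical part is a
  well-defined element of the vertical space rests on \<open>\<nabla>g = 0\<close> (\<open>vertical_part\<close>).
  The result is \<open>twistor_cstruct_formula\<close>.

  It remains to find the vertical part \<open>B'\<close> of the image of \<open>(w, B)\<close>. Let \<open>\<theta>(w) = \<nabla>'\<^sub>w A - A \<nabla>\<^sub>w\<close>, a complex linear
  map of the fibres of the complexified bundles. Differentiating \<open>A l\<close> for sections
  \<open>l\<close> of \<open>E\<^sup>0\<^sup>,\<^sup>1\<close> gives, modulo the subspace \<open>E'\<^sup>0\<^sup>,\<^sup>1\<close> belonging to \<open>J'\<close>,
  \<open>\<i> B' (re a) = \<theta>(w) (a + \<i> J a) + A (\<i> B a)\<close> (\<open>differential_formula\<close>). As \<open>A\<close> intertwines the Dolbeault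
  operators, \<open>\<theta>(I w) = \<i> \<theta>(w)\<close>. Modulo \<open>E\<^sup>0\<^sup>,\<^sup>1\<close> the endomorphism \<open>J\<close> acts on real vectors as
  multiplication by \<open>\<i>\<close>, so replacing \<open>(w, B)\<close> by \<open>(I w, J B)\<close> multiplies the right-hand side by \<open>\<i>\<close> and therefore
  replaces \<open>B'\<close> by \<open>J' B'\<close>. This is the compatibility of \<open>F\<close> with the complex structures.
\<close>

section \<open>Calculus of smooth maps\<close>

lemma Ck_on_cong:
  assumes "open S" "\<And>x. x \<in> S \<Longrightarrow> f x = g x"
  shows "Ck_on k S f \<longleftrightarrow> Ck_on k S g"
  using assms(2)
proof (induction k arbitrary: f g)
  case 0
  then show ?case by (simp cong: continuous_on_cong)
next
  case (Suc k)
  have d: "f differentiable (at x) \<longleftrightarrow> g differentiable (at x)" if "x \<in> S" for x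
    using Suc.prems that assms(1)
    by (metis differentiable_def has_derivative_transform_within_open)
  have e: "frechet_derivative f (at x) = frechet_derivative g (at x)"
    if "x \<in> S" "f differentiable (at x)" for x
    using Suc.prems that assms(1) frechet_derivative_transform_within_open by blast
  show ?case
    using d e Suc.IH[of "\<lambda>x. frechet_derivative f (at x) v" "\<lambda>x. frechet_derivative g (at x) v" for v]
    by auto
qed

lemma Ck_on_subset: "Ck_on k S f \<Longrightarrow> T \<subseteq> S \<Longrightarrow> Ck_on k T f"
  by (induction k arbitrary: f) (auto intro: continuous_on_subset)

lemma Ck_on_SucI:
  assumes "open S" "\<And>x. x \<in> S \<Longrightarrow> (f has_derivative f' x) (at x)" "\<And>v. Ck_on k S (\<lambda>x. f' x v)"
  shows "Ck_on (Suc k) S f"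
proof -
  have "frechet_derivative f (at x) = f' x" if "x \<in> S" for x
    using assms(2)[OF that] frechet_derivative_at by metis
  then have "Ck_on k S (\<lambda>x. frechet_derivative f (at x) v)" for v
    using Ck_on_cong[OF assms(1), of "\<lambda>x. frechet_derivative f (at x) v" "\<lambda>x. f' x v"] assms(3) by simp
  then show ?thesis using assms(2) by (auto simp: differentiable_def)
qed

lemma Ck_on_has_derivative:
  "Ck_on (Suc k) S f \<Longrightarrow> x \<in> S \<Longrightarrow> (f has_derivative frechet_derivative f (at x)) (at x)"
  by (simp add: frechet_derivative_works)

lemma Ck_on_SucD: "Ck_on (Suc k) S f \<Longrightarrow> Ck_on k S f"
proof (induction k arbitrary: f)
  case 0
  then show ?case
    by (auto intro!: continuous_at_imp_continuous_on differentiable_imp_continuous_within)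
next
  case (Suc k)
  then show ?case by (metis Ck_on.simps(2))
qed

lemma Ck_on_local:
  assumes "\<And>x. x \<in> S \<Longrightarrow> \<exists>T. open T \<and> x \<in> T \<and> Ck_on k T f"
  shows "Ck_on k S f"
  using assms
proof (induction k arbitrary: f)
  case 0
  show ?case
    using 0 by (metis Ck_on.simps(1) continuous_at_imp_continuous_on continuous_on_eq_continuous_at)
next
  case (Suc k)
  have "Ck_on k S (\<lambda>x. frechet_derivative f (at x) v)" for v
    using Suc.prems by (intro Suc.IH) fastforce
  moreover have "f differentiable (at x)" if "x \<in> S" for x
    using Suc.prems[OF that] by auto
  ultimately show ?case by simp
qed

lemma Ck_on_const: "Ck_on k S (\<lambda>x. c)"
  by (induction k arbitrary: c) auto

lemma Ck_on_linear_compose: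
  assumes "open S" "bounded_linear L"
  shows "Ck_on k S f \<Longrightarrow> Ck_on k S (\<lambda>x. L (f x))"
proof (induction k arbitrary: f)
  case 0
  then show ?case using assms(2) by (auto intro: bounded_linear.continuous_on)
next
  case (Suc k)
  show ?case
  proof (rule Ck_on_SucI[OF assms(1)])
    show "((\<lambda>x. L (f x)) has_derivative (\<lambda>v. L (frechet_derivative f (at x) v))) (at x)"
      if "x \<in> S" for x
      using bounded_linear.has_derivative[OF assms(2) Ck_on_has_derivative[OF Suc.prems that]] .
    show "Ck_on k S (\<lambda>x. L (frechet_derivative f (at x) v))" for v
      using Suc by auto
  qed
qed

lemma Ck_on_add:
  assumes "open S"
  shows "Ck_on k S f \<Longrightarrow> Ck_on k S g \<Longrightarrow> Ck_on k S (\<lambda>x. f x + g x)"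
proof (induction k arbitrary: f g)
  case 0
  then show ?case by (auto intro: continuous_intros)
next
  case (Suc k)
  show ?case
  proof (rule Ck_on_SucI[OF assms(1)])
    show "((\<lambda>x. f x + g x) has_derivative
        (\<lambda>v. frechet_derivative f (at x) v + frechet_derivative g (at x) v)) (at x)"
      if "x \<in> S" for x
      using Ck_on_has_derivative[OF Suc.prems(1) that] Ck_on_has_derivative[OF Suc.prems(2) that]
      by (rule has_derivative_add)
    show "Ck_on k S (\<lambda>x. frechet_derivative f (at x) v + frechet_derivative g (at x) v)" for v
      using Suc by auto
  qed
qed

lemma Ck_on_bilinear:
  assumes "open S" "bounded_bilinear P"
  shows "Ck_on k S f \<Longrightarrow> Ck_on k S g \<Longrightarrow> Ck_on k S (\<lambda>x. P (f x) (g x))"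
proof (induction k arbitrary: f g)
  case 0
  then show ?case using assms(2) by (auto intro: bounded_bilinear.continuous_on)
next
  case (Suc k)
  show ?case
  proof (rule Ck_on_SucI[OF assms(1)])
    show "((\<lambda>x. P (f x) (g x)) has_derivative
        (\<lambda>v. P (f x) (frechet_derivative g (at x) v) + P (frechet_derivative f (at x) v) (g x))) (at x)"
      if "x \<in> S" for x
      using bounded_bilinear.FDERIV[OF assms(2)]
        Ck_on_has_derivative[OF Suc.prems(1) that] Ck_on_has_derivative[OF Suc.prems(2) that] by metis
    have "Ck_on k S f" "Ck_on k S g"
      using Suc.prems Ck_on_SucD by blast+
    then show "Ck_on k S (\<lambda>x. P (f x) (frechet_derivative g (at x) v) + P (frechet_derivative f (at x) v) (g x))" for v
      using Suc by (intro Ck_on_add assms) auto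
  qed
qed

lemma Ck_on_sum:
  assumes "open S" "\<And>i. i \<in> I \<Longrightarrow> Ck_on k S (f i)"
  shows "Ck_on k S (\<lambda>x. \<Sum>i\<in>I. f i x)"
  using assms(2)
  by (induction I rule: infinite_finite_induct) (auto intro: Ck_on_const Ck_on_add assms)

text \<open>
  The chain rule for \<open>k\<close>-fold differentiability. The intermediate space is Euclidean so that the
  differential of the outer map, applied to the moving vector \<open>df(v)\<close>, expands into finitely many
  partial derivatives, to which the induction hypothesis applies.
\<close>
lemma Ck_on_compose:
  fixes f :: "'a::real_normed_vector \<Rightarrow> 'b::euclidean_space"
    and h :: "'b \<Rightarrow> 'c::real_normed_vector"
  assumes "open S" "f ` S \<subseteq> T"
  shows "Ck_on k S f \<Longrightarrow> Ck_on k T h \<Longrightarrow> Ck_on k S (\<lambda>x. h (f x))"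
  using assms(2)
proof (induction k arbitrary: f h)
  case 0
  then show ?case by (auto intro: continuous_on_compose2)
next
  case (Suc k)
  have eq: "frechet_derivative h (at y) v = (\<Sum>b\<in>Basis. (v \<bullet> b) *\<^sub>R frechet_derivative h (at y) b)"
    if "y \<in> T" for y v
  proof -
    have l: "linear (frechet_derivative h (at y))"
      using Suc.prems(2) that by (intro linear_frechet_derivative) auto
    have "frechet_derivative h (at y) v = frechet_derivative h (at y) (\<Sum>b\<in>Basis. (v \<bullet> b) *\<^sub>R b)"
      by (simp add: euclidean_representation)
    also have "\<dots> = (\<Sum>b\<in>Basis. (v \<bullet> b) *\<^sub>R frechet_derivative h (at y) b)"
      by (simp add: linear_sum[OF l] linear_scale[OF l])
    finally show ?thesis .
  qed
  show ?case
  proof (rule Ck_on_SucI[OF assms(1)])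
    show "((\<lambda>x. h (f x)) has_derivative
        (\<lambda>v. \<Sum>b\<in>Basis. (frechet_derivative f (at x) v \<bullet> b) *\<^sub>R frechet_derivative h (at (f x)) b)) (at x)"
      if "x \<in> S" for x
    proof -
      have fx: "f x \<in> T" using that Suc.prems by auto
      have "(\<lambda>v. \<Sum>b\<in>Basis. (frechet_derivative f (at x) v \<bullet> b) *\<^sub>R frechet_derivative h (at (f x)) b)
          = (\<lambda>v. frechet_derivative h (at (f x)) (frechet_derivative f (at x) v))"
        by (rule ext) (rule eq[OF fx, symmetric])
      then show ?thesis
        using has_derivative_compose[OF Ck_on_has_derivative[OF Suc.prems(1) that]
            Ck_on_has_derivative[OF Suc.prems(2) fx]] by (simp only:)
    qed
    have fk: "Ck_on k S f" using Suc.prems Ck_on_SucD by blast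
    show "Ck_on k S (\<lambda>x. \<Sum>b\<in>Basis. (frechet_derivative f (at x) v \<bullet> b) *\<^sub>R frechet_derivative h (at (f x)) b)" for v
    proof (intro Ck_on_sum[OF assms(1)] Ck_on_bilinear[OF assms(1) bounded_bilinear_scaleR])
      show "Ck_on k S (\<lambda>x. frechet_derivative f (at x) v \<bullet> b)" for b
        using Suc.prems by (intro Ck_on_linear_compose[OF assms(1) bounded_linear_inner_left]) auto
      show "Ck_on k S (\<lambda>x. frechet_derivative h (at (f x)) b)" for b
        using Suc.prems(2,3) by (intro Suc.IH[OF fk]) auto
    qed
  qed
qed

lemma Ck_on_inverse: "Ck_on k {x::real. x \<noteq> 0} inverse"
proof (induction k)
  case 0
  show ?case by (auto intro!: continuous_intros)
next
  case (Suc k)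
  have o: "open {x::real. x \<noteq> 0}" by (simp add: open_Collect_neq)
  show ?case
  proof (rule Ck_on_SucI[OF o])
    show "(inverse has_derivative (\<lambda>v. - v * (inverse x * inverse x))) (at x)" if "x \<in> {x::real. x \<noteq> 0}" for x
      using that by (auto intro!: derivative_eq_intros simp: algebra_simps)
    show "Ck_on k {x::real. x \<noteq> 0} (\<lambda>x. - v * (inverse x * inverse x))" for v
      by (intro Ck_on_bilinear[OF o bounded_bilinear_mult] Ck_on_const Suc)
  qed
qed

named_theorems smooth_intros

lemma smooth_on_cong: "open S \<Longrightarrow> (\<And>x. x \<in> S \<Longrightarrow> f x = g x) \<Longrightarrow> smooth_on S f \<longleftrightarrow> smooth_on S g"
  unfolding smooth_on_def using Ck_on_cong by blast

lemma smooth_on_subset: "smooth_on S f \<Longrightarrow> T \<subseteq> S \<Longrightarrow> smooth_on T f"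
  unfolding smooth_on_def using Ck_on_subset by blast

lemma smooth_on_local:
  assumes "\<And>x. x \<in> S \<Longrightarrow> \<exists>T. open T \<and> x \<in> T \<and> smooth_on T f"
  shows "smooth_on S f"
  unfolding smooth_on_def
  by (intro allI Ck_on_local) (use assms smooth_on_def in blast)

lemma smooth_on_const [smooth_intros]: "smooth_on S (\<lambda>x. c)"
  by (simp add: smooth_on_def Ck_on_const)

lemma smooth_on_linear_compose:
  "open S \<Longrightarrow> bounded_linear L \<Longrightarrow> smooth_on S f \<Longrightarrow> smooth_on S (\<lambda>x. L (f x))"
  by (simp add: smooth_on_def Ck_on_linear_compose)

lemma smooth_on_ident [smooth_intros]: "smooth_on S (\<lambda>x. x)"
  unfolding smooth_on_def
proof
  fix k show "Ck_on k S (\<lambda>x. x)"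
    by (cases k) (auto simp: Ck_on_const)
qed

lemma smooth_on_linear: "open S \<Longrightarrow> bounded_linear L \<Longrightarrow> smooth_on S L"
  using smooth_on_linear_compose[of S L "\<lambda>x. x"] smooth_on_ident by auto

lemma smooth_on_inner_left: "open S \<Longrightarrow> smooth_on S (\<lambda>u. u \<bullet> b)"
  by (rule smooth_on_linear[OF _ bounded_linear_inner_left])

lemma smooth_on_fst: "open S \<Longrightarrow> smooth_on S fst"
  by (rule smooth_on_linear[OF _ bounded_linear_fst])

lemma smooth_on_snd: "open S \<Longrightarrow> smooth_on S snd"
  by (rule smooth_on_linear[OF _ bounded_linear_snd])

lemma smooth_on_add [smooth_intros]:
  "open S \<Longrightarrow> smooth_on S f \<Longrightarrow> smooth_on S g \<Longrightarrow> smooth_on S (\<lambda>x. f x + g x)"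
  by (simp add: smooth_on_def Ck_on_add)

lemma smooth_on_bilinear:
  "open S \<Longrightarrow> bounded_bilinear P \<Longrightarrow> smooth_on S f \<Longrightarrow> smooth_on S g \<Longrightarrow> smooth_on S (\<lambda>x. P (f x) (g x))"
  by (simp add: smooth_on_def Ck_on_bilinear)

lemmas smooth_on_mult [smooth_intros] = smooth_on_bilinear[OF _ bounded_bilinear_mult]
  and smooth_on_scaleR [smooth_intros] = smooth_on_bilinear[OF _ bounded_bilinear_scaleR]
  and smooth_on_inner = smooth_on_linear_compose[OF _ bounded_linear_inner_left]

lemma smooth_on_sum [smooth_intros]:
  "open S \<Longrightarrow> (\<And>i. i \<in> I \<Longrightarrow> smooth_on S (f i)) \<Longrightarrow> smooth_on S (\<lambda>x. \<Sum>i\<in>I. f i x)"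
  by (simp add: smooth_on_def Ck_on_sum)

lemma smooth_on_compose:
  fixes f :: "'a::real_normed_vector \<Rightarrow> 'b::euclidean_space"
  shows "open S \<Longrightarrow> smooth_on S f \<Longrightarrow> smooth_on T h \<Longrightarrow> f ` S \<subseteq> T \<Longrightarrow> smooth_on S (\<lambda>x. h (f x))"
  by (simp add: smooth_on_def Ck_on_compose)

lemma smooth_on_inverse: "smooth_on {x::real. x \<noteq> 0} inverse"
  by (simp add: smooth_on_def Ck_on_inverse)

lemma smooth_on_continuous: "smooth_on S f \<Longrightarrow> continuous_on S f"
  unfolding smooth_on_def by (metis Ck_on.simps(1))

lemma smooth_on_has_derivative:
  "smooth_on S f \<Longrightarrow> x \<in> S \<Longrightarrow> (f has_derivative frechet_derivative f (at x)) (at x)"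
  unfolding smooth_on_def using Ck_on_has_derivative by blast

lemma smooth_on_derivative:
  "smooth_on S f \<Longrightarrow> smooth_on S (\<lambda>x. frechet_derivative f (at x) v)"
  unfolding smooth_on_def by (metis Ck_on.simps(2))

lemma smooth_on_euclidean:
  fixes f :: "'a::real_normed_vector \<Rightarrow> 'b::euclidean_space"
  assumes "open S" "\<And>b. b \<in> Basis \<Longrightarrow> smooth_on S (\<lambda>x. f x \<bullet> b)"
  shows "smooth_on S f"
proof -
  have "smooth_on S (\<lambda>x. \<Sum>b\<in>Basis. (f x \<bullet> b) *\<^sub>R b)"
    using assms by (intro smooth_intros) auto
  then show ?thesis by (simp add: euclidean_representation)
qed

section \<open>Functions that are smooth in a chart\<close>

text \<open>
  Both kinds of smooth functions in this development, those on the base and those on the twistor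
  space, are locally of the form \<open>G \<circ> c\<close> for a smooth function \<open>G\<close> of Euclidean coordinates
  \<open>c\<close>. The chart \<open>c\<close> is not required to be open: for the twistor space it takes
  values in a submanifold. Treating this notion abstractly gives the algebra of smooth germs, the change of
  charts and the chain rule for velocities once for both.
\<close>
definition germ_smooth ::
    "'x set \<Rightarrow> ('x \<Rightarrow> 'e::euclidean_space) \<Rightarrow> 'x \<Rightarrow> ('x \<Rightarrow> real) \<Rightarrow> bool" where
  "germ_smooth Y c x f \<longleftrightarrow> (\<exists>W G. open W \<and> c x \<in> W \<and> smooth_on W G \<and> (\<forall>y\<in>Y. c y \<in> W \<longrightarrow> f y = G (c y)))"

lemma germ_smoothI:
  "open W \<Longrightarrow> c x \<in> W \<Longrightarrow> smooth_on W G \<Longrightarrow> (\<And>y. y \<in> Y \<Longrightarrow> c y \<in> W \<Longrightarrow> f y = G (c y)) \<Longrightarrow> germ_smooth Y c x f"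
  unfolding germ_smooth_def by blast

lemma germ_smoothE:
  assumes "germ_smooth Y c x f"
  obtains W G where "open W" "c x \<in> W" "smooth_on W G" "\<And>y. y \<in> Y \<Longrightarrow> c y \<in> W \<Longrightarrow> f y = G (c y)"
  using assms unfolding germ_smooth_def by blast

lemma germ_smooth_vec:
  fixes h :: "'x \<Rightarrow> 'b::euclidean_space"
  assumes "\<And>b. b \<in> Basis \<Longrightarrow> germ_smooth Y c x (\<lambda>y. h y \<bullet> b)"
  obtains W G where "open W" "c x \<in> W" "smooth_on W G" "\<And>y. y \<in> Y \<Longrightarrow> c y \<in> W \<Longrightarrow> h y = G (c y)"
proof -
  from assms obtain W G where WG: "\<And>b. b \<in> Basis \<Longrightarrow> open (W b) \<and> c x \<in> W b \<and> smooth_on (W b) (G b) \<and>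
     (\<forall>y\<in>Y. c y \<in> W b \<longrightarrow> h y \<bullet> b = G b (c y))"
    unfolding germ_smooth_def by metis
  let ?W = "\<Inter>b\<in>Basis. W b" and ?G = "\<lambda>u. \<Sum>b\<in>Basis. G b u *\<^sub>R b"
  have o: "open ?W" using WG by (intro open_INT) auto
  have "smooth_on ?W ?G"
    by (intro smooth_intros o) (meson INT_lower WG smooth_on_subset)
  moreover have "h y = ?G (c y)" if "y \<in> Y" "c y \<in> ?W" for y
  proof -
    have "h y = (\<Sum>b\<in>Basis. (h y \<bullet> b) *\<^sub>R b)" by (simp add: euclidean_representation)
    also have "\<dots> = ?G (c y)" using WG that by (intro sum.cong) auto
    finally show ?thesis .
  qed
  ultimately show ?thesis using that[of ?W ?G] o WG by blast
qed

lemma germ_smooth_compose: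
  fixes h :: "'x \<Rightarrow> 'b::euclidean_space"
  assumes "x \<in> Y" "\<And>b. b \<in> Basis \<Longrightarrow> germ_smooth Y c x (\<lambda>y. h y \<bullet> b)"
    and "open W" "h x \<in> W" "smooth_on W H"
  shows "germ_smooth Y c x (\<lambda>y. H (h y))"
proof -
  obtain W' G where G: "open W'" "c x \<in> W'" "smooth_on W' G"
      "\<And>y. y \<in> Y \<Longrightarrow> c y \<in> W' \<Longrightarrow> h y = G (c y)"
    using germ_smooth_vec[OF assms(2)] by blast
  have o: "open (W' \<inter> G -` W)"
    using G assms(3) smooth_on_continuous continuous_open_preimage by blast
  show ?thesis
  proof (rule germ_smoothI[OF o])
    show "c x \<in> W' \<inter> G -` W" using G assms by auto
    show "smooth_on (W' \<inter> G -` W) (\<lambda>u. H (G u))"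
      by (rule smooth_on_compose[OF o smooth_on_subset[OF G(3)] assms(5)]) auto
  qed (use G in auto)
qed

lemma germ_smooth_const: "germ_smooth Y c x (\<lambda>y. a)"
  by (rule germ_smoothI[of UNIV _ _ "\<lambda>_. a"]) (auto intro: smooth_intros)

lemma germ_smooth_component: "germ_smooth Y c x (\<lambda>y. c y \<bullet> b)"
  by (rule germ_smoothI[of UNIV _ _ "\<lambda>u. u \<bullet> b"]) (auto intro: smooth_on_inner_left)

lemma germ_smooth_binary:
  assumes "x \<in> Y" "germ_smooth Y c x f" "germ_smooth Y c x f'"
    and "open W" "(f x, f' x) \<in> W" "smooth_on W (\<lambda>u::real\<times>real. H (fst u) (snd u))"
  shows "germ_smooth Y c x (\<lambda>y. H (f y) (f' y))"
proof (rule germ_smooth_compose[where h="\<lambda>y. (f y, f' y)" and H="\<lambda>u. H (fst u) (snd u)", simplified fst_conv snd_conv])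
  show "germ_smooth Y c x (\<lambda>y. (f y, f' y) \<bullet> b)" if "b \<in> Basis" for b
    using that assms(2,3) by (auto simp: Basis_prod_def)
qed (use assms in auto)

lemma germ_smooth_add:
  "x \<in> Y \<Longrightarrow> germ_smooth Y c x f \<Longrightarrow> germ_smooth Y c x f' \<Longrightarrow> germ_smooth Y c x (\<lambda>y. f y + f' y)"
  by (rule germ_smooth_binary[where W=UNIV and H="\<lambda>a b. a + b"])
    (auto simp: smooth_on_add smooth_on_fst smooth_on_snd)

lemma germ_smooth_mult:
  "x \<in> Y \<Longrightarrow> germ_smooth Y c x f \<Longrightarrow> germ_smooth Y c x f' \<Longrightarrow> germ_smooth Y c x (\<lambda>y. f y * f' y)"
  by (rule germ_smooth_binary[where W=UNIV and H="\<lambda>a b. a * b"])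
    (auto simp: smooth_on_mult smooth_on_fst smooth_on_snd)

lemma germ_smooth_inverse:
  assumes "x \<in> Y" "germ_smooth Y c x f" "f x \<noteq> 0"
  shows "germ_smooth Y c x (\<lambda>y. inverse (f y))"
  using germ_smooth_compose[OF assms(1), of c f "{x. x \<noteq> 0}" inverse] assms
  by (auto simp: smooth_on_inverse open_Collect_neq)

lemma germ_smooth_sum:
  assumes "x \<in> Y" "\<And>i. i \<in> I \<Longrightarrow> germ_smooth Y c x (f i)"
  shows "germ_smooth Y c x (\<lambda>y. \<Sum>i\<in>I. f i y)"
  using assms(2)
  by (induction I rule: infinite_finite_induct) (auto intro: germ_smooth_const germ_smooth_add assms)

lemma germ_smooth_prod:
  assumes "x \<in> Y" "\<And>i. i \<in> I \<Longrightarrow> germ_smooth Y c x (f i)"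
  shows "germ_smooth Y c x (\<lambda>y. \<Prod>i\<in>I. f i y)"
  using assms(2)
  by (induction I rule: infinite_finite_induct) (auto intro: germ_smooth_const germ_smooth_mult assms)

lemma germ_smooth_cong:
  assumes "open W" "c x \<in> W" "\<And>y. y \<in> Y \<Longrightarrow> c y \<in> W \<Longrightarrow> f y = f' y" "germ_smooth Y c x f"
  shows "germ_smooth Y c x f'"
proof -
  obtain W' G where G: "open W'" "c x \<in> W'" "smooth_on W' G" "\<And>y. y \<in> Y \<Longrightarrow> c y \<in> W' \<Longrightarrow> f y = G (c y)"
    using germ_smoothE[OF assms(4)] by blast
  show ?thesis
  proof (rule germ_smoothI[where W="W \<inter> W'" and G=G])
    show "smooth_on (W \<inter> W') G" using smooth_on_subset[OF G(3)] by blast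
    show "f' y = G (c y)" if "y \<in> Y" "c y \<in> W \<inter> W'" for y
      using G(4)[of y] assms(3)[of y] that by auto
  qed (use G assms in auto)
qed

lemma germ_smooth_diff:
  assumes "x \<in> Y" "germ_smooth Y c x f" "germ_smooth Y c x f'"
  shows "germ_smooth Y c x (\<lambda>y. f y - f' y)"
  using germ_smooth_add[OF assms(1,2) germ_smooth_mult[OF assms(1) germ_smooth_const[of _ _ _ "-1"] assms(3)]]
  by simp

lemma germ_smooth_change_chart:
  fixes c :: "'x \<Rightarrow> 'e::euclidean_space" and c' :: "'x \<Rightarrow> 'f::euclidean_space"
  assumes "x \<in> Y" "germ_smooth Y' c' x f"
    and "\<And>b. b \<in> Basis \<Longrightarrow> germ_smooth Y c x (\<lambda>y. c' y \<bullet> b)"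
    and "open W0" "c x \<in> W0" "\<And>y. y \<in> Y \<Longrightarrow> c y \<in> W0 \<Longrightarrow> y \<in> Y'"
  shows "germ_smooth Y c x f"
proof -
  obtain W G where G: "open W" "c' x \<in> W" "smooth_on W G" "\<And>y. y \<in> Y' \<Longrightarrow> c' y \<in> W \<Longrightarrow> f y = G (c' y)"
    using germ_smoothE[OF assms(2)] by blast
  obtain W1 H where H: "open W1" "c x \<in> W1" "smooth_on W1 H" "\<And>y. y \<in> Y \<Longrightarrow> c y \<in> W1 \<Longrightarrow> c' y = H (c y)"
    using germ_smooth_vec[OF assms(3)] by blast
  have 1: "germ_smooth Y c x (\<lambda>y. G (c' y))"
    by (rule germ_smooth_compose[OF assms(1,3) G(1,2,3)])
  have o: "open (W1 \<inter> H -` W)"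
    using G H smooth_on_continuous continuous_open_preimage by blast
  show ?thesis
  proof (rule germ_smooth_cong[OF _ _ _ 1])
    show "open (W0 \<inter> (W1 \<inter> H -` W))" using o assms by auto
    show "c x \<in> W0 \<inter> (W1 \<inter> H -` W)" using assms G H by auto
    show "G (c' y) = f y" if "y \<in> Y" "c y \<in> W0 \<inter> (W1 \<inter> H -` W)" for y
      using that assms(6)[of y] G(4)[of y] H(4)[of y] by auto
  qed
qed

lemma germ_smooth_along_curve_vec:
  fixes c :: "'x \<Rightarrow> 'e::euclidean_space" and h :: "'x \<Rightarrow> 'b::euclidean_space"
  assumes "\<And>b. b \<in> Basis \<Longrightarrow> germ_smooth Y c (\<Gamma> t0) (\<lambda>y. h y \<bullet> b)"
    and "open T" "t0 \<in> T" "smooth_on T (\<lambda>t. c (\<Gamma> t))" "\<And>t. t \<in> T \<Longrightarrow> \<Gamma> t \<in> Y"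
  shows "\<exists>T'. open T' \<and> t0 \<in> T' \<and> T' \<subseteq> T \<and> smooth_on T' (\<lambda>t. h (\<Gamma> t))"
proof -
  obtain W G where G: "open W" "c (\<Gamma> t0) \<in> W" "smooth_on W G" "\<And>y. y \<in> Y \<Longrightarrow> c y \<in> W \<Longrightarrow> h y = G (c y)"
    using germ_smooth_vec[OF assms(1)] by blast
  let ?T = "T \<inter> (\<lambda>t. c (\<Gamma> t)) -` W"
  have o: "open ?T" using G assms smooth_on_continuous continuous_open_preimage by blast
  have s: "smooth_on ?T (\<lambda>t. G (c (\<Gamma> t)))"
    by (rule smooth_on_compose[OF o smooth_on_subset[OF assms(4)] G(3)]) auto
  have "smooth_on ?T (\<lambda>t. h (\<Gamma> t)) \<longleftrightarrow> smooth_on ?T (\<lambda>t. G (c (\<Gamma> t)))"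
    using G assms by (intro smooth_on_cong o) auto
  then have "smooth_on ?T (\<lambda>t. h (\<Gamma> t))" using s by simp
  then show ?thesis using o G assms by (intro exI[of _ ?T]) auto
qed

lemma germ_smooth_along_curve:
  fixes c :: "'x \<Rightarrow> 'e::euclidean_space"
  assumes "germ_smooth Y c (\<Gamma> t0) f" "open T" "t0 \<in> T" "smooth_on T (\<lambda>t. c (\<Gamma> t))" "\<And>t. t \<in> T \<Longrightarrow> \<Gamma> t \<in> Y"
  shows "\<exists>T'. open T' \<and> t0 \<in> T' \<and> T' \<subseteq> T \<and> smooth_on T' (\<lambda>t. f (\<Gamma> t))"
  by (rule germ_smooth_along_curve_vec[where c=c and \<Gamma>=\<Gamma> and h=f, OF _ assms(2-5)]) (use assms(1) in simp_all)

text \<open>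
  These functionals are the derivations sending \<open>G \<circ> c\<close> to \<open>dG(h)\<close>; their values on functions that are not
  smooth in the chart remain arbitrary.
\<close>
definition chart_vec ::
    "'x set \<Rightarrow> ('x \<Rightarrow> 'e::euclidean_space) \<Rightarrow> 'x \<Rightarrow> 'x tvec \<Rightarrow> 'e \<Rightarrow> bool" where
  "chart_vec Y c x v h \<longleftrightarrow> (\<forall>f W G. open W \<and> c x \<in> W \<and> smooth_on W G \<and> (\<forall>y\<in>Y. c y \<in> W \<longrightarrow> f y = G (c y))
     \<longrightarrow> v f = frechet_derivative G (at (c x)) h)"

lemma chart_vec_eval:
  assumes "chart_vec Y c x v h" "open W" "c x \<in> W" "smooth_on W G" "\<And>y. y \<in> Y \<Longrightarrow> c y \<in> W \<Longrightarrow> f y = G (c y)"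
  shows "v f = frechet_derivative G (at (c x)) h"
  using assms unfolding chart_vec_def by blast

lemma chart_vec_component:
  assumes "chart_vec Y c x v h"
  shows "v (\<lambda>y. c y \<bullet> b) = h \<bullet> b"
proof -
  have "v (\<lambda>y. c y \<bullet> b) = frechet_derivative (\<lambda>u. u \<bullet> b) (at (c x)) h"
    by (rule chart_vec_eval[OF assms, of UNIV]) (auto simp: smooth_on_inner_left)
  also have "frechet_derivative (\<lambda>u. u \<bullet> b) (at (c x)) = (\<lambda>u. u \<bullet> b)"
    by (rule frechet_derivative_at[symmetric])
      (rule bounded_linear_imp_has_derivative[OF bounded_linear_inner_left])
  finally show ?thesis .
qed

lemma chart_vec_tadd:
  assumes "chart_vec Y c x v h" "chart_vec Y c x v' h'"
  shows "chart_vec Y c x (tadd v v') (h + h')"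
  unfolding chart_vec_def
proof (intro allI impI)
  fix f :: "'a \<Rightarrow> real" and W G
  assume a: "open W \<and> c x \<in> W \<and> smooth_on W G \<and> (\<forall>y\<in>Y. c y \<in> W \<longrightarrow> f y = G (c y))"
  have l: "linear (frechet_derivative G (at (c x)))"
    using a smooth_on_has_derivative has_derivative_linear by blast
  show "tadd v v' f = frechet_derivative G (at (c x)) (h + h')"
    using chart_vec_eval[OF assms(1), of W G f] chart_vec_eval[OF assms(2), of W G f] a
    by (simp add: tadd_def linear_add[OF l])
qed

lemma chart_vec_unique:
  assumes "chart_vec Y c x v h" "chart_vec Y c x v' h" "germ_smooth Y c x f"
  shows "v f = v' f"
  using assms unfolding germ_smooth_def chart_vec_def by metis

lemma chart_curve_derivative:
  fixes c :: "'x \<Rightarrow> 'e::euclidean_space"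
  assumes "((\<lambda>t. c (\<Gamma> t)) has_vector_derivative h) (at t0)" "\<forall>\<^sub>F t in nhds t0. \<Gamma> t \<in> Y"
    and "open W" "c (\<Gamma> t0) \<in> W" "smooth_on W G" "\<And>y. y \<in> Y \<Longrightarrow> c y \<in> W \<Longrightarrow> f y = G (c y)"
  shows "((\<lambda>t. f (\<Gamma> t)) has_real_derivative frechet_derivative G (at (c (\<Gamma> t0))) h) (at t0)"
proof -
  have l: "linear (frechet_derivative G (at (c (\<Gamma> t0))))"
    using assms smooth_on_has_derivative has_derivative_linear by blast
  have "((\<lambda>t. G (c (\<Gamma> t))) has_derivative
      (\<lambda>r. frechet_derivative G (at (c (\<Gamma> t0))) (r *\<^sub>R h))) (at t0)"
    using has_derivative_compose[OF assms(1)[unfolded has_vector_derivative_def]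
        smooth_on_has_derivative[OF assms(5,4)]] .
  then have 1: "((\<lambda>t. G (c (\<Gamma> t))) has_real_derivative frechet_derivative G (at (c (\<Gamma> t0))) h) (at t0)"
    by (simp add: has_field_derivative_def linear_scale[OF l] mult_commute_abs)
  have "isCont (\<lambda>t. c (\<Gamma> t)) t0"
    using assms(1) has_vector_derivative_continuous by blast
  then have "\<forall>\<^sub>F t in nhds t0. c (\<Gamma> t) \<in> W"
    using assms(3,4) by (auto simp: continuous_at tendsto_def eventually_nhds_conv_at)
  with assms(2) have "\<forall>\<^sub>F t in nhds t0. G (c (\<Gamma> t)) = f (\<Gamma> t)"
    by eventually_elim (use assms(6) in auto)
  then show ?thesis
    using 1 DERIV_cong_ev[OF refl, of "\<lambda>t. G (c (\<Gamma> t))" "\<lambda>t. f (\<Gamma> t)" t0 _, OF _ refl] by blast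
qed

lemma chart_vec_velocity:
  fixes c :: "'x \<Rightarrow> 'e::euclidean_space"
  assumes "((\<lambda>t. c (\<Gamma> t)) has_vector_derivative h) (at t0)" "\<forall>\<^sub>F t in nhds t0. \<Gamma> t \<in> Y"
    and "\<And>f. germ_smooth Y c (\<Gamma> t0) f \<Longrightarrow> sm (\<Gamma> t0) f"
  shows "chart_vec Y c (\<Gamma> t0) (velocity sm \<Gamma> t0) h"
  unfolding chart_vec_def
proof (intro allI impI)
  fix f :: "'x \<Rightarrow> real" and W G
  assume a: "open W \<and> c (\<Gamma> t0) \<in> W \<and> smooth_on W G \<and> (\<forall>y\<in>Y. c y \<in> W \<longrightarrow> f y = G (c y))"
  then have "sm (\<Gamma> t0) f" using assms(3) unfolding germ_smooth_def by blast
  then show "velocity sm \<Gamma> t0 f = frechet_derivative G (at (c (\<Gamma> t0))) h"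
    using chart_curve_derivative[OF assms(1,2), of W G f] a DERIV_imp_deriv
    unfolding velocity_def by auto
qed

lemma smooth_on_has_vector_derivative:
  "smooth_on T f \<Longrightarrow> t \<in> T \<Longrightarrow> (f has_vector_derivative vector_derivative f (at t)) (at t)"
  for f :: "real \<Rightarrow> 'a::real_normed_vector"
  by (rule vector_derivative_works[THEN iffD1, OF differentiableI[OF smooth_on_has_derivative]])

section \<open>Charts and tangent vectors of the base\<close>

locale complex_mfd =
  fixes M :: "('m::{t2_space,second_countable_topology}, 'n::finite) cmanifold"
  assumes cm: "complex_manifold M"
begin

lemmas atlas_conditions = cm[unfolded complex_manifold_def]

lemma chart_exists: obtains U z where "(U, z) \<in> atlas M" "p \<in> U"
proof -
  have "p \<in> (\<Union>(U, z)\<in>atlas M. U)" using atlas_conditions[THEN conjunct1] by simp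
  then show ?thesis using that by auto
qed

context
  fixes U z assumes uz: "(U, z) \<in> atlas M"
begin

lemma chart_open: "open U"
  using atlas_conditions[THEN conjunct2, THEN conjunct1, rule_format, OF uz] by simp

lemma chart_image: "openin (top_of_set (cmodel M)) (z ` U)"
  using atlas_conditions[THEN conjunct2, THEN conjunct1, rule_format, OF uz] by simp

lemma chart_homeo: "homeomorphism U (z ` U) z (inv_into U z)"
  using atlas_conditions[THEN conjunct2, THEN conjunct1, rule_format, OF uz] by simp

lemma chart_cmodel: "q \<in> U \<Longrightarrow> z q \<in> cmodel M"
  using chart_image openin_imp_subset by blast

lemma chart_inverse: "q \<in> U \<Longrightarrow> inv_into U z (z q) = q"
  using chart_homeo by (auto simp: homeomorphism_def)

lemma chart_nbhd:
  assumes "p \<in> U" "open Ob" "p \<in> Ob"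
  shows "\<exists>W0. open W0 \<and> z p \<in> W0 \<and> (\<forall>q\<in>U. z q \<in> W0 \<longrightarrow> q \<in> Ob)"
proof -
  have "continuous_on (z ` U) (inv_into U z)"
    using chart_homeo by (auto simp: homeomorphism_def)
  then have "openin (top_of_set (z ` U)) (z ` U \<inter> inv_into U z -` Ob)"
    using assms(2) continuous_openin_preimage_gen by blast
  then obtain W0 where W0: "open W0" "z ` U \<inter> inv_into U z -` Ob = z ` U \<inter> W0"
    unfolding openin_open by blast
  have "z q \<in> W0 \<longleftrightarrow> q \<in> Ob" if "q \<in> U" for q
  proof -
    have "z q \<in> z ` U \<inter> W0 \<longleftrightarrow> z q \<in> z ` U \<inter> inv_into U z -` Ob" using W0(2) by simp
    then show ?thesis using that chart_inverse[OF that] by simp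
  qed
  then show ?thesis using W0(1) assms by (intro exI[of _ W0]) auto
qed

lemma chart_nbhd_ev:
  assumes "p \<in> U" "\<forall>\<^sub>F q in nhds p. P q"
  shows "\<exists>W0. open W0 \<and> z p \<in> W0 \<and> (\<forall>q\<in>U. z q \<in> W0 \<longrightarrow> P q)"
  using assms(2) chart_nbhd[OF assms(1)] unfolding eventually_nhds by meson

lemma chart_ev:
  assumes "p \<in> U" "open W" "z p \<in> W"
  shows "\<forall>\<^sub>F q in nhds p. q \<in> U \<and> z q \<in> W"
proof -
  have "continuous_on U z" using chart_homeo by (auto simp: homeomorphism_def)
  then have "open (U \<inter> z -` W)" using chart_open assms(2) continuous_open_preimage by blast
  then show ?thesis using assms by (auto simp: eventually_nhds intro!: exI[of _ "U \<inter> z -` W"])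
qed

lemma germ_smooth_ev:
  assumes "p \<in> U" "\<forall>\<^sub>F q in nhds p. f q = f' q" "germ_smooth U z p f"
  shows "germ_smooth U z p f'"
  using chart_nbhd_ev[OF assms(1,2)] germ_smooth_cong[OF _ _ _ assms(3), of _ f'] by metis

end

lemma transition:
  assumes "(U, z) \<in> atlas M" "(V, w) \<in> atlas M" "p \<in> U" "p \<in> V"
  obtains W \<tau> where "open W" "z p \<in> W" "holomorphic_map_on W \<tau>" "\<And>q. q \<in> U \<Longrightarrow> z q \<in> W \<Longrightarrow> q \<in> V \<and> w q = \<tau> (z q)"
proof -
  obtain W \<tau> where 1: "open W" "z p \<in> W" "holomorphic_map_on W \<tau>" "\<forall>\<^sub>F q in nhds p. w q = \<tau> (z q)"
    using atlas_conditions[THEN conjunct2, THEN conjunct2, rule_format, OF assms(1), unfolded prod.case,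
        rule_format, OF assms(2), unfolded prod.case, rule_format, of p] assms(3,4) by blast
  have "\<forall>\<^sub>F q in nhds p. q \<in> V"
    using chart_open[OF assms(2)] assms(4) by (simp add: eventually_nhds_in_open)
  with 1(4) have "\<forall>\<^sub>F q in nhds p. q \<in> V \<and> w q = \<tau> (z q)" by eventually_elim auto
  from chart_nbhd_ev[OF assms(1,3) this] obtain W0
    where W0: "open W0" "z p \<in> W0" "\<forall>q\<in>U. z q \<in> W0 \<longrightarrow> q \<in> V \<and> w q = \<tau> (z q)" by blast
  have "holomorphic_map_on (W \<inter> W0) \<tau>"
    using 1(3) smooth_on_subset[of W \<tau> "W \<inter> W0"] by (auto simp: holomorphic_map_on_def)
  then show ?thesis using that[of "W \<inter> W0" \<tau>] 1 W0 by blast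
qed

lemma germ_smooth_transition:
  assumes "(U, z) \<in> atlas M" "(V, w) \<in> atlas M" "p \<in> U" "p \<in> V"
  shows "germ_smooth U z p (\<lambda>q. w q \<bullet> b)"
proof -
  obtain W \<tau> where 1: "open W" "z p \<in> W" "holomorphic_map_on W \<tau>" "\<And>q. q \<in> U \<Longrightarrow> z q \<in> W \<Longrightarrow> q \<in> V \<and> w q = \<tau> (z q)"
    using transition[OF assms] by metis
  have "smooth_on W (\<lambda>u. \<tau> u \<bullet> b)"
    using 1 by (intro smooth_on_inner) (auto simp: holomorphic_map_on_def)
  then show ?thesis using 1 by (intro germ_smoothI[of W z p "\<lambda>u. \<tau> u \<bullet> b"]) auto
qed

lemma germ_smooth_other_chart:
  assumes "(U, z) \<in> atlas M" "(V, w) \<in> atlas M" "p \<in> U" "p \<in> V" "germ_smooth V w p f"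
  shows "germ_smooth U z p f"
proof -
  obtain W0 where W0: "open W0" "z p \<in> W0" "\<forall>q\<in>U. z q \<in> W0 \<longrightarrow> q \<in> V"
    using chart_nbhd[OF assms(1,3) chart_open[OF assms(2)] assms(4)] by blast
  show ?thesis
    by (rule germ_smooth_change_chart[OF assms(3,5) germ_smooth_transition[OF assms(1-4)] W0(1,2)])
      (use W0(3) in auto)
qed

lemma smooth_near_iff:
  assumes "(U, z) \<in> atlas M" "p \<in> U"
  shows "smooth_near M p f \<longleftrightarrow> germ_smooth U z p f"
proof
  assume "smooth_near M p f"
  then obtain V w W G where 1: "(V, w) \<in> atlas M" "p \<in> V" "open W" "w p \<in> W" "smooth_on W G"
      "\<forall>\<^sub>F q in nhds p. f q = G (w q)"
    unfolding smooth_near_def by blast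
  have a: "germ_smooth V w p (\<lambda>q. G (w q))" using 1 by (intro germ_smoothI[of W w p G]) auto
  have "\<forall>\<^sub>F q in nhds p. G (w q) = f q" using 1(6) by eventually_elim simp
  then have "germ_smooth V w p f" by (rule germ_smooth_ev[OF 1(1,2) _ a])
  then show "germ_smooth U z p f" using germ_smooth_other_chart assms 1 by blast
next
  assume "germ_smooth U z p f"
  then obtain W G where G: "open W" "z p \<in> W" "smooth_on W G" "\<And>y. y \<in> U \<Longrightarrow> z y \<in> W \<Longrightarrow> f y = G (z y)"
    using germ_smoothE by metis
  have "\<forall>\<^sub>F q in nhds p. f q = G (z q)"
    using chart_ev[OF assms G(1,2)] by eventually_elim (use G(4) in auto)
  then show "smooth_near M p f" unfolding smooth_near_def using G assms by blast
qed

lemma smooth_near_const: "smooth_near M p (\<lambda>q. a)"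
  by (rule chart_exists[of p]) (simp add: smooth_near_iff germ_smooth_const)

lemma smooth_near_add: "smooth_near M p f \<Longrightarrow> smooth_near M p f' \<Longrightarrow> smooth_near M p (\<lambda>q. f q + f' q)"
  by (rule chart_exists[of p]) (simp add: smooth_near_iff germ_smooth_add)

lemma smooth_near_mult: "smooth_near M p f \<Longrightarrow> smooth_near M p f' \<Longrightarrow> smooth_near M p (\<lambda>q. f q * f' q)"
  by (rule chart_exists[of p]) (simp add: smooth_near_iff germ_smooth_mult)

lemma smooth_near_sum: "(\<And>i. i \<in> I \<Longrightarrow> smooth_near M p (f i)) \<Longrightarrow> smooth_near M p (\<lambda>q. \<Sum>i\<in>I. f i q)"
  by (induction I rule: infinite_finite_induct) (auto intro: smooth_near_const smooth_near_add)

lemma smooth_near_ev: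
  "smooth_near M p f \<Longrightarrow> \<forall>\<^sub>F q in nhds p. f q = f' q \<Longrightarrow> smooth_near M p f'"
  by (rule chart_exists[of p]) (metis germ_smooth_ev smooth_near_iff)

subsection \<open>Curves\<close>

lemma smooth_curve_chart:
  assumes "smooth_curve M S \<gamma>" "open S" "(U, z) \<in> atlas M"
  shows "open {t\<in>S. \<gamma> t \<in> U}" "smooth_on {t\<in>S. \<gamma> t \<in> U} (\<lambda>t. z (\<gamma> t))"
proof -
  have "{t\<in>S. \<gamma> t \<in> U} = S \<inter> \<gamma> -` U" by auto
  then show "open {t\<in>S. \<gamma> t \<in> U}"
    using assms chart_open[OF assms(3)] continuous_open_preimage[of S \<gamma> U]
    by (auto simp: smooth_curve_def)
  show "smooth_on {t\<in>S. \<gamma> t \<in> U} (\<lambda>t. z (\<gamma> t))"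
    using assms by (auto simp: smooth_curve_def)
qed

lemma smooth_curveI_local:
  assumes "\<And>t. t \<in> S \<Longrightarrow> \<exists>U z T. (U, z) \<in> atlas M \<and> open T \<and> t \<in> T \<and> (\<forall>s\<in>T. \<gamma> s \<in> U) \<and> smooth_on T (\<lambda>s. z (\<gamma> s))"
  shows "smooth_curve M S \<gamma>"
  unfolding smooth_curve_def
proof
  show "continuous_on S \<gamma>"
  proof (rule continuous_at_imp_continuous_on, rule ballI)
    fix t assume "t \<in> S"
    then obtain U z T where 1: "(U, z) \<in> atlas M" "open T" "t \<in> T" "\<forall>s\<in>T. \<gamma> s \<in> U" "smooth_on T (\<lambda>s. z (\<gamma> s))"
      using assms by blast
    have "continuous_on (z ` U) (inv_into U z)"
      using chart_homeo[OF 1(1)] by (auto simp: homeomorphism_def)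
    then have "continuous_on T (\<lambda>s. inv_into U z (z (\<gamma> s)))"
      by (rule continuous_on_compose2[OF _ smooth_on_continuous[OF 1(5)]]) (use 1(4) in auto)
    moreover have "inv_into U z (z (\<gamma> s)) = \<gamma> s" if "s \<in> T" for s
      using 1 that chart_inverse by blast
    ultimately have "continuous_on T \<gamma>" by (simp cong: continuous_on_cong)
    then show "isCont \<gamma> t" using 1 continuous_on_eq_continuous_at by blast
  qed
  show "\<forall>(U, z)\<in>atlas M. smooth_on {t \<in> S. \<gamma> t \<in> U} (\<lambda>t. z (\<gamma> t))"
  proof safe
    fix V w assume vw: "(V, w) \<in> atlas M"
    show "smooth_on {t \<in> S. \<gamma> t \<in> V} (\<lambda>t. w (\<gamma> t))"
    proof (rule smooth_on_local)
      fix t assume t: "t \<in> {t \<in> S. \<gamma> t \<in> V}"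
      then obtain U z T where 1: "(U, z) \<in> atlas M" "open T" "t \<in> T" "\<forall>s\<in>T. \<gamma> s \<in> U" "smooth_on T (\<lambda>s. z (\<gamma> s))"
        using assms by blast
      show "\<exists>T. open T \<and> t \<in> T \<and> smooth_on T (\<lambda>t. w (\<gamma> t))"
        using germ_smooth_along_curve_vec[where \<Gamma>=\<gamma> and h=w, OF germ_smooth_transition[OF 1(1) vw] 1(2,3,5)] 1 t
        by blast
    qed
  qed
qed

lemma curve_derivative:
  assumes "smooth_curve M S \<gamma>" "open S" "t \<in> S" "smooth_near M (\<gamma> t) f"
  shows "((\<lambda>s. f (\<gamma> s)) has_real_derivative velocity (smooth_near M) \<gamma> t f) (at t)"
proof -
  obtain U z where uz: "(U, z) \<in> atlas M" "\<gamma> t \<in> U" using chart_exists by blast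
  have T: "open {t\<in>S. \<gamma> t \<in> U}" "smooth_on {t\<in>S. \<gamma> t \<in> U} (\<lambda>t. z (\<gamma> t))"
    using smooth_curve_chart[OF assms(1,2) uz(1)] by auto
  obtain W G where G: "open W" "z (\<gamma> t) \<in> W" "smooth_on W G" "\<And>y. y \<in> U \<Longrightarrow> z y \<in> W \<Longrightarrow> f y = G (z y)"
    using germ_smoothE assms(4) smooth_near_iff[OF uz] by metis
  have ev: "\<forall>\<^sub>F s in nhds t. \<gamma> s \<in> U"
    using eventually_nhds_in_open[OF T(1), of t] uz(2) assms(3) by (auto elim: eventually_mono)
  have "(\<lambda>s. f (\<gamma> s)) differentiable (at t)"
    using chart_curve_derivative[OF smooth_on_has_vector_derivative[OF T(2)] ev G] assms(3) uz(2)
    by (auto intro: differentiableI simp: has_field_derivative_def)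
  then show ?thesis
    using assms(4) by (simp add: velocity_def DERIV_deriv_iff_real_differentiable)
qed

lemma velocity_in_tangent:
  assumes "smooth_curve M S \<gamma>" "open S" "t \<in> S"
  shows "velocity (smooth_near M) \<gamma> t \<in> tangent M (\<gamma> t)"
proof -
  obtain e where e: "e > 0" "ball t e \<subseteq> S" using assms(2,3) openE by blast
  have in_S: "t + s \<in> S" if "s \<in> {-e<..<e}" for s
    using e(2) that by (auto simp: dist_real_def subset_iff)
  have "smooth_curve M {-e<..<e} (\<lambda>s. \<gamma> (t + s))"
  proof (rule smooth_curveI_local)
    fix s assume s: "s \<in> {-e<..<e}"
    obtain U z where uz: "(U, z) \<in> atlas M" "\<gamma> (t + s) \<in> U" using chart_exists by blast
    let ?T = "{t\<in>S. \<gamma> t \<in> U}" and ?T' = "(\<lambda>s. t + s) -` {t\<in>S. \<gamma> t \<in> U}"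
    have T: "open ?T" "smooth_on ?T (\<lambda>t. z (\<gamma> t))"
      using smooth_curve_chart[OF assms(1,2) uz(1)] by auto
    have o: "open ?T'" by (rule open_vimage[OF T(1)]) (rule continuous_on_add[OF continuous_on_const continuous_on_id])
    have "smooth_on ?T' (\<lambda>s. z (\<gamma> (t + s)))"
      by (rule smooth_on_compose[OF o smooth_on_add[OF o smooth_on_const smooth_on_ident] T(2)]) auto
    then show "\<exists>U z T. (U, z) \<in> atlas M \<and> open T \<and> s \<in> T \<and> (\<forall>s\<in>T. \<gamma> (t + s) \<in> U) \<and> smooth_on T (\<lambda>s. z (\<gamma> (t + s)))"
      using uz o in_S[OF s] by (intro exI[of _ U] exI[of _ z] exI[of _ ?T']) auto
  qed
  moreover have "velocity (smooth_near M) \<gamma> t = velocity (smooth_near M) (\<lambda>s. \<gamma> (t + s)) 0"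
    unfolding velocity_def by (rule ext) (auto simp: deriv_shift_0[of _ t] o_def)
  ultimately show ?thesis using e(1) unfolding tangent_def by (auto intro!: exI[of _ "\<lambda>s. \<gamma> (t + s)"])
qed

subsection \<open>Tangent vectors in coordinates\<close>

lemma chart_vec_curve:
  assumes "smooth_curve M S \<gamma>" "open S" "t \<in> S" "(U, z) \<in> atlas M" "\<gamma> t \<in> U"
  shows "chart_vec U z (\<gamma> t) (velocity (smooth_near M) \<gamma> t) (vector_derivative (\<lambda>s. z (\<gamma> s)) (at t))"
proof (rule chart_vec_velocity)
  have T: "open {t\<in>S. \<gamma> t \<in> U}" "smooth_on {t\<in>S. \<gamma> t \<in> U} (\<lambda>t. z (\<gamma> t))"
    using smooth_curve_chart[OF assms(1,2,4)] by auto
  show "((\<lambda>s. z (\<gamma> s)) has_vector_derivative vector_derivative (\<lambda>s. z (\<gamma> s)) (at t)) (at t)"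
    using smooth_on_has_vector_derivative[OF T(2)] assms by auto
  show "\<forall>\<^sub>F s in nhds t. \<gamma> s \<in> U"
    using eventually_nhds_in_open[OF T(1), of t] assms by (auto elim: eventually_mono)
qed (use smooth_near_iff assms in blast)

lemma dcoord_chart_vec:
  assumes "chart_vec U z p v h"
  shows "dcoord z v = h"
proof -
  have "v (\<lambda>q. Re (z q $ k)) = Re (h $ k)" "v (\<lambda>q. Im (z q $ k)) = Im (h $ k)" for k
    using chart_vec_component[OF assms, of "axis k 1"] chart_vec_component[OF assms, of "axis k \<i>"]
    by (auto simp: inner_axis inner_complex_def)
  then show ?thesis by (simp add: dcoord_def vec_eq_iff complex_eq_iff)
qed

lemma tangentE:
  assumes "v \<in> tangent M p"
  obtains \<gamma> \<epsilon> where "\<epsilon> > 0" "smooth_curve M {-\<epsilon><..<\<epsilon>} \<gamma>" "\<gamma> 0 = p" "v = velocity (smooth_near M) \<gamma> 0"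
  using assms unfolding tangent_def by blast

lemma chart_vec_tangent:
  assumes "(U, z) \<in> atlas M" "p \<in> U" "v \<in> tangent M p"
  shows "chart_vec U z p v (dcoord z v)"
proof -
  obtain \<gamma> \<epsilon> where 1: "\<epsilon> > 0" "smooth_curve M {-\<epsilon><..<\<epsilon>} \<gamma>" "\<gamma> 0 = p" "v = velocity (smooth_near M) \<gamma> 0"
    using tangentE[OF assms(3)] by blast
  have "chart_vec U z p v (vector_derivative (\<lambda>s. z (\<gamma> s)) (at 0))"
    using chart_vec_curve[OF 1(2) _ _ assms(1), of 0] 1 assms by auto
  then show ?thesis using dcoord_chart_vec by metis
qed

lemma tangent_outside: "v \<in> tangent M p \<Longrightarrow> \<not> smooth_near M p f \<Longrightarrow> v f = 0"
  by (auto elim!: tangentE simp: velocity_def)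

lemma tangent_eqI:
  assumes "(U, z) \<in> atlas M" "p \<in> U" "v \<in> tangent M p" "w \<in> tangent M p" "dcoord z v = dcoord z w"
  shows "v = w"
proof
  fix f show "v f = w f"
    using chart_vec_unique chart_vec_tangent[OF assms(1,2,3)] chart_vec_tangent[OF assms(1,2,4)] assms(5)
      tangent_outside[OF assms(3)] tangent_outside[OF assms(4)] smooth_near_iff[OF assms(1,2)]
    by metis
qed

lemma dcoord_cmodel:
  assumes "(U, z) \<in> atlas M" "p \<in> U" "v \<in> tangent M p"
  shows "dcoord z v \<in> cmodel M"
proof -
  have "dcoord z v $ k = 0" if "k \<notin> cindex M" for k
  proof -
    have 0: "z q $ k = 0" if "q \<in> U" for q
      using chart_cmodel[OF assms(1) that] \<open>k \<notin> cindex M\<close> by (auto simp: cmodel_def)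
    have "v f = 0" if "\<forall>q\<in>U. f q = 0" for f
      using chart_vec_eval[OF chart_vec_tangent[OF assms], of UNIV "\<lambda>_. 0" f] that
      by (auto intro: smooth_intros)
    then show ?thesis using 0 by (simp add: dcoord_def complex_eq_iff)
  qed
  then show ?thesis by (auto simp: cmodel_def)
qed

lemma subspace_cmodel: "subspace (cmodel M)"
  unfolding subspace_def cmodel_def by auto

text \<open>The straight lines of a chart are the curves that realise all coordinate vectors.\<close>
lemma chart_line:
  assumes "(U, z) \<in> atlas M" "p \<in> U" "c \<in> cmodel M"
  obtains \<gamma> \<epsilon> where "\<epsilon> > 0" "smooth_curve M {-\<epsilon><..<\<epsilon>} \<gamma>" "\<gamma> 0 = p"
    "\<And>t. t \<in> {-\<epsilon><..<\<epsilon>} \<Longrightarrow> \<gamma> t \<in> U \<and> z (\<gamma> t) = z p + t *\<^sub>R c"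
proof -
  obtain W where W: "open W" "z ` U = cmodel M \<inter> W"
    using chart_image[OF assms(1)] unfolding openin_open by blast
  have "open ((\<lambda>t. z p + t *\<^sub>R c) -` W)"
    by (intro open_vimage W continuous_intros)
  moreover have "0 \<in> (\<lambda>t. z p + t *\<^sub>R c) -` W" using W assms by auto
  ultimately obtain e where e: "e > 0" "ball 0 e \<subseteq> (\<lambda>t. z p + t *\<^sub>R c) -` W" using openE by blast
  define \<gamma> where "\<gamma> t = inv_into U z (z p + t *\<^sub>R c)" for t
  have in_im: "z p + t *\<^sub>R c \<in> z ` U" if "t \<in> {-e<..<e}" for t
  proof -
    have "z p + t *\<^sub>R c \<in> W" using e(2) that by (auto simp: subset_iff dist_real_def)
    moreover have "z p + t *\<^sub>R c \<in> cmodel M"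
      using subspace_cmodel chart_cmodel[OF assms(1,2)] assms(3) by (simp add: subspace_add subspace_scale)
    ultimately show ?thesis using W by auto
  qed
  have \<gamma>: "\<gamma> t \<in> U \<and> z (\<gamma> t) = z p + t *\<^sub>R c" if "t \<in> {-e<..<e}" for t
    using in_im[OF that] unfolding \<gamma>_def by (auto intro: inv_into_into f_inv_into_f)
  have "smooth_curve M {-e<..<e} \<gamma>"
  proof (rule smooth_curveI_local)
    fix t assume t: "t \<in> {-e<..<e}"
    have o: "open {-e<..<e}" by simp
    have "smooth_on {-e<..<e} (\<lambda>t. z p + t *\<^sub>R c)" by (intro smooth_intros o)
    then have "smooth_on {-e<..<e} (\<lambda>t. z (\<gamma> t))" using smooth_on_cong[OF o] \<gamma> by (metis (no_types, lifting))
    then show "\<exists>U z T. (U, z) \<in> atlas M \<and> open T \<and> t \<in> T \<and> (\<forall>s\<in>T. \<gamma> s \<in> U) \<and> smooth_on T (\<lambda>s. z (\<gamma> s))"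
      using assms(1) \<gamma> t o by (intro exI[of _ U] exI[of _ z] exI[of _ "{-e<..<e}"]) auto
  qed
  moreover have "\<gamma> 0 = p" unfolding \<gamma>_def using chart_inverse[OF assms(1,2)] by simp
  ultimately show ?thesis using that e(1) \<gamma> by blast
qed

lemma chart_line_velocity:
  assumes "(U, z) \<in> atlas M" "smooth_curve M {-\<epsilon><..<\<epsilon>} \<gamma>"
    and "\<And>t. t \<in> {-\<epsilon><..<\<epsilon>} \<Longrightarrow> \<gamma> t \<in> U \<and> z (\<gamma> t) = a + t *\<^sub>R c" "t \<in> {-\<epsilon><..<\<epsilon>}"
  shows "dcoord z (velocity (smooth_near M) \<gamma> t) = c"
proof -
  have "((\<lambda>s. a + s *\<^sub>R c) has_vector_derivative c) (at t)"
    by (auto intro!: derivative_eq_intros)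
  then have "((\<lambda>s. z (\<gamma> s)) has_vector_derivative c) (at t)"
    by (rule has_vector_derivative_transform_within_open[of _ _ _ "{-\<epsilon><..<\<epsilon>}"]) (use assms in auto)
  then have "vector_derivative (\<lambda>s. z (\<gamma> s)) (at t) = c" using vector_derivative_at by blast
  then show ?thesis
    using dcoord_chart_vec[OF chart_vec_curve[OF assms(2) _ assms(4) assms(1)]] assms(3)[OF assms(4)] by auto
qed

lemma tangent_exists:
  assumes "(U, z) \<in> atlas M" "p \<in> U" "c \<in> cmodel M"
  obtains w where "w \<in> tangent M p" "dcoord z w = c"
proof -
  obtain \<gamma> \<epsilon> where 1: "\<epsilon> > 0" "smooth_curve M {-\<epsilon><..<\<epsilon>} \<gamma>" "\<gamma> 0 = p"
    "\<And>t. t \<in> {-\<epsilon><..<\<epsilon>} \<Longrightarrow> \<gamma> t \<in> U \<and> z (\<gamma> t) = z p + t *\<^sub>R c"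
    using chart_line[OF assms] by metis
  show ?thesis
    using that[of "velocity (smooth_near M) \<gamma> 0"] velocity_in_tangent[OF 1(2), of 0]
      chart_line_velocity[OF assms(1) 1(2,4), of 0] 1 by auto
qed

lemma velocity_const: "velocity (smooth_near M) (\<lambda>_. p) t = (\<lambda>f. 0)"
  by (auto simp: velocity_def)

lemma smooth_curve_const: "smooth_curve M S (\<lambda>_. p)"
  by (auto simp: smooth_curve_def intro: smooth_intros)

lemma zero_in_tangent: "(\<lambda>f. 0) \<in> tangent M p"
  using velocity_in_tangent[OF smooth_curve_const, of UNIV 0 p] velocity_const by simp

text \<open>Transition maps are holomorphic, so multiplication by \<open>\<i>\<close> does not depend on the chart.\<close>
lemma cstruct:
  assumes "v \<in> tangent M p"
  shows "cstruct M p v \<in> tangent M p"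
    and "(U, z) \<in> atlas M \<Longrightarrow> p \<in> U \<Longrightarrow> dcoord z (cstruct M p v) = \<i> *s dcoord z v"
proof -
  obtain V w where vw: "(V, w) \<in> atlas M" "p \<in> V" using chart_exists by blast
  have "\<i> *s dcoord w v \<in> cmodel M" using dcoord_cmodel[OF vw assms] by (auto simp: cmodel_def)
  then obtain u where u: "u \<in> tangent M p" "dcoord w u = \<i> *s dcoord w v"
    using tangent_exists[OF vw] by metis
  have all: "dcoord z u = \<i> *s dcoord z v" if uz: "(U, z) \<in> atlas M" "p \<in> U" for U z
  proof -
    obtain W \<tau> where W: "open W" "w p \<in> W" "holomorphic_map_on W \<tau>"
        "\<And>q. q \<in> V \<Longrightarrow> w q \<in> W \<Longrightarrow> q \<in> U \<and> z q = \<tau> (w q)"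
      using transition[OF vw(1) uz(1) vw(2) uz(2)] by metis
    have s: "smooth_on W \<tau>" using W by (simp add: holomorphic_map_on_def)
    have key: "dcoord z u' = frechet_derivative \<tau> (at (w p)) (dcoord w u')" if "u' \<in> tangent M p" for u'
    proof (rule euclidean_eqI)
      fix b :: "complex ^ 'n" 
      have "dcoord z u' \<bullet> b = u' (\<lambda>q. z q \<bullet> b)"
        using chart_vec_component[OF chart_vec_tangent[OF uz that]] by simp
      also have "\<dots> = frechet_derivative (\<lambda>x. \<tau> x \<bullet> b) (at (w p)) (dcoord w u')"
        using W s by (intro chart_vec_eval[OF chart_vec_tangent[OF vw that], of W]) (auto intro: smooth_on_inner)
      also have "frechet_derivative (\<lambda>x. \<tau> x \<bullet> b) (at (w p)) = (\<lambda>h. frechet_derivative \<tau> (at (w p)) h \<bullet> b)"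
        using smooth_on_has_derivative[OF s W(2)]
        by (intro frechet_derivative_at[symmetric] bounded_linear.has_derivative[OF bounded_linear_inner_left])
      finally show "dcoord z u' \<bullet> b = frechet_derivative \<tau> (at (w p)) (dcoord w u') \<bullet> b" .
    qed
    show ?thesis using key[OF u(1)] key[OF assms] u(2) W by (simp add: holomorphic_map_on_def)
  qed
  have "cstruct M p v = u"
    unfolding cstruct_def
  proof (rule the_equality)
    show "u \<in> tangent M p \<and> (\<forall>(U, z)\<in>atlas M. p \<in> U \<longrightarrow> dcoord z u = \<i> *s dcoord z v)"
      using u all by auto
    show "u' = u" if "u' \<in> tangent M p \<and> (\<forall>(U, z)\<in>atlas M. p \<in> U \<longrightarrow> dcoord z u' = \<i> *s dcoord z v)" for u'
      using that vw u by (intro tangent_eqI[OF vw]) auto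
  qed
  then show "cstruct M p v \<in> tangent M p"
    and "(U, z) \<in> atlas M \<Longrightarrow> p \<in> U \<Longrightarrow> dcoord z (cstruct M p v) = \<i> *s dcoord z v"
    using u all by auto
qed

text \<open>
  The velocities of the lines of a chart extend to a field with constant components; with it, the covariant
  derivatives along a line become values of a smooth section of the bundle.
\<close>
lemma coordinate_field:
  assumes "(U, z) \<in> atlas M" "c \<in> cmodel M"
  obtains X where "\<And>q. q \<in> U \<Longrightarrow> X q \<in> tangent M q \<and> dcoord z (X q) = c"
    "\<And>p. p \<in> U \<Longrightarrow> smooth_field_near M p X"
proof -
  obtain X where X: "\<And>q. q \<in> U \<Longrightarrow> X q \<in> tangent M q \<and> dcoord z (X q) = c"
    using bchoice[of U "\<lambda>q v. v \<in> tangent M q \<and> dcoord z v = c"] tangent_exists[OF assms(1) _ assms(2)] by (smt (verit))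
  have "smooth_field_near M p X" if p: "p \<in> U" for p
    unfolding smooth_field_near_def
  proof (intro conjI allI impI)
    show "\<forall>\<^sub>F q in nhds p. X q \<in> tangent M q"
      using eventually_nhds_in_open[OF chart_open[OF assms(1)] p] by eventually_elim (use X in auto)
    fix f assume "smooth_near M p f"
    then obtain W G where G: "open W" "z p \<in> W" "smooth_on W G" "\<And>y. y \<in> U \<Longrightarrow> z y \<in> W \<Longrightarrow> f y = G (z y)"
      using germ_smoothE smooth_near_iff[OF assms(1) p] by metis
    have "X q f = frechet_derivative G (at (z q)) c" if "q \<in> U" "z q \<in> W" for q
      using chart_vec_eval[OF chart_vec_tangent[OF assms(1) that(1)], of "X q" W G f] X[OF that(1)] G that by auto
    then have "germ_smooth U z p (\<lambda>q. X q f)"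
      using G by (intro germ_smoothI[of W z p "\<lambda>u. frechet_derivative G (at u) c"] smooth_on_derivative) auto
    then show "smooth_near M p (\<lambda>q. X q f)" using smooth_near_iff[OF assms(1) p] by simp
  qed
  then show ?thesis using that X by blast
qed

end

section \<open>Local frames, sections and endomorphisms\<close>

lemma (in complex_mfd) open_ev: "open S \<Longrightarrow> p \<in> S \<Longrightarrow> \<forall>\<^sub>F q in nhds p. q \<in> S"
  by (rule eventually_nhds_in_open)

locale vec_bundle = complex_mfd M
  for M :: "('m::{t2_space,second_countable_topology}, 'n::finite) cmanifold" +
  fixes E :: "('m, 'v::real_vector, 'k::finite) vbundle"
  assumes vb: "vector_bundle M E"
begin

abbreviation "I \<equiv> bindex E"

lemmas frame_conditions = vb[unfolded vector_bundle_def]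

lemma subspace_fibre: "subspace (fibre E p)"
  using frame_conditions by simp

lemmas fibre_add = subspace_add[OF subspace_fibre]
  and fibre_scale = subspace_scale[OF subspace_fibre]
  and fibre_zero = subspace_0[OF subspace_fibre]
  and fibre_neg = subspace_neg[OF subspace_fibre]
  and fibre_diff = subspace_diff[OF subspace_fibre]
  and fibre_sum = subspace_sum[OF subspace_fibre]

lemma frame_exists: obtains V s where "(V, s) \<in> frames E" "p \<in> V"
proof -
  have "p \<in> (\<Union>(V, s)\<in>frames E. V)" using frame_conditions[THEN conjunct2, THEN conjunct1] by simp
  then show ?thesis using that by auto
qed

context
  fixes V s assumes vs: "(V, s) \<in> frames E"
begin

lemma frame_open: "open V"
  using frame_conditions[THEN conjunct2, THEN conjunct2, THEN conjunct1, rule_format, OF vs] by simp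

lemma frame_basis:
  assumes "p \<in> V"
  shows "inj_on (\<lambda>i. s i p) I" "independent ((\<lambda>i. s i p) ` I)" "span ((\<lambda>i. s i p) ` I) = fibre E p"
proof -
  have c: "\<forall>p\<in>V. inj_on (\<lambda>i. s i p) I \<and> independent ((\<lambda>i. s i p) ` I) \<and> span ((\<lambda>i. s i p) ` I) = fibre E p"
    using frame_conditions[THEN conjunct2, THEN conjunct2, THEN conjunct1, rule_format, OF vs]
    unfolding prod.case by (rule conjunct2)
  show "inj_on (\<lambda>i. s i p) I" "independent ((\<lambda>i. s i p) ` I)" "span ((\<lambda>i. s i p) ` I) = fibre E p"
    using bspec[OF c assms] by (rule conjunct1, rule conjunct2[THEN conjunct1], rule conjunct2[THEN conjunct2])
qed

lemma frame_in_fibre: "p \<in> V \<Longrightarrow> i \<in> I \<Longrightarrow> s i p \<in> fibre E p"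
  using span_base[of "s i p" "(\<lambda>i. s i p) ` I"] frame_basis(3)[of p] by simp

lemma coef_expand:
  assumes "p \<in> V" "e \<in> fibre E p"
  shows "(\<Sum>i\<in>I. coef E s p e i *\<^sub>R s i p) = e"
proof -
  have "(\<Sum>b\<in>(\<lambda>i. s i p) ` I. representation ((\<lambda>i. s i p) ` I) e b *\<^sub>R b) = e"
    using frame_basis[OF assms(1)] assms(2) by (intro real_vector.sum_representation_eq) auto
  then show ?thesis unfolding coef_def by (simp add: sum.reindex[OF frame_basis(1)[OF assms(1)]] o_def)
qed

lemma coef_add:
  assumes "p \<in> V" "e \<in> fibre E p" "e' \<in> fibre E p"
  shows "coef E s p (e + e') i = coef E s p e i + coef E s p e' i"
  using assms frame_basis[OF assms(1)] by (simp add: coef_def real_vector.representation_add)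

lemma coef_scale:
  assumes "p \<in> V" "e \<in> fibre E p"
  shows "coef E s p (a *\<^sub>R e) i = a * coef E s p e i"
  using assms frame_basis[OF assms(1)] by (simp add: coef_def real_vector.representation_scale)

lemma coef_zero: "coef E s p 0 i = 0"
  by (simp add: coef_def real_vector.representation_zero)

lemma coef_frame:
  assumes "p \<in> V" "i \<in> I" "j \<in> I"
  shows "coef E s p (s j p) i = (if i = j then 1 else 0)"
  using real_vector.representation_basis[OF frame_basis(2)[OF assms(1)], of "s j p"] assms
    inj_onD[OF frame_basis(1)[OF assms(1)], of i j]
  by (auto simp: coef_def)

lemma coef_lincomb:
  assumes "p \<in> V" "\<And>j. j \<in> K \<Longrightarrow> e j \<in> fibre E p"
  shows "coef E s p (\<Sum>j\<in>K. a j *\<^sub>R e j) i = (\<Sum>j\<in>K. a j * coef E s p (e j) i)"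
  using assms(2)
proof (induction K rule: infinite_finite_induct)
  case (insert j K)
  then show ?case
    using assms(1) by (simp add: coef_add coef_scale fibre_sum fibre_scale)
qed (auto simp: coef_zero)

lemma coef_frame_sum:
  assumes "p \<in> V" "i \<in> I"
  shows "coef E s p (\<Sum>j\<in>I. a j *\<^sub>R s j p) i = a i"
proof -
  have "coef E s p (\<Sum>j\<in>I. a j *\<^sub>R s j p) i = (\<Sum>j\<in>I. a j * coef E s p (s j p) i)"
    using assms by (intro coef_lincomb) (auto simp: frame_in_fibre)
  also have "\<dots> = (\<Sum>j\<in>I. if j = i then a j else 0)"
    using assms by (intro sum.cong) (auto simp: coef_frame)
  finally show ?thesis using assms(2) by (simp add: sum.delta)
qed

lemma fibre_eqI:
  assumes "p \<in> V" "e \<in> fibre E p" "e' \<in> fibre E p" "\<And>i. i \<in> I \<Longrightarrow> coef E s p e i = coef E s p e' i"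
  shows "e = e'"
  using coef_expand[OF assms(1,2)] coef_expand[OF assms(1,3)] assms(4) by (metis (no_types, lifting) sum.cong)

lemma frame_linear_indep:
  assumes "p \<in> V" "(\<Sum>i\<in>I. a i *\<^sub>R s i p) = 0" "i \<in> I"
  shows "a i = 0"
  using coef_frame_sum[OF assms(1,3), of a] assms(2) coef_zero by simp

end

lemma coef_change:
  assumes "(V, s) \<in> frames E" "(V', s') \<in> frames E" "p \<in> V" "p \<in> V'" "e \<in> fibre E p"
  shows "coef E s' p e i = (\<Sum>j\<in>I. coef E s p e j * coef E s' p (s j p) i)"
proof -
  have "coef E s' p e i = coef E s' p (\<Sum>j\<in>I. coef E s p e j *\<^sub>R s j p) i"
    using coef_expand[OF assms(1,3,5)] by simp
  also have "\<dots> = (\<Sum>j\<in>I. coef E s p e j * coef E s' p (s j p) i)"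
    using assms by (intro coef_lincomb[OF assms(2)]) (auto simp: frame_in_fibre[OF assms(1)])
  finally show ?thesis .
qed

lemma transition_smooth:
  assumes "(V, s) \<in> frames E" "(V', s') \<in> frames E" "p \<in> V" "p \<in> V'" "i \<in> I" "j \<in> I"
  shows "smooth_near M p (\<lambda>q. coef E s' q (s j q) i)"
  using frame_conditions[THEN conjunct2, THEN conjunct2, THEN conjunct2, rule_format, OF assms(1),
      unfolded prod.case, rule_format, OF assms(2), unfolded prod.case, rule_format, of p i j] assms by simp

subsection \<open>Sections\<close>

lemma section_fibre: "smooth_section_near M E p \<sigma> \<Longrightarrow> \<sigma> p \<in> fibre E p"
  unfolding smooth_section_near_def using eventually_nhds_x_imp_x by fast

text \<open>One frame decides whether a section is smooth, since the transition matrices are smooth.\<close>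
lemma section_iff:
  assumes "(V, s) \<in> frames E" "p \<in> V"
  shows "smooth_section_near M E p \<sigma> \<longleftrightarrow> (\<forall>\<^sub>F q in nhds p. \<sigma> q \<in> fibre E q) \<and>
     (\<forall>i\<in>I. smooth_near M p (\<lambda>q. coef E s q (\<sigma> q) i))"
proof
  assume "smooth_section_near M E p \<sigma>"
  then show "(\<forall>\<^sub>F q in nhds p. \<sigma> q \<in> fibre E q) \<and> (\<forall>i\<in>I. smooth_near M p (\<lambda>q. coef E s q (\<sigma> q) i))"
    using assms unfolding smooth_section_near_def by blast
next
  assume a: "(\<forall>\<^sub>F q in nhds p. \<sigma> q \<in> fibre E q) \<and> (\<forall>i\<in>I. smooth_near M p (\<lambda>q. coef E s q (\<sigma> q) i))"
  have "smooth_near M p (\<lambda>q. coef E s' q (\<sigma> q) i)"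
    if vs': "(V', s') \<in> frames E" "p \<in> V'" and i: "i \<in> I" for V' s' i
  proof (rule smooth_near_ev)
    show "smooth_near M p (\<lambda>q. \<Sum>j\<in>I. coef E s q (\<sigma> q) j * coef E s' q (s j q) i)"
      using a i transition_smooth[OF assms(1) vs'(1) assms(2) vs'(2)]
      by (intro smooth_near_sum smooth_near_mult) auto
    show "\<forall>\<^sub>F q in nhds p. (\<Sum>j\<in>I. coef E s q (\<sigma> q) j * coef E s' q (s j q) i) = coef E s' q (\<sigma> q) i"
      using a[THEN conjunct1] open_ev[OF frame_open[OF assms(1)] assms(2)] open_ev[OF frame_open[OF vs'(1)] vs'(2)]
      by eventually_elim (simp add: coef_change[OF assms(1) vs'(1)])
  qed
  then show "smooth_section_near M E p \<sigma>"
    using a unfolding smooth_section_near_def by blast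
qed

lemma section_frame:
  assumes "(V, s) \<in> frames E" "p \<in> V" "j \<in> I"
  shows "smooth_section_near M E p (s j)"
  unfolding section_iff[OF assms(1,2)]
  using open_ev[OF frame_open[OF assms(1)] assms(2)] transition_smooth[OF assms(1,1,2,2) _ assms(3)]
    frame_in_fibre[OF assms(1) _ assms(3)] by (auto elim: eventually_mono)

lemma section_add:
  assumes "smooth_section_near M E p \<sigma>" "smooth_section_near M E p \<tau>"
  shows "smooth_section_near M E p (\<lambda>q. \<sigma> q + \<tau> q)"
proof -
  obtain V s where vs: "(V, s) \<in> frames E" "p \<in> V" by (rule frame_exists)
  note a = assms(1)[unfolded section_iff[OF vs]] assms(2)[unfolded section_iff[OF vs]]
  have "\<forall>\<^sub>F q in nhds p. \<sigma> q + \<tau> q \<in> fibre E q"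
    using a(1)[THEN conjunct1] a(2)[THEN conjunct1] by eventually_elim (simp add: fibre_add)
  moreover have "smooth_near M p (\<lambda>q. coef E s q (\<sigma> q + \<tau> q) i)" if "i \<in> I" for i
  proof (rule smooth_near_ev[OF smooth_near_add])
    show "smooth_near M p (\<lambda>q. coef E s q (\<sigma> q) i)" "smooth_near M p (\<lambda>q. coef E s q (\<tau> q) i)"
      using a that by auto
    show "\<forall>\<^sub>F q in nhds p. coef E s q (\<sigma> q) i + coef E s q (\<tau> q) i = coef E s q (\<sigma> q + \<tau> q) i"
      using a(1)[THEN conjunct1] a(2)[THEN conjunct1] open_ev[OF frame_open[OF vs(1)] vs(2)]
      by eventually_elim (simp add: coef_add[OF vs(1)])
  qed
  ultimately show ?thesis unfolding section_iff[OF vs] by blast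
qed

lemma section_scale:
  assumes "smooth_section_near M E p \<sigma>" "smooth_near M p f"
  shows "smooth_section_near M E p (\<lambda>q. f q *\<^sub>R \<sigma> q)"
proof -
  obtain V s where vs: "(V, s) \<in> frames E" "p \<in> V" by (rule frame_exists)
  note a = assms(1)[unfolded section_iff[OF vs]]
  have "\<forall>\<^sub>F q in nhds p. f q *\<^sub>R \<sigma> q \<in> fibre E q"
    using a[THEN conjunct1] by eventually_elim (simp add: fibre_scale)
  moreover have "smooth_near M p (\<lambda>q. coef E s q (f q *\<^sub>R \<sigma> q) i)" if "i \<in> I" for i
  proof (rule smooth_near_ev[OF smooth_near_mult])
    show "smooth_near M p f" "smooth_near M p (\<lambda>q. coef E s q (\<sigma> q) i)"
      using a assms that by auto
    show "\<forall>\<^sub>F q in nhds p. f q * coef E s q (\<sigma> q) i = coef E s q (f q *\<^sub>R \<sigma> q) i"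
      using a[THEN conjunct1] open_ev[OF frame_open[OF vs(1)] vs(2)]
      by eventually_elim (simp add: coef_scale[OF vs(1)])
  qed
  ultimately show ?thesis unfolding section_iff[OF vs] by blast
qed

lemma section_zero: "smooth_section_near M E p (\<lambda>q. 0)"
proof -
  obtain V s where vs: "(V, s) \<in> frames E" "p \<in> V" by (rule frame_exists)
  show ?thesis unfolding section_iff[OF vs]
    by (simp add: fibre_zero coef_zero[OF vs(1)] smooth_near_const)
qed

lemma section_sum:
  "(\<And>i. i \<in> K \<Longrightarrow> smooth_section_near M E p (\<sigma> i)) \<Longrightarrow> smooth_section_near M E p (\<lambda>q. \<Sum>i\<in>K. \<sigma> i q)"
  by (induction K rule: infinite_finite_induct) (auto intro: section_zero section_add)

subsection \<open>Endomorphisms of a fibre and their matrices\<close>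

abbreviation fmat :: "('k \<Rightarrow> 'm \<Rightarrow> 'v) \<Rightarrow> 'm \<times> ('v \<Rightarrow> 'v) \<Rightarrow> real ^ 'k ^ 'k" where
  "fmat s y \<equiv> frame_matrix E s (fst y) (snd y)"

lemma End_in: "J \<in> End_fibre E p \<Longrightarrow> e \<in> fibre E p \<Longrightarrow> J e \<in> fibre E p"
  by (simp add: End_fibre_def)

lemma End_add: "J \<in> End_fibre E p \<Longrightarrow> e \<in> fibre E p \<Longrightarrow> e' \<in> fibre E p \<Longrightarrow> J (e + e') = J e + J e'"
  by (simp add: End_fibre_def)

lemma End_scale: "J \<in> End_fibre E p \<Longrightarrow> e \<in> fibre E p \<Longrightarrow> J (a *\<^sub>R e) = a *\<^sub>R J e"
  by (simp add: End_fibre_def)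

lemma End_lincomb:
  assumes "J \<in> End_fibre E p" "\<And>j. j \<in> K \<Longrightarrow> e j \<in> fibre E p"
  shows "J (\<Sum>j\<in>K. a j *\<^sub>R e j) = (\<Sum>j\<in>K. a j *\<^sub>R J (e j))"
  using assms(2)
proof (induction K rule: infinite_finite_induct)
  case (insert j K)
  then show ?case
    using assms(1) by (simp add: End_add End_scale fibre_sum fibre_scale)
next
  case (infinite K)
  have "J (0 *\<^sub>R 0) = 0 *\<^sub>R J 0" using assms(1) fibre_zero unfolding End_fibre_def by blast
  then show ?case using infinite by simp
next
  case empty
  have "J (0 *\<^sub>R 0) = 0 *\<^sub>R J 0" using assms(1) fibre_zero unfolding End_fibre_def by blast
  then show ?case by simp
qed

lemma End_zero: "J \<in> End_fibre E p \<Longrightarrow> J 0 = 0"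
  using End_lincomb[of J p "{}"] by simp

lemma End_neg: "J \<in> End_fibre E p \<Longrightarrow> e \<in> fibre E p \<Longrightarrow> J (- e) = - J e"
  using End_scale[of J p e "-1"] by simp

lemma End_diff: "J \<in> End_fibre E p \<Longrightarrow> e \<in> fibre E p \<Longrightarrow> e' \<in> fibre E p \<Longrightarrow> J (e - e') = J e - J e'"
  using End_add[of J p e "- e'"] End_neg[of J p e'] by (simp add: fibre_neg)

lemma End_eqI:
  assumes "J \<in> End_fibre E p" "J' \<in> End_fibre E p" "\<And>e. e \<in> fibre E p \<Longrightarrow> J e = J' e"
  shows "J = J'"
proof
  fix e show "J e = J' e"
    using assms by (cases "e \<in> fibre E p") (auto simp: End_fibre_def)
qed

context
  fixes V s p assumes vs: "(V, s) \<in> frames E" and p: "p \<in> V"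
begin

lemma End_expand:
  assumes "J \<in> End_fibre E p" "e \<in> fibre E p"
  shows "J e = (\<Sum>j\<in>I. coef E s p e j *\<^sub>R J (s j p))"
  using End_lincomb[OF assms(1), of I "\<lambda>j. s j p" "coef E s p e"] coef_expand[OF vs p assms(2)]
    frame_in_fibre[OF vs p] by simp

lemma End_frame_eqI:
  assumes "J \<in> End_fibre E p" "J' \<in> End_fibre E p" "\<And>j. j \<in> I \<Longrightarrow> J (s j p) = J' (s j p)"
  shows "J = J'"
  using assms by (intro End_eqI) (auto simp: End_expand)

lemma matrix_frame:
  assumes "J \<in> End_fibre E p" "j \<in> I"
  shows "J (s j p) = (\<Sum>i\<in>I. frame_matrix E s p J $ i $ j *\<^sub>R s i p)"
proof -
  have "(\<Sum>i\<in>I. coef E s p (J (s j p)) i *\<^sub>R s i p) = J (s j p)"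
    using assms frame_in_fibre[OF vs p] End_in by (intro coef_expand[OF vs p]) auto
  then show ?thesis using assms(2) by (simp add: frame_matrix_def)
qed

lemma matrix_outside: "\<not> (i \<in> I \<and> j \<in> I) \<Longrightarrow> frame_matrix E s p J $ i $ j = 0"
  by (auto simp: frame_matrix_def)

lemma matrix_coef:
  assumes "J \<in> End_fibre E p" "e \<in> fibre E p" "i \<in> I"
  shows "coef E s p (J e) i = (\<Sum>j\<in>I. frame_matrix E s p J $ i $ j * coef E s p e j)"
proof -
  have "coef E s p (J e) i = (\<Sum>j\<in>I. coef E s p e j * coef E s p (J (s j p)) i)"
    unfolding End_expand[OF assms(1,2)]
    using assms frame_in_fibre[OF vs p] End_in by (intro coef_lincomb[OF vs p]) auto
  then show ?thesis using assms(3) by (simp add: frame_matrix_def mult.commute)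
qed

lemma matrix_End_eqI:
  assumes "J \<in> End_fibre E p" "J' \<in> End_fibre E p" "frame_matrix E s p J = frame_matrix E s p J'"
  shows "J = J'"
  using assms by (intro End_frame_eqI) (auto simp: matrix_frame)

end

definition endo :: "('k \<Rightarrow> 'm \<Rightarrow> 'v) \<Rightarrow> 'm \<Rightarrow> real ^ 'k ^ 'k \<Rightarrow> 'v \<Rightarrow> 'v" where
  "endo s p X e = (if e \<in> fibre E p then \<Sum>i\<in>I. (\<Sum>j\<in>I. X $ i $ j * coef E s p e j) *\<^sub>R s i p else 0)"

context
  fixes V s p assumes vs: "(V, s) \<in> frames E" and p: "p \<in> V"
begin

lemma endo_in_End: "endo s p X \<in> End_fibre E p"
  unfolding End_fibre_def
  by (auto simp: endo_def coef_add[OF vs p] coef_scale[OF vs p] fibre_add fibre_scale sum.distrib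
      algebra_simps sum_distrib_left scaleR_sum_right
      intro!: fibre_sum fibre_scale frame_in_fibre[OF vs p])

lemma endo_frame: "j \<in> I \<Longrightarrow> endo s p X (s j p) = (\<Sum>i\<in>I. X $ i $ j *\<^sub>R s i p)"
proof -
  assume j: "j \<in> I"
  have "(\<Sum>l\<in>I. X $ i $ l * coef E s p (s j p) l) = X $ i $ j" if "i \<in> I" for i
  proof -
    have "(\<Sum>l\<in>I. X $ i $ l * coef E s p (s j p) l) = (\<Sum>l\<in>I. if l = j then X $ i $ l else 0)"
      using j by (intro sum.cong) (auto simp: coef_frame[OF vs p])
    then show ?thesis using j by simp
  qed
  then show ?thesis using frame_in_fibre[OF vs p j] by (simp add: endo_def)
qed

lemma matrix_endo: "i \<in> I \<Longrightarrow> j \<in> I \<Longrightarrow> frame_matrix E s p (endo s p X) $ i $ j = X $ i $ j"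
  by (simp add: frame_matrix_def endo_frame coef_frame_sum[OF vs p])

lemma matrix_endo_eq:
  assumes "\<And>i j. \<not> (i \<in> I \<and> j \<in> I) \<Longrightarrow> X $ i $ j = 0"
  shows "frame_matrix E s p (endo s p X) = X"
proof -
  have "frame_matrix E s p (endo s p X) $ i $ j = X $ i $ j" for i j
    using matrix_endo[of i j] matrix_outside[OF vs p, of i j] assms[of i j] by (cases "i \<in> I \<and> j \<in> I") auto
  then show ?thesis by (simp add: vec_eq_iff)
qed

end

end

section \<open>The smooth structure of the twistor space\<close>

locale metric_bundle = vec_bundle M E
  for M :: "('m::{t2_space,second_countable_topology}, 'n::finite) cmanifold"
    and E :: "('m, 'v::real_vector, 'k::finite) vbundle" +
  fixes g :: "'m \<Rightarrow> 'v \<Rightarrow> 'v \<Rightarrow> real"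
  assumes fm: "fibre_metric M E g"
begin

lemma metric_fibre:
  assumes "x \<in> fibre E p" "y \<in> fibre E p"
  shows g_sym: "g p x y = g p y x"
    and g_add_left: "w \<in> fibre E p \<Longrightarrow> g p (x + y) w = g p x w + g p y w"
    and g_scale_left: "g p (a *\<^sub>R x) y = a * g p x y"
    and g_pos: "x \<noteq> 0 \<Longrightarrow> g p x x > 0"
  using fm assms unfolding fibre_metric_def by metis+

lemma metric_smooth:
  "smooth_section_near M E p \<sigma> \<Longrightarrow> smooth_section_near M E p \<tau> \<Longrightarrow> smooth_near M p (\<lambda>q. g q (\<sigma> q) (\<tau> q))"
  using fm unfolding fibre_metric_def by metis

lemma g_add_right:
  "x \<in> fibre E p \<Longrightarrow> y \<in> fibre E p \<Longrightarrow> w \<in> fibre E p \<Longrightarrow> g p w (x + y) = g p w x + g p w y"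
  using g_sym g_add_left fibre_add by metis

lemma g_scale_right: "x \<in> fibre E p \<Longrightarrow> y \<in> fibre E p \<Longrightarrow> g p x (a *\<^sub>R y) = a * g p x y"
  using g_sym g_scale_left fibre_scale by metis

lemma g_zero: "x \<in> fibre E p \<Longrightarrow> g p 0 x = 0" "x \<in> fibre E p \<Longrightarrow> g p x 0 = 0"
  using g_scale_left[of 0 p x 0] g_scale_right[of x p 0 0] fibre_zero by auto

lemma g_neg:
  assumes "x \<in> fibre E p" "y \<in> fibre E p"
  shows "g p (- x) y = - g p x y" "g p x (- y) = - g p x y"
  using g_scale_left[OF assms, of "-1"] g_scale_right[OF assms, of "-1"] by auto

lemma g_diff:
  assumes "x \<in> fibre E p" "y \<in> fibre E p" "w \<in> fibre E p"
  shows "g p (x - y) w = g p x w - g p y w" "g p w (x - y) = g p w x - g p w y"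
  using g_add_left[of x p "- y" w] g_add_right[of x p "- y" w] g_neg assms fibre_neg by auto

lemma g_sum_left:
  assumes "\<And>j. j \<in> K \<Longrightarrow> e j \<in> fibre E p" "x \<in> fibre E p"
  shows "g p (\<Sum>j\<in>K. a j *\<^sub>R e j) x = (\<Sum>j\<in>K. a j * g p (e j) x)"
  using assms(1)
  by (induction K rule: infinite_finite_induct)
    (auto simp: g_zero assms(2) g_add_left g_scale_left fibre_sum fibre_scale)

lemma g_sum_right:
  assumes "\<And>j. j \<in> K \<Longrightarrow> e j \<in> fibre E p" "x \<in> fibre E p"
  shows "g p x (\<Sum>j\<in>K. a j *\<^sub>R e j) = (\<Sum>j\<in>K. a j * g p x (e j))"
  using assms(1)
  by (induction K rule: infinite_finite_induct)
    (auto simp: g_zero assms(2) g_add_right g_scale_right fibre_sum fibre_scale)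

lemma g_definite: "x \<in> fibre E p \<Longrightarrow> g p x x = 0 \<Longrightarrow> x = 0"
  using g_pos[of x p x] by fastforce

lemma g_nondegenerate:
  assumes "x \<in> fibre E p" "y \<in> fibre E p" "\<And>w. w \<in> fibre E p \<Longrightarrow> g p x w = g p y w"
  shows "x = y"
  using g_definite[of "x - y" p] g_diff(1)[OF assms(1,2)] assms fibre_diff by simp

lemma gram_smooth:
  assumes "(V, s) \<in> frames E" "p \<in> V" "i \<in> I" "j \<in> I"
  shows "smooth_near M p (\<lambda>q. g q (s i q) (s j q))"
  using metric_smooth section_frame assms by blast

lemma twistorD:
  assumes "x \<in> twistor E g"
  shows "snd x \<in> End_fibre E (fst x)"
    and "e \<in> fibre E (fst x) \<Longrightarrow> snd x (snd x e) = - e"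
    and "e \<in> fibre E (fst x) \<Longrightarrow> e' \<in> fibre E (fst x) \<Longrightarrow> g (fst x) (snd x e) (snd x e') = g (fst x) e e'"
  using assms unfolding twistor_def by auto

lemma twistor_skew:
  assumes "x \<in> twistor E g" "e \<in> fibre E (fst x)" "e' \<in> fibre E (fst x)"
  shows "g (fst x) (snd x e) e' = - g (fst x) e (snd x e')"
proof -
  have "g (fst x) (snd x e) e' = g (fst x) (snd x (snd x e)) (snd x e')"
    using twistorD[OF assms(1)] assms End_in by metis
  then show ?thesis
    using twistorD[OF assms(1)] assms End_in g_neg by metis
qed

subsection \<open>Coordinates\<close>

definition tdom :: "'m set \<Rightarrow> 'm set \<Rightarrow> ('m \<times> ('v \<Rightarrow> 'v)) set" where
  "tdom U V = {y \<in> twistor E g. fst y \<in> U \<inter> V}"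

definition tchart :: "('m \<Rightarrow> complex ^ 'n) \<Rightarrow> ('k \<Rightarrow> 'm \<Rightarrow> 'v) \<Rightarrow> 'm \<times> ('v \<Rightarrow> 'v) \<Rightarrow> (complex ^ 'n) \<times> (real ^ 'k ^ 'k)" where
  "tchart z s y = (z (fst y), fmat s y)"

lemma tchart_Basis:
  assumes "b \<in> (Basis :: ((complex ^ 'n) \<times> (real ^ 'k ^ 'k)) set)"
  obtains a where "\<And>y. tchart z s y \<bullet> b = z (fst y) \<bullet> a"
  | i j where "\<And>y. tchart z s y \<bullet> b = fmat s y $ i $ j"
proof -
  consider a where "b = (a, 0)" | a where "b = (0, a)" "a \<in> Basis"
    using assms by (auto simp: Basis_prod_def)
  then show ?thesis
  proof cases
    case (1 a)
    then show ?thesis using that(1)[of a] by (simp add: tchart_def)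
  next
    case (2 a)
    then obtain i j where "a = axis i (axis j 1)" by (auto simp: Basis_vec_def)
    then show ?thesis using that(2)[of i j] 2 by (simp add: tchart_def inner_axis)
  qed
qed

lemma twistor_smooth_def_germ:
  "twistor_smooth_near M E g x f \<longleftrightarrow> (\<exists>(U, z)\<in>atlas M. \<exists>(V, s)\<in>frames E. fst x \<in> U \<inter> V \<and>
     germ_smooth (tdom U V) (tchart z s) x f)"
proof -
  have "(\<forall>y\<in>tdom U V. tchart z s y \<in> W \<longrightarrow> f y = G (tchart z s y)) \<longleftrightarrow>
     (\<forall>(q, J)\<in>twistor E g. q \<in> U \<inter> V \<and> (z q, frame_matrix E s q J) \<in> W \<longrightarrow>
           f (q, J) = G (z q, frame_matrix E s q J))" for U V z s W and G :: "_ \<Rightarrow> real"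
    by (auto simp: tdom_def tchart_def)
  then show ?thesis
    unfolding twistor_smooth_near_def germ_smooth_def by (simp add: tchart_def)
qed

context
  fixes U z V s assumes uz: "(U, z) \<in> atlas M" and vs: "(V, s) \<in> frames E"
begin

lemma germ_pullback:
  assumes "germ_smooth U z (fst x) f"
  shows "germ_smooth (tdom U V) (tchart z s) x (\<lambda>y. f (fst y))"
proof -
  obtain W G where G: "open W" "z (fst x) \<in> W" "smooth_on W G" "\<And>y. y \<in> U \<Longrightarrow> z y \<in> W \<Longrightarrow> f y = G (z y)"
    using germ_smoothE[OF assms] by metis
  have o: "open (W \<times> (UNIV :: (real ^ 'k ^ 'k) set))" using G by (simp add: open_Times)
  have "smooth_on (W \<times> (UNIV :: (real ^ 'k ^ 'k) set)) (\<lambda>u. G (fst u))"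
    by (rule smooth_on_compose[OF o smooth_on_fst[OF o] G(3)]) auto
  then show ?thesis
    using G o by (intro germ_smoothI[of "W \<times> UNIV" _ _ "\<lambda>u. G (fst u)"]) (auto simp: tchart_def tdom_def)
qed

lemma germ_entry: "germ_smooth (tdom U V) (tchart z s) x (\<lambda>y. fmat s y $ i $ j)"
  using germ_smooth_component[of "tdom U V" "tchart z s" x "(0, axis i (axis j 1))"]
  by (simp add: tchart_def inner_axis)

lemma tdom_nbhd:
  assumes "fst x \<in> U" "open Ob" "fst x \<in> Ob"
  shows "\<exists>W0. open W0 \<and> tchart z s x \<in> W0 \<and> (\<forall>y\<in>tdom U V. tchart z s y \<in> W0 \<longrightarrow> fst y \<in> Ob)"
proof -
  obtain W0 where "open W0" "z (fst x) \<in> W0" "\<forall>q\<in>U. z q \<in> W0 \<longrightarrow> q \<in> Ob"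
    using chart_nbhd[OF uz assms] by blast
  then show ?thesis
    by (intro exI[of _ "W0 \<times> UNIV"]) (auto simp: tdom_def tchart_def open_Times)
qed

end

text \<open>In another frame the matrix of \<open>J\<close> is \<open>C\<inverse> M C\<close> with \<open>C\<close> the smooth transition matrix.\<close>
lemma germ_other_entry:
  assumes uz: "(U, z) \<in> atlas M" and vs: "(V, s) \<in> frames E" and vs': "(V', s') \<in> frames E"
    and x: "x \<in> tdom U V" "fst x \<in> V'"
  shows "germ_smooth (tdom U V) (tchart z s) x (\<lambda>y. fmat s' y $ i $ j)"
proof (cases "i \<in> I \<and> j \<in> I")
  case False
  then show ?thesis using germ_smooth_const[of _ _ _ 0] by (auto simp: frame_matrix_def)
next
  case True
  have p: "fst x \<in> U" "fst x \<in> V" using x by (auto simp: tdom_def)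
  let ?f = "\<lambda>y. \<Sum>l\<in>I. (\<Sum>k\<in>I. fmat s y $ l $ k * coef E s (fst y) (s' j (fst y)) k)
      * coef E s' (fst y) (s l (fst y)) i"
  obtain W0 where W0: "open W0" "tchart z s x \<in> W0" "\<forall>y\<in>tdom U V. tchart z s y \<in> W0 \<longrightarrow> fst y \<in> V'"
    using tdom_nbhd[OF uz vs p(1) frame_open[OF vs'] x(2)] by blast
  show ?thesis
  proof (rule germ_smooth_cong[where c="tchart z s" and x=x and f="?f", OF W0(1,2)])
    show "germ_smooth (tdom U V) (tchart z s) x ?f"
      using transition_smooth[OF vs' vs x(2) p(2)] transition_smooth[OF vs vs' p(2) x(2)] True
      by (intro germ_smooth_sum germ_smooth_mult x germ_entry[OF uz vs] germ_pullback[OF uz vs, of x])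
        (auto simp: smooth_near_iff[OF uz p(1)])
    fix y assume y: "y \<in> tdom U V" "tchart z s y \<in> W0"
    have q: "fst y \<in> V" "fst y \<in> V'" "snd y \<in> End_fibre E (fst y)"
      using W0(3)[rule_format, OF y] y(1) twistorD(1)[of y] by (simp_all add: tdom_def)
    have f: "s' j (fst y) \<in> fibre E (fst y)" using frame_in_fibre[OF vs' q(2)] True by blast
    have "coef E s' (fst y) (snd y (s' j (fst y))) i
        = (\<Sum>l\<in>I. coef E s (fst y) (snd y (s' j (fst y))) l * coef E s' (fst y) (s l (fst y)) i)"
      using f q End_in by (intro coef_change[OF vs vs']) auto
    also have "\<dots> = ?f y"
      using f q by (intro sum.cong refl) (simp add: matrix_coef[OF vs])
    finally show "?f y = fmat s' y $ i $ j" using True by (simp add: frame_matrix_def)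
  qed
qed

lemma germ_other_tchart:
  assumes uz: "(U, z) \<in> atlas M" and vs: "(V, s) \<in> frames E"
    and uz': "(U', z') \<in> atlas M" and vs': "(V', s') \<in> frames E"
    and x: "x \<in> tdom U V" "fst x \<in> U' \<inter> V'" and b: "b \<in> Basis"
  shows "germ_smooth (tdom U V) (tchart z s) x (\<lambda>y. tchart z' s' y \<bullet> b)"
  using b
proof (rule tchart_Basis[where z=z' and s=s'])
  fix a assume "\<And>y. tchart z' s' y \<bullet> b = z' (fst y) \<bullet> a"
  then show ?thesis
    using germ_pullback[OF uz vs germ_smooth_transition[OF uz uz', of "fst x" a]] x by (simp add: tdom_def)
next
  fix i j assume "\<And>y. tchart z' s' y \<bullet> b = fmat s' y $ i $ j"
  then show ?thesis using germ_other_entry[OF uz vs vs' x(1)] x(2) by simp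
qed

lemma twistor_smooth_iff:
  assumes uz: "(U, z) \<in> atlas M" and vs: "(V, s) \<in> frames E" and x: "x \<in> tdom U V"
  shows "twistor_smooth_near M E g x f \<longleftrightarrow> germ_smooth (tdom U V) (tchart z s) x f"
proof
  assume "twistor_smooth_near M E g x f"
  then obtain U' z' V' s' where 1: "(U', z') \<in> atlas M" "(V', s') \<in> frames E" "fst x \<in> U'" "fst x \<in> V'"
      "germ_smooth (tdom U' V') (tchart z' s') x f"
    unfolding twistor_smooth_def_germ by auto
  have "fst x \<in> U" using x by (simp add: tdom_def)
  obtain W0 where W0: "open W0" "tchart z s x \<in> W0" "\<forall>y\<in>tdom U V. tchart z s y \<in> W0 \<longrightarrow> fst y \<in> U' \<inter> V'"
    using tdom_nbhd[OF uz vs \<open>fst x \<in> U\<close> open_Int[OF chart_open[OF 1(1)] frame_open[OF 1(2)]]] 1(3,4) by blast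
  show "germ_smooth (tdom U V) (tchart z s) x f"
  proof (rule germ_smooth_change_chart[OF x 1(5) germ_other_tchart[OF uz vs 1(1,2) x] W0(1,2)])
    show "y \<in> tdom U' V'" if "y \<in> tdom U V" "tchart z s y \<in> W0" for y
      using W0(3)[rule_format, OF that] that(1) by (simp add: tdom_def)
  qed (use 1 in auto)
next
  assume "germ_smooth (tdom U V) (tchart z s) x f"
  then show "twistor_smooth_near M E g x f"
    unfolding twistor_smooth_def_germ using uz vs x by (auto simp: tdom_def)
qed

lemma tdom_exists:
  assumes "x \<in> twistor E g"
  obtains U z V s where "(U, z) \<in> atlas M" "(V, s) \<in> frames E" "x \<in> tdom U V"
proof -
  obtain U z where 1: "(U, z) \<in> atlas M" "fst x \<in> U" by (rule chart_exists)
  obtain V s where 2: "(V, s) \<in> frames E" "fst x \<in> V" by (rule frame_exists)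
  show ?thesis using that[OF 1(1) 2(1)] 1 2 assms by (simp add: tdom_def)
qed

subsection \<open>Curves and tangent vectors\<close>

lemma twistor_curve_base: "twistor_curve M E g S \<Gamma> \<Longrightarrow> smooth_curve M S (\<lambda>t. fst (\<Gamma> t))"
  by (simp add: twistor_curve_def)

lemma twistor_curve_in: "twistor_curve M E g S \<Gamma> \<Longrightarrow> t \<in> S \<Longrightarrow> \<Gamma> t \<in> twistor E g"
  by (simp add: twistor_curve_def)

lemma twistor_curve_chart:
  assumes \<Gamma>: "twistor_curve M E g S \<Gamma>" and S: "open S" and uz: "(U, z) \<in> atlas M" and vs: "(V, s) \<in> frames E"
  shows "open {t\<in>S. fst (\<Gamma> t) \<in> U \<inter> V}" (is "open ?T")
    and "smooth_on {t\<in>S. fst (\<Gamma> t) \<in> U \<inter> V} (\<lambda>t. tchart z s (\<Gamma> t))"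
proof -
  have "?T = S \<inter> (\<lambda>t. fst (\<Gamma> t)) -` (U \<inter> V)" by auto
  then show o: "open ?T"
    using twistor_curve_base[OF \<Gamma>] S chart_open[OF uz] frame_open[OF vs]
      continuous_open_preimage[of S "\<lambda>t. fst (\<Gamma> t)" "U \<inter> V"]
    by (auto simp: smooth_curve_def)
  have z: "smooth_on ?T (\<lambda>t. z (fst (\<Gamma> t)))"
    by (rule smooth_on_subset[OF smooth_curve_chart(2)[OF twistor_curve_base[OF \<Gamma>] S uz]]) auto
  have "\<forall>(V, s)\<in>frames E. smooth_on {t\<in>S. fst (\<Gamma> t) \<in> V} (\<lambda>t. fmat s (\<Gamma> t))"
    using \<Gamma> by (simp add: twistor_curve_def)
  then have m': "smooth_on {t\<in>S. fst (\<Gamma> t) \<in> V} (\<lambda>t. fmat s (\<Gamma> t))"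
    using vs by blast
  have m: "smooth_on ?T (\<lambda>t. fmat s (\<Gamma> t))"
    by (rule smooth_on_subset[OF m']) auto
  show "smooth_on ?T (\<lambda>t. tchart z s (\<Gamma> t))"
  proof (rule smooth_on_euclidean[OF o])
    fix b :: "(complex ^ 'n) \<times> (real ^ 'k ^ 'k)"
    assume "b \<in> Basis"
    then show "smooth_on ?T (\<lambda>t. tchart z s (\<Gamma> t) \<bullet> b)"
      using smooth_on_inner[OF o z, of "fst b"] smooth_on_inner[OF o m, of "snd b"]
      by (auto simp: Basis_prod_def tchart_def)
  qed
qed

lemma twistor_curveI_local:
  assumes "\<And>t. t \<in> S \<Longrightarrow> \<Gamma> t \<in> twistor E g"
    and "\<And>t. t \<in> S \<Longrightarrow> \<exists>U z V s T. (U, z) \<in> atlas M \<and> (V, s) \<in> frames E \<and> open T \<and> t \<in> T \<and>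
        (\<forall>r\<in>T. \<Gamma> r \<in> tdom U V) \<and> smooth_on T (\<lambda>r. tchart z s (\<Gamma> r))"
  shows "twistor_curve M E g S \<Gamma>"
  unfolding twistor_curve_def
proof (intro conjI ballI)
  show "smooth_curve M S (\<lambda>t. fst (\<Gamma> t))"
  proof (rule smooth_curveI_local)
    fix t assume "t \<in> S"
    then obtain U z V s T where 1: "(U, z) \<in> atlas M" "(V, s) \<in> frames E" "open T" "t \<in> T"
        "\<forall>r\<in>T. \<Gamma> r \<in> tdom U V" "smooth_on T (\<lambda>r. tchart z s (\<Gamma> r))"
      using assms(2) by metis
    have "smooth_on T (\<lambda>r. fst (tchart z s (\<Gamma> r)))"
      by (rule smooth_on_linear_compose[OF 1(3) bounded_linear_fst 1(6)])
    then have "smooth_on T (\<lambda>r. z (fst (\<Gamma> r)))" by (simp add: tchart_def)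
    moreover have "\<forall>r\<in>T. fst (\<Gamma> r) \<in> U" using 1(5) by (auto simp: tdom_def)
    ultimately show "\<exists>U z T. (U, z) \<in> atlas M \<and> open T \<and> t \<in> T \<and> (\<forall>s\<in>T. fst (\<Gamma> s) \<in> U) \<and> smooth_on T (\<lambda>s. z (fst (\<Gamma> s)))"
      using 1(1,3,4) by blast
  qed
  fix vs' assume vs': "vs' \<in> frames E"
  obtain V' s' where vs'_eq: "vs' = (V', s')" by fastforce
  have "smooth_on {t \<in> S. fst (\<Gamma> t) \<in> V'} (\<lambda>t. fmat s' (\<Gamma> t))"
  proof (rule smooth_on_local)
    fix t assume t: "t \<in> {t \<in> S. fst (\<Gamma> t) \<in> V'}"
    then have "t \<in> S" by simp
    from assms(2)[OF this] obtain U z V s T where 1: "(U, z) \<in> atlas M" "(V, s) \<in> frames E" "open T" "t \<in> T"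
        "\<forall>r\<in>T. \<Gamma> r \<in> tdom U V" "smooth_on T (\<lambda>r. tchart z s (\<Gamma> r))"
      by blast
    have t': "\<Gamma> t \<in> tdom U V" "fst (\<Gamma> t) \<in> V'" using 1(4,5) t by auto
    have "\<exists>T'. open T' \<and> t \<in> T' \<and> T' \<subseteq> T \<and> smooth_on T' (\<lambda>t. (\<lambda>y. fmat s' y) (\<Gamma> t))"
    proof (rule germ_smooth_along_curve_vec[where c="tchart z s" and \<Gamma>=\<Gamma>, OF _ 1(3,4,6)])
      fix b :: "real ^ 'k ^ 'k" assume "b \<in> Basis"
      then obtain i j where b: "b = axis i (axis j 1)" by (auto simp: Basis_vec_def)
      show "germ_smooth (tdom U V) (tchart z s) (\<Gamma> t) (\<lambda>y. fmat s' y \<bullet> b)"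
        using germ_other_entry[OF 1(1,2) vs'[unfolded vs'_eq] t', of i j] by (simp add: b inner_axis)
    qed (use 1(5) in auto)
    then show "\<exists>T. open T \<and> t \<in> T \<and> smooth_on T (\<lambda>t. fmat s' (\<Gamma> t))"
      by blast
  qed
  then show "case vs' of (V, s) \<Rightarrow> smooth_on {t \<in> S. fst (\<Gamma> t) \<in> V} (\<lambda>t. fmat s (\<Gamma> t))"
    by (simp add: vs'_eq)
qed (use assms(1) in auto)

text \<open>
  A tangent vector \<open>v\<close> of the twistor space at \<open>x\<close> is recorded by its projection \<open>w\<close> to the base and its
  matrix part \<open>N\<close> in a frame \<open>s\<close>; \<open>v\<close> and \<open>(w, N)\<close> determine each other.
\<close>
definition tw_data ::
    "'m set \<Rightarrow> ('k \<Rightarrow> 'm \<Rightarrow> 'v) \<Rightarrow> 'm \<times> ('v \<Rightarrow> 'v) \<Rightarrow> ('m \<times> ('v \<Rightarrow> 'v)) tvec \<Rightarrow> 'm tvec \<Rightarrow> real ^ 'k ^ 'k \<Rightarrow> bool" where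
  "tw_data V s x v w N \<longleftrightarrow> w \<in> tangent M (fst x) \<and>
     (\<forall>U z. (U, z) \<in> atlas M \<and> fst x \<in> U \<longrightarrow> chart_vec (tdom U V) (tchart z s) x v (dcoord z w, N)) \<and>
     (\<forall>f. \<not> twistor_smooth_near M E g x f \<longrightarrow> v f = 0)"

lemma tw_data_entry:
  assumes "tw_data V s x v w N"
  shows "v (\<lambda>y. fmat s y $ i $ j) = N $ i $ j"
proof -
  obtain U z where 1: "(U, z) \<in> atlas M" "fst x \<in> U" by (rule chart_exists)
  then have "chart_vec (tdom U V) (tchart z s) x v (dcoord z w, N)" using assms by (simp add: tw_data_def)
  from chart_vec_component[OF this, of "(0, axis i (axis j 1))"] show ?thesis
    by (simp add: tchart_def inner_axis)
qed

lemma tw_data_outside: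
  assumes "tw_data V s x v w N" "\<not> (i \<in> I \<and> j \<in> I)"
  shows "N $ i $ j = 0"
proof -
  obtain U z where 1: "(U, z) \<in> atlas M" "fst x \<in> U" by (rule chart_exists)
  then have "chart_vec (tdom U V) (tchart z s) x v (dcoord z w, N)" using assms by (simp add: tw_data_def)
  moreover have "fmat s y $ i $ j = 0" for y
    using assms(2) by (auto simp: frame_matrix_def)
  ultimately have "v (\<lambda>y. fmat s y $ i $ j) = 0"
    using chart_vec_eval[of "tdom U V" "tchart z s" x v _ UNIV "\<lambda>_. 0"] by (auto simp: smooth_on_const)
  then show ?thesis using tw_data_entry[OF assms(1)] by simp
qed

lemma tw_data_unique:
  assumes "tw_data V s x v w N" "tw_data V s x v w' N'"
  shows "w = w'" "N = N'"
proof -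
  obtain U z where uz: "(U, z) \<in> atlas M" "fst x \<in> U" by (rule chart_exists)
  have c: "chart_vec (tdom U V) (tchart z s) x v (dcoord z w, N)" "chart_vec (tdom U V) (tchart z s) x v (dcoord z w', N')"
    using assms uz by (auto simp: tw_data_def)
  have "(dcoord z w, N) = (dcoord z w', N')"
    by (rule euclidean_eqI) (rule trans[OF chart_vec_component[OF c(1), symmetric] chart_vec_component[OF c(2)]])
  then show "w = w'" "N = N'"
    using assms tangent_eqI[OF uz] by (auto simp: tw_data_def)
qed

lemma tw_data_eqI:
  assumes x: "x \<in> twistor E g" and vs: "(V, s) \<in> frames E" "fst x \<in> V"
    and "tw_data V s x v w N" "tw_data V s x v' w N"
  shows "v = v'"
proof
  fix f
  obtain U z where uz: "(U, z) \<in> atlas M" "fst x \<in> U" by (rule chart_exists)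
  have xt: "x \<in> tdom U V" using x uz vs by (simp add: tdom_def)
  have "chart_vec (tdom U V) (tchart z s) x v (dcoord z w, N)" "chart_vec (tdom U V) (tchart z s) x v' (dcoord z w, N)"
    using assms uz by (auto simp: tw_data_def)
  from chart_vec_unique[OF this] show "v f = v' f"
    using assms(4,5) twistor_smooth_iff[OF uz(1) vs(1) xt] by (cases "twistor_smooth_near M E g x f") (auto simp: tw_data_def)
qed

lemma tw_data_tadd:
  assumes "tw_data V s x v (\<lambda>f. 0) N" "tw_data V s x v' w N'"
  shows "tw_data V s x (tadd v v') w (N + N')"
proof -
  have 0: "dcoord z (\<lambda>f. 0) = 0" for z :: "'m \<Rightarrow> complex ^ 'n"
    by (simp add: dcoord_def vec_eq_iff complex_eq_iff)
  show ?thesis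
    unfolding tw_data_def
  proof (intro conjI allI impI)
    fix U z assume "(U, z) \<in> atlas M \<and> fst x \<in> U"
    then have "chart_vec (tdom U V) (tchart z s) x v (0, N)" "chart_vec (tdom U V) (tchart z s) x v' (dcoord z w, N')"
      using assms 0 by (auto simp: tw_data_def)
    from chart_vec_tadd[OF this] show "chart_vec (tdom U V) (tchart z s) x (tadd v v') (dcoord z w, N + N')" by simp
  qed (use assms in \<open>auto simp: tw_data_def tadd_def\<close>)
qed

lemma tw_data_velocity:
  assumes \<Gamma>: "twistor_curve M E g S \<Gamma>" and S: "open S" "t \<in> S" and vs: "(V, s) \<in> frames E" "fst (\<Gamma> t) \<in> V"
  shows "tw_data V s (\<Gamma> t) (velocity (twistor_smooth_near M E g) \<Gamma> t) (velocity (smooth_near M) (\<lambda>t. fst (\<Gamma> t)) t)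
     (vector_derivative (\<lambda>r. fmat s (\<Gamma> r)) (at t))"
  unfolding tw_data_def
proof (intro conjI allI impI)
  show "velocity (smooth_near M) (\<lambda>t. fst (\<Gamma> t)) t \<in> tangent M (fst (\<Gamma> t))"
    using velocity_in_tangent[OF twistor_curve_base[OF \<Gamma>] S] .
  show "velocity (twistor_smooth_near M E g) \<Gamma> t f = 0" if "\<not> twistor_smooth_near M E g (\<Gamma> t) f" for f
    using that by (simp add: velocity_def)
  fix U z assume uz: "(U, z) \<in> atlas M \<and> fst (\<Gamma> t) \<in> U"
  let ?T = "{t\<in>S. fst (\<Gamma> t) \<in> U \<inter> V}"
  have T: "open ?T" "smooth_on ?T (\<lambda>t. tchart z s (\<Gamma> t))"
    using twistor_curve_chart[OF \<Gamma> S(1) uz[THEN conjunct1] vs(1)] by auto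
  have tT: "t \<in> ?T" using S uz vs by auto
  let ?h = "vector_derivative (\<lambda>t. tchart z s (\<Gamma> t)) (at t)"
  have d: "((\<lambda>t. tchart z s (\<Gamma> t)) has_vector_derivative ?h) (at t)"
    by (rule smooth_on_has_vector_derivative[OF T(2) tT])
  have xt: "\<Gamma> t \<in> tdom U V" using twistor_curve_in[OF \<Gamma>] tT by (auto simp: tdom_def)
  have "((\<lambda>r. snd (tchart z s (\<Gamma> r))) has_vector_derivative snd ?h) (at t)"
    by (rule bounded_linear.has_vector_derivative[OF bounded_linear_snd d])
  then have 2: "vector_derivative (\<lambda>r. fmat s (\<Gamma> r)) (at t) = snd ?h"
    by (simp add: tchart_def vector_derivative_at)
  have "((\<lambda>r. fst (tchart z s (\<Gamma> r))) has_vector_derivative fst ?h) (at t)"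
    by (rule bounded_linear.has_vector_derivative[OF bounded_linear_fst d])
  then have "vector_derivative (\<lambda>r. z (fst (\<Gamma> r))) (at t) = fst ?h"
    by (simp add: tchart_def vector_derivative_at)
  then have 1: "dcoord z (velocity (smooth_near M) (\<lambda>t. fst (\<Gamma> t)) t) = fst ?h"
    using dcoord_chart_vec[OF chart_vec_curve[OF twistor_curve_base[OF \<Gamma>] S uz[THEN conjunct1]]] uz by simp
  have "chart_vec (tdom U V) (tchart z s) (\<Gamma> t) (velocity (twistor_smooth_near M E g) \<Gamma> t) ?h"
  proof (rule chart_vec_velocity[where c="tchart z s" and \<Gamma>=\<Gamma>, OF d])
    show "\<forall>\<^sub>F r in nhds t. \<Gamma> r \<in> tdom U V"
      using eventually_nhds_in_open[OF T(1) tT] twistor_curve_in[OF \<Gamma>] by (auto simp: tdom_def elim!: eventually_mono)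
    show "twistor_smooth_near M E g (\<Gamma> t) f" if "germ_smooth (tdom U V) (tchart z s) (\<Gamma> t) f" for f
      using that twistor_smooth_iff[OF uz[THEN conjunct1] vs(1) xt] by simp
  qed
  then show "chart_vec (tdom U V) (tchart z s) (\<Gamma> t) (velocity (twistor_smooth_near M E g) \<Gamma> t)
      (dcoord z (velocity (smooth_near M) (\<lambda>t. fst (\<Gamma> t)) t),
       vector_derivative (\<lambda>r. fmat s (\<Gamma> r)) (at t))"
    using 1 2 by simp
qed

end

section \<open>Linear differential equations\<close>

lemma vector_mean_value_bound:
  fixes f :: "real \<Rightarrow> 'a::real_normed_vector"
  assumes "\<And>x. x \<in> {a..b} \<Longrightarrow> (f has_vector_derivative f' x) (at x within {a..b})"
    and B: "\<And>x. x \<in> {a..b} \<Longrightarrow> norm (f' x) \<le> B" and xy: "x \<in> {a..b}" "y \<in> {a..b}"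
  shows "norm (f x - f y) \<le> B * \<bar>x - y\<bar>"
proof -
  have "0 \<le> B" using B[OF xy(1)] norm_ge_zero[of "f' x"] by linarith
  have "norm (f x - f y) \<le> B * norm (x - y)"
  proof (rule differentiable_bound[where S="{a..b}" and f'="\<lambda>x h. h *\<^sub>R f' x"])
    show "onorm (\<lambda>h. h *\<^sub>R f' x) \<le> B" if "x \<in> {a..b}" for x
    proof (rule onorm_bound[OF \<open>0 \<le> B\<close>])
      show "norm (h *\<^sub>R f' x) \<le> B * norm h" for h
        using mult_left_mono[OF B[OF that], of "\<bar>h\<bar>"] by (simp add: mult.commute)
    qed
  qed (use assms in \<open>auto simp: has_vector_derivative_def\<close>)
  then show ?thesis by simp
qed

lemma bilinear_bound_on_compact:
  fixes P :: "'b::real_normed_vector \<Rightarrow> 'a::real_normed_vector \<Rightarrow> 'a"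
  assumes "bounded_bilinear P" "continuous_on {a..b::real} \<omega>"
  obtains K where "K \<ge> 0" "\<And>t y. t \<in> {a..b} \<Longrightarrow> norm (P (\<omega> t) y) \<le> K * norm y"
proof -
  obtain C where C: "C \<ge> 0" "\<And>u v. norm (P u v) \<le> norm u * norm v * C"
    using bounded_bilinear.nonneg_bounded[OF assms(1)] by blast
  have "bounded (\<omega> ` {a..b})"
    using assms(2) compact_continuous_image compact_imp_bounded by blast
  then obtain R where R: "R > 0" "\<And>t. t \<in> {a..b} \<Longrightarrow> norm (\<omega> t) \<le> R"
    unfolding bounded_pos by auto
  have "norm (P (\<omega> t) y) \<le> (R * C) * norm y" if "t \<in> {a..b}" for t y
  proof -
    have "norm (P (\<omega> t) y) \<le> norm (\<omega> t) * norm y * C" by (rule C(2))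
    also have "\<dots> \<le> R * norm y * C"
      using R(2)[OF that] C(1) by (intro mult_right_mono) auto
    finally show ?thesis by (simp add: algebra_simps)
  qed
  then show ?thesis using that[of "R * C"] R C by simp
qed

text \<open>
  The equivalent integral equation is a fixed point problem for a contraction, once the interval is short. Smoothness
  follows from the equation itself, which makes \<open>X\<close> once more differentiable than it is known to be.
\<close>
lemma linear_ode_exists:
  fixes P :: "'b::real_normed_vector \<Rightarrow> 'a::banach \<Rightarrow> 'a" and \<omega> :: "real \<Rightarrow> 'b"
  assumes P: "bounded_bilinear P" and e: "\<epsilon> > 0" and \<omega>: "smooth_on {-\<epsilon><..<\<epsilon>} \<omega>"
  obtains \<delta> X where "0 < \<delta>" "\<delta> \<le> \<epsilon>" "X 0 = x0" "smooth_on {-\<delta><..<\<delta>} X"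
    "\<And>t. t \<in> {-\<delta><..<\<delta>} \<Longrightarrow> (X has_vector_derivative P (\<omega> t) (X t)) (at t)"
proof -
  have c\<omega>: "continuous_on {-\<epsilon>/2..\<epsilon>/2} \<omega>"
    by (rule continuous_on_subset[OF smooth_on_continuous[OF \<omega>]]) (use e in auto)
  obtain K where K: "K \<ge> 0" "\<And>t y. t \<in> {-\<epsilon>/2..\<epsilon>/2} \<Longrightarrow> norm (P (\<omega> t) y) \<le> K * norm y"
    using bilinear_bound_on_compact[OF P c\<omega>] by blast
  \<comment> \<open>On \<open>[-\<delta>, \<delta>]\<close> the integral operator has Lipschitz constant \<open>K \<delta> \<le> 1/2\<close>.\<close>
  define \<delta> where "\<delta> = min (\<epsilon>/2) (1 / (2 * (K + 1)))"
  have \<delta>: "\<delta> > 0" "\<delta> \<le> \<epsilon>/2" "K * \<delta> \<le> 1/2"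
  proof -
    show "\<delta> > 0" "\<delta> \<le> \<epsilon>/2" using e K(1) by (auto simp: \<delta>_def)
    have "K * \<delta> \<le> K * (1 / (2 * (K + 1)))" using K(1) by (intro mult_left_mono) (auto simp: \<delta>_def)
    also have "\<dots> \<le> 1/2" using K(1) by (simp add: field_simps)
    finally show "K * \<delta> \<le> 1/2" .
  qed
  have K': "norm (P (\<omega> t) y) \<le> K * norm y" if "t \<in> {-\<delta>..\<delta>}" for t y
    using K(2) that \<delta>(2) by auto
  define h where "h X s = P (\<omega> s) (X s)" for X :: "real \<Rightarrow> 'a" and s
  define H where "H X u = integral {-\<delta>..u} (h X)" for X :: "real \<Rightarrow> 'a" and u
  have h_cont: "continuous_on {-\<delta>..\<delta>} (h X)" if "continuous_on UNIV X" for X :: "real \<Rightarrow> 'a"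
    unfolding h_def
    by (intro bounded_bilinear.continuous_on[OF P] continuous_on_subset[OF c\<omega>] continuous_on_subset[OF that])
      (use \<delta> in auto)
  have H_deriv: "(H X has_vector_derivative h X u) (at u within {-\<delta>..\<delta>})"
    if "continuous_on UNIV X" "u \<in> {-\<delta>..\<delta>}" for X :: "real \<Rightarrow> 'a" and u
    unfolding H_def using integral_has_vector_derivative[OF h_cont[OF that(1)] that(2)] .
  \<comment> \<open>Clamping the argument turns the integral operator on \<open>[-\<delta>, \<delta>]\<close> into one on bounded functions on the line.\<close>
  define cl where "cl t = max (-\<delta>) (min \<delta> t)" for t :: real
  have cl: "cl t \<in> {-\<delta>..\<delta>}" for t using \<delta>(1) by (auto simp: cl_def)
  define \<Psi> where "\<Psi> X t = x0 + (H X (cl t) - H X 0)" for X :: "real \<Rightarrow> 'a" and t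
  have \<Psi>_b: "\<Psi> (apply_bcontfun X) \<in> bcontfun" for X :: "real \<Rightarrow>\<^sub>C 'a"
  proof -
    have cX: "continuous_on UNIV (apply_bcontfun X)" by simp
    have "continuous_on {-\<delta>..\<delta>} (H X)"
      using H_deriv[OF cX] by (meson continuous_on_eq_continuous_within has_vector_derivative_continuous)
    then have c: "continuous_on {-\<delta>..\<delta>} (\<lambda>u. x0 + (H X u - H X 0))" by (intro continuous_intros)
    have ccl: "continuous_on UNIV cl" unfolding cl_def by (intro continuous_intros)
    have "continuous_on UNIV (\<Psi> X)"
      unfolding \<Psi>_def by (rule continuous_on_compose2[OF c ccl]) (use cl in auto)
    moreover have "bounded (range (\<Psi> X))"
    proof -
      have "bounded ((\<lambda>u. x0 + (H X u - H X 0)) ` {-\<delta>..\<delta>})"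
        using c compact_continuous_image compact_imp_bounded by blast
      then show ?thesis by (rule bounded_subset) (use cl in \<open>auto simp: \<Psi>_def\<close>)
    qed
    ultimately show ?thesis by (simp add: bcontfun_def)
  qed
  define F where "F X = Bcontfun (\<Psi> (apply_bcontfun X))" for X :: "real \<Rightarrow>\<^sub>C 'a"
  have F: "apply_bcontfun (F X) = \<Psi> X" for X
    unfolding F_def using Bcontfun_inverse[OF \<Psi>_b] .
  have "\<exists>!X. F X = X"
  proof (rule banach_fix_type[of "1/2"])
    show "\<forall>X Y. dist (F X) (F Y) \<le> 1/2 * dist X Y"
    proof (intro allI dist_bound)
      fix X Y :: "real \<Rightarrow>\<^sub>C 'a" and t
      have cX: "continuous_on UNIV (apply_bcontfun X)" "continuous_on UNIV (apply_bcontfun Y)" by simp_all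
      have "norm ((H X (cl t) - H Y (cl t)) - (H X 0 - H Y 0)) \<le> (K * dist X Y) * \<bar>cl t - 0\<bar>"
      proof (rule vector_mean_value_bound[where a="-\<delta>" and b=\<delta> and f="\<lambda>u. H X u - H Y u" and f'="\<lambda>u. h X u - h Y u"])
        show "((\<lambda>u. H X u - H Y u) has_vector_derivative h X u - h Y u) (at u within {-\<delta>..\<delta>})"
          if "u \<in> {-\<delta>..\<delta>}" for u
          using H_deriv[OF cX(1) that] H_deriv[OF cX(2) that] by (rule has_vector_derivative_diff)
        show "norm (h X u - h Y u) \<le> K * dist X Y" if "u \<in> {-\<delta>..\<delta>}" for u
        proof -
          have "norm (h X u - h Y u) = norm (P (\<omega> u) (X u - Y u))"
            by (simp add: h_def bounded_bilinear.diff_right[OF P])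
          also have "\<dots> \<le> K * norm (X u - Y u)" by (rule K'[OF that])
          also have "\<dots> \<le> K * dist X Y"
            using K(1) dist_bounded[of X u Y] by (intro mult_left_mono) (auto simp: dist_norm)
          finally show ?thesis .
        qed
      qed (use cl \<delta>(1) in auto)
      also have "\<dots> \<le> (K * dist X Y) * \<delta>"
        using cl[of t] K(1) by (intro mult_left_mono) auto
      also have "\<dots> = (K * \<delta>) * dist X Y" by simp
      also have "\<dots> \<le> 1/2 * dist X Y" using \<delta>(3) by (intro mult_right_mono) auto
      finally show "dist (F X t) (F Y t) \<le> 1/2 * dist X Y"
        by (simp add: F \<Psi>_def dist_norm algebra_simps)
    qed
  qed auto
  then obtain X where X: "F X = X" by blast
  have cX: "continuous_on UNIV (apply_bcontfun X)" by simp
  have Xeq: "X t = x0 + (H X t - H X 0)" if "t \<in> {-\<delta>..\<delta>}" for t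
  proof -
    have "X t = \<Psi> X t" using F[of X] X by simp
    moreover have "cl t = t" using that by (auto simp: cl_def)
    ultimately show ?thesis by (simp add: \<Psi>_def)
  qed
  have deriv: "(X has_vector_derivative P (\<omega> t) (X t)) (at t)" if t: "t \<in> {-\<delta><..<\<delta>}" for t
  proof -
    have "(H X has_vector_derivative h X t) (at t within {-\<delta><..<\<delta>})"
      by (rule has_vector_derivative_within_subset[OF H_deriv[OF cX]]) (use t in auto)
    then have H: "(H X has_vector_derivative h X t) (at t)"
      by (simp only: at_within_open[OF t open_greaterThanLessThan])
    have "((\<lambda>u. x0 + (H X u - H X 0)) has_vector_derivative 0 + (h X t - 0)) (at t)"
      by (intro has_vector_derivative_add has_vector_derivative_diff has_vector_derivative_const H)
    then have "((\<lambda>u. x0 + (H X u - H X 0)) has_vector_derivative P (\<omega> t) (X t)) (at t)"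
      by (simp add: h_def)
    then show ?thesis
      by (rule has_vector_derivative_transform_within_open[of _ _ _ "{-\<delta><..<\<delta>}"]) (use t Xeq in auto)
  qed
  have o: "open {-\<delta><..<\<delta>}" by simp
  have "Ck_on k {-\<delta><..<\<delta>} X" for k
  proof (induction k)
    case 0
    show ?case using cX continuous_on_subset by auto
  next
    case (Suc k)
    have "smooth_on {-\<delta><..<\<delta>} \<omega>" by (rule smooth_on_subset[OF \<omega>]) (use \<delta> e in auto)
    then have "Ck_on k {-\<delta><..<\<delta>} (\<lambda>t. P (\<omega> t) (X t))"
      unfolding smooth_on_def by (intro Ck_on_bilinear[OF o P] Suc) blast
    then show ?case
      using deriv unfolding has_vector_derivative_def
      by (intro Ck_on_SucI[OF o, where f'="\<lambda>t r. r *\<^sub>R P (\<omega> t) (X t)"])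
        (auto intro: Ck_on_linear_compose[OF o bounded_linear_scaleR_right])
  qed
  then have "smooth_on {-\<delta><..<\<delta>} X" by (simp add: smooth_on_def)
  moreover have "X 0 = x0" using Xeq[of 0] \<delta>(1) by simp
  ultimately show ?thesis using that[of \<delta> X] \<delta> e deriv by simp
qed

text \<open>
  On a short interval the maximum of \<open>|X|\<close> is at most half of itself, by the mean value inequality.
\<close>
lemma linear_ode_unique:
  fixes P :: "'b::real_normed_vector \<Rightarrow> 'a::real_normed_vector \<Rightarrow> 'a" and \<omega> :: "real \<Rightarrow> 'b"
  assumes P: "bounded_bilinear P" and d: "\<delta> > 0" and \<omega>: "continuous_on {-\<delta><..<\<delta>} \<omega>"
    and X: "X 0 = 0" "\<And>t. t \<in> {-\<delta><..<\<delta>} \<Longrightarrow> (X has_vector_derivative P (\<omega> t) (X t)) (at t)"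
  obtains \<eta> where "0 < \<eta>" "\<eta> \<le> \<delta>" "\<And>t. t \<in> {-\<eta><..<\<eta>} \<Longrightarrow> X t = 0"
proof -
  have c\<omega>: "continuous_on {-\<delta>/2..\<delta>/2} \<omega>"
    by (rule continuous_on_subset[OF \<omega>]) (use d in auto)
  obtain K where K: "K \<ge> 0" "\<And>t y. t \<in> {-\<delta>/2..\<delta>/2} \<Longrightarrow> norm (P (\<omega> t) y) \<le> K * norm y"
    using bilinear_bound_on_compact[OF P c\<omega>] by blast
  define \<eta> where "\<eta> = min (\<delta>/2) (1 / (2 * (K + 1)))"
  have \<eta>: "\<eta> > 0" "\<eta> \<le> \<delta>/2" "K * \<eta> \<le> 1/2"
  proof -
    show "\<eta> > 0" "\<eta> \<le> \<delta>/2" using d K(1) by (auto simp: \<eta>_def)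
    have "K * \<eta> \<le> K * (1 / (2 * (K + 1)))" using K(1) by (intro mult_left_mono) (auto simp: \<eta>_def)
    also have "\<dots> \<le> 1/2" using K(1) by (simp add: field_simps)
    finally show "K * \<eta> \<le> 1/2" .
  qed
  have dX: "(X has_vector_derivative P (\<omega> t) (X t)) (at t within {-\<eta>..\<eta>})" if "t \<in> {-\<eta>..\<eta>}" for t
  proof -
    have "t \<in> {-\<delta><..<\<delta>}" using that \<eta>(2) d by simp
    then show ?thesis by (rule has_vector_derivative_at_within[OF X(2)])
  qed
  then have "continuous_on {-\<eta>..\<eta>} (\<lambda>t. norm (X t))"
    by (intro continuous_on_norm) (meson continuous_on_eq_continuous_within has_vector_derivative_continuous)
  then obtain t1 where t1: "t1 \<in> {-\<eta>..\<eta>}" "\<And>t. t \<in> {-\<eta>..\<eta>} \<Longrightarrow> norm (X t) \<le> norm (X t1)"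
    using continuous_attains_sup[of "{-\<eta>..\<eta>}" "\<lambda>t. norm (X t)"] \<eta>(1) by fastforce
  have "norm (X t1 - X 0) \<le> (K * norm (X t1)) * \<bar>t1 - 0\<bar>"
  proof (rule vector_mean_value_bound[OF dX])
    show "norm (P (\<omega> t) (X t)) \<le> K * norm (X t1)" if "t \<in> {-\<eta>..\<eta>}" for t
    proof -
      have "norm (P (\<omega> t) (X t)) \<le> K * norm (X t)" using K(2) that \<eta>(2) by auto
      also have "\<dots> \<le> K * norm (X t1)" using K(1) t1(2)[OF that] by (rule mult_left_mono[rotated])
      finally show ?thesis .
    qed
  qed (use t1 \<eta>(1) in auto)
  also have "\<dots> \<le> (K * norm (X t1)) * \<eta>" using t1(1) K(1) by (intro mult_left_mono) auto
  also have "\<dots> = (K * \<eta>) * norm (X t1)" by simp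
  also have "\<dots> \<le> 1/2 * norm (X t1)" using \<eta>(3) by (intro mult_right_mono) auto
  finally have "norm (X t1) \<le> 0" using X(1) by simp
  then have "X t = 0" if "t \<in> {-\<eta><..<\<eta>}" for t
    using t1(2)[of t] that by auto
  then show ?thesis using that[of \<eta>] \<eta> by simp
qed

section \<open>Bump functions\<close>

text \<open>
  The functions \<open>p(1/t) exp(-1/t)\<close>, extended by zero to \<open>t \<le> 0\<close>, are closed under differentiation, so each of
  them is smooth as soon as each of them is differentiable.
\<close>
definition flat :: "real poly \<Rightarrow> real \<Rightarrow> real" where
  "flat p t = (if t > 0 then poly p (1 / t) * exp (- (1 / t)) else 0)"

lemma poly_exp_decay: "((\<lambda>x::real. poly p x * exp (- x)) \<longlongrightarrow> 0) at_top"
proof -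
  have "((\<lambda>x. \<Sum>i\<le>degree p. coeff p i * (x ^ i / exp x)) \<longlongrightarrow> (\<Sum>i\<le>degree p. coeff p i * 0)) at_top"
    by (intro tendsto_sum tendsto_mult tendsto_const tendsto_power_div_exp_0)
  moreover have "(\<Sum>i\<le>degree p. coeff p i * (x ^ i / exp x)) = poly p x * exp (- x)" for x :: real
    by (simp add: poly_altdef sum_distrib_right exp_minus divide_inverse mult.assoc)
  ultimately show ?thesis by simp
qed

lemma flat_deriv: "(flat p has_real_derivative flat ([:0, 0, 1:] * (p - pderiv p)) t) (at t)"
proof -
  consider "t > 0" | "t < 0" | "t = 0" by linarith
  then show ?thesis
  proof cases
    case 1
    have "((\<lambda>t. poly p (1 / t) * exp (- (1 / t))) has_real_derivative
        flat ([:0, 0, 1:] * (p - pderiv p)) t) (at t)"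
      using 1 by (auto intro!: derivative_eq_intros DERIV_chain2[OF poly_DERIV]
          simp: flat_def field_simps power2_eq_square)
    then show ?thesis
      by (rule has_field_derivative_transform_within_open[where S="{0<..}"]) (use 1 in \<open>auto simp: flat_def\<close>)
  next
    case 2
    have "((\<lambda>t. 0) has_real_derivative flat ([:0, 0, 1:] * (p - pderiv p)) t) (at t)"
      using 2 by (simp add: flat_def)
    then show ?thesis
      by (rule has_field_derivative_transform_within_open[where S="{..<0}"]) (use 2 in \<open>auto simp: flat_def\<close>)
  next
    case 3
    have "((\<lambda>h. poly ([:0, 1:] * p) (1 / h) * exp (- (1 / h))) \<longlongrightarrow> 0) (at_right 0)"
      by (rule filterlim_compose[OF poly_exp_decay]) (simp add: filterlim_inverse_at_top_right inverse_eq_divide[symmetric])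
    then have r: "((\<lambda>h. flat p h / h) \<longlongrightarrow> 0) (at_right 0)"
      by (rule Lim_transform_eventually) (auto simp: eventually_at_filter flat_def)
    have "((\<lambda>h. 0) \<longlongrightarrow> (0::real)) (at_left 0)" by simp
    then have l: "((\<lambda>h. flat p h / h) \<longlongrightarrow> 0) (at_left 0)"
      by (rule Lim_transform_eventually) (auto simp: eventually_at_filter flat_def)
    have "((\<lambda>h. flat p h / h) \<longlongrightarrow> 0) (at 0)" using l r filterlim_split_at by blast
    then show ?thesis using 3 by (simp add: has_field_derivative_iff flat_def)
  qed
qed

lemma flat_smooth: "smooth_on UNIV (flat p)"
proof -
  have "Ck_on k UNIV (flat p)" for k
  proof (induction k arbitrary: p)
    case 0
    show ?case using flat_deriv by (auto intro!: continuous_at_imp_continuous_on DERIV_isCont)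
  next
    case (Suc k)
    show ?case
    proof (rule Ck_on_SucI[OF open_UNIV])
      show "(flat p has_derivative (\<lambda>v. flat ([:0, 0, 1:] * (p - pderiv p)) t * v)) (at t)" for t
        using flat_deriv unfolding has_field_derivative_def by simp
      show "Ck_on k UNIV (\<lambda>t. flat ([:0, 0, 1:] * (p - pderiv p)) t * v)" for v
        by (intro Ck_on_bilinear[OF open_UNIV bounded_bilinear_mult] Suc Ck_on_const)
    qed
  qed
  then show ?thesis by (simp add: smooth_on_def)
qed

lemma bump_exists:
  fixes \<delta> :: real
  assumes "\<delta> > 0"
  obtains \<rho> :: "real \<Rightarrow> real" where "smooth_on UNIV \<rho>" "\<rho> 0 \<noteq> 0" "\<And>t. \<bar>t\<bar> \<ge> \<delta> \<Longrightarrow> \<rho> t = 0"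
proof
  let ?\<rho> = "\<lambda>t. flat 1 (\<delta> * \<delta> + (-1) * (t * t))"
  show "smooth_on UNIV ?\<rho>"
    by (rule smooth_on_compose[OF open_UNIV _ flat_smooth]) (intro smooth_intros open_UNIV, simp)
  show "?\<rho> 0 \<noteq> 0" using assms by (simp add: flat_def)
  show "?\<rho> t = 0" if "\<bar>t\<bar> \<ge> \<delta>" for t
  proof -
    have "\<delta> * \<delta> \<le> \<bar>t\<bar> * \<bar>t\<bar>" using that assms by (intro mult_mono) auto
    then show ?thesis by (simp add: flat_def)
  qed
qed

section \<open>Smooth dependence of solutions of linear systems\<close>

lemma germ_smooth_det:
  fixes A :: "'x \<Rightarrow> real ^ 'k ^ 'k"
  assumes "x \<in> Y" "\<And>i j. germ_smooth Y c x (\<lambda>y. A y $ i $ j)"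
  shows "germ_smooth Y c x (\<lambda>y. det (A y))"
  unfolding det_def
  by (intro germ_smooth_sum germ_smooth_mult germ_smooth_prod germ_smooth_const assms)

lemma germ_smooth_restrict:
  assumes "open W0" "c x \<in> W0" "germ_smooth {y\<in>Y. c y \<in> W0} c x f"
  shows "germ_smooth Y c x f"
proof -
  obtain W G where G: "open W" "c x \<in> W" "smooth_on W G" "\<And>y. y \<in> {y\<in>Y. c y \<in> W0} \<Longrightarrow> c y \<in> W \<Longrightarrow> f y = G (c y)"
    using germ_smoothE[OF assms(3)] by blast
  show ?thesis
    using G assms smooth_on_subset[OF G(3)] by (intro germ_smoothI[of "W \<inter> W0" _ _ G]) auto
qed

lemma germ_smooth_subset: "germ_smooth Y c x f \<Longrightarrow> Y' \<subseteq> Y \<Longrightarrow> germ_smooth Y' c x f"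
  unfolding germ_smooth_def by blast

text \<open>
  The system may be rectangular: the normal equations \<open>R\<^sup>T R u = R\<^sup>T t\<close> are square and invertible, and Cramer's rule expresses
  \<open>u\<close> through determinants. Their matrix is completed by the identity outside the index set \<open>K\<close>.
\<close>
lemma germ_smooth_solve:
  fixes R :: "'x \<Rightarrow> 'l::finite \<Rightarrow> 'k::finite \<Rightarrow> real" and K :: "'k set" and L :: "'l set"
  assumes x: "x \<in> Y"
    and R: "\<And>l k. l \<in> L \<Longrightarrow> k \<in> K \<Longrightarrow> germ_smooth Y c x (\<lambda>y. R y l k)"
    and t: "\<And>l. l \<in> L \<Longrightarrow> germ_smooth Y c x (\<lambda>y. t y l)"
    and sol: "\<And>y l. y \<in> Y \<Longrightarrow> l \<in> L \<Longrightarrow> (\<Sum>k\<in>K. R y l k * u y k) = t y l"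
    and inj: "\<And>y a k. y \<in> Y \<Longrightarrow> (\<And>l. l \<in> L \<Longrightarrow> (\<Sum>k\<in>K. R y l k * a k) = 0) \<Longrightarrow> k \<in> K \<Longrightarrow> a k = 0"
    and k: "k \<in> K"
  shows "germ_smooth Y c x (\<lambda>y. u y k)"
proof -
  define A where "A y = (\<chi> i j. if i \<in> K \<and> j \<in> K then \<Sum>l\<in>L. R y l i * R y l j else if i = j then 1 else 0)" for y
  define b where "b y = (\<chi> i. if i \<in> K then \<Sum>l\<in>L. R y l i * t y l else 0)" for y
  define w where "w y = (\<chi> i. if i \<in> K then u y i else 0)" for y
  have Av: "(A y *v v) $ i = (if i \<in> K then \<Sum>l\<in>L. R y l i * (\<Sum>j\<in>K. R y l j * v $ j) else v $ i)" for y v i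
  proof (cases "i \<in> K")
    case True
    have "(A y *v v) $ i = (\<Sum>j\<in>UNIV. if j \<in> K then (\<Sum>l\<in>L. R y l i * R y l j) * v $ j else 0)"
      unfolding A_def matrix_vector_mult_def using True by (auto intro!: sum.cong)
    also have "\<dots> = (\<Sum>j\<in>K. \<Sum>l\<in>L. R y l i * R y l j * v $ j)"
      by (simp add: sum.If_cases sum_distrib_right)
    also have "\<dots> = (\<Sum>l\<in>L. R y l i * (\<Sum>j\<in>K. R y l j * v $ j))"
      by (subst sum.swap) (simp add: sum_distrib_left mult.assoc)
    finally show ?thesis using True by simp
  next
    case False
    have "(A y *v v) $ i = (\<Sum>j\<in>UNIV. A y $ i $ j * v $ j)"
      by (simp add: matrix_vector_mult_def)
    also have "\<dots> = (\<Sum>j\<in>UNIV. if j = i then v $ j else 0)"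
      using False by (intro sum.cong) (auto simp: A_def)
    finally have "(A y *v v) $ i = (\<Sum>j\<in>UNIV. if j = i then v $ j else 0)" .
    then show ?thesis using False by simp
  qed
  have det: "det (A y) \<noteq> 0" if y: "y \<in> Y" for y
  proof -
    have "v = 0" if v: "A y *v v = 0" for v
    proof -
      have out: "v $ i = 0" if "i \<notin> K" for i using Av[of y v i] v that by simp
      have "0 = (\<Sum>i\<in>K. v $ i * (A y *v v) $ i)" using v by simp
      also have "\<dots> = (\<Sum>i\<in>K. \<Sum>l\<in>L. v $ i * R y l i * (\<Sum>j\<in>K. R y l j * v $ j))"
        by (intro sum.cong refl) (simp add: Av sum_distrib_left mult.assoc)
      also have "\<dots> = (\<Sum>l\<in>L. (\<Sum>j\<in>K. R y l j * v $ j)\<^sup>2)"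
        by (subst sum.swap) (simp add: sum_distrib_right power2_eq_square mult_ac)
      finally have z: "(\<Sum>j\<in>K. R y l j * v $ j) = 0" if "l \<in> L" for l
        using that sum_nonneg_eq_0_iff[of L "\<lambda>l. (\<Sum>j\<in>K. R y l j * v $ j)\<^sup>2"] by simp
      have "v $ i = 0" if "i \<in> K" for i using inj[OF y, of "\<lambda>j. v $ j" i] z that by blast
      then show "v = 0" using out by (auto simp: vec_eq_iff)
    qed
    then have "invertible (A y)"
      using matrix_left_invertible_ker[of "A y"] by (simp add: invertible_left_inverse)
    then show ?thesis using invertible_det_nz by blast
  qed
  have sol': "w y $ k = det (\<chi> i j. if j = k then b y $ i else A y $ i $ j) / det (A y)" if y: "y \<in> Y" for y
  proof -
    have "A y *v w y = b y"
      using sol[OF y] by (auto simp: vec_eq_iff Av b_def w_def intro!: sum.cong)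
    then have "w y = (\<chi> k. det (\<chi> i j. if j = k then b y $ i else A y $ i $ j) / det (A y))"
      using cramer[OF det[OF y]] by blast
    then show ?thesis by simp
  qed
  have sA: "germ_smooth Y c x (\<lambda>y. A y $ i $ j)" for i j
    unfolding A_def using germ_smooth_const[of Y c x 0] germ_smooth_const[of Y c x 1]
    by (cases "i \<in> K \<and> j \<in> K"; cases "i = j") (auto intro!: germ_smooth_sum germ_smooth_mult x R)
  have sb: "germ_smooth Y c x (\<lambda>y. b y $ i)" for i
    unfolding b_def using germ_smooth_const[of Y c x 0]
    by (cases "i \<in> K") (auto intro!: germ_smooth_sum germ_smooth_mult x R t)
  have "germ_smooth Y c x (\<lambda>y. det (\<chi> i j. if j = k then b y $ i else A y $ i $ j) * inverse (det (A y)))"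
  proof (intro germ_smooth_mult germ_smooth_inverse germ_smooth_det x sA det)
    show "germ_smooth Y c x (\<lambda>y. (\<chi> i j. if j = k then b y $ i else A y $ i $ j) $ i $ j)" for i j
      using sA sb by (cases "j = k") auto
  qed
  then show ?thesis
    by (rule germ_smooth_cong[where W=UNIV, rotated 3]) (use sol' k in \<open>auto simp: w_def divide_inverse\<close>)
qed

section \<open>Matrix-valued functions\<close>

lemma matrix_mult_bounded_bilinear:
  "bounded_bilinear ((**) :: real ^ 'k::finite ^ 'k \<Rightarrow> real ^ 'k ^ 'k \<Rightarrow> real ^ 'k ^ 'k)"
  unfolding bilinear_conv_bounded_bilinear[symmetric] bilinear_def linear_iff
  by (simp add: vec_eq_iff matrix_matrix_mult_def sum.distrib algebra_simps sum_distrib_left)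

interpretation mm: bounded_bilinear "(**) :: real ^ 'k::finite ^ 'k \<Rightarrow> real ^ 'k ^ 'k \<Rightarrow> real ^ 'k ^ 'k"
  by (rule matrix_mult_bounded_bilinear)

lemma commutator_bounded_bilinear:
  "bounded_bilinear (\<lambda>\<omega> X :: real ^ 'k::finite ^ 'k. X ** \<omega> - \<omega> ** X)"
  unfolding bilinear_conv_bounded_bilinear[symmetric] bilinear_def linear_iff
  by (simp add: mm.add_left mm.add_right mm.scaleR_left mm.scaleR_right algebra_simps)

lemma transpose_add: "transpose (A + B) = transpose A + transpose (B :: real ^ 'k ^ 'k)"
  by (simp add: vec_eq_iff transpose_def)

lemma congruence_bounded_bilinear:
  "bounded_bilinear (\<lambda>\<omega> Z :: real ^ 'k::finite ^ 'k. transpose \<omega> ** Z + Z ** \<omega>)"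
  unfolding bilinear_conv_bounded_bilinear[symmetric] bilinear_def linear_iff
  by (simp add: mm.add_left mm.add_right mm.scaleR_left mm.scaleR_right transpose_add transpose_scalar algebra_simps)

lemma transpose_bounded_linear: "bounded_linear (transpose :: real ^ 'k::finite ^ 'k \<Rightarrow> real ^ 'k ^ 'k)"
  unfolding linear_conv_bounded_linear[symmetric] linear_iff by (simp add: transpose_add transpose_scalar)

lemma has_vector_derivative_entry:
  "(X has_vector_derivative N) (at t) \<Longrightarrow> ((\<lambda>r. X r $ i $ j) has_real_derivative N $ i $ j) (at t)"
  for X :: "real \<Rightarrow> real ^ 'k::finite ^ 'l::finite"
  using bounded_linear.has_vector_derivative[OF bounded_linear_vec_nth[of j]
      bounded_linear.has_vector_derivative[OF bounded_linear_vec_nth[of i]]]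
  by (simp add: has_real_derivative_iff_has_vector_derivative)

section \<open>Connections along curves\<close>

context complex_mfd
begin

lemma smooth_near_along_curve:
  assumes "smooth_curve M S \<gamma>" "open S" "t \<in> S" "smooth_near M (\<gamma> t) f"
  shows "\<exists>T. open T \<and> t \<in> T \<and> T \<subseteq> S \<and> smooth_on T (\<lambda>r. f (\<gamma> r))"
proof -
  obtain U z where uz: "(U, z) \<in> atlas M" "\<gamma> t \<in> U" by (rule chart_exists)
  have "\<exists>T. open T \<and> t \<in> T \<and> T \<subseteq> {r\<in>S. \<gamma> r \<in> U} \<and> smooth_on T (\<lambda>r. f (\<gamma> r))"
    by (rule germ_smooth_along_curve[where c=z and \<Gamma>=\<gamma> and f=f, OF _ smooth_curve_chart(1)[OF assms(1,2) uz(1)] _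
          smooth_curve_chart(2)[OF assms(1,2) uz(1)]])
      (use assms uz smooth_near_iff[OF uz] in auto)
  then show ?thesis by blast
qed

lemma curve_preimage_open: "smooth_curve M S \<gamma> \<Longrightarrow> open S \<Longrightarrow> open V \<Longrightarrow> open {t\<in>S. \<gamma> t \<in> V}"
proof -
  assume a: "smooth_curve M S \<gamma>" "open S" "open V"
  have "{t\<in>S. \<gamma> t \<in> V} = S \<inter> \<gamma> -` V" by auto
  then show ?thesis using a continuous_open_preimage[of S \<gamma> V] by (simp add: smooth_curve_def)
qed

end

locale conn_bundle = metric_bundle M E g
  for M :: "('m::{t2_space,second_countable_topology}, 'n::finite) cmanifold"
    and E :: "('m, 'v::real_vector, 'k::finite) vbundle"
    and g :: "'m \<Rightarrow> 'v \<Rightarrow> 'v \<Rightarrow> real" +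
  fixes D :: "('m, 'v) connection"
  assumes conn: "is_connection M E D" and mc: "metric_connection M E g D"
begin

lemma conn_rules:
  assumes "v \<in> tangent M p" "smooth_section_near M E p \<sigma>"
  shows conn_in: "D p v \<sigma> \<in> fibre E p"
    and conn_cong: "smooth_section_near M E p \<tau> \<Longrightarrow> \<forall>\<^sub>F q in nhds p. \<sigma> q = \<tau> q \<Longrightarrow> D p v \<sigma> = D p v \<tau>"
    and conn_tscale: "D p (tscale a v) \<sigma> = a *\<^sub>R D p v \<sigma>"
    and conn_add: "smooth_section_near M E p \<tau> \<Longrightarrow> D p v (\<lambda>q. \<sigma> q + \<tau> q) = D p v \<sigma> + D p v \<tau>"
    and conn_scale: "smooth_near M p f \<Longrightarrow> D p v (\<lambda>q. f q *\<^sub>R \<sigma> q) = v f *\<^sub>R \<sigma> p + f p *\<^sub>R D p v \<sigma>"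
proof -
  note c = conn[unfolded is_connection_def, THEN conjunct1, rule_format, OF assms(1,1)]
  note c1 = c[OF conjI[OF assms(2) conjI[OF assms(2) smooth_near_const[of p 0]]]]
  show "D p v \<sigma> \<in> fibre E p" "D p (tscale a v) \<sigma> = a *\<^sub>R D p v \<sigma>" using c1 by auto
  show "smooth_section_near M E p \<tau> \<Longrightarrow> \<forall>\<^sub>F q in nhds p. \<sigma> q = \<tau> q \<Longrightarrow> D p v \<sigma> = D p v \<tau>"
    using c[OF conjI[OF assms(2) conjI[OF _ smooth_near_const[of p 0]]], of \<tau>] by auto
  show "smooth_section_near M E p \<tau> \<Longrightarrow> D p v (\<lambda>q. \<sigma> q + \<tau> q) = D p v \<sigma> + D p v \<tau>"
    using c[OF conjI[OF assms(2) conjI[OF _ smooth_near_const[of p 0]]], of \<tau>] by auto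
  show "smooth_near M p f \<Longrightarrow> D p v (\<lambda>q. f q *\<^sub>R \<sigma> q) = v f *\<^sub>R \<sigma> p + f p *\<^sub>R D p v \<sigma>"
    using c[OF conjI[OF assms(2) conjI[OF assms(2)]], of f] by auto
qed

lemma conn_field:
  "smooth_field_near M p X \<Longrightarrow> smooth_section_near M E p \<sigma> \<Longrightarrow> smooth_section_near M E p (\<lambda>q. D q (X q) \<sigma>)"
  using conn unfolding is_connection_def by blast

lemma conn_metric:
  "v \<in> tangent M p \<Longrightarrow> smooth_section_near M E p \<sigma> \<Longrightarrow> smooth_section_near M E p \<tau> \<Longrightarrow>
     v (\<lambda>q. g q (\<sigma> q) (\<tau> q)) = g p (D p v \<sigma>) (\<tau> p) + g p (\<sigma> p) (D p v \<tau>)"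
  using mc unfolding metric_connection_def by blast

lemma conn_zero_vector:
  assumes "smooth_section_near M E p \<sigma>"
  shows "D p (\<lambda>f. 0) \<sigma> = 0"
  using conn_tscale[OF zero_in_tangent assms, of 0] by (simp add: tscale_def)

lemma conn_zero_section:
  assumes "v \<in> tangent M p"
  shows "D p v (\<lambda>q. 0) = 0"
  using conn_add[OF assms section_zero section_zero] by simp

lemma conn_sum:
  assumes "v \<in> tangent M p" "\<And>i. i \<in> K \<Longrightarrow> smooth_section_near M E p (\<sigma> i)" "\<And>i. i \<in> K \<Longrightarrow> smooth_near M p (f i)"
  shows "D p v (\<lambda>q. \<Sum>i\<in>K. f i q *\<^sub>R \<sigma> i q) = (\<Sum>i\<in>K. v (f i) *\<^sub>R \<sigma> i p + f i p *\<^sub>R D p v (\<sigma> i))"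
  using assms(2,3)
proof (induction K rule: infinite_finite_induct)
  case (insert i K)
  have "D p v (\<lambda>q. f i q *\<^sub>R \<sigma> i q + (\<Sum>i\<in>K. f i q *\<^sub>R \<sigma> i q))
      = D p v (\<lambda>q. f i q *\<^sub>R \<sigma> i q) + D p v (\<lambda>q. \<Sum>i\<in>K. f i q *\<^sub>R \<sigma> i q)"
    using insert by (intro conn_add assms(1) section_scale section_sum) auto
  then show ?case using insert by (simp add: conn_scale[OF assms(1)])
qed (auto simp: conn_zero_section[OF assms(1)])

lemma conn_expand:
  assumes "v \<in> tangent M p" "(V, s) \<in> frames E" "p \<in> V" "smooth_section_near M E p \<sigma>"
  shows "D p v \<sigma> = (\<Sum>i\<in>I. v (\<lambda>q. coef E s q (\<sigma> q) i) *\<^sub>R s i p + coef E s p (\<sigma> p) i *\<^sub>R D p v (s i))"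
proof -
  let ?\<tau> = "\<lambda>q. \<Sum>i\<in>I. coef E s q (\<sigma> q) i *\<^sub>R s i q"
  note a = assms(4)[unfolded section_iff[OF assms(2,3)]]
  have "\<forall>\<^sub>F q in nhds p. \<sigma> q = ?\<tau> q"
    using a[THEN conjunct1] open_ev[OF frame_open[OF assms(2)] assms(3)]
    by eventually_elim (simp add: coef_expand[OF assms(2)])
  then have "D p v \<sigma> = D p v ?\<tau>"
    using a section_frame[OF assms(2,3)]
    by (intro conn_cong[OF assms(1,4)] section_sum section_scale) auto
  also have "\<dots> = (\<Sum>i\<in>I. v (\<lambda>q. coef E s q (\<sigma> q) i) *\<^sub>R s i p + coef E s p (\<sigma> p) i *\<^sub>R D p v (s i))"
    using a section_frame[OF assms(2,3)] by (intro conn_sum assms(1)) auto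
  finally show ?thesis .
qed

lemma frame_conn_in:
  "v \<in> tangent M p \<Longrightarrow> (V, s) \<in> frames E \<Longrightarrow> p \<in> V \<Longrightarrow> i \<in> I \<Longrightarrow> D p v (s i) \<in> fibre E p"
  using conn_in section_frame by blast

subsection \<open>Sections along curves\<close>

context
  fixes S \<gamma> e
  assumes \<gamma>: "smooth_curve M S \<gamma>" and S: "open S" and e: "smooth_section_along E S \<gamma> e"
begin

lemma along_in: "t \<in> S \<Longrightarrow> e t \<in> fibre E (\<gamma> t)"
  using e by (simp add: smooth_section_along_def)

lemma along_smooth:
  assumes "(V, s) \<in> frames E" "i \<in> I"
  shows "smooth_on {t\<in>S. \<gamma> t \<in> V} (\<lambda>t. coef E s (\<gamma> t) (e t) i)"
proof -
  have "\<forall>(V, s)\<in>frames E. \<forall>i\<in>I. smooth_on {t\<in>S. \<gamma> t \<in> V} (\<lambda>t. coef E s (\<gamma> t) (e t) i)"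
    using e by (simp add: smooth_section_along_def)
  then show ?thesis using assms by blast
qed

lemma along_deriv:
  assumes "(V, s) \<in> frames E" "i \<in> I" "t \<in> S" "\<gamma> t \<in> V"
  shows "((\<lambda>r. coef E s (\<gamma> r) (e r) i) has_real_derivative deriv (\<lambda>r. coef E s (\<gamma> r) (e r) i) t) (at t)"
  using smooth_on_has_derivative[OF along_smooth[OF assms(1,2)], of t] assms(3,4)
  by (auto simp: DERIV_deriv_iff_real_differentiable intro: differentiableI)

text \<open>
  The frame is expanded as \<open>s\<^sub>i = \<Sum>k. c\<^sub>k\<^sub>i s'\<^sub>k\<close>; the derivatives of \<open>c\<^sub>k\<^sub>i\<close> along the curve come once from the
  coefficients of \<open>e\<close> and once from the Leibniz rule for \<open>\<nabla>s\<^sub>i\<close>, with the same result.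
\<close>
lemma cov_deriv_frame_independent:
  assumes vs: "(V, s) \<in> frames E" and vs': "(V', s') \<in> frames E" and t: "t \<in> S" "\<gamma> t \<in> V" "\<gamma> t \<in> V'"
  shows "cov_deriv_along M E D s' \<gamma> e t = cov_deriv_along M E D s \<gamma> e t"
proof -
  define w where "w = velocity (smooth_near M) \<gamma> t"
  have w: "w \<in> tangent M (\<gamma> t)" unfolding w_def by (rule velocity_in_tangent[OF \<gamma> S t(1)])
  define c where "c k i q = coef E s' q (s i q) k" for k i q
  have cs: "smooth_near M (\<gamma> t) (c k i)" if "k \<in> I" "i \<in> I" for k i
    unfolding c_def by (rule transition_smooth[OF vs vs' t(2,3) that])
  let ?a = "\<lambda>i r. coef E s (\<gamma> r) (e r) i" and ?a' = "\<lambda>i r. coef E s' (\<gamma> r) (e r) i"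
  have da: "(?a i has_real_derivative deriv (?a i) t) (at t)" if "i \<in> I" for i
    by (rule along_deriv[OF vs that t(1,2)])
  have dc: "((\<lambda>r. c k i (\<gamma> r)) has_real_derivative w (c k i)) (at t)" if "k \<in> I" "i \<in> I" for k i
    unfolding w_def by (rule curve_derivative[OF \<gamma> S t(1) cs[OF that]])
  have o: "open {r\<in>S. \<gamma> r \<in> V \<inter> V'}"
    using curve_preimage_open[OF \<gamma> S] frame_open[OF vs] frame_open[OF vs'] by blast
  have a'_eq: "?a' k r = (\<Sum>i\<in>I. ?a i r * c k i (\<gamma> r))" if "r \<in> {r\<in>S. \<gamma> r \<in> V \<inter> V'}" for k r
    using that unfolding c_def by (intro coef_change[OF vs vs']) (auto simp: along_in)
  have da': "deriv (?a' k) t = (\<Sum>i\<in>I. deriv (?a i) t * c k i (\<gamma> t) + ?a i t * w (c k i))" if k: "k \<in> I" for k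
  proof (rule DERIV_imp_deriv)
    have "((\<lambda>r. \<Sum>i\<in>I. ?a i r * c k i (\<gamma> r)) has_real_derivative
        (\<Sum>i\<in>I. deriv (?a i) t * c k i (\<gamma> t) + ?a i t * w (c k i))) (at t)"
      using da dc[OF k] by (intro DERIV_sum) (auto intro!: derivative_eq_intros)
    then show "(?a' k has_real_derivative (\<Sum>i\<in>I. deriv (?a i) t * c k i (\<gamma> t) + ?a i t * w (c k i))) (at t)"
      by (rule has_field_derivative_transform_within_open[OF _ o]) (use t a'_eq in auto)
  qed
  have s_exp: "s i (\<gamma> t) = (\<Sum>k\<in>I. c k i (\<gamma> t) *\<^sub>R s' k (\<gamma> t))" if "i \<in> I" for i
    unfolding c_def using coef_expand[OF vs' t(3) frame_in_fibre[OF vs t(2) that]] by simp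
  have Ds: "D (\<gamma> t) w (s i) = (\<Sum>k\<in>I. w (c k i) *\<^sub>R s' k (\<gamma> t) + c k i (\<gamma> t) *\<^sub>R D (\<gamma> t) w (s' k))" if "i \<in> I" for i
    unfolding c_def by (rule conn_expand[OF w vs' t(3) section_frame[OF vs t(2) that]])
  have "cov_deriv_along M E D s \<gamma> e t
      = (\<Sum>i\<in>I. \<Sum>k\<in>I. (deriv (?a i) t * c k i (\<gamma> t) + ?a i t * w (c k i)) *\<^sub>R s' k (\<gamma> t)
          + (?a i t * c k i (\<gamma> t)) *\<^sub>R D (\<gamma> t) w (s' k))"
    unfolding cov_deriv_along_def w_def[symmetric]
    by (intro sum.cong refl, subst s_exp, assumption, subst Ds, assumption)
      (simp add: scaleR_sum_right sum.distrib[symmetric] algebra_simps)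
  also have "\<dots> = (\<Sum>k\<in>I. (\<Sum>i\<in>I. deriv (?a i) t * c k i (\<gamma> t) + ?a i t * w (c k i)) *\<^sub>R s' k (\<gamma> t)
          + (\<Sum>i\<in>I. ?a i t * c k i (\<gamma> t)) *\<^sub>R D (\<gamma> t) w (s' k))"
    by (subst sum.swap) (simp add: scaleR_sum_left scaleR_add_left sum.distrib)
  also have "\<dots> = cov_deriv_along M E D s' \<gamma> e t"
    unfolding cov_deriv_along_def w_def[symmetric]
    using t by (intro sum.cong refl) (simp add: da' a'_eq)
  finally show ?thesis by simp
qed

end

subsection \<open>The covariant derivative of an endomorphism\<close>

text \<open>
  For a tangent vector of the twistor space at \<open>x = (p, J)\<close> with data \<open>(w, N)\<close>, the vectors \<open>covd s x w N j\<close>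
  are the values on the frame of its vertical part, the endomorphism \<open>\<nabla>\<^sub>w J\<close>.
\<close>
definition covd :: "('k \<Rightarrow> 'm \<Rightarrow> 'v) \<Rightarrow> 'm \<times> ('v \<Rightarrow> 'v) \<Rightarrow> 'm tvec \<Rightarrow> real ^ 'k ^ 'k \<Rightarrow> 'k \<Rightarrow> 'v" where
  "covd s x w N j = (\<Sum>i\<in>I. N $ i $ j *\<^sub>R s i (fst x)) +
     (\<Sum>i\<in>I. fmat s x $ i $ j *\<^sub>R D (fst x) w (s i)) - snd x (D (fst x) w (s j))"

lemma covd_in:
  assumes "x \<in> twistor E g" "(V, s) \<in> frames E" "fst x \<in> V" "w \<in> tangent M (fst x)" "j \<in> I"
  shows "covd s x w N j \<in> fibre E (fst x)"
  unfolding covd_def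
  by (intro fibre_diff fibre_add fibre_sum fibre_scale frame_in_fibre[OF assms(2,3)]
      frame_conn_in[OF assms(4,2,3)] End_in[OF twistorD(1)[OF assms(1)]] assms(5))

lemma covd_add: "covd s x w (N + N') j = (\<Sum>i\<in>I. N $ i $ j *\<^sub>R s i (fst x)) + covd s x w N' j"
  by (simp add: covd_def sum.distrib algebra_simps)

lemma covd_zero_vector:
  assumes "x \<in> twistor E g" "(V, s) \<in> frames E" "fst x \<in> V" "j \<in> I"
  shows "covd s x (\<lambda>f. 0) N j = (\<Sum>i\<in>I. N $ i $ j *\<^sub>R s i (fst x))"
  using conn_zero_vector[OF section_frame[OF assms(2,3)]] End_zero[OF twistorD(1)[OF assms(1)]] assms(4)
  by (simp add: covd_def)

lemma covd_inject:
  assumes "(V, s) \<in> frames E" "fst x \<in> V" "\<And>j. j \<in> I \<Longrightarrow> covd s x w N j = covd s x w N' j"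
    and "\<And>i j. \<not> (i \<in> I \<and> j \<in> I) \<Longrightarrow> N $ i $ j = 0" "\<And>i j. \<not> (i \<in> I \<and> j \<in> I) \<Longrightarrow> N' $ i $ j = 0"
  shows "N = N'"
proof -
  have "N $ i $ j = N' $ i $ j" for i j
  proof (cases "i \<in> I \<and> j \<in> I")
    case True
    have "(\<Sum>i\<in>I. N $ i $ j *\<^sub>R s i (fst x)) = (\<Sum>i\<in>I. N' $ i $ j *\<^sub>R s i (fst x))"
      using assms(3)[of j] True by (simp add: covd_def)
    then show ?thesis
      using coef_frame_sum[OF assms(1,2), of i "\<lambda>i. N $ i $ j"] coef_frame_sum[OF assms(1,2), of i "\<lambda>i. N' $ i $ j"] True
      by simp
  qed (use assms(4,5) in auto)
  then show ?thesis by (simp add: vec_eq_iff)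
qed

lemma twistor_curve_matrix:
  assumes \<Gamma>: "twistor_curve M E g S \<Gamma>" and S: "open S" "t \<in> S" and vs: "(V, s) \<in> frames E" "fst (\<Gamma> t) \<in> V"
  shows "((\<lambda>r. fmat s (\<Gamma> r)) has_vector_derivative
      vector_derivative (\<lambda>r. fmat s (\<Gamma> r)) (at t)) (at t)"
proof -
  have "\<forall>(V, s)\<in>frames E. smooth_on {t\<in>S. fst (\<Gamma> t) \<in> V} (\<lambda>t. fmat s (\<Gamma> t))"
    using \<Gamma> by (simp add: twistor_curve_def)
  then have "smooth_on {t\<in>S. fst (\<Gamma> t) \<in> V} (\<lambda>t. fmat s (\<Gamma> t))"
    using vs(1) by blast
  then show ?thesis by (rule smooth_on_has_vector_derivative) (use S vs in auto)
qed

lemma along_apply: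
  assumes \<Gamma>: "twistor_curve M E g S \<Gamma>" and S: "open S" and e: "smooth_section_along E S (\<lambda>t. fst (\<Gamma> t)) e"
  shows "smooth_section_along E S (\<lambda>t. fst (\<Gamma> t)) (\<lambda>t. snd (\<Gamma> t) (e t))"
  unfolding smooth_section_along_def
proof (intro conjI ballI)
  note \<gamma> = twistor_curve_base[OF \<Gamma>]
  show "snd (\<Gamma> t) (e t) \<in> fibre E (fst (\<Gamma> t))" if "t \<in> S" for t
    using End_in[OF twistorD(1)[OF twistor_curve_in[OF \<Gamma> that]] along_in[OF \<gamma> S e that]] .
  fix vs assume vs: "vs \<in> frames E"
  obtain V s where vs_eq: "vs = (V, s)" by fastforce
  note vs = vs[unfolded vs_eq]
  have "smooth_on {t\<in>S. fst (\<Gamma> t) \<in> V} (\<lambda>t. coef E s (fst (\<Gamma> t)) (snd (\<Gamma> t) (e t)) i)" if i: "i \<in> I" for i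
  proof -
    have o: "open {t\<in>S. fst (\<Gamma> t) \<in> V}" by (rule curve_preimage_open[OF \<gamma> S frame_open[OF vs]])
    have "\<forall>(V, s)\<in>frames E. smooth_on {t\<in>S. fst (\<Gamma> t) \<in> V} (\<lambda>t. fmat s (\<Gamma> t))"
      using \<Gamma> by (simp add: twistor_curve_def)
    then have m: "smooth_on {t\<in>S. fst (\<Gamma> t) \<in> V} (\<lambda>t. fmat s (\<Gamma> t))"
      using vs by blast
    have m': "smooth_on {t\<in>S. fst (\<Gamma> t) \<in> V} (\<lambda>t. fmat s (\<Gamma> t) $ i $ j)" for j
      using smooth_on_inner[OF o m, of "axis i (axis j 1)"] by (simp add: inner_axis)
    have "smooth_on {t\<in>S. fst (\<Gamma> t) \<in> V}
        (\<lambda>t. \<Sum>j\<in>I. fmat s (\<Gamma> t) $ i $ j * coef E s (fst (\<Gamma> t)) (e t) j)"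
      by (intro smooth_on_sum smooth_on_mult o m' along_smooth[OF \<gamma> S e vs])
    then show ?thesis
      by (subst smooth_on_cong[OF o, where g="\<lambda>t. \<Sum>j\<in>I. fmat s (\<Gamma> t) $ i $ j * coef E s (fst (\<Gamma> t)) (e t) j"])
        (use i vs twistorD(1)[OF twistor_curve_in[OF \<Gamma>]] along_in[OF \<gamma> S e] in \<open>auto simp: matrix_coef\<close>)
  qed
  then show "case vs of (V, s) \<Rightarrow> \<forall>i\<in>I. smooth_on {t\<in>S. fst (\<Gamma> t) \<in> V} (\<lambda>t. coef E s (fst (\<Gamma> t)) (snd (\<Gamma> t) (e t)) i)"
    by (simp add: vs_eq)
qed

text \<open>
  The Leibniz rule \<open>\<nabla>(J e) - J (\<nabla>e) = (\<nabla>J) e\<close>; it translates parallelism of \<open>J\<close> into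
  the vanishing of \<open>covd\<close>.
\<close>
lemma cov_deriv_apply:
  assumes \<Gamma>: "twistor_curve M E g S \<Gamma>" and S: "open S" "t \<in> S" and e: "smooth_section_along E S (\<lambda>t. fst (\<Gamma> t)) e"
    and vs: "(V, s) \<in> frames E" "fst (\<Gamma> t) \<in> V"
  shows "cov_deriv_along M E D s (\<lambda>t. fst (\<Gamma> t)) (\<lambda>r. snd (\<Gamma> r) (e r)) t
      = snd (\<Gamma> t) (cov_deriv_along M E D s (\<lambda>t. fst (\<Gamma> t)) e t)
        + (\<Sum>j\<in>I. coef E s (fst (\<Gamma> t)) (e t) j *\<^sub>R covd s (\<Gamma> t) (velocity (smooth_near M) (\<lambda>t. fst (\<Gamma> t)) t)
            (vector_derivative (\<lambda>r. fmat s (\<Gamma> r)) (at t)) j)"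
proof -
  note \<gamma> = twistor_curve_base[OF \<Gamma>]
  define w where "w = velocity (smooth_near M) (\<lambda>t. fst (\<Gamma> t)) t"
  have w: "w \<in> tangent M (fst (\<Gamma> t))" unfolding w_def by (rule velocity_in_tangent[OF \<gamma> S])
  define N where "N = vector_derivative (\<lambda>r. fmat s (\<Gamma> r)) (at t)"
  let ?M = "\<lambda>r. fmat s (\<Gamma> r)"
  let ?a = "\<lambda>j r. coef E s (fst (\<Gamma> r)) (e r) j"
  let ?s = "\<lambda>i. s i (fst (\<Gamma> t))" and ?D = "\<lambda>i. D (fst (\<Gamma> t)) w (s i)" and ?J = "snd (\<Gamma> t)"
  have dM: "((\<lambda>r. ?M r $ i $ j) has_real_derivative N $ i $ j) (at t)" for i j
    unfolding N_def by (rule has_vector_derivative_entry[OF twistor_curve_matrix[OF \<Gamma> S vs]])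
  have da: "(?a j has_real_derivative deriv (?a j) t) (at t)" if "j \<in> I" for j
    using along_deriv[OF \<gamma> S(1) e vs(1) that S(2)] vs(2) by simp
  have J: "snd (\<Gamma> r) \<in> End_fibre E (fst (\<Gamma> r))" if "r \<in> S" for r
    by (rule twistorD(1)[OF twistor_curve_in[OF \<Gamma> that]])
  have Ms: "?J (?s j) = (\<Sum>i\<in>I. ?M t $ i $ j *\<^sub>R ?s i)" if "j \<in> I" for j
    by (rule matrix_frame[OF vs J[OF S(2)] that])
  have o: "open {r\<in>S. fst (\<Gamma> r) \<in> V}" by (rule curve_preimage_open[OF \<gamma> S(1) frame_open[OF vs(1)]])
  have b: "coef E s (fst (\<Gamma> r)) (snd (\<Gamma> r) (e r)) i = (\<Sum>j\<in>I. ?M r $ i $ j * ?a j r)"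
    if "r \<in> {r\<in>S. fst (\<Gamma> r) \<in> V}" "i \<in> I" for r i
    using that by (intro matrix_coef[OF vs(1)] J along_in[OF \<gamma> S(1) e]) auto
  have db: "deriv (\<lambda>r. coef E s (fst (\<Gamma> r)) (snd (\<Gamma> r) (e r)) i) t = (\<Sum>j\<in>I. N $ i $ j * ?a j t + ?M t $ i $ j * deriv (?a j) t)"
    if i: "i \<in> I" for i
  proof (rule DERIV_imp_deriv)
    have "((\<lambda>r. \<Sum>j\<in>I. ?M r $ i $ j * ?a j r) has_real_derivative
        (\<Sum>j\<in>I. N $ i $ j * ?a j t + ?M t $ i $ j * deriv (?a j) t)) (at t)"
      using da dM by (intro DERIV_sum) (auto intro!: derivative_eq_intros)
    then show "((\<lambda>r. coef E s (fst (\<Gamma> r)) (snd (\<Gamma> r) (e r)) i) has_real_derivative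
        (\<Sum>j\<in>I. N $ i $ j * ?a j t + ?M t $ i $ j * deriv (?a j) t)) (at t)"
      by (rule has_field_derivative_transform_within_open[OF _ o]) (use S vs b[OF _ i] in auto)
  qed
  have t: "t \<in> {r\<in>S. fst (\<Gamma> r) \<in> V}" using S vs by simp
  have L: "cov_deriv_along M E D s (\<lambda>t. fst (\<Gamma> t)) (\<lambda>r. snd (\<Gamma> r) (e r)) t
      = (\<Sum>i\<in>I. \<Sum>j\<in>I. (N $ i $ j * ?a j t + ?M t $ i $ j * deriv (?a j) t) *\<^sub>R ?s i + (?M t $ i $ j * ?a j t) *\<^sub>R ?D i)"
    unfolding cov_deriv_along_def w_def[symmetric]
    by (intro sum.cong refl) (simp add: db b[OF t] scaleR_sum_left scaleR_add_left sum.distrib)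
  also have "\<dots> = (\<Sum>j\<in>I. deriv (?a j) t *\<^sub>R ?J (?s j) + ?a j t *\<^sub>R ?J (?D j)) + (\<Sum>j\<in>I. ?a j t *\<^sub>R covd s (\<Gamma> t) w N j)"
    unfolding sum.distrib[symmetric]
    by (subst sum.swap, intro sum.cong refl)
      (simp add: covd_def Ms scaleR_sum_right sum.distrib algebra_simps)
  also have "(\<Sum>j\<in>I. deriv (?a j) t *\<^sub>R ?J (?s j) + ?a j t *\<^sub>R ?J (?D j)) = ?J (cov_deriv_along M E D s (\<lambda>t. fst (\<Gamma> t)) e t)"
  proof -
    note J' = J[OF S(2)]
    have f: "?s j \<in> fibre E (fst (\<Gamma> t))" "?D j \<in> fibre E (fst (\<Gamma> t))" if "j \<in> I" for j
      using frame_in_fibre[OF vs that] frame_conn_in[OF w vs that] by auto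
    have "?J (cov_deriv_along M E D s (\<lambda>t. fst (\<Gamma> t)) e t)
        = ?J ((\<Sum>j\<in>I. deriv (?a j) t *\<^sub>R ?s j) + (\<Sum>j\<in>I. ?a j t *\<^sub>R ?D j))"
      unfolding cov_deriv_along_def w_def[symmetric] by (simp add: sum.distrib)
    also have "\<dots> = (\<Sum>j\<in>I. deriv (?a j) t *\<^sub>R ?J (?s j)) + (\<Sum>j\<in>I. ?a j t *\<^sub>R ?J (?D j))"
      using f by (simp add: End_add[OF J'] End_lincomb[OF J'] fibre_sum fibre_scale)
    finally show ?thesis by (simp add: sum.distrib)
  qed
  finally show ?thesis unfolding w_def N_def .
qed

lemma parallel_if_covd_zero:
  assumes \<Gamma>: "twistor_curve M E g S \<Gamma>" and S: "open S" and vs: "(V, s) \<in> frames E" "\<And>t. t \<in> S \<Longrightarrow> fst (\<Gamma> t) \<in> V"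
    and zero: "\<And>t j. t \<in> S \<Longrightarrow> j \<in> I \<Longrightarrow> covd s (\<Gamma> t) (velocity (smooth_near M) (\<lambda>t. fst (\<Gamma> t)) t)
            (vector_derivative (\<lambda>r. fmat s (\<Gamma> r)) (at t)) j = 0"
  shows "parallel_along M E D S \<Gamma>"
  unfolding parallel_along_def Let_def
proof (intro allI impI ballI)
  fix e t vs' assume e: "smooth_section_along E S (\<lambda>t. fst (\<Gamma> t)) e" and t: "t \<in> S" and vs'0: "vs' \<in> frames E"
  obtain V' s' where vs'1: "vs' = (V', s')" by (cases vs')
  note vs' = vs'1 vs'0[unfolded vs'1]
  note \<gamma> = twistor_curve_base[OF \<Gamma>]
  have "cov_deriv_along M E D s' (\<lambda>t. fst (\<Gamma> t)) (\<lambda>r. snd (\<Gamma> r) (e r)) t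
      = snd (\<Gamma> t) (cov_deriv_along M E D s' (\<lambda>t. fst (\<Gamma> t)) e t)" if "fst (\<Gamma> t) \<in> V'"
    using cov_deriv_apply[OF \<Gamma> S t e vs(1) vs(2)[OF t]] zero[OF t]
      cov_deriv_frame_independent[OF \<gamma> S e vs(1) vs'(2) t vs(2)[OF t] that]
      cov_deriv_frame_independent[OF \<gamma> S along_apply[OF \<Gamma> S e] vs(1) vs'(2) t vs(2)[OF t] that]
    by simp
  then show "case vs' of (V, s) \<Rightarrow> fst (\<Gamma> t) \<in> V \<longrightarrow>
      cov_deriv_along M E D s (\<lambda>t. fst (\<Gamma> t)) (\<lambda>r. snd (\<Gamma> r) (e r)) t
        = snd (\<Gamma> t) (cov_deriv_along M E D s (\<lambda>t. fst (\<Gamma> t)) e t)"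
    by (simp add: vs'(1))
qed

text \<open>
  Conversely, sections with arbitrary value at \<open>t = 0\<close> are needed to read off \<open>covd = 0\<close> from
  parallelism; cutting off a frame by a bump function makes it a smooth section along the whole curve.
\<close>
lemma covd_zero_if_parallel:
  assumes \<Gamma>: "twistor_curve M E g {-\<epsilon><..<\<epsilon>} \<Gamma>" and e: "\<epsilon> > 0" and par: "parallel_along M E D {-\<epsilon><..<\<epsilon>} \<Gamma>"
    and vs: "(V, s) \<in> frames E" "fst (\<Gamma> 0) \<in> V" and j: "j \<in> I"
  shows "covd s (\<Gamma> 0) (velocity (smooth_near M) (\<lambda>t. fst (\<Gamma> t)) 0)
            (vector_derivative (\<lambda>r. fmat s (\<Gamma> r)) (at 0)) j = 0"
proof -
  let ?S = "{-\<epsilon><..<\<epsilon>}" and ?\<gamma> = "\<lambda>t. fst (\<Gamma> t)"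
  have S: "open ?S" "0 \<in> ?S" using e by auto
  note \<gamma> = twistor_curve_base[OF \<Gamma>]
  have o: "open {r\<in>?S. ?\<gamma> r \<in> V}" by (rule curve_preimage_open[OF \<gamma> S(1) frame_open[OF vs(1)]])
  obtain \<delta> where \<delta>: "\<delta> > 0" "ball 0 \<delta> \<subseteq> {r\<in>?S. ?\<gamma> r \<in> V}"
    using openE[OF o, of 0] S(2) vs(2) by blast
  then have in_V: "?\<gamma> r \<in> V" if "\<bar>r\<bar> < \<delta>" for r using that by (auto simp: subset_iff dist_real_def)
  obtain \<rho> :: "real \<Rightarrow> real" where \<rho>: "smooth_on UNIV \<rho>" "\<rho> 0 \<noteq> 0" "\<And>t. \<bar>t\<bar> \<ge> \<delta> / 2 \<Longrightarrow> \<rho> t = 0"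
    using bump_exists[of "\<delta> / 2"] \<delta>(1) by auto
  define a where "a r = (if \<bar>r\<bar> < \<delta> then \<rho> r *\<^sub>R s j (?\<gamma> r) else 0)" for r
  have a: "smooth_section_along E ?S ?\<gamma> a"
    unfolding smooth_section_along_def
  proof (intro conjI ballI)
    show "a t \<in> fibre E (?\<gamma> t)" for t
      using in_V frame_in_fibre[OF vs(1) _ j] by (auto simp: a_def fibre_zero fibre_scale)
    fix vs' assume vs'0: "vs' \<in> frames E"
    obtain V' s' where vs'1: "vs' = (V', s')" by (cases vs')
    note vs' = vs'1 vs'0[unfolded vs'1]
    have "smooth_on {t \<in> ?S. ?\<gamma> t \<in> V'} (\<lambda>t. coef E s' (?\<gamma> t) (a t) i)" if i: "i \<in> I" for i
    proof (rule smooth_on_local)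
      fix t assume t: "t \<in> {t \<in> ?S. ?\<gamma> t \<in> V'}"
      show "\<exists>T. open T \<and> t \<in> T \<and> smooth_on T (\<lambda>t. coef E s' (?\<gamma> t) (a t) i)"
      proof (cases "\<bar>t\<bar> < \<delta>")
        case True
        obtain T where T: "open T" "t \<in> T" "smooth_on T (\<lambda>r. coef E s' (?\<gamma> r) (s j (?\<gamma> r)) i)"
          using smooth_near_along_curve[OF \<gamma> S(1) _ transition_smooth[OF vs(1) vs'(2) in_V[OF True] _ i j]] t by auto
        let ?T = "T \<inter> {-\<delta><..<\<delta>} \<inter> {t \<in> ?S. ?\<gamma> t \<in> V'}"
        have oT: "open ?T" by (intro open_Int T(1) open_greaterThanLessThan curve_preimage_open[OF \<gamma> S(1) frame_open[OF vs'(2)]])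
        have "smooth_on ?T (\<lambda>r. \<rho> r * coef E s' (?\<gamma> r) (s j (?\<gamma> r)) i)"
          by (intro smooth_on_mult oT smooth_on_subset[OF \<rho>(1)] smooth_on_subset[OF T(3)]) auto
        then have "smooth_on ?T (\<lambda>t. coef E s' (?\<gamma> t) (a t) i)"
          by (subst smooth_on_cong[OF oT, where g="\<lambda>r. \<rho> r * coef E s' (?\<gamma> r) (s j (?\<gamma> r)) i"])
            (use in_V frame_in_fibre[OF vs(1) _ j] in \<open>auto simp: a_def coef_scale[OF vs'(2)]\<close>)
        then show ?thesis using oT T(2) True t by (intro exI[of _ ?T]) auto
      next
        case False
        let ?T = "{r. \<delta> / 2 < \<bar>r\<bar>}"
        have oT: "open ?T" by (intro open_Collect_less continuous_intros)
        have "coef E s' (?\<gamma> r) (a r) i = 0" if "r \<in> ?T" for r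
          using that \<rho>(3)[of r] coef_zero[OF vs'(2)] by (simp add: a_def)
        then have "smooth_on ?T (\<lambda>t. coef E s' (?\<gamma> t) (a t) i)"
          using smooth_on_const[of ?T 0] by (subst smooth_on_cong[OF oT, where g="\<lambda>_. 0"]) auto
        then show ?thesis using oT False \<delta>(1) by (intro exI[of _ ?T]) auto
      qed
    qed
    then show "case vs' of (V, s) \<Rightarrow> \<forall>i\<in>I. smooth_on {t \<in> ?S. ?\<gamma> t \<in> V} (\<lambda>t. coef E s (?\<gamma> t) (a t) i)"
      by (simp add: vs'(1))
  qed
  have "\<forall>(V, s)\<in>frames E. ?\<gamma> 0 \<in> V \<longrightarrow>
      cov_deriv_along M E D s ?\<gamma> (\<lambda>r. snd (\<Gamma> r) (a r)) 0 = snd (\<Gamma> 0) (cov_deriv_along M E D s ?\<gamma> a 0)"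
    using par a S(2) unfolding parallel_along_def Let_def by blast
  then have "cov_deriv_along M E D s ?\<gamma> (\<lambda>r. snd (\<Gamma> r) (a r)) 0 = snd (\<Gamma> 0) (cov_deriv_along M E D s ?\<gamma> a 0)"
    using vs by blast
  then have z: "(\<Sum>l\<in>I. coef E s (?\<gamma> 0) (a 0) l *\<^sub>R covd s (\<Gamma> 0) (velocity (smooth_near M) ?\<gamma> 0)
            (vector_derivative (\<lambda>r. fmat s (\<Gamma> r)) (at 0)) l) = 0" (is "?sum = 0")
    using cov_deriv_apply[OF \<Gamma> S a vs] by simp
  have c: "coef E s (?\<gamma> 0) (a 0) l = (if l = j then \<rho> 0 else 0)" if "l \<in> I" for l
    using \<delta>(1) frame_in_fibre[OF vs j] coef_frame[OF vs that j] by (simp add: a_def coef_scale[OF vs])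
  have "?sum = (\<Sum>l\<in>I. if l = j then \<rho> 0 *\<^sub>R covd s (\<Gamma> 0) (velocity (smooth_near M) ?\<gamma> 0)
            (vector_derivative (\<lambda>r. fmat s (\<Gamma> r)) (at 0)) l else 0)"
    by (intro sum.cong refl) (simp add: c)
  then show ?thesis using z \<rho>(2) j by (simp add: sum.delta)
qed

end

section \<open>Curves of complex structures with prescribed commutator\<close>

lemma transpose_diff: "transpose (A - B) = transpose A - transpose (B :: real ^ 'k ^ 'k)"
  by (simp add: vec_eq_iff transpose_def)

context vec_bundle
begin

lemma sum_index: "(\<And>k. k \<notin> I \<Longrightarrow> f k = 0) \<Longrightarrow> (\<Sum>k\<in>UNIV. f k) = (\<Sum>k\<in>I. f k)" for f :: "'k \<Rightarrow> 'b::comm_monoid_add"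
  by (rule sum.mono_neutral_right) auto

text \<open>
  The frames are indexed by a subset of \<open>'k\<close>, so the matrices of endomorphisms vanish outside this subset; they form
  a ring with unit \<open>idm\<close>.
\<close>
definition supported :: "real ^ 'k ^ 'k \<Rightarrow> bool" where
  "supported X \<longleftrightarrow> (\<forall>i j. \<not> (i \<in> I \<and> j \<in> I) \<longrightarrow> X $ i $ j = 0)"

definition idm :: "real ^ 'k ^ 'k" where
  "idm = (\<chi> i j. if i = j \<and> i \<in> I then 1 else 0)"

lemma supportedD: "supported X \<Longrightarrow> \<not> (i \<in> I \<and> j \<in> I) \<Longrightarrow> X $ i $ j = 0"
  by (simp add: supported_def)

lemma supported_frame_matrix: "supported (frame_matrix E s p J)"
  by (auto simp: supported_def frame_matrix_def)

lemma supported_mult: "supported X \<Longrightarrow> (X ** Z) $ i $ j = (\<Sum>k\<in>I. X $ i $ k * Z $ k $ j)"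
  unfolding matrix_matrix_mult_def by (simp, intro sum_index) (auto simp: supported_def)

lemma idm_left: "(idm ** X) $ i $ j = (if i \<in> I then X $ i $ j else 0)"
proof -
  have "(idm ** X) $ i $ j = (\<Sum>k\<in>UNIV. idm $ i $ k * X $ k $ j)" by (simp add: matrix_matrix_mult_def)
  also have "\<dots> = (\<Sum>k\<in>UNIV. if k = i then (if i \<in> I then X $ k $ j else 0) else 0)"
    by (intro sum.cong) (auto simp: idm_def)
  finally show ?thesis by (simp add: sum.delta)
qed

lemma idm_right: "(X ** idm) $ i $ j = (if j \<in> I then X $ i $ j else 0)"
proof -
  have "(X ** idm) $ i $ j = (\<Sum>k\<in>UNIV. X $ i $ k * idm $ k $ j)" by (simp add: matrix_matrix_mult_def)
  also have "\<dots> = (\<Sum>k\<in>UNIV. if k = j then (if j \<in> I then X $ i $ k else 0) else 0)"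
    by (intro sum.cong) (auto simp: idm_def)
  finally show ?thesis by (simp add: sum.delta)
qed

lemma supported_idm: "supported X \<Longrightarrow> idm ** X = X" "supported X \<Longrightarrow> X ** idm = X"
  by (auto simp: vec_eq_iff idm_left idm_right supported_def)

lemma supported_iff_idm: "supported X \<longleftrightarrow> idm ** X ** idm = X"
  by (auto simp: vec_eq_iff idm_left idm_right supported_def)

lemma coef_neg: "(V, s) \<in> frames E \<Longrightarrow> p \<in> V \<Longrightarrow> e \<in> fibre E p \<Longrightarrow> coef E s p (- e) i = - coef E s p e i"
  using coef_scale[of V s p e "-1" i] by simp

lemma matrix_compose:
  assumes "(V, s) \<in> frames E" "p \<in> V" "J \<in> End_fibre E p" "K \<in> End_fibre E p"
  shows "frame_matrix E s p (J \<circ> K) = frame_matrix E s p J ** frame_matrix E s p K"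
proof -
  have "frame_matrix E s p (J \<circ> K) $ i $ j = (\<Sum>k\<in>I. frame_matrix E s p J $ i $ k * frame_matrix E s p K $ k $ j)" for i j
  proof (cases "i \<in> I \<and> j \<in> I")
    case True
    then have "K (s j p) \<in> fibre E p" using End_in[OF assms(4)] frame_in_fibre[OF assms(1,2)] by blast
    from matrix_coef[OF assms(1,2,3) this, of i] True show ?thesis
      by (simp add: frame_matrix_def)
  next
    case False
    then show ?thesis by (auto simp: frame_matrix_def intro!: sum.neutral)
  qed
  then show ?thesis by (simp add: vec_eq_iff supported_mult[OF supported_frame_matrix])
qed

lemma End_compose: "J \<in> End_fibre E p \<Longrightarrow> K \<in> End_fibre E p \<Longrightarrow> J \<circ> K \<in> End_fibre E p"
  using End_zero by (auto simp: End_fibre_def)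

end

context metric_bundle
begin

lemma g_double_sum:
  assumes "\<And>i. i \<in> K \<Longrightarrow> e i \<in> fibre E p" "\<And>j. j \<in> L \<Longrightarrow> e' j \<in> fibre E p"
  shows "g p (\<Sum>i\<in>K. a i *\<^sub>R e i) (\<Sum>j\<in>L. b j *\<^sub>R e' j) = (\<Sum>i\<in>K. a i * (\<Sum>j\<in>L. b j * g p (e i) (e' j)))"
proof -
  have "g p (\<Sum>i\<in>K. a i *\<^sub>R e i) (\<Sum>j\<in>L. b j *\<^sub>R e' j) = (\<Sum>i\<in>K. a i * g p (e i) (\<Sum>j\<in>L. b j *\<^sub>R e' j))"
    using assms by (intro g_sum_left fibre_sum fibre_scale) auto
  then show ?thesis using assms by (simp add: g_sum_right)
qed

lemma twistor_frameI:
  assumes vs: "(V, s) \<in> frames E" "p \<in> V" and J: "J \<in> End_fibre E p"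
    and sq: "\<And>j. j \<in> I \<Longrightarrow> J (J (s j p)) = - s j p"
    and orth: "\<And>i j. i \<in> I \<Longrightarrow> j \<in> I \<Longrightarrow> g p (J (s i p)) (J (s j p)) = g p (s i p) (s j p)"
  shows "(p, J) \<in> twistor E g"
proof -
  have s: "s j p \<in> fibre E p" "J (s j p) \<in> fibre E p" if "j \<in> I" for j
    using frame_in_fibre[OF vs that] End_in[OF J] by auto
  have "J (J e) = - e" if e: "e \<in> fibre E p" for e
  proof -
    have "J (J e) = J (\<Sum>j\<in>I. coef E s p e j *\<^sub>R J (s j p))" by (simp add: End_expand[OF vs J e, symmetric])
    also have "\<dots> = (\<Sum>j\<in>I. coef E s p e j *\<^sub>R J (J (s j p)))" using s by (intro End_lincomb[OF J]) auto
    also have "\<dots> = - (\<Sum>j\<in>I. coef E s p e j *\<^sub>R s j p)" by (simp add: sq sum_negf)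
    finally show ?thesis using coef_expand[OF vs e] by simp
  qed
  moreover have "g p (J e) (J e') = g p e e'" if e: "e \<in> fibre E p" "e' \<in> fibre E p" for e e'
  proof -
    let ?a = "coef E s p e" and ?b = "coef E s p e'"
    have "g p (J e) (J e') = g p (\<Sum>i\<in>I. ?a i *\<^sub>R J (s i p)) (\<Sum>j\<in>I. ?b j *\<^sub>R J (s j p))"
      using e by (simp add: End_expand[OF vs J, symmetric])
    also have "\<dots> = (\<Sum>i\<in>I. ?a i * (\<Sum>j\<in>I. ?b j * g p (J (s i p)) (J (s j p))))"
      using s by (simp add: g_double_sum)
    also have "\<dots> = (\<Sum>i\<in>I. ?a i * (\<Sum>j\<in>I. ?b j * g p (s i p) (s j p)))"
      by (simp add: orth)
    also have "\<dots> = g p (\<Sum>i\<in>I. ?a i *\<^sub>R s i p) (\<Sum>j\<in>I. ?b j *\<^sub>R s j p)"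
      using s by (simp add: g_double_sum)
    finally show ?thesis using coef_expand[OF vs] e by simp
  qed
  ultimately show ?thesis using J by (simp add: twistor_def)
qed

definition gram :: "('k \<Rightarrow> 'm \<Rightarrow> 'v) \<Rightarrow> 'm \<Rightarrow> real ^ 'k ^ 'k" where
  "gram s p = (\<chi> i j. if i \<in> I \<and> j \<in> I then g p (s i p) (s j p) else 0)"

lemma supported_gram: "supported (gram s p)"
  by (auto simp: supported_def gram_def)

lemma gram_congruence:
  assumes vs: "(V, s) \<in> frames E" "p \<in> V" and J: "J \<in> End_fibre E p" and ij: "i \<in> I" "j \<in> I"
  shows "(transpose (frame_matrix E s p J) ** gram s p ** frame_matrix E s p J) $ i $ j = g p (J (s i p)) (J (s j p))"
proof -
  let ?M = "frame_matrix E s p J"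
  have s: "s j p \<in> fibre E p" "J (s j p) \<in> fibre E p" if "j \<in> I" for j
    using frame_in_fibre[OF vs that] End_in[OF J] by auto
  have t: "supported (transpose ?M)" by (auto simp: supported_def transpose_def frame_matrix_def)
  have "(transpose ?M ** gram s p ** ?M) $ i $ j = (\<Sum>k\<in>I. ?M $ k $ i * (gram s p ** ?M) $ k $ j)"
    unfolding matrix_mul_assoc[symmetric] by (simp add: supported_mult[OF t]) (simp add: transpose_def)
  also have "\<dots> = (\<Sum>k\<in>I. ?M $ k $ i * (\<Sum>l\<in>I. ?M $ l $ j * g p (s k p) (s l p)))"
    by (simp add: supported_mult[OF supported_gram]) (simp add: gram_def mult.commute)
  also have "\<dots> = g p (\<Sum>k\<in>I. ?M $ k $ i *\<^sub>R s k p) (\<Sum>l\<in>I. ?M $ l $ j *\<^sub>R s l p)"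
    using s by (simp add: g_double_sum)
  also have "\<dots> = g p (J (s i p)) (J (s j p))" by (simp add: matrix_frame[OF vs J] ij)
  finally show ?thesis .
qed

lemma twistor_matrix_square:
  assumes x: "x \<in> twistor E g" and vs: "(V, s) \<in> frames E" "fst x \<in> V"
  shows "fmat s x ** fmat s x = - idm"
proof -
  let ?M = "fmat s x"
  have J: "snd x \<in> End_fibre E (fst x)" by (rule twistorD(1)[OF x])
  have "(?M ** ?M) $ i $ j = - idm $ i $ j" for i j
  proof (cases "i \<in> I \<and> j \<in> I")
    case True
    have "coef E s (fst x) (snd x (snd x (s j (fst x)))) i = - coef E s (fst x) (s j (fst x)) i"
      using twistorD(2)[OF x frame_in_fibre[OF vs]] coef_neg[OF vs frame_in_fibre[OF vs]] True by simp
    then show ?thesis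
      using True unfolding matrix_compose[OF vs J J, symmetric]
      by (simp add: frame_matrix_def idm_def coef_frame[OF vs])
  next
    case False
    then show ?thesis
      unfolding matrix_compose[OF vs J J, symmetric] by (auto simp: frame_matrix_def idm_def)
  qed
  then show ?thesis by (simp add: vec_eq_iff)
qed

text \<open>
  A point \<open>J\<close> of the twistor space is moved along a curve of the base by solving \<open>X' = X \<omega> - \<omega> X\<close> for its
  matrix. If \<open>\<omega>\<close> is infinitesimally compatible with the metric, the conditions \<open>X\<^sup>2 = -1\<close> and
  \<open>X\<^sup>T G X = G\<close> propagate, because both defects solve linear homogeneous equations. Taking for \<open>\<omega>\<close> the connection
  matrix gives parallel transport, and a constant \<open>\<omega>\<close> over a constant curve gives curves in the fibre.
\<close>
lemma twistor_transport:
  assumes x: "x \<in> twistor E g" and uz: "(U, z) \<in> atlas M" and vs: "(V, s) \<in> frames E"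
    and e: "\<epsilon> > 0" and \<gamma>: "smooth_curve M {-\<epsilon><..<\<epsilon>} \<gamma>" "\<gamma> 0 = fst x" "\<And>t. t \<in> {-\<epsilon><..<\<epsilon>} \<Longrightarrow> \<gamma> t \<in> U \<inter> V"
    and \<omega>: "smooth_on {-\<epsilon><..<\<epsilon>} \<omega>" "\<And>t. supported (\<omega> t)"
    and G: "\<And>t. t \<in> {-\<epsilon><..<\<epsilon>} \<Longrightarrow> ((\<lambda>r. gram s (\<gamma> r)) has_vector_derivative
        transpose (\<omega> t) ** gram s (\<gamma> t) + gram s (\<gamma> t) ** \<omega> t) (at t)"
  obtains \<delta> \<Gamma> where "0 < \<delta>" "\<delta> \<le> \<epsilon>" "twistor_curve M E g {-\<delta><..<\<delta>} \<Gamma>" "\<Gamma> 0 = x" "\<And>t. fst (\<Gamma> t) = \<gamma> t"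
    "\<And>t. t \<in> {-\<delta><..<\<delta>} \<Longrightarrow> ((\<lambda>r. fmat s (\<Gamma> r)) has_vector_derivative
        fmat s (\<Gamma> t) ** \<omega> t - \<omega> t ** fmat s (\<Gamma> t)) (at t)"
proof -
  have p: "fst x \<in> V" using \<gamma>(2) \<gamma>(3)[of 0] e by auto
  let ?M0 = "fmat s x"
  obtain \<delta>0 X where X: "0 < \<delta>0" "\<delta>0 \<le> \<epsilon>" "X 0 = ?M0" "smooth_on {-\<delta>0<..<\<delta>0} X"
    "\<And>t. t \<in> {-\<delta>0<..<\<delta>0} \<Longrightarrow> (X has_vector_derivative X t ** \<omega> t - \<omega> t ** X t) (at t)"
    using linear_ode_exists[OF commutator_bounded_bilinear e \<omega>(1)] by metis
  have c\<omega>: "continuous_on {-\<delta>0<..<\<delta>0} \<omega>"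
    by (rule continuous_on_subset[OF smooth_on_continuous[OF \<omega>(1)]]) (use X in auto)
  note \<omega>l = supported_idm(1)[OF \<omega>(2)] and \<omega>r = supported_idm(2)[OF \<omega>(2)]
  have idm_comm: "idm ** (X t ** \<omega> t - \<omega> t ** X t) ** idm
      = (idm ** X t ** idm) ** \<omega> t - \<omega> t ** (idm ** X t ** idm)" for t
  proof -
    have "idm ** (X t ** \<omega> t) ** idm = idm ** X t ** (\<omega> t ** idm)" by (simp only: matrix_mul_assoc)
    also have "\<dots> = idm ** X t ** (idm ** \<omega> t)" by (simp only: \<omega>l \<omega>r)
    finally have 1: "idm ** (X t ** \<omega> t) ** idm = (idm ** X t ** idm) ** \<omega> t" by (simp only: matrix_mul_assoc)
    have "idm ** (\<omega> t ** X t) ** idm = (idm ** \<omega> t) ** X t ** idm" by (simp only: matrix_mul_assoc)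
    also have "\<dots> = (\<omega> t ** idm) ** X t ** idm" by (simp only: \<omega>l \<omega>r)
    finally have 2: "idm ** (\<omega> t ** X t) ** idm = \<omega> t ** (idm ** X t ** idm)" by (simp only: matrix_mul_assoc)
    show ?thesis by (simp only: mm.diff_left mm.diff_right 1 2)
  qed
  have M0: "supported ?M0" by (rule supported_frame_matrix)
  \<comment> \<open>The solution keeps its support.\<close>
  obtain \<eta>1 where \<eta>1: "0 < \<eta>1" "\<eta>1 \<le> \<delta>0" "\<And>t. t \<in> {-\<eta>1<..<\<eta>1} \<Longrightarrow> X t - idm ** X t ** idm = 0"
  proof (rule linear_ode_unique[OF commutator_bounded_bilinear X(1) c\<omega>, where X="\<lambda>t. X t - idm ** X t ** idm"])
    show "X 0 - idm ** X 0 ** idm = 0" using M0[unfolded supported_iff_idm] by (simp add: X(3))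
    fix t assume t: "t \<in> {-\<delta>0<..<\<delta>0}"
    have "((\<lambda>t. idm ** X t ** idm) has_vector_derivative idm ** (X t ** \<omega> t - \<omega> t ** X t) ** idm) (at t)"
      by (intro bounded_linear.has_vector_derivative[OF mm.bounded_linear_left]
          bounded_linear.has_vector_derivative[OF mm.bounded_linear_right] X(5) t)
    from has_vector_derivative_diff[OF X(5)[OF t] this]
    show "((\<lambda>t. X t - idm ** X t ** idm) has_vector_derivative
        (X t - idm ** X t ** idm) ** \<omega> t - \<omega> t ** (X t - idm ** X t ** idm)) (at t)"
      unfolding idm_comm by (simp add: mm.diff_left mm.diff_right algebra_simps)
  qed blast
  have J0: "snd x \<in> End_fibre E (fst x)" by (rule twistorD(1)[OF x])
  have M0sq: "?M0 ** ?M0 + idm = 0" by (simp add: twistor_matrix_square[OF x vs p])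
  \<comment> \<open>It keeps the square \<open>-1\<close>.\<close>
  obtain \<eta>2 where \<eta>2: "0 < \<eta>2" "\<eta>2 \<le> \<delta>0" "\<And>t. t \<in> {-\<eta>2<..<\<eta>2} \<Longrightarrow> X t ** X t + idm = 0"
  proof (rule linear_ode_unique[OF commutator_bounded_bilinear X(1) c\<omega>, where X="\<lambda>t. X t ** X t + idm"])
    show "X 0 ** X 0 + idm = 0" using M0sq by (simp add: X(3))
    fix t assume t: "t \<in> {-\<delta>0<..<\<delta>0}"
    have "((\<lambda>t. X t ** X t + idm) has_vector_derivative
        (X t ** (X t ** \<omega> t - \<omega> t ** X t) + (X t ** \<omega> t - \<omega> t ** X t) ** X t) + 0) (at t)"
      by (intro has_vector_derivative_add mm.has_vector_derivative X(5) t has_vector_derivative_const)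
    then show "((\<lambda>t. X t ** X t + idm) has_vector_derivative
        (X t ** X t + idm) ** \<omega> t - \<omega> t ** (X t ** X t + idm)) (at t)"
      by (simp add: mm.diff_left mm.diff_right mm.add_left mm.add_right matrix_mul_assoc \<omega>l \<omega>r)
  qed blast
  let ?G = "\<lambda>t. gram s (\<gamma> t)"
  \<comment> \<open>It stays orthogonal.\<close>
  obtain \<eta>3 where \<eta>3: "0 < \<eta>3" "\<eta>3 \<le> \<delta>0" "\<And>t. t \<in> {-\<eta>3<..<\<eta>3} \<Longrightarrow> transpose (X t) ** ?G t ** X t - ?G t = 0"
  proof (rule linear_ode_unique[OF congruence_bounded_bilinear X(1) c\<omega>, where X="\<lambda>t. transpose (X t) ** ?G t ** X t - ?G t"])
    have "(transpose ?M0 ** gram s (fst x) ** ?M0) $ i $ j = gram s (fst x) $ i $ j" for i j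
    proof (cases "i \<in> I \<and> j \<in> I")
      case True
      then show ?thesis
        using gram_congruence[OF vs p J0, of i j] twistorD(3)[OF x] frame_in_fibre[OF vs p] by (simp add: gram_def)
    next
      case False
      have t: "supported (transpose ?M0)" by (auto simp: supported_def transpose_def frame_matrix_def)
      have "supported (transpose ?M0 ** gram s (fst x) ** ?M0)"
        unfolding supported_iff_idm
        by (metis matrix_mul_assoc supported_idm(1)[OF t] supported_idm(2)[OF M0])
      then show ?thesis using False supported_gram[of s "fst x"] by (simp add: supportedD)
    qed
    then show "transpose (X 0) ** ?G 0 ** X 0 - ?G 0 = 0" by (simp add: X(3) \<gamma>(2) vec_eq_iff)
    fix t assume t: "t \<in> {-\<delta>0<..<\<delta>0}"
    then have t': "t \<in> {-\<epsilon><..<\<epsilon>}" using X(2) by auto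
    let ?C = "X t ** \<omega> t - \<omega> t ** X t" and ?G' = "transpose (\<omega> t) ** ?G t + ?G t ** \<omega> t"
    have "((\<lambda>t. transpose (X t) ** ?G t ** X t - ?G t) has_vector_derivative
        (transpose (X t) ** ?G t ** ?C + (transpose (X t) ** ?G' + transpose ?C ** ?G t) ** X t) - ?G') (at t)"
      by (intro has_vector_derivative_diff mm.has_vector_derivative X(5) t G t'
          bounded_linear.has_vector_derivative[OF transpose_bounded_linear])
    moreover have "(transpose (X t) ** ?G t ** ?C + (transpose (X t) ** ?G' + transpose ?C ** ?G t) ** X t) - ?G'
        = transpose (\<omega> t) ** (transpose (X t) ** ?G t ** X t - ?G t) + (transpose (X t) ** ?G t ** X t - ?G t) ** \<omega> t"
      by (simp add: transpose_diff matrix_transpose_mul mm.diff_left mm.diff_right mm.add_left mm.add_right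
          matrix_mul_assoc algebra_simps)
    ultimately show "((\<lambda>t. transpose (X t) ** ?G t ** X t - ?G t) has_vector_derivative
        transpose (\<omega> t) ** (transpose (X t) ** ?G t ** X t - ?G t) + (transpose (X t) ** ?G t ** X t - ?G t) ** \<omega> t) (at t)"
      by simp
  qed blast
  define \<delta> where "\<delta> = min \<eta>1 (min \<eta>2 \<eta>3)"
  have \<delta>: "0 < \<delta>" "\<delta> \<le> \<delta>0" using \<eta>1 \<eta>2 \<eta>3 by (auto simp: \<delta>_def)
  define \<Gamma> where "\<Gamma> t = (\<gamma> t, endo s (\<gamma> t) (X t))" for t
  have t_facts: "\<gamma> t \<in> U" "\<gamma> t \<in> V" "supported (X t)" "X t ** X t = - idm" "transpose (X t) ** ?G t ** X t = ?G t"
    if "t \<in> {-\<delta><..<\<delta>}" for t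
  proof -
    have "t \<in> {-\<epsilon><..<\<epsilon>}" "t \<in> {-\<eta>1<..<\<eta>1}" "t \<in> {-\<eta>2<..<\<eta>2}" "t \<in> {-\<eta>3<..<\<eta>3}"
      using that \<delta> X(2) by (auto simp: \<delta>_def)
    then show "\<gamma> t \<in> U" "\<gamma> t \<in> V" "supported (X t)" "X t ** X t = - idm" "transpose (X t) ** ?G t ** X t = ?G t"
      using \<gamma>(3) \<eta>1(3) \<eta>2(3) \<eta>3(3) unfolding supported_iff_idm by (auto simp: eq_neg_iff_add_eq_0)
  qed
  have mat: "fmat s (\<Gamma> t) = X t" if t: "t \<in> {-\<delta><..<\<delta>}" for t
    unfolding \<Gamma>_def using t_facts[OF t] by (simp add: matrix_endo_eq[OF vs] supportedD)
  have tw: "\<Gamma> t \<in> twistor E g" if t: "t \<in> {-\<delta><..<\<delta>}" for t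
    unfolding \<Gamma>_def
  proof (rule twistor_frameI[OF vs t_facts(2)[OF t] endo_in_End[OF vs t_facts(2)[OF t]]])
    let ?J = "endo s (\<gamma> t) (X t)"
    note V = t_facts(2)[OF t]
    have J: "?J \<in> End_fibre E (\<gamma> t)" by (rule endo_in_End[OF vs V])
    have m: "frame_matrix E s (\<gamma> t) ?J = X t" using mat[OF t] by (simp add: \<Gamma>_def)
    show "?J (?J (s j (\<gamma> t))) = - s j (\<gamma> t)" if j: "j \<in> I" for j
    proof (rule fibre_eqI[OF vs V])
      have sj: "s j (\<gamma> t) \<in> fibre E (\<gamma> t)" by (rule frame_in_fibre[OF vs V j])
      then show "?J (?J (s j (\<gamma> t))) \<in> fibre E (\<gamma> t)" "- s j (\<gamma> t) \<in> fibre E (\<gamma> t)"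
        using End_in[OF J] fibre_neg by auto
      fix i assume i: "i \<in> I"
      have "coef E s (\<gamma> t) (?J (?J (s j (\<gamma> t)))) i = frame_matrix E s (\<gamma> t) (?J \<circ> ?J) $ i $ j"
        using i j by (simp add: frame_matrix_def)
      also have "\<dots> = - idm $ i $ j" by (simp add: matrix_compose[OF vs V J J] m t_facts(4)[OF t])
      also have "\<dots> = coef E s (\<gamma> t) (- s j (\<gamma> t)) i"
        using i j coef_neg[OF vs V sj] by (simp add: idm_def coef_frame[OF vs V])
      finally show "coef E s (\<gamma> t) (?J (?J (s j (\<gamma> t)))) i = coef E s (\<gamma> t) (- s j (\<gamma> t)) i" .
    qed
    show "g (\<gamma> t) (?J (s i (\<gamma> t))) (?J (s j (\<gamma> t))) = g (\<gamma> t) (s i (\<gamma> t)) (s j (\<gamma> t))" if "i \<in> I" "j \<in> I" for i j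
      using gram_congruence[OF vs V J that] that by (simp add: m t_facts(5)[OF t]) (simp add: gram_def)
  qed
  have o: "open {-\<delta><..<\<delta>}" by simp
  show ?thesis
  proof (rule that[of \<delta> \<Gamma>])
    show "0 < \<delta>" "\<delta> \<le> \<epsilon>" using \<delta> X by auto
    show "\<Gamma> 0 = x"
    proof -
      have "0 \<in> {-\<delta><..<\<delta>}" using \<delta> by simp
      have "endo s (fst x) (X 0) = snd x"
        by (rule matrix_End_eqI[OF vs p endo_in_End[OF vs p] J0])
          (use X(3) M0 in \<open>simp add: matrix_endo_eq[OF vs p] supportedD\<close>)
      then show ?thesis by (simp add: \<Gamma>_def \<gamma>(2))
    qed
    show "fst (\<Gamma> t) = \<gamma> t" for t by (simp add: \<Gamma>_def)
    show "twistor_curve M E g {-\<delta><..<\<delta>} \<Gamma>"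
    proof (rule twistor_curveI_local[OF tw])
      fix t assume t: "t \<in> {-\<delta><..<\<delta>}"
      have zs: "smooth_on {-\<delta><..<\<delta>} (\<lambda>r. z (\<gamma> r))"
        by (rule smooth_on_subset[OF smooth_curve_chart(2)[OF \<gamma>(1) open_greaterThanLessThan uz]])
          (use \<delta> X(2) t_facts(1) in auto)
      have Xs: "smooth_on {-\<delta><..<\<delta>} X" by (rule smooth_on_subset[OF X(4)]) (use \<delta> in auto)
      have "smooth_on {-\<delta><..<\<delta>} (\<lambda>r. (z (\<gamma> r), X r))"
      proof (rule smooth_on_euclidean[OF o])
        fix b :: "(complex ^ 'n) \<times> (real ^ 'k ^ 'k)" assume "b \<in> Basis"
        then show "smooth_on {-\<delta><..<\<delta>} (\<lambda>r. (z (\<gamma> r), X r) \<bullet> b)"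
          using smooth_on_inner[OF o zs, of "fst b"] smooth_on_inner[OF o Xs, of "snd b"]
          by (auto simp: Basis_prod_def)
      qed
      then have "smooth_on {-\<delta><..<\<delta>} (\<lambda>r. tchart z s (\<Gamma> r))"
        by (subst smooth_on_cong[OF o, where g="\<lambda>r. (z (\<gamma> r), X r)"])
          (use mat in \<open>auto simp: tchart_def \<Gamma>_def\<close>)
      moreover have "\<forall>r\<in>{-\<delta><..<\<delta>}. \<Gamma> r \<in> tdom U V"
        using tw t_facts(1,2) by (auto simp: tdom_def \<Gamma>_def)
      ultimately show "\<exists>U z V s T. (U, z) \<in> atlas M \<and> (V, s) \<in> frames E \<and> open T \<and> t \<in> T \<and>
        (\<forall>r\<in>T. \<Gamma> r \<in> tdom U V) \<and> smooth_on T (\<lambda>r. tchart z s (\<Gamma> r))"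
        using uz vs t o by blast
    qed
    fix t assume t: "t \<in> {-\<delta><..<\<delta>}"
    have "(X has_vector_derivative X t ** \<omega> t - \<omega> t ** X t) (at t)"
      using X(5)[of t] t \<delta> by simp
    then have "((\<lambda>r. fmat s (\<Gamma> r)) has_vector_derivative X t ** \<omega> t - \<omega> t ** X t) (at t)"
      by (rule has_vector_derivative_transform_within_open[OF _ o t]) (simp add: mat)
    then show "((\<lambda>r. fmat s (\<Gamma> r)) has_vector_derivative
        fmat s (\<Gamma> t) ** \<omega> t - \<omega> t ** fmat s (\<Gamma> t)) (at t)"
      by (simp only: mat[OF t])
  qed
qed

end

section \<open>Vertical vectors and horizontal lifts\<close>

lemma has_vector_derivative_matrixI:
  fixes X :: "real \<Rightarrow> real ^ 'k::finite ^ 'l::finite"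
  assumes "\<And>i j. ((\<lambda>r. X r $ i $ j) has_real_derivative N $ i $ j) (at t)"
  shows "(X has_vector_derivative N) (at t)"
  unfolding has_vector_derivative_def
proof (subst has_derivative_componentwise_within, intro ballI)
  fix b :: "real ^ 'k ^ 'l" assume "b \<in> Basis"
  then obtain i j where b: "b = axis i (axis j 1)" by (auto simp: Basis_vec_def)
  show "((\<lambda>r. X r \<bullet> b) has_derivative (\<lambda>r. (r *\<^sub>R N) \<bullet> b)) (at t)"
    using assms[of i j] by (simp add: b inner_axis has_field_derivative_def mult_commute_abs)
qed

context conn_bundle
begin

lemma gram_derivative_parallel:
  assumes \<gamma>: "smooth_curve M S \<gamma>" "open S" "t \<in> S" and vs: "(V, s) \<in> frames E" "\<gamma> t \<in> V" and ij: "i \<in> I" "j \<in> I"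
  shows "((\<lambda>r. g (\<gamma> r) (s i (\<gamma> r)) (s j (\<gamma> r))) has_real_derivative
      g (\<gamma> t) (D (\<gamma> t) (velocity (smooth_near M) \<gamma> t) (s i)) (s j (\<gamma> t))
      + g (\<gamma> t) (s i (\<gamma> t)) (D (\<gamma> t) (velocity (smooth_near M) \<gamma> t) (s j))) (at t)"
  using curve_derivative[OF \<gamma> gram_smooth[OF vs ij]]
    conn_metric[OF velocity_in_tangent[OF \<gamma>] section_frame[OF vs ij(1)] section_frame[OF vs ij(2)]] by simp

text \<open>
  Parallel transport along a coordinate line: there the connection matrix is a smooth function of the parameter,
  because the velocity extends to a coordinate field.
\<close>
lemma horizontal_curve_exists:
  assumes x: "x \<in> twistor E g" and w: "w \<in> tangent M (fst x)"
  obtains \<Gamma> \<epsilon> where "\<epsilon> > 0" "twistor_curve M E g {-\<epsilon><..<\<epsilon>} \<Gamma>" "\<Gamma> 0 = x" "parallel_along M E D {-\<epsilon><..<\<epsilon>} \<Gamma>"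
    "velocity (smooth_near M) (\<lambda>t. fst (\<Gamma> t)) 0 = w"
proof -
  obtain U z V s where uz: "(U, z) \<in> atlas M" and vs: "(V, s) \<in> frames E" and xt: "x \<in> tdom U V"
    using tdom_exists[OF x] by blast
  have p: "fst x \<in> U" "fst x \<in> V" using xt by (auto simp: tdom_def)
  define c where "c = dcoord z w"
  have c: "c \<in> cmodel M" unfolding c_def by (rule dcoord_cmodel[OF uz p(1) w])
  obtain \<gamma> \<epsilon>0 where \<gamma>: "\<epsilon>0 > 0" "smooth_curve M {-\<epsilon>0<..<\<epsilon>0} \<gamma>" "\<gamma> 0 = fst x"
    "\<And>t. t \<in> {-\<epsilon>0<..<\<epsilon>0} \<Longrightarrow> \<gamma> t \<in> U \<and> z (\<gamma> t) = z (fst x) + t *\<^sub>R c"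
    using chart_line[OF uz p(1) c] by metis
  let ?S = "{-\<epsilon>0<..<\<epsilon>0}"
  have S: "open ?S" "0 \<in> ?S" using \<gamma>(1) by auto
  obtain X where X: "\<And>q. q \<in> U \<Longrightarrow> X q \<in> tangent M q \<and> dcoord z (X q) = c"
    "\<And>p. p \<in> U \<Longrightarrow> smooth_field_near M p X"
    using coordinate_field[OF uz c] by metis
  have vel: "velocity (smooth_near M) \<gamma> t = X (\<gamma> t)" if t: "t \<in> ?S" for t
    using chart_line_velocity[OF uz \<gamma>(2,4) t] X(1) \<gamma>(4)[OF t]
    by (intro tangent_eqI[OF uz _ velocity_in_tangent[OF \<gamma>(2) S(1) t]]) auto
  define F where "F i j q = coef E s q (D q (X q) (s j)) i" for i j q
  have F: "smooth_near M (fst x) (F i j)" if "i \<in> I" "j \<in> I" for i j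
    using conn_field[OF X(2)[OF p(1)] section_frame[OF vs p(2) that(2)]] that(1)
    unfolding section_iff[OF vs p(2)] F_def by blast
  have "\<exists>T. open T \<and> 0 \<in> T \<and> smooth_on T (\<lambda>t. F (fst ij) (snd ij) (\<gamma> t))" if "ij \<in> I \<times> I" for ij
    using smooth_near_along_curve[OF \<gamma>(2) S, of "F (fst ij) (snd ij)"] F[of "fst ij" "snd ij"] that \<gamma>(3) by auto
  then have "\<forall>ij\<in>I \<times> I. \<exists>T. open T \<and> 0 \<in> T \<and> smooth_on T (\<lambda>t. F (fst ij) (snd ij) (\<gamma> t))" by blast
  from bchoice[OF this] obtain T' where T':
    "\<forall>ij\<in>I \<times> I. open (T' ij) \<and> 0 \<in> T' ij \<and> smooth_on (T' ij) (\<lambda>t. F (fst ij) (snd ij) (\<gamma> t))" ..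
  define T where "T i j = T' (i, j)" for i j
  have T: "open (T i j) \<and> 0 \<in> T i j \<and> smooth_on (T i j) (\<lambda>t. F i j (\<gamma> t))" if "i \<in> I" "j \<in> I" for i j
    using bspec[OF T', of "(i, j)"] that by (simp add: T_def)
  let ?T = "{t\<in>?S. \<gamma> t \<in> V} \<inter> (\<Inter>i\<in>I. \<Inter>j\<in>I. T i j)"
  have "open ?T"
    using T curve_preimage_open[OF \<gamma>(2) S(1) frame_open[OF vs]] by (intro open_Int open_INT) auto
  moreover have "0 \<in> ?T" using S(2) \<gamma>(3) p(2) T by auto
  ultimately obtain \<epsilon> where \<epsilon>: "\<epsilon> > 0" "ball 0 \<epsilon> \<subseteq> ?T" using openE by blast
  have sub: "{-\<epsilon><..<\<epsilon>} \<subseteq> ?T"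
  proof
    fix t assume "t \<in> {-\<epsilon><..<\<epsilon>}"
    then have "t \<in> ball 0 \<epsilon>" by (simp add: dist_real_def abs_less_iff)
    then show "t \<in> ?T" using \<epsilon>(2) by blast
  qed
  have o: "open {-\<epsilon><..<\<epsilon>}" by simp
  define \<omega> where "\<omega> t = (\<chi> i j. if i \<in> I \<and> j \<in> I then F i j (\<gamma> t) else 0)" for t
  have \<omega>_smooth: "smooth_on {-\<epsilon><..<\<epsilon>} \<omega>"
  proof (rule smooth_on_euclidean[OF o])
    fix b :: "real ^ 'k ^ 'k" assume "b \<in> Basis"
    then obtain i j where b: "b = axis i (axis j 1)" by (auto simp: Basis_vec_def)
    show "smooth_on {-\<epsilon><..<\<epsilon>} (\<lambda>t. \<omega> t \<bullet> b)"
    proof (cases "i \<in> I \<and> j \<in> I")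
      case True
      then have "?T \<subseteq> T i j" by blast
      then have "{-\<epsilon><..<\<epsilon>} \<subseteq> T i j" using sub by (rule subset_trans[rotated])
      moreover have "smooth_on (T i j) (\<lambda>t. F i j (\<gamma> t))" using T True by simp
      ultimately have "smooth_on {-\<epsilon><..<\<epsilon>} (\<lambda>t. F i j (\<gamma> t))" by (rule smooth_on_subset[rotated])
      then show ?thesis using True by (simp add: b inner_axis \<omega>_def)
    next
      case False
      then show ?thesis using smooth_on_const[of "{-\<epsilon><..<\<epsilon>}" 0] by (auto simp: b inner_axis \<omega>_def)
    qed
  qed
  have \<omega>_supp: "supported (\<omega> t)" for t by (auto simp: supported_def \<omega>_def)
  have t_facts: "t \<in> ?S" "\<gamma> t \<in> U" "\<gamma> t \<in> V" if "t \<in> {-\<epsilon><..<\<epsilon>}" for t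
  proof -
    have "t \<in> ?T" using sub that by blast
    then show "t \<in> ?S" "\<gamma> t \<in> V" by auto
    then show "\<gamma> t \<in> U" using \<gamma>(4) by blast
  qed
  have Dw: "D (\<gamma> t) (X (\<gamma> t)) (s j) = (\<Sum>i\<in>I. \<omega> t $ i $ j *\<^sub>R s i (\<gamma> t))" if t: "t \<in> {-\<epsilon><..<\<epsilon>}" and j: "j \<in> I" for t j
  proof -
    have "(\<Sum>i\<in>I. coef E s (\<gamma> t) (D (\<gamma> t) (X (\<gamma> t)) (s j)) i *\<^sub>R s i (\<gamma> t)) = D (\<gamma> t) (X (\<gamma> t)) (s j)"
      using X(1)[OF t_facts(2)[OF t]]
      by (intro coef_expand[OF vs t_facts(3)[OF t]] frame_conn_in[OF _ vs t_facts(3)[OF t] j]) auto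
    then show ?thesis using j by (simp add: \<omega>_def F_def)
  qed
  have \<gamma>\<epsilon>: "smooth_curve M {-\<epsilon><..<\<epsilon>} \<gamma>"
    using \<gamma>(2) t_facts(1) unfolding smooth_curve_def
    by (auto elim!: continuous_on_subset smooth_on_subset)
  have G: "((\<lambda>r. gram s (\<gamma> r)) has_vector_derivative
        transpose (\<omega> t) ** gram s (\<gamma> t) + gram s (\<gamma> t) ** \<omega> t) (at t)" if t: "t \<in> {-\<epsilon><..<\<epsilon>}" for t
  proof (rule has_vector_derivative_matrixI)
    fix i j
    have supp_t: "supported (transpose (\<omega> t))" using \<omega>_supp by (auto simp: supported_def transpose_def)
    have eq: "(transpose (\<omega> t) ** gram s (\<gamma> t) + gram s (\<gamma> t) ** \<omega> t) $ i $ j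
        = (\<Sum>k\<in>I. \<omega> t $ k $ i * gram s (\<gamma> t) $ k $ j) + (\<Sum>k\<in>I. gram s (\<gamma> t) $ i $ k * \<omega> t $ k $ j)"
      by (simp add: supported_mult[OF supp_t] supported_mult[OF supported_gram]) (simp add: transpose_def)
    show "((\<lambda>r. gram s (\<gamma> r) $ i $ j) has_real_derivative
        (transpose (\<omega> t) ** gram s (\<gamma> t) + gram s (\<gamma> t) ** \<omega> t) $ i $ j) (at t)"
    proof (cases "i \<in> I \<and> j \<in> I")
      case True
      have f: "s k (\<gamma> t) \<in> fibre E (\<gamma> t)" if "k \<in> I" for k by (rule frame_in_fibre[OF vs t_facts(3)[OF t] that])
      have "g (\<gamma> t) (D (\<gamma> t) (X (\<gamma> t)) (s i)) (s j (\<gamma> t)) + g (\<gamma> t) (s i (\<gamma> t)) (D (\<gamma> t) (X (\<gamma> t)) (s j))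
          = (transpose (\<omega> t) ** gram s (\<gamma> t) + gram s (\<gamma> t) ** \<omega> t) $ i $ j"
        unfolding eq using True f by (simp add: Dw[OF t] g_sum_left g_sum_right gram_def mult.commute)
      then show ?thesis
        using gram_derivative_parallel[OF \<gamma>(2) S(1) t_facts(1)[OF t] vs t_facts(3)[OF t], of i j] True
        by (simp add: vel[OF t_facts(1)[OF t]] gram_def)
    next
      case False
      then have "gram s (\<gamma> r) $ i $ j = 0" for r by (auto simp: gram_def)
      moreover have "(transpose (\<omega> t) ** gram s (\<gamma> t) + gram s (\<gamma> t) ** \<omega> t) $ i $ j = 0"
        unfolding eq using False by (auto simp: gram_def \<omega>_def intro!: sum.neutral)
      ultimately show ?thesis by simp
    qed
  qed
  obtain \<delta> \<Gamma> where \<Gamma>: "0 < \<delta>" "\<delta> \<le> \<epsilon>" "twistor_curve M E g {-\<delta><..<\<delta>} \<Gamma>" "\<Gamma> 0 = x" "\<And>t. fst (\<Gamma> t) = \<gamma> t"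
    "\<And>t. t \<in> {-\<delta><..<\<delta>} \<Longrightarrow> ((\<lambda>r. fmat s (\<Gamma> r)) has_vector_derivative
        fmat s (\<Gamma> t) ** \<omega> t - \<omega> t ** fmat s (\<Gamma> t)) (at t)"
  proof (rule twistor_transport[OF x uz vs \<epsilon>(1) \<gamma>\<epsilon> \<gamma>(3) _ \<omega>_smooth \<omega>_supp G])
    show "\<gamma> t \<in> U \<inter> V" if "t \<in> {-\<epsilon><..<\<epsilon>}" for t using t_facts[OF that] by blast
  qed blast+
  have "parallel_along M E D {-\<delta><..<\<delta>} \<Gamma>"
  proof (rule parallel_if_covd_zero[OF \<Gamma>(3) open_greaterThanLessThan vs])
    show "fst (\<Gamma> t) \<in> V" if "t \<in> {-\<delta><..<\<delta>}" for t using t_facts(3)[of t] that \<Gamma>(2,5) by simp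
    fix t j assume t: "t \<in> {-\<delta><..<\<delta>}" and j: "j \<in> I"
    have t': "t \<in> {-\<epsilon><..<\<epsilon>}" using t \<Gamma>(2) by auto
    let ?M = "frame_matrix E s (\<gamma> t) (snd (\<Gamma> t))"
    have J: "snd (\<Gamma> t) \<in> End_fibre E (\<gamma> t)"
      using twistorD(1)[OF twistor_curve_in[OF \<Gamma>(3) t]] by (simp add: \<Gamma>(5))
    have f: "s k (\<gamma> t) \<in> fibre E (\<gamma> t)" if "k \<in> I" for k by (rule frame_in_fibre[OF vs t_facts(3)[OF t'] that])
    have N: "vector_derivative (\<lambda>r. fmat s (\<Gamma> r)) (at t) = ?M ** \<omega> t - \<omega> t ** ?M"
      using vector_derivative_at[OF \<Gamma>(6)[OF t]] by (simp add: \<Gamma>(5))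
    have v: "velocity (smooth_near M) (\<lambda>t. fst (\<Gamma> t)) t = X (\<gamma> t)"
      using vel[OF t_facts(1)[OF t']] by (simp add: \<Gamma>(5))
    have 1: "snd (\<Gamma> t) (D (\<gamma> t) (X (\<gamma> t)) (s j)) = (\<Sum>i\<in>I. (?M ** \<omega> t) $ i $ j *\<^sub>R s i (\<gamma> t))"
    proof -
      have "snd (\<Gamma> t) (D (\<gamma> t) (X (\<gamma> t)) (s j)) = (\<Sum>k\<in>I. \<omega> t $ k $ j *\<^sub>R snd (\<Gamma> t) (s k (\<gamma> t)))"
        unfolding Dw[OF t' j] by (rule End_lincomb[OF J f])
      also have "\<dots> = (\<Sum>k\<in>I. \<Sum>i\<in>I. (\<omega> t $ k $ j * ?M $ i $ k) *\<^sub>R s i (\<gamma> t))"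
        by (simp add: matrix_frame[OF vs t_facts(3)[OF t'] J] scaleR_sum_right)
      also have "\<dots> = (\<Sum>i\<in>I. (?M ** \<omega> t) $ i $ j *\<^sub>R s i (\<gamma> t))"
        by (subst sum.swap) (simp add: supported_mult[OF supported_frame_matrix] scaleR_sum_left mult.commute)
      finally show ?thesis .
    qed
    have 2: "(\<Sum>k\<in>I. ?M $ k $ j *\<^sub>R D (\<gamma> t) (X (\<gamma> t)) (s k)) = (\<Sum>i\<in>I. (\<omega> t ** ?M) $ i $ j *\<^sub>R s i (\<gamma> t))"
    proof -
      have "(\<Sum>k\<in>I. ?M $ k $ j *\<^sub>R D (\<gamma> t) (X (\<gamma> t)) (s k)) = (\<Sum>k\<in>I. \<Sum>i\<in>I. (?M $ k $ j * \<omega> t $ i $ k) *\<^sub>R s i (\<gamma> t))"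
        by (simp add: Dw[OF t'] scaleR_sum_right)
      also have "\<dots> = (\<Sum>i\<in>I. (\<omega> t ** ?M) $ i $ j *\<^sub>R s i (\<gamma> t))"
        by (subst sum.swap) (simp add: supported_mult[OF \<omega>_supp] scaleR_sum_left mult.commute)
      finally show ?thesis .
    qed
    show "covd s (\<Gamma> t) (velocity (smooth_near M) (\<lambda>t. fst (\<Gamma> t)) t)
        (vector_derivative (\<lambda>r. fmat s (\<Gamma> r)) (at t)) j = 0"
      unfolding N v unfolding covd_def \<Gamma>(5) unfolding 1 2 by (simp add: scaleR_diff_left sum_subtractf)
  qed
  moreover have "velocity (smooth_near M) (\<lambda>t. fst (\<Gamma> t)) 0 = w"
  proof (rule tangent_eqI[OF uz p(1) _ w])
    show "velocity (smooth_near M) (\<lambda>t. fst (\<Gamma> t)) 0 \<in> tangent M (fst x)"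
      "dcoord z (velocity (smooth_near M) (\<lambda>t. fst (\<Gamma> t)) 0) = dcoord z w"
      using vel[OF S(2)] X(1)[OF p(1)] by (auto simp: \<Gamma>(5) \<gamma>(3) c_def)
  qed
  ultimately show ?thesis using that[of \<delta> \<Gamma>] \<Gamma>(1,3,4) by blast
qed

lemma tw_data_curve0:
  assumes "twistor_curve M E g {-\<epsilon><..<\<epsilon>} \<Gamma>" "\<epsilon> > 0" "\<Gamma> 0 = x" "(V, s) \<in> frames E" "fst x \<in> V"
  shows "tw_data V s x (velocity (twistor_smooth_near M E g) \<Gamma> 0) (velocity (smooth_near M) (\<lambda>t. fst (\<Gamma> t)) 0)
     (vector_derivative (\<lambda>r. fmat s (\<Gamma> r)) (at 0))"
  using tw_data_velocity[OF assms(1) open_greaterThanLessThan _ assms(4), of 0] assms(2,3,5) by simp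

lemma twistor_tangentI:
  "twistor_curve M E g {-\<epsilon><..<\<epsilon>} \<Gamma> \<Longrightarrow> \<epsilon> > 0 \<Longrightarrow> \<Gamma> 0 = x \<Longrightarrow>
     velocity (twistor_smooth_near M E g) \<Gamma> 0 \<in> twistor_tangent M E g x"
  unfolding twistor_tangent_def by blast

lemma twistor_tangentE:
  assumes "v \<in> twistor_tangent M E g x"
  obtains \<Gamma> \<epsilon> where "\<epsilon> > 0" "twistor_curve M E g {-\<epsilon><..<\<epsilon>} \<Gamma>" "\<Gamma> 0 = x" "v = velocity (twistor_smooth_near M E g) \<Gamma> 0"
  using assms unfolding twistor_tangent_def by blast

lemma horizontal_lift:
  assumes x: "x \<in> twistor E g" and w: "w \<in> tangent M (fst x)"
  shows horizontal_lift_tangent: "horizontal_lift M E g D x w \<in> twistor_tangent M E g x"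
    and horizontal_lift_data: "(V, s) \<in> frames E \<Longrightarrow> fst x \<in> V \<Longrightarrow>
      \<exists>N. tw_data V s x (horizontal_lift M E g D x w) w N \<and> (\<forall>j\<in>I. covd s x w N j = 0)"
proof -
  obtain \<Gamma> \<epsilon> where \<Gamma>: "\<epsilon> > 0" "twistor_curve M E g {-\<epsilon><..<\<epsilon>} \<Gamma>" "\<Gamma> 0 = x" "parallel_along M E D {-\<epsilon><..<\<epsilon>} \<Gamma>"
    "velocity (smooth_near M) (\<lambda>t. fst (\<Gamma> t)) 0 = w"
    using horizontal_curve_exists[OF x w] by metis
  let ?v = "velocity (twistor_smooth_near M E g) \<Gamma> 0"
  have data: "\<exists>N. tw_data V s x (velocity (twistor_smooth_near M E g) \<Gamma>' 0) w N \<and> (\<forall>j\<in>I. covd s x w N j = 0)"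
    if vs: "(V, s) \<in> frames E" "fst x \<in> V" and
      \<Gamma>': "\<epsilon>' > 0" "twistor_curve M E g {-\<epsilon>'<..<\<epsilon>'} \<Gamma>'" "\<Gamma>' 0 = x" "parallel_along M E D {-\<epsilon>'<..<\<epsilon>'} \<Gamma>'"
      "velocity (smooth_near M) (\<lambda>t. fst (\<Gamma>' t)) 0 = w" for V s \<Gamma>' \<epsilon>'
    using tw_data_curve0[OF \<Gamma>'(2,1,3) vs] covd_zero_if_parallel[OF \<Gamma>'(2,1,4) vs(1)] vs(2) \<Gamma>'(3,5) by auto
  have "horizontal_lift M E g D x w = ?v"
    unfolding horizontal_lift_def
  proof (rule the_equality)
    show "\<exists>\<Gamma> \<epsilon>. \<epsilon> > 0 \<and> twistor_curve M E g {-\<epsilon><..<\<epsilon>} \<Gamma> \<and> \<Gamma> 0 = x \<and> parallel_along M E D {-\<epsilon><..<\<epsilon>} \<Gamma> \<and>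
       velocity (smooth_near M) (\<lambda>t. fst (\<Gamma> t)) 0 = w \<and> ?v = velocity (twistor_smooth_near M E g) \<Gamma> 0"
      using \<Gamma> by blast
    fix v assume "\<exists>\<Gamma> \<epsilon>. \<epsilon> > 0 \<and> twistor_curve M E g {-\<epsilon><..<\<epsilon>} \<Gamma> \<and> \<Gamma> 0 = x \<and> parallel_along M E D {-\<epsilon><..<\<epsilon>} \<Gamma> \<and>
       velocity (smooth_near M) (\<lambda>t. fst (\<Gamma> t)) 0 = w \<and> v = velocity (twistor_smooth_near M E g) \<Gamma> 0"
    then obtain \<Gamma>' \<epsilon>' where \<Gamma>': "\<epsilon>' > 0" "twistor_curve M E g {-\<epsilon>'<..<\<epsilon>'} \<Gamma>'" "\<Gamma>' 0 = x" "parallel_along M E D {-\<epsilon>'<..<\<epsilon>'} \<Gamma>'"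
      "velocity (smooth_near M) (\<lambda>t. fst (\<Gamma>' t)) 0 = w" "v = velocity (twistor_smooth_near M E g) \<Gamma>' 0" by blast
    obtain V s where vs: "(V, s) \<in> frames E" "fst x \<in> V" by (rule frame_exists)
    obtain N N' where N: "tw_data V s x ?v w N" "\<forall>j\<in>I. covd s x w N j = 0"
      and N': "tw_data V s x v w N'" "\<forall>j\<in>I. covd s x w N' j = 0"
      using data[OF vs \<Gamma>] data[OF vs \<Gamma>'(1-5)] \<Gamma>'(6) by blast
    have "N' = N"
      by (rule covd_inject[OF vs, where w=w]) (use N N' tw_data_outside[OF N(1)] tw_data_outside[OF N'(1)] in auto)
    then show "v = ?v" using tw_data_eqI[OF x vs] N(1) N'(1) by blast
  qed
  then show "horizontal_lift M E g D x w \<in> twistor_tangent M E g x"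
    and "(V, s) \<in> frames E \<Longrightarrow> fst x \<in> V \<Longrightarrow>
      \<exists>N. tw_data V s x (horizontal_lift M E g D x w) w N \<and> (\<forall>j\<in>I. covd s x w N j = 0)"
    using twistor_tangentI[OF \<Gamma>(2,1,3)] data[OF _ _ \<Gamma>] by simp_all
qed

lemma g_matrix:
  assumes vs: "(V, s) \<in> frames E" "p \<in> V" and J: "J \<in> End_fibre E p" and e: "e \<in> fibre E p" "e' \<in> fibre E p"
  shows "g p (J e) e' = (\<Sum>j\<in>I. coef E s p e j * (\<Sum>i\<in>I. frame_matrix E s p J $ i $ j * g p (s i p) e'))"
proof -
  have s: "s j p \<in> fibre E p" "J (s j p) \<in> fibre E p" if "j \<in> I" for j
    using frame_in_fibre[OF vs that] End_in[OF J] by auto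
  have "g p (J e) e' = (\<Sum>j\<in>I. coef E s p e j * g p (J (s j p)) e')"
    unfolding End_expand[OF vs J e(1)] using s e by (intro g_sum_left) auto
  also have "\<dots> = (\<Sum>j\<in>I. coef E s p e j * g p (\<Sum>i\<in>I. frame_matrix E s p J $ i $ j *\<^sub>R s i p) e')"
    by (simp add: matrix_frame[OF vs J])
  also have "\<dots> = (\<Sum>j\<in>I. coef E s p e j * (\<Sum>i\<in>I. frame_matrix E s p J $ i $ j * g p (s i p) e'))"
    using s e by (simp add: g_sum_left)
  finally show ?thesis .
qed

lemma verticalD:
  assumes "B \<in> vertical E g x"
  shows "B \<in> End_fibre E (fst x)"
    and "e \<in> fibre E (fst x) \<Longrightarrow> e' \<in> fibre E (fst x) \<Longrightarrow> g (fst x) (B e) e' + g (fst x) e (B e') = 0"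
    and "e \<in> fibre E (fst x) \<Longrightarrow> B (snd x e) + snd x (B e) = 0"
  using assms unfolding vertical_def by (auto split: prod.splits)

lemma vertical_compose:
  assumes x: "x \<in> twistor E g" and B: "B \<in> vertical E g x"
  shows "snd x \<circ> B \<in> vertical E g x"
proof -
  note J = twistorD(1)[OF x] and B1 = verticalD(1)[OF B]
  have 1: "g (fst x) (snd x (B e)) e' + g (fst x) e (snd x (B e')) = 0"
    if e: "e \<in> fibre E (fst x)" "e' \<in> fibre E (fst x)" for e e'
  proof -
    have "snd x (B e') = - B (snd x e')" using verticalD(3)[OF B e(2)] by (simp add: eq_neg_iff_add_eq_0 add.commute)
    then have "g (fst x) e (snd x (B e')) = - g (fst x) e (B (snd x e'))"
      using g_neg(2)[OF e(1) End_in[OF B1 End_in[OF J e(2)]]] by simp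
    moreover have "g (fst x) (snd x (B e)) e' = - g (fst x) (B e) (snd x e')"
      by (rule twistor_skew[OF x End_in[OF B1 e(1)] e(2)])
    ultimately show ?thesis using verticalD(2)[OF B e(1) End_in[OF J e(2)]] by simp
  qed
  have 2: "snd x (B (snd x e)) + snd x (snd x (B e)) = 0" if e: "e \<in> fibre E (fst x)" for e
  proof -
    have "snd x (B (snd x e)) + snd x (snd x (B e)) = snd x (B (snd x e) + snd x (B e))"
      by (rule End_add[OF J End_in[OF B1 End_in[OF J e]] End_in[OF J End_in[OF B1 e]], symmetric])
    also have "\<dots> = 0" using verticalD(3)[OF B e] End_zero[OF J] by simp
    finally show ?thesis .
  qed
  show ?thesis
    using 1 2 End_compose[OF J B1] unfolding vertical_def by (auto split: prod.splits)
qed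

text \<open>
  Transport over the constant curve, with the constant skew endomorphism \<open>\<omega> = -JB/2\<close>: its commutator
  \<open>J \<omega> - \<omega> J\<close> is \<open>B\<close>.
\<close>
lemma vertical_curve_exists:
  assumes x: "x \<in> twistor E g" and B: "B \<in> vertical E g x"
  obtains \<Gamma> \<epsilon> where "\<epsilon> > 0" "twistor_curve M E g {-\<epsilon><..<\<epsilon>} \<Gamma>" "\<Gamma> 0 = x" "\<And>t. fst (\<Gamma> t) = fst x"
    "\<And>e e'. e \<in> fibre E (fst x) \<Longrightarrow> e' \<in> fibre E (fst x) \<Longrightarrow>
        ((\<lambda>t. g (fst x) (snd (\<Gamma> t) e) e') has_real_derivative g (fst x) (B e) e') (at 0)"
proof -
  obtain U z V s where uz: "(U, z) \<in> atlas M" and vs: "(V, s) \<in> frames E" and xt: "x \<in> tdom U V"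
    using tdom_exists[OF x] by blast
  have p: "fst x \<in> U" "fst x \<in> V" using xt by (auto simp: tdom_def)
  note J = twistorD(1)[OF x] and B1 = verticalD(1)[OF B]
  let ?K = "snd x \<circ> B" and ?M = "frame_matrix E s (fst x)"
  note K = vertical_compose[OF x B]
  note K1 = verticalD(1)[OF K]
  define \<omega> where "\<omega> = (- 1 / 2) *\<^sub>R ?M ?K"
  have \<omega>_supp: "supported \<omega>" using supported_frame_matrix[of s "fst x" ?K] by (auto simp: supported_def \<omega>_def)
  have supp_t: "supported (transpose \<omega>)" using \<omega>_supp by (auto simp: supported_def transpose_def)
  have G0: "transpose \<omega> ** gram s (fst x) + gram s (fst x) ** \<omega> = 0"
  proof -
    have "(transpose \<omega> ** gram s (fst x) + gram s (fst x) ** \<omega>) $ i $ j = 0" for i j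
    proof -
      have eq: "(transpose \<omega> ** gram s (fst x) + gram s (fst x) ** \<omega>) $ i $ j
          = (\<Sum>k\<in>I. \<omega> $ k $ i * gram s (fst x) $ k $ j) + (\<Sum>k\<in>I. gram s (fst x) $ i $ k * \<omega> $ k $ j)"
        by (simp add: supported_mult[OF supp_t] supported_mult[OF supported_gram]) (simp add: transpose_def)
      show ?thesis
      proof (cases "i \<in> I \<and> j \<in> I")
        case True
        have f: "s k (fst x) \<in> fibre E (fst x)" if "k \<in> I" for k by (rule frame_in_fibre[OF vs p(2) that])
        have "(\<Sum>k\<in>I. \<omega> $ k $ i * gram s (fst x) $ k $ j) = - 1/2 * g (fst x) (?K (s i (fst x))) (s j (fst x))"
          unfolding matrix_frame[OF vs p(2) K1 conjunct1[OF True]]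
          using True f by (simp add: g_sum_left gram_def \<omega>_def sum_distrib_left mult_ac sum_negf sum_divide_distrib)
        moreover have "(\<Sum>k\<in>I. gram s (fst x) $ i $ k * \<omega> $ k $ j) = - 1/2 * g (fst x) (s i (fst x)) (?K (s j (fst x)))"
          unfolding matrix_frame[OF vs p(2) K1 conjunct2[OF True]]
          using True f by (simp add: g_sum_right gram_def \<omega>_def sum_distrib_left mult_ac sum_negf sum_divide_distrib)
        ultimately show ?thesis
          unfolding eq using verticalD(2)[OF K f f, of i j] True by simp
      next
        case False
        then show ?thesis
          unfolding eq using \<omega>_supp by (auto simp: gram_def supportedD intro!: sum.neutral)
      qed
    qed
    then show ?thesis by (simp add: vec_eq_iff)
  qed
  obtain \<delta> \<Gamma> where \<Gamma>: "0 < \<delta>" "\<delta> \<le> 1" "twistor_curve M E g {-\<delta><..<\<delta>} \<Gamma>" "\<Gamma> 0 = x" "\<And>t. fst (\<Gamma> t) = fst x"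
    "\<And>t. t \<in> {-\<delta><..<\<delta>} \<Longrightarrow> ((\<lambda>r. fmat s (\<Gamma> r)) has_vector_derivative
        fmat s (\<Gamma> t) ** \<omega> - \<omega> ** fmat s (\<Gamma> t)) (at t)"
  proof (rule twistor_transport[OF x uz vs, of 1 "\<lambda>_. fst x" "\<lambda>_. \<omega>"])
    show "((\<lambda>r. gram s (fst x)) has_vector_derivative transpose \<omega> ** gram s (fst x) + gram s (fst x) ** \<omega>) (at t)" for t
      unfolding G0 by (rule has_vector_derivative_const)
  qed (use p \<omega>_supp smooth_curve_const smooth_on_const in auto)
  have "?M (snd x) ** ?M ?K = - ?M B"
  proof -
    have "?M (snd x \<circ> ?K) $ i $ j = - ?M B $ i $ j" for i j
      using twistorD(2)[OF x End_in[OF B1 frame_in_fibre[OF vs p(2)]]]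
        coef_neg[OF vs p(2) End_in[OF B1 frame_in_fibre[OF vs p(2)]]]
      by (simp add: frame_matrix_def)
    then show ?thesis unfolding matrix_compose[OF vs p(2) J K1, symmetric] by (simp add: vec_eq_iff)
  qed
  moreover have "?M ?K ** ?M (snd x) = ?M B"
  proof -
    have "snd x (B (snd x e)) = B e" if e: "e \<in> fibre E (fst x)" for e
      using verticalD(3)[OF K e] twistorD(2)[OF x End_in[OF B1 e]] by simp
    then have "?M (?K \<circ> snd x) $ i $ j = ?M B $ i $ j" for i j
      using frame_in_fibre[OF vs p(2)] by (simp add: frame_matrix_def)
    then show ?thesis unfolding matrix_compose[OF vs p(2) K1 J, symmetric] by (simp add: vec_eq_iff)
  qed
  ultimately have comm: "?M (snd x) ** \<omega> - \<omega> ** ?M (snd x) = ?M B"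
    by (simp add: \<omega>_def mm.scaleR_right mm.scaleR_left mm.minus_left mm.minus_right)
  have deriv: "((\<lambda>r. ?M (snd (\<Gamma> r)) $ i $ j) has_real_derivative ?M B $ i $ j) (at 0)" for i j
    using has_vector_derivative_entry[OF \<Gamma>(6)[of 0]] \<Gamma>(1) by (simp add: \<Gamma>(4,5) comm)
  have Jt: "snd (\<Gamma> t) \<in> End_fibre E (fst x)" if "t \<in> {-\<delta><..<\<delta>}" for t
    using twistorD(1)[OF twistor_curve_in[OF \<Gamma>(3) that]] by (simp add: \<Gamma>(5))
  have "((\<lambda>t. g (fst x) (snd (\<Gamma> t) e) e') has_real_derivative g (fst x) (B e) e') (at 0)"
    if e: "e \<in> fibre E (fst x)" "e' \<in> fibre E (fst x)" for e e'
  proof -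
    have "((\<lambda>t. \<Sum>j\<in>I. coef E s (fst x) e j * (\<Sum>i\<in>I. ?M (snd (\<Gamma> t)) $ i $ j * g (fst x) (s i (fst x)) e'))
        has_real_derivative (\<Sum>j\<in>I. coef E s (fst x) e j * (\<Sum>i\<in>I. ?M B $ i $ j * g (fst x) (s i (fst x)) e'))) (at 0)"
      by (intro DERIV_sum DERIV_cmult DERIV_cmult_right deriv)
    then show ?thesis
      unfolding g_matrix[OF vs p(2) B1 e]
      by (rule has_field_derivative_transform_within_open[where S="{-\<delta><..<\<delta>}"])
        (use \<Gamma>(1) in \<open>auto simp: g_matrix[OF vs p(2) Jt e]\<close>)
  qed
  then show ?thesis using that[of \<delta> \<Gamma>] \<Gamma> by blast
qed

lemma vertical_vector:
  assumes x: "x \<in> twistor E g" and B: "B \<in> vertical E g x"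
  shows vertical_vector_tangent: "vertical_vector M E g x B \<in> twistor_tangent M E g x"
    and vertical_vector_data: "(V, s) \<in> frames E \<Longrightarrow> fst x \<in> V \<Longrightarrow>
      tw_data V s x (vertical_vector M E g x B) (\<lambda>f. 0) (frame_matrix E s (fst x) B)"
proof -
  let ?cond = "\<lambda>\<Gamma> \<epsilon>. \<epsilon> > 0 \<and> twistor_curve M E g {-\<epsilon><..<\<epsilon>} \<Gamma> \<and> \<Gamma> 0 = x \<and> (\<forall>t\<in>{-\<epsilon><..<\<epsilon>}. fst (\<Gamma> t) = fst x) \<and>
     (\<forall>e\<in>fibre E (fst x). \<forall>e'\<in>fibre E (fst x).
        ((\<lambda>t. g (fst x) (snd (\<Gamma> t) e) e') has_real_derivative g (fst x) (B e) e') (at 0))"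
  note B1 = verticalD(1)[OF B]
  have data: "tw_data V s x (velocity (twistor_smooth_near M E g) \<Gamma> 0) (\<lambda>f. 0) (frame_matrix E s (fst x) B)"
    if vs: "(V, s) \<in> frames E" "fst x \<in> V" and cond: "?cond \<Gamma> \<epsilon>" for V s \<Gamma> \<epsilon>
  proof -
    let ?N = "vector_derivative (\<lambda>r. fmat s (\<Gamma> r)) (at 0)"
    have \<Gamma>: "\<epsilon> > 0" "twistor_curve M E g {-\<epsilon><..<\<epsilon>} \<Gamma>" "\<Gamma> 0 = x" "\<And>t. t \<in> {-\<epsilon><..<\<epsilon>} \<Longrightarrow> fst (\<Gamma> t) = fst x"
      using cond by auto
    have o: "open {-\<epsilon><..<\<epsilon>}" "0 \<in> {-\<epsilon><..<\<epsilon>}" using \<Gamma>(1) by auto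
    have v0: "velocity (smooth_near M) (\<lambda>t. fst (\<Gamma> t)) 0 = (\<lambda>f. 0)"
    proof
      fix f :: "'m \<Rightarrow> real"
      have "((\<lambda>t. f (fst x)) has_real_derivative 0) (at 0)" by simp
      then have "((\<lambda>t. f (fst (\<Gamma> t))) has_real_derivative 0) (at 0)"
        by (rule has_field_derivative_transform_within_open[OF _ o]) (simp add: \<Gamma>(4))
      then show "velocity (smooth_near M) (\<lambda>t. fst (\<Gamma> t)) 0 f = 0"
        by (simp add: velocity_def DERIV_imp_deriv)
    qed
    have d: "tw_data V s x (velocity (twistor_smooth_near M E g) \<Gamma> 0) (\<lambda>f. 0) ?N"
      using tw_data_curve0[OF \<Gamma>(2,1,3) vs] v0 by simp
    have f: "s k (fst x) \<in> fibre E (fst x)" if "k \<in> I" for k by (rule frame_in_fibre[OF vs that])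
    have dM: "((\<lambda>r. fmat s (\<Gamma> r) $ i $ j) has_real_derivative ?N $ i $ j) (at 0)" for i j
      using twistor_curve_matrix[OF \<Gamma>(2) o vs(1)] vs(2) \<Gamma>(3) by (intro has_vector_derivative_entry) auto
    have "(\<Sum>i\<in>I. ?N $ i $ j *\<^sub>R s i (fst x)) = B (s j (fst x))" if j: "j \<in> I" for j
    proof (rule g_nondegenerate)
      show "(\<Sum>i\<in>I. ?N $ i $ j *\<^sub>R s i (fst x)) \<in> fibre E (fst x)" "B (s j (fst x)) \<in> fibre E (fst x)"
        using f j End_in[OF B1] by (auto intro!: fibre_sum fibre_scale)
      fix e' assume e': "e' \<in> fibre E (fst x)"
      have "((\<lambda>t. \<Sum>i\<in>I. fmat s (\<Gamma> t) $ i $ j * g (fst x) (s i (fst x)) e')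
          has_real_derivative (\<Sum>i\<in>I. ?N $ i $ j * g (fst x) (s i (fst x)) e')) (at 0)"
        by (intro DERIV_sum DERIV_cmult_right dM)
      then have "((\<lambda>t. g (fst x) (snd (\<Gamma> t) (s j (fst x))) e')
          has_real_derivative (\<Sum>i\<in>I. ?N $ i $ j * g (fst x) (s i (fst x)) e')) (at 0)"
      proof (rule has_field_derivative_transform_within_open[OF _ o])
        fix t assume t: "t \<in> {-\<epsilon><..<\<epsilon>}"
        have "snd (\<Gamma> t) \<in> End_fibre E (fst x)"
          using twistorD(1)[OF twistor_curve_in[OF \<Gamma>(2) t]] \<Gamma>(4)[OF t] by simp
        then show "(\<Sum>i\<in>I. fmat s (\<Gamma> t) $ i $ j * g (fst x) (s i (fst x)) e')
            = g (fst x) (snd (\<Gamma> t) (s j (fst x))) e'"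
          using f e' by (simp add: \<Gamma>(4)[OF t] matrix_frame[OF vs _ j] g_sum_left)
      qed
      moreover have "((\<lambda>t. g (fst x) (snd (\<Gamma> t) (s j (fst x))) e') has_real_derivative g (fst x) (B (s j (fst x))) e') (at 0)"
        using cond f[OF j] e' by blast
      ultimately have "(\<Sum>i\<in>I. ?N $ i $ j * g (fst x) (s i (fst x)) e') = g (fst x) (B (s j (fst x))) e'"
        by (rule DERIV_unique)
      then show "g (fst x) (\<Sum>i\<in>I. ?N $ i $ j *\<^sub>R s i (fst x)) e' = g (fst x) (B (s j (fst x))) e'"
        using f e' by (simp add: g_sum_left)
    qed
    then have "?N $ i $ j = frame_matrix E s (fst x) B $ i $ j" for i j
      using coef_frame_sum[OF vs, of i "\<lambda>i. ?N $ i $ j"] tw_data_outside[OF d, of i j]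
      by (cases "i \<in> I \<and> j \<in> I") (auto simp: frame_matrix_def)
    then have "?N = frame_matrix E s (fst x) B" by (simp add: vec_eq_iff)
    then show ?thesis using d by simp
  qed
  obtain \<Gamma> \<epsilon> where \<Gamma>: "?cond \<Gamma> \<epsilon>"
    by (rule vertical_curve_exists[OF x B]) blast
  have "vertical_vector M E g x B = velocity (twistor_smooth_near M E g) \<Gamma> 0"
    unfolding vertical_vector_def
  proof (rule the_equality)
    show "\<exists>\<Gamma>' \<epsilon>. \<epsilon> > 0 \<and> twistor_curve M E g {-\<epsilon><..<\<epsilon>} \<Gamma>' \<and> \<Gamma>' 0 = x \<and> (\<forall>t\<in>{-\<epsilon><..<\<epsilon>}. fst (\<Gamma>' t) = fst x) \<and>
     (\<forall>e\<in>fibre E (fst x). \<forall>e'\<in>fibre E (fst x).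
        ((\<lambda>t. g (fst x) (snd (\<Gamma>' t) e) e') has_real_derivative g (fst x) (B e) e') (at 0)) \<and>
     velocity (twistor_smooth_near M E g) \<Gamma> 0 = velocity (twistor_smooth_near M E g) \<Gamma>' 0"
      using \<Gamma> by blast
    fix v assume "\<exists>\<Gamma>' \<epsilon>. \<epsilon> > 0 \<and> twistor_curve M E g {-\<epsilon><..<\<epsilon>} \<Gamma>' \<and> \<Gamma>' 0 = x \<and> (\<forall>t\<in>{-\<epsilon><..<\<epsilon>}. fst (\<Gamma>' t) = fst x) \<and>
     (\<forall>e\<in>fibre E (fst x). \<forall>e'\<in>fibre E (fst x).
        ((\<lambda>t. g (fst x) (snd (\<Gamma>' t) e) e') has_real_derivative g (fst x) (B e) e') (at 0)) \<and>
     v = velocity (twistor_smooth_near M E g) \<Gamma>' 0"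
    then obtain \<Gamma>' \<epsilon>' where \<Gamma>': "?cond \<Gamma>' \<epsilon>'" "v = velocity (twistor_smooth_near M E g) \<Gamma>' 0" by blast
    obtain V s where vs: "(V, s) \<in> frames E" "fst x \<in> V" by (rule frame_exists)
    show "v = velocity (twistor_smooth_near M E g) \<Gamma> 0"
      unfolding \<Gamma>'(2) by (rule tw_data_eqI[OF x vs data[OF vs \<Gamma>'(1)] data[OF vs \<Gamma>]])
  qed
  then show "vertical_vector M E g x B \<in> twistor_tangent M E g x"
    and "(V, s) \<in> frames E \<Longrightarrow> fst x \<in> V \<Longrightarrow>
      tw_data V s x (vertical_vector M E g x B) (\<lambda>f. 0) (frame_matrix E s (fst x) B)"
    using \<Gamma> data[OF _ _ \<Gamma>] twistor_tangentI[of \<epsilon> \<Gamma> x] by auto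
qed

text \<open>
  The vertical part of a tangent vector, \<open>\<nabla>J\<close>, lies in the vertical space: differentiate \<open>J\<^sup>2 = -1\<close> and the
  skew-symmetry of \<open>J\<close> along a curve, the latter with \<open>\<nabla>g = 0\<close>.
\<close>
lemma vertical_part:
  assumes x: "x \<in> twistor E g" and v: "v \<in> twistor_tangent M E g x" and vs: "(V, s) \<in> frames E" "fst x \<in> V"
  obtains B w N where "B \<in> vertical E g x" "tw_data V s x v w N" "\<And>j. j \<in> I \<Longrightarrow> covd s x w N j = B (s j (fst x))"
proof -
  obtain \<Gamma> \<epsilon> where \<Gamma>: "\<epsilon> > 0" "twistor_curve M E g {-\<epsilon><..<\<epsilon>} \<Gamma>" "\<Gamma> 0 = x" "v = velocity (twistor_smooth_near M E g) \<Gamma> 0"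
    using twistor_tangentE[OF v] by metis
  let ?\<gamma> = "\<lambda>t. fst (\<Gamma> t)" and ?S = "{-\<epsilon><..<\<epsilon>}"
  have S: "open ?S" "0 \<in> ?S" using \<Gamma>(1) by auto
  note \<gamma> = twistor_curve_base[OF \<Gamma>(2)]
  define p where "p = fst x"
  define J where "J = snd x"
  define w where "w = velocity (smooth_near M) ?\<gamma> 0"
  define N where "N = vector_derivative (\<lambda>r. fmat s (\<Gamma> r)) (at 0)"
  have p: "p \<in> V" "?\<gamma> 0 = p" using vs \<Gamma>(3) by (auto simp: p_def)
  have data: "tw_data V s x v w N"
    unfolding w_def N_def \<Gamma>(4) by (rule tw_data_curve0[OF \<Gamma>(2,1,3) vs])
  have w: "w \<in> tangent M p" using data by (simp add: tw_data_def p_def)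
  have J: "J \<in> End_fibre E p" using twistorD(1)[OF x] by (simp add: J_def p_def)
  let ?M = "\<lambda>r. fmat s (\<Gamma> r)"
  have M0: "?M 0 = frame_matrix E s p J" by (simp add: \<Gamma>(3) p_def J_def)
  have dM: "(?M has_vector_derivative N) (at 0)"
    unfolding N_def by (rule twistor_curve_matrix[OF \<Gamma>(2) S vs(1)]) (use p in auto)
  have N_supp: "supported N" using tw_data_outside[OF data] by (simp add: supported_def)
  define Nh where "Nh = endo s p N"
  define \<Omega> where "\<Omega> = endo s p (\<chi> i j. coef E s p (D p w (s j)) i)"
  define B where "B = endo s p (\<chi> i j. coef E s p (covd s x w N j) i)"
  have End: "Nh \<in> End_fibre E p" "\<Omega> \<in> End_fibre E p" "B \<in> End_fibre E p"
    unfolding Nh_def \<Omega>_def B_def by (auto intro: endo_in_End[OF vs(1) p(1)])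
  have sf: "s j p \<in> fibre E p" if "j \<in> I" for j by (rule frame_in_fibre[OF vs(1) p(1) that])
  have B_frame: "B (s j p) = covd s x w N j" if j: "j \<in> I" for j
  proof -
    have "covd s x w N j \<in> fibre E p" using covd_in[OF x vs, of w j N] w j by (simp add: p_def)
    then show ?thesis unfolding B_def by (simp add: endo_frame[OF vs(1) p(1) j] coef_expand[OF vs(1) p(1)])
  qed
  have \<Omega>_frame: "\<Omega> (s j p) = D p w (s j)" if j: "j \<in> I" for j
    using frame_conn_in[OF w vs(1) p(1) j]
    unfolding \<Omega>_def by (simp add: endo_frame[OF vs(1) p(1) j] coef_expand[OF vs(1) p(1)])
  have Nh_frame: "Nh (s j p) = (\<Sum>i\<in>I. N $ i $ j *\<^sub>R s i p)" if j: "j \<in> I" for j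
    unfolding Nh_def by (rule endo_frame[OF vs(1) p(1) j])
  have Nh_mat: "frame_matrix E s p Nh = N"
    unfolding Nh_def by (rule matrix_endo_eq[OF vs(1) p(1)]) (use N_supp in \<open>auto simp: supported_def\<close>)
  have JJ: "J (J e) = - e" if "e \<in> fibre E p" for e using twistorD(2)[OF x] that by (simp add: J_def p_def)
  have \<Omega>J: "\<Omega> (J (s j p)) = (\<Sum>i\<in>I. ?M 0 $ i $ j *\<^sub>R D p w (s i))" if j: "j \<in> I" for j
  proof -
    have "\<Omega> (J (s j p)) = \<Omega> (\<Sum>i\<in>I. ?M 0 $ i $ j *\<^sub>R s i p)" unfolding M0 using matrix_frame[OF vs(1) p(1) J j] by simp
    also have "\<dots> = (\<Sum>i\<in>I. ?M 0 $ i $ j *\<^sub>R \<Omega> (s i p))" by (rule End_lincomb[OF End(2) sf])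
    finally show ?thesis by (simp add: \<Omega>_frame)
  qed
  have B_eq0: "B (s j p) = Nh (s j p) + \<Omega> (J (s j p)) - J (\<Omega> (s j p))" if j: "j \<in> I" for j
    unfolding B_frame[OF j] covd_def \<Omega>J[OF j] Nh_frame[OF j] \<Omega>_frame[OF j] by (simp add: p_def J_def \<Gamma>(3))
  have B_eq: "B e = Nh e + \<Omega> (J e) - J (\<Omega> e)" if e: "e \<in> fibre E p" for e
    using End_expand[OF vs(1) p(1) End(3) e] End_expand[OF vs(1) p(1) End(1) e]
      End_expand[OF vs(1) p(1) End_compose[OF End(2) J] e] End_expand[OF vs(1) p(1) End_compose[OF J End(2)] e]
    by (simp add: B_eq0 sum.distrib sum_subtractf scaleR_add_right scaleR_diff_right)
  have anti: "Nh (J (s j p)) = - J (Nh (s j p))" if j: "j \<in> I" for j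
  proof -
    have "((\<lambda>r. ?M r ** ?M r) has_vector_derivative ?M 0 ** N + N ** ?M 0) (at 0)"
      by (rule mm.has_vector_derivative[OF dM dM])
    moreover have "((\<lambda>r. ?M r ** ?M r) has_vector_derivative 0) (at 0)"
    proof (rule has_vector_derivative_transform_within_open[OF has_vector_derivative_const[of "- idm"]])
      show "open {r\<in>?S. ?\<gamma> r \<in> V}" by (rule curve_preimage_open[OF \<gamma> S(1) frame_open[OF vs(1)]])
      show "0 \<in> {r\<in>?S. ?\<gamma> r \<in> V}" using S p by simp
      show "- idm = ?M r ** ?M r" if "r \<in> {r\<in>?S. ?\<gamma> r \<in> V}" for r
        using twistor_matrix_square[OF twistor_curve_in[OF \<Gamma>(2)] vs(1)] that by simp
    qed
    ultimately have z: "?M 0 ** N + N ** ?M 0 = 0" using vector_derivative_unique_at by blast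
    have z': "frame_matrix E s p (J \<circ> Nh) + frame_matrix E s p (Nh \<circ> J) = 0"
      using z unfolding M0 matrix_compose[OF vs(1) p(1) J End(1)] matrix_compose[OF vs(1) p(1) End(1) J] Nh_mat .
    have c: "coef E s p (Nh (J (s j p))) i = - coef E s p (J (Nh (s j p))) i" if "i \<in> I" for i
    proof -
      have "(frame_matrix E s p (J \<circ> Nh) + frame_matrix E s p (Nh \<circ> J)) $ i $ j = 0"
        unfolding z' by simp
      then show ?thesis using that j by (simp add: frame_matrix_def)
    qed
    have f: "Nh (J (s j p)) \<in> fibre E p" "J (Nh (s j p)) \<in> fibre E p" using sf[OF j] End_in End J by auto
    show ?thesis
      by (rule fibre_eqI[OF vs(1) p(1) f(1) fibre_neg[OF f(2)]]) (simp add: c coef_neg[OF vs(1) p(1) f(2)])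
  qed
  have antiN: "Nh (J e) = - J (Nh e)" if e: "e \<in> fibre E p" for e
    using End_expand[OF vs(1) p(1) End_compose[OF End(1) J] e] End_expand[OF vs(1) p(1) End_compose[OF J End(1)] e]
    by (simp add: anti sum_negf)
  have B_anti: "B (J e) + J (B e) = 0" if e: "e \<in> fibre E p" for e
  proof -
    note in_f = End_in[OF J e] End_in[OF End(1) e] End_in[OF End(2) e] End_in[OF End(2) End_in[OF J e]]
      End_in[OF J End_in[OF End(2) e]]
    have "B (J e) = Nh (J e) + \<Omega> (J (J e)) - J (\<Omega> (J e))" by (rule B_eq[OF in_f(1)])
    moreover have "\<Omega> (J (J e)) = - \<Omega> e" by (simp add: JJ[OF e] End_neg[OF End(2) e])
    moreover have "J (B e) = J (Nh e) + J (\<Omega> (J e)) - J (J (\<Omega> e))"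
      using in_f by (simp add: B_eq[OF e] End_diff[OF J] End_add[OF J] fibre_add)
    ultimately show ?thesis by (simp add: antiN[OF e] JJ[OF in_f(3)])
  qed
  have skew: "g p (B (s i p)) (s j p) + g p (s i p) (B (s j p)) = 0" if i: "i \<in> I" and j: "j \<in> I" for i j
  proof -
    let ?G = "\<lambda>k l r. g (?\<gamma> r) (s k (?\<gamma> r)) (s l (?\<gamma> r))"
    let ?G' = "\<lambda>k l. g p (\<Omega> (s k p)) (s l p) + g p (s k p) (\<Omega> (s l p))"
    have dG: "(?G k l has_real_derivative ?G' k l) (at 0)" if "k \<in> I" "l \<in> I" for k l
      using gram_derivative_parallel[OF \<gamma> S vs(1) _ that] p that by (simp add: \<Omega>_frame w_def)
    have dMe: "((\<lambda>r. ?M r $ k $ l) has_real_derivative N $ k $ l) (at 0)" for k l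
      by (rule has_vector_derivative_entry[OF dM])
    have "((\<lambda>r. (\<Sum>k\<in>I. ?M r $ k $ i * ?G k j r) + (\<Sum>k\<in>I. ?M r $ k $ j * ?G i k r)) has_real_derivative
        (\<Sum>k\<in>I. N $ k $ i * ?G k j 0 + ?G' k j * ?M 0 $ k $ i) + (\<Sum>k\<in>I. N $ k $ j * ?G i k 0 + ?G' i k * ?M 0 $ k $ j)) (at 0)"
      by (intro DERIV_add DERIV_sum DERIV_mult dMe dG i j)
    moreover have "((\<lambda>r. (\<Sum>k\<in>I. ?M r $ k $ i * ?G k j r) + (\<Sum>k\<in>I. ?M r $ k $ j * ?G i k r)) has_real_derivative 0) (at 0)"
    proof (rule has_field_derivative_transform_within_open[OF DERIV_const[of 0]])
      show "open {r\<in>?S. ?\<gamma> r \<in> V}" by (rule curve_preimage_open[OF \<gamma> S(1) frame_open[OF vs(1)]])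
      show "0 \<in> {r\<in>?S. ?\<gamma> r \<in> V}" using S p by simp
      fix r assume r: "r \<in> {r\<in>?S. ?\<gamma> r \<in> V}"
      have tw: "\<Gamma> r \<in> twistor E g" using twistor_curve_in[OF \<Gamma>(2)] r by simp
      have rV: "?\<gamma> r \<in> V" using r by simp
      have f: "s k (?\<gamma> r) \<in> fibre E (?\<gamma> r)" if "k \<in> I" for k by (rule frame_in_fibre[OF vs(1) rV that])
      have "(\<Sum>k\<in>I. ?M r $ k $ i * ?G k j r) = g (?\<gamma> r) (snd (\<Gamma> r) (s i (?\<gamma> r))) (s j (?\<gamma> r))"
        using f i j by (simp add: matrix_frame[OF vs(1) rV twistorD(1)[OF tw] i] g_sum_left)
      moreover have "(\<Sum>k\<in>I. ?M r $ k $ j * ?G i k r) = g (?\<gamma> r) (s i (?\<gamma> r)) (snd (\<Gamma> r) (s j (?\<gamma> r)))"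
        using f i j by (simp add: matrix_frame[OF vs(1) rV twistorD(1)[OF tw] j] g_sum_right)
      ultimately show "0 = (\<Sum>k\<in>I. ?M r $ k $ i * ?G k j r) + (\<Sum>k\<in>I. ?M r $ k $ j * ?G i k r)"
        using twistor_skew[OF tw f f, of i j] i j by simp
    qed
    ultimately have z: "(\<Sum>k\<in>I. N $ k $ i * ?G k j 0 + ?G' k j * ?M 0 $ k $ i) + (\<Sum>k\<in>I. N $ k $ j * ?G i k 0 + ?G' i k * ?M 0 $ k $ j) = 0"
      by (rule DERIV_unique)
    have in_f: "Nh (s k p) \<in> fibre E p" "\<Omega> (s k p) \<in> fibre E p" "J (s k p) \<in> fibre E p" "\<Omega> (J (s k p)) \<in> fibre E p" "J (\<Omega> (s k p)) \<in> fibre E p"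
      if "k \<in> I" for k using End_in[OF End(1)] End_in[OF End(2)] End_in[OF J] sf[OF that] by auto
    have \<Omega>J': "\<Omega> (J (s l p)) = (\<Sum>k\<in>I. ?M 0 $ k $ l *\<^sub>R \<Omega> (s k p))" if "l \<in> I" for l
      unfolding \<Omega>J[OF that] by (simp add: \<Omega>_frame)
    have J': "J (s l p) = (\<Sum>k\<in>I. ?M 0 $ k $ l *\<^sub>R s k p)" if "l \<in> I" for l
      unfolding M0 by (rule matrix_frame[OF vs(1) p(1) J that])
    have left: "g p (Nh (s l p)) y = (\<Sum>k\<in>I. N $ k $ l * g p (s k p) y)"
        "g p (\<Omega> (J (s l p))) y = (\<Sum>k\<in>I. ?M 0 $ k $ l * g p (\<Omega> (s k p)) y)"
        "g p (J (s l p)) y = (\<Sum>k\<in>I. ?M 0 $ k $ l * g p (s k p) y)"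
      if "l \<in> I" "y \<in> fibre E p" for l y
      unfolding Nh_frame[OF that(1)] \<Omega>J'[OF that(1)] unfolding J'[OF that(1)]
      using sf in_f(2) that(2) by (intro g_sum_left; blast)+
    have right: "g p y (Nh (s l p)) = (\<Sum>k\<in>I. N $ k $ l * g p y (s k p))"
        "g p y (\<Omega> (J (s l p))) = (\<Sum>k\<in>I. ?M 0 $ k $ l * g p y (\<Omega> (s k p)))"
        "g p y (J (s l p)) = (\<Sum>k\<in>I. ?M 0 $ k $ l * g p y (s k p))"
      if "l \<in> I" "y \<in> fibre E p" for l y
      unfolding Nh_frame[OF that(1)] \<Omega>J'[OF that(1)] unfolding J'[OF that(1)]
      using sf in_f(2) that(2) by (intro g_sum_right; blast)+
    have "(\<Sum>k\<in>I. N $ k $ i * ?G k j 0 + ?G' k j * ?M 0 $ k $ i)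
        = g p (Nh (s i p)) (s j p) + g p (\<Omega> (J (s i p))) (s j p) + g p (J (s i p)) (\<Omega> (s j p))"
      using left[OF i] sf[OF j] in_f(2)[OF j] by (simp add: sum.distrib algebra_simps p(2))
    moreover have "(\<Sum>k\<in>I. N $ k $ j * ?G i k 0 + ?G' i k * ?M 0 $ k $ j)
        = g p (s i p) (Nh (s j p)) + g p (\<Omega> (s i p)) (J (s j p)) + g p (s i p) (\<Omega> (J (s j p)))"
      using right[OF j] sf[OF i] in_f(2)[OF i] by (simp add: sum.distrib algebra_simps p(2))
    moreover have "g p (J (\<Omega> (s i p))) (s j p) = - g p (\<Omega> (s i p)) (J (s j p))"
      using twistor_skew[OF x, of "\<Omega> (s i p)" "s j p"] in_f[OF i] sf[OF j] by (simp add: p_def J_def)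
    moreover have "g p (s i p) (J (\<Omega> (s j p))) = - g p (J (s i p)) (\<Omega> (s j p))"
      using twistor_skew[OF x, of "s i p" "\<Omega> (s j p)"] in_f[OF j] sf[OF i] by (simp add: p_def J_def)
    ultimately show ?thesis
      using z in_f[OF i] in_f[OF j] sf[OF i] sf[OF j]
      by (simp add: B_eq0[OF i] B_eq0[OF j] g_diff g_add_left g_add_right fibre_add)
  qed
  have B_skew: "g p (B e) e' + g p e (B e') = 0" if e: "e \<in> fibre E p" "e' \<in> fibre E p" for e e'
  proof -
    let ?a = "coef E s p e" and ?b = "coef E s p e'"
    have Bs: "B (s j p) \<in> fibre E p" if "j \<in> I" for j using End_in[OF End(3) sf[OF that]] .
    have "g p (B e) e' = g p (\<Sum>i\<in>I. ?a i *\<^sub>R B (s i p)) (\<Sum>j\<in>I. ?b j *\<^sub>R s j p)"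
      by (simp add: End_expand[OF vs(1) p(1) End(3) e(1), symmetric] coef_expand[OF vs(1) p(1) e(2)])
    moreover have "g p e (B e') = g p (\<Sum>i\<in>I. ?a i *\<^sub>R s i p) (\<Sum>j\<in>I. ?b j *\<^sub>R B (s j p))"
      by (simp add: End_expand[OF vs(1) p(1) End(3) e(2), symmetric] coef_expand[OF vs(1) p(1) e(1)])
    ultimately have "g p (B e) e' + g p e (B e') =
        (\<Sum>i\<in>I. \<Sum>j\<in>I. ?a i * (?b j * (g p (B (s i p)) (s j p) + g p (s i p) (B (s j p)))))"
      using sf Bs by (simp add: g_double_sum sum.distrib sum_distrib_left algebra_simps)
    then show ?thesis by (simp add: skew)
  qed
  have "B \<in> vertical E g x"
    using End(3) B_skew B_anti unfolding vertical_def p_def J_def by (auto split: prod.splits)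
  then show ?thesis using that[OF _ data] B_frame by (simp add: p_def)
qed

text \<open>
  The decomposition of a tangent vector into \<open>B\<close> and \<open>w\<^sup>\<nabla>\<close> exists by the previous lemma. It is unique, because
  \<open>w\<close> is the projection to the base and \<open>B\<close> is given by \<open>covd\<close>, which vanishes on horizontal lifts.
\<close>
lemma twistor_cstruct_formula:
  assumes x: "x \<in> twistor E g" and v: "v \<in> twistor_tangent M E g x" and vs: "(V, s) \<in> frames E" "fst x \<in> V"
  obtains B w N where "B \<in> vertical E g x" "tw_data V s x v w N" "\<And>j. j \<in> I \<Longrightarrow> covd s x w N j = B (s j (fst x))"
    "twistor_cstruct M E g D x v = tadd (vertical_vector M E g x (snd x \<circ> B)) (horizontal_lift M E g D x (cstruct M (fst x) w))"
proof -
  obtain B w N where B: "B \<in> vertical E g x" "tw_data V s x v w N" "\<And>j. j \<in> I \<Longrightarrow> covd s x w N j = B (s j (fst x))"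
    using vertical_part[OF x v vs] by metis
  let ?dec = "\<lambda>B w. tadd (vertical_vector M E g x B) (horizontal_lift M E g D x w)"
  have data: "\<exists>N. tw_data V s x (?dec B w) w N \<and> (\<forall>j\<in>I. covd s x w N j = B (s j (fst x)))"
    if Bw: "B \<in> vertical E g x" "w \<in> tangent M (fst x)" for B w
  proof -
    obtain N where N: "tw_data V s x (horizontal_lift M E g D x w) w N" "\<forall>j\<in>I. covd s x w N j = 0"
      using horizontal_lift_data[OF x Bw(2) vs] by blast
    have "covd s x w (frame_matrix E s (fst x) B + N) j = B (s j (fst x))" if "j \<in> I" for j
      using N(2) that matrix_frame[OF vs verticalD(1)[OF Bw(1)] that] by (simp add: covd_add)
    then show ?thesis using tw_data_tadd[OF vertical_vector_data[OF x Bw(1) vs] N(1)] by blast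
  qed
  have w: "w \<in> tangent M (fst x)" using B(2) by (simp add: tw_data_def)
  have uniq: "v = ?dec B' w' \<longleftrightarrow> B' = B \<and> w' = w" if B': "B' \<in> vertical E g x" "w' \<in> tangent M (fst x)" for B' w'
  proof -
    obtain N' where N': "tw_data V s x (?dec B' w') w' N'" "\<forall>j\<in>I. covd s x w' N' j = B' (s j (fst x))"
      using data[OF B'] by blast
    show ?thesis
    proof
      assume "v = ?dec B' w'"
      then have "w' = w" "N' = N" using tw_data_unique[OF B(2)] N'(1) by auto
      moreover have "B' = B"
        by (rule End_frame_eqI[OF vs verticalD(1)[OF B'(1)] verticalD(1)[OF B(1)]])
          (use N'(2) B(3) calculation in simp)
      ultimately show "B' = B \<and> w' = w" by simp
    next
      assume eq: "B' = B \<and> w' = w"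
      have "N' = N"
        by (rule covd_inject[OF vs, where w=w]) (use N' B eq tw_data_outside[OF N'(1)] tw_data_outside[OF B(2)] in auto)
      then show "v = ?dec B' w'" using tw_data_eqI[OF x vs B(2)] N'(1) eq by simp
    qed
  qed
  have "twistor_cstruct M E g D x v = ?dec (snd x \<circ> B) (cstruct M (fst x) w)"
    unfolding twistor_cstruct_def
  proof (rule the_equality)
    show "\<exists>B'\<in>vertical E g x. \<exists>w'\<in>tangent M (fst x). v = ?dec B' w' \<and>
        ?dec (snd x \<circ> B) (cstruct M (fst x) w) = ?dec (snd x \<circ> B') (cstruct M (fst x) w')"
      using uniq[OF B(1) w] B(1) w by blast
    fix v' assume "\<exists>B'\<in>vertical E g x. \<exists>w'\<in>tangent M (fst x). v = ?dec B' w' \<and> v' = ?dec (snd x \<circ> B') (cstruct M (fst x) w')"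
    then show "v' = ?dec (snd x \<circ> B) (cstruct M (fst x) w)" using uniq by metis
  qed
  then show ?thesis using that[OF B] by blast
qed

end

section \<open>The induced map on complex structures\<close>

lemma imul_simps:
  "imul (x + y) = imul x + imul y" "imul (a *\<^sub>R x) = a *\<^sub>R imul x" "imul (imul x) = - x"
  "imul (- x) = - imul x" "imul (x - y) = imul x - imul y" "imul 0 = 0"
  by (auto simp: imul_def prod_eq_iff)

lemma imul_sum: "imul (\<Sum>i\<in>K. f i) = (\<Sum>i\<in>K. imul (f i))"
  by (induction K rule: infinite_finite_induct) (auto simp: imul_simps)

context vec_bundle
begin

lemma subspace_cfibre: "subspace (cfibre E p)"
  unfolding cfibre_def by (rule subspace_Times[OF subspace_fibre subspace_fibre])

lemmas cfibre_add = subspace_add[OF subspace_cfibre]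
  and cfibre_scale = subspace_scale[OF subspace_cfibre]
  and cfibre_neg = subspace_neg[OF subspace_cfibre]
  and cfibre_diff = subspace_diff[OF subspace_cfibre]
  and cfibre_zero = subspace_0[OF subspace_cfibre]
  and cfibre_sum = subspace_sum[OF subspace_cfibre]

lemma cfibre_iff: "(a, b) \<in> cfibre E p \<longleftrightarrow> a \<in> fibre E p \<and> b \<in> fibre E p"
  by (simp add: cfibre_def)

lemma cfibre_imul: "x \<in> cfibre E p \<Longrightarrow> imul x \<in> cfibre E p"
  by (auto simp: cfibre_def imul_def fibre_neg)

end

context metric_bundle
begin

lemma orth_span:
  assumes "B \<subseteq> fibre E p" "y \<in> fibre E p" "\<And>b. b \<in> B \<Longrightarrow> g p y b = 0" "z \<in> span B"
  shows "g p y z = 0"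
proof -
  have "z \<in> fibre E p \<and> g p y z = 0"
    using assms(4)
  proof (induction rule: span_induct_alt)
    case base
    then show ?case using g_zero fibre_zero assms(2) by simp
  next
    case (step c b z)
    then have b: "b \<in> fibre E p" using assms(1) by blast
    then show ?case
      using step assms(2,3) by (simp add: g_add_right g_scale_right fibre_add fibre_scale)
  qed
  then show ?thesis by simp
qed

text \<open>
  Gram--Schmidt: a new vector \<open>u\<close> is replaced by its component \<open>u'\<close> orthogonal to the previous ones, and the
  approximation of \<open>y\<close> is corrected by a multiple of \<open>u'\<close>.
\<close>
lemma orth_projection:
  assumes "finite B" "B \<subseteq> fibre E p" "y \<in> fibre E p"
  shows "\<exists>z\<in>span B. \<forall>b\<in>B. g p (y - z) b = 0"
  using assms
proof (induction B arbitrary: y rule: finite_induct)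
  case empty
  then show ?case by auto
next
  case (insert u B)
  have uB: "u \<in> fibre E p" "B \<subseteq> fibre E p" using insert.prems by auto
  have sp: "z \<in> fibre E p" if "z \<in> span B" for z
    using that uB(2) span_minimal[OF uB(2) subspace_fibre] by blast
  obtain zu where zu: "zu \<in> span B" "\<forall>b\<in>B. g p (u - zu) b = 0" using insert.IH[OF uB(2,1)] by blast
  obtain z where z: "z \<in> span B" "\<forall>b\<in>B. g p (y - z) b = 0" using insert.IH[OF uB(2) insert.prems(2)] by blast
  define u' where "u' = u - zu"
  define y' where "y' = y - z"
  have f: "u' \<in> fibre E p" "y' \<in> fibre E p" "zu \<in> fibre E p"
    using uB sp zu z insert.prems unfolding u'_def y'_def by (auto intro: fibre_diff)
  define c where "c = (if u' = 0 then 0 else g p y' u' / g p u' u')"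
  have cu: "g p y' u' = c * g p u' u'"
    using g_pos[OF f(1,1)] g_zero(2)[OF f(2)] by (auto simp: c_def)
  have r: "y' - c *\<^sub>R u' \<in> fibre E p" using f by (intro fibre_diff fibre_scale)
  have B0: "g p (y' - c *\<^sub>R u') b = 0" if "b \<in> B" for b
    using that z zu uB f by (auto simp: g_diff fibre_scale g_scale_left y'_def[symmetric] u'_def[symmetric])
  have "g p (y' - c *\<^sub>R u') u = g p (y' - c *\<^sub>R u') (u' + zu)" by (simp add: u'_def)
  also have "\<dots> = g p (y' - c *\<^sub>R u') u' + g p (y' - c *\<^sub>R u') zu" by (rule g_add_right[OF f(1,3) r])
  also have "g p (y' - c *\<^sub>R u') zu = 0" by (rule orth_span[OF uB(2) r B0 zu(1)])
  also have "g p (y' - c *\<^sub>R u') u' = 0" using f cu by (simp add: g_diff fibre_scale g_scale_left)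
  finally have u0: "g p (y' - c *\<^sub>R u') u = 0" by simp
  have eq: "y - (z + c *\<^sub>R u') = y' - c *\<^sub>R u'" by (simp add: y'_def)
  have "z + c *\<^sub>R u' \<in> span (insert u B)"
  proof -
    have "span B \<subseteq> span (insert u B)" by (rule span_mono) auto
    then show ?thesis
      using z(1) zu(1) unfolding u'_def by (intro span_add span_scale span_diff) (auto intro: span_base)
  qed
  moreover have "\<forall>b\<in>insert u B. g p (y - (z + c *\<^sub>R u')) b = 0"
    unfolding eq using B0 u0 by blast
  ultimately show ?case by blast
qed

text \<open>The equation \<open>J (a + \<i> b) = - \<i> (a + \<i> b)\<close> says that \<open>b = J a\<close>.\<close>
lemma E01_graph:
  assumes "x \<in> twistor E g"
  shows "E01 E x = (\<lambda>a. (a, snd x a)) ` fibre E (fst x)"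
proof -
  have "y \<in> E01 E x \<longleftrightarrow> fst y \<in> fibre E (fst x) \<and> snd y = snd x (fst y)" for y
  proof -
    have "y \<in> E01 E x \<longleftrightarrow> fst y \<in> fibre E (fst x) \<and> snd y \<in> fibre E (fst x) \<and>
        snd x (fst y) = snd y \<and> snd x (snd y) = - fst y"
      by (cases x) (auto simp: E01_def cfibre_def imul_def mem_Times_iff)
    then show ?thesis
      using twistorD(2)[OF assms, of "fst y"] End_in[OF twistorD(1)[OF assms], of "fst y"] by auto
  qed
  then show ?thesis by (auto simp: image_iff prod_eq_iff)
qed

lemma twistor_eqI:
  assumes "x \<in> twistor E g" "x' \<in> twistor E g" "fst x = fst x'" "E01 E x = E01 E x'"
  shows "x = x'"
proof -
  have "snd x a = snd x' a" if "a \<in> fibre E (fst x)" for a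
  proof -
    have "(a, snd x a) \<in> E01 E x'" using that assms by (auto simp: E01_graph[symmetric] E01_graph[OF assms(1)])
    then show ?thesis by (auto simp: E01_graph[OF assms(2)])
  qed
  then have "snd x = snd x'"
    using End_eqI twistorD(1)[OF assms(1)] twistorD(1)[OF assms(2)] assms(3) by simp
  then show ?thesis using assms(3) by (simp add: prod_eq_iff)
qed

end

locale metric_pair = e: metric_bundle M E g + f: metric_bundle M E' g'
  for M :: "('m::{t2_space,second_countable_topology}, 'n::finite) cmanifold"
    and E :: "('m, 'v::real_vector, 'k::finite) vbundle" and g :: "'m \<Rightarrow> 'v \<Rightarrow> 'v \<Rightarrow> real"
    and E' :: "('m, 'w::real_vector, 'l::finite) vbundle" and g' :: "'m \<Rightarrow> 'w \<Rightarrow> 'w \<Rightarrow> real"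

locale metric_iso = metric_pair M E g E' g'
  for M :: "('m::{t2_space,second_countable_topology}, 'n::finite) cmanifold"
    and E :: "('m, 'v::real_vector, 'k::finite) vbundle" and g :: "'m \<Rightarrow> 'v \<Rightarrow> 'v \<Rightarrow> real"
    and E' :: "('m, 'w::real_vector, 'l::finite) vbundle" and g' :: "'m \<Rightarrow> 'w \<Rightarrow> 'w \<Rightarrow> real" +
  fixes A :: "'m \<Rightarrow> 'v \<times> 'v \<Rightarrow> 'w \<times> 'w"
  assumes A_bij: "bij_betw (A p) (cfibre E p) (cfibre E' p)"
    and A_add: "x \<in> cfibre E p \<Longrightarrow> y \<in> cfibre E p \<Longrightarrow> A p (x + y) = A p x + A p y"
    and A_scale: "x \<in> cfibre E p \<Longrightarrow> A p (a *\<^sub>R x) = a *\<^sub>R A p x"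
    and A_imul: "x \<in> cfibre E p \<Longrightarrow> A p (imul x) = imul (A p x)"
    and A_orth: "x \<in> cfibre E p \<Longrightarrow> y \<in> cfibre E p \<Longrightarrow> cbilinear (g' p) (A p x) (A p y) = cbilinear (g p) x y"
begin

lemma A_in: "x \<in> cfibre E p \<Longrightarrow> A p x \<in> cfibre E' p"
  using A_bij bij_betwE by blast

lemma A_inj: "x \<in> cfibre E p \<Longrightarrow> y \<in> cfibre E p \<Longrightarrow> A p x = A p y \<Longrightarrow> x = y"
  using A_bij[of p] by (auto simp: bij_betw_def inj_on_def)

lemma A_zero: "A p 0 = 0"
  using A_scale[OF e.cfibre_zero, of p 0] by simp

lemma A_neg: "x \<in> cfibre E p \<Longrightarrow> A p (- x) = - A p x"
  using A_scale[of x p "-1"] by simp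

lemma A_lincomb:
  assumes "\<And>j. j \<in> K \<Longrightarrow> y j \<in> cfibre E p"
  shows "A p (\<Sum>j\<in>K. a j *\<^sub>R y j) = (\<Sum>j\<in>K. a j *\<^sub>R A p (y j))"
  using assms
  by (induction K rule: infinite_finite_induct) (auto simp: A_zero A_add A_scale e.cfibre_sum e.cfibre_scale)

lemma A_snd: "b \<in> fibre E p \<Longrightarrow> A p (0, b) = imul (A p (b, 0))"
  using A_imul[of "(b, 0)" p] by (simp add: imul_def e.cfibre_iff e.fibre_zero)

lemma A_pair: "a \<in> fibre E p \<Longrightarrow> b \<in> fibre E p \<Longrightarrow> A p (a, b) = A p (a, 0) + imul (A p (b, 0))"
  using A_add[of "(a, 0)" p "(0, b)"] A_snd by (simp add: e.cfibre_iff e.fibre_zero)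

lemma inverse_iso: "metric_iso M E' g' E g (\<lambda>p. inv_into (cfibre E p) (A p))"
proof unfold_locales
  fix p
  let ?B = "inv_into (cfibre E p) (A p)"
  show bij: "bij_betw ?B (cfibre E' p) (cfibre E p)" by (rule bij_betw_inv_into[OF A_bij])
  have B: "?B y \<in> cfibre E p" "A p (?B y) = y" if "y \<in> cfibre E' p" for y
    using that bij bij_betwE A_bij bij_betw_inv_into_right by metis+
  show "?B (x + y) = ?B x + ?B y" if "x \<in> cfibre E' p" "y \<in> cfibre E' p" for x y
    using B[OF that(1)] B[OF that(2)] B[OF f.cfibre_add[OF that]]
    by (intro A_inj[of _ p]) (auto simp: A_add e.cfibre_add)
  show "?B (a *\<^sub>R x) = a *\<^sub>R ?B x" if "x \<in> cfibre E' p" for x a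
    using B[OF that] B[OF f.cfibre_scale[OF that]]
    by (intro A_inj[of _ p]) (auto simp: A_scale e.cfibre_scale)
  show "?B (imul x) = imul (?B x)" if "x \<in> cfibre E' p" for x
    using B[OF that] B[OF f.cfibre_imul[OF that]]
    by (intro A_inj[of _ p]) (auto simp: A_imul e.cfibre_imul)
  show "cbilinear (g p) (?B x) (?B y) = cbilinear (g' p) x y" if "x \<in> cfibre E' p" "y \<in> cfibre E' p" for x y
    using A_orth[of "?B x" p "?B y"] B that by simp
qed

context
  fixes x assumes x: "x \<in> twistor E g"
begin

text \<open>The image of \<open>E\<^sup>0\<^sup>,\<^sup>1\<^bsub>J\<^esub>\<close> under \<open>A\<close> is parametrised by \<open>a \<mapsto> (re a, re (J a))\<close>.\<close>
definition re :: "'v \<Rightarrow> 'w" where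
  "re a = fst (A (fst x) (a, snd x a))"

lemma graph_in: "a \<in> fibre E (fst x) \<Longrightarrow> (a, snd x a) \<in> cfibre E (fst x)"
  by (simp add: e.cfibre_iff e.End_in[OF e.twistorD(1)[OF x]])

lemma A_graph:
  assumes a: "a \<in> fibre E (fst x)"
  shows "A (fst x) (a, snd x a) = (re a, re (snd x a))"
proof -
  have "(snd x a, snd x (snd x a)) = - imul (a, snd x a)"
    using e.twistorD(2)[OF x a] by (simp add: imul_def)
  then have "A (fst x) (snd x a, snd x (snd x a)) = - imul (A (fst x) (a, snd x a))"
    using graph_in[OF a] by (simp add: A_neg A_imul e.cfibre_imul)
  then have "re (snd x a) = snd (A (fst x) (a, snd x a))" by (simp add: re_def imul_def)
  then show ?thesis by (simp add: re_def prod_eq_iff)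
qed

lemma re_in: "a \<in> fibre E (fst x) \<Longrightarrow> re a \<in> fibre E' (fst x)"
  using A_in[OF graph_in] by (auto simp: A_graph f.cfibre_iff)

lemma re_add:
  assumes "a \<in> fibre E (fst x)" "b \<in> fibre E (fst x)"
  shows "re (a + b) = re a + re b"
  using A_add[OF graph_in[OF assms(1)] graph_in[OF assms(2)]] e.End_add[OF e.twistorD(1)[OF x] assms]
  by (simp add: re_def)

lemma re_scale:
  assumes "a \<in> fibre E (fst x)"
  shows "re (c *\<^sub>R a) = c *\<^sub>R re a"
  using A_scale[OF graph_in[OF assms], of c] e.End_scale[OF e.twistorD(1)[OF x] assms, of c]
  by (simp add: re_def)

lemma re_lincomb:
  assumes "\<And>j. j \<in> K \<Longrightarrow> a j \<in> fibre E (fst x)"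
  shows "re (\<Sum>j\<in>K. c j *\<^sub>R a j) = (\<Sum>j\<in>K. c j *\<^sub>R re (a j))"
  using assms
proof (induction K rule: infinite_finite_induct)
  case (insert j K)
  then show ?case by (simp add: re_add re_scale e.fibre_sum e.fibre_scale)
qed (use re_scale[OF e.fibre_zero, of 0] in auto)

lemma re_isotropic:
  assumes a: "a \<in> fibre E (fst x)" and b: "b \<in> fibre E (fst x)"
  shows "g' (fst x) (re (snd x a)) (re (snd x b)) = g' (fst x) (re a) (re b)"
proof -
  have "g (fst x) a (snd x b) + g (fst x) (snd x a) b = 0"
    using e.twistor_skew[OF x a b] by simp
  then have "cbilinear (g (fst x)) (a, snd x a) (b, snd x b) = 0"
    using e.twistorD(3)[OF x a b] by (simp add: cbilinear_def complex_eq_iff)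
  then have "cbilinear (g' (fst x)) (re a, re (snd x a)) (re b, re (snd x b)) = 0"
    using A_orth[OF graph_in[OF a] graph_in[OF b]] by (simp add: A_graph a b)
  then show ?thesis by (simp add: cbilinear_def complex_eq_iff)
qed

text \<open>
  Maximality of the isotropic subspace \<open>E\<^sup>0\<^sup>,\<^sup>1\<close>: if \<open>u + \<i> v\<close> is orthogonal to all \<open>a + \<i> J a\<close>, the imaginary
  part \<open>g(u, J a) + g(v, a)\<close> vanishes for all \<open>a\<close>, and \<open>J\<close> is skew.
\<close>
lemma graph_maximal:
  assumes uv: "(u, v) \<in> cfibre E (fst x)"
    and orth: "\<And>a. a \<in> fibre E (fst x) \<Longrightarrow> cbilinear (g (fst x)) (u, v) (a, snd x a) = 0"
  shows "v = snd x u"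
proof -
  have f: "u \<in> fibre E (fst x)" "v \<in> fibre E (fst x)" using uv by (auto simp: e.cfibre_iff)
  note J = e.twistorD(1)[OF x]
  show ?thesis
  proof (rule e.g_nondegenerate[OF f(2) e.End_in[OF J f(1)]])
    fix a assume a: "a \<in> fibre E (fst x)"
    have "g (fst x) u (snd x a) + g (fst x) v a = 0"
      using orth[OF a] by (simp add: cbilinear_def complex_eq_iff)
    then show "g (fst x) v a = g (fst x) (snd x u) a" using e.twistor_skew[OF x f(1) a] by simp
  qed
qed

lemma re_inj:
  assumes a: "a \<in> fibre E (fst x)" and 0: "re a = 0"
  shows "a = 0"
proof -
  have "re (snd x a) = 0"
    using re_isotropic[OF a a] 0 f.g_zero(1)[OF f.fibre_zero] f.g_definite re_in[OF e.End_in[OF e.twistorD(1)[OF x] a]] by simp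
  then have "A (fst x) (a, snd x a) = A (fst x) 0" using A_graph[OF a] 0 A_zero by (simp add: zero_prod_def)
  then have "(a, snd x a) = 0" by (rule A_inj[OF graph_in[OF a] e.cfibre_zero])
  then show ?thesis by (simp add: zero_prod_def)
qed

text \<open>
  Surjectivity without counting dimensions: a real vector \<open>y\<close> orthogonal to the image of \<open>re\<close> is
  complex orthogonal to \<open>A(E\<^sup>0\<^sup>,\<^sup>1)\<close>, hence lies in this isotropic subspace, so that \<open>g'(y, y) = 0\<close>.
\<close>
lemma re_surj:
  assumes y: "y \<in> fibre E' (fst x)"
  obtains a where "a \<in> fibre E (fst x)" "re a = y"
proof -
  let ?p = "fst x"
  note J = e.twistorD(1)[OF x]
  obtain V s where vs: "(V, s) \<in> frames E" "?p \<in> V" by (rule e.frame_exists)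
  let ?B = "(\<lambda>i. re (s i ?p)) ` bindex E"
  have sf: "s i ?p \<in> fibre E ?p" if "i \<in> bindex E" for i by (rule e.frame_in_fibre[OF vs that])
  have B: "?B \<subseteq> fibre E' ?p" using re_in sf by auto
  have "finite ?B" by simp
  from f.orth_projection[OF this B y] obtain z where z: "z \<in> span ?B" "\<forall>b\<in>?B. g' ?p (y - z) b = 0" by blast
  have sub: "subspace (re ` fibre E ?p)"
    unfolding subspace_def
  proof (intro conjI ballI allI)
    have "re (0 *\<^sub>R 0) = 0 *\<^sub>R re 0" by (rule re_scale[OF e.fibre_zero])
    then show "0 \<in> re ` fibre E ?p" using e.fibre_zero by (metis image_eqI scaleR_zero_left)
    show "u + v \<in> re ` fibre E ?p" if "u \<in> re ` fibre E ?p" "v \<in> re ` fibre E ?p" for u v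
      using that re_add e.fibre_add by (auto simp: image_iff) metis
    show "c *\<^sub>R u \<in> re ` fibre E ?p" if "u \<in> re ` fibre E ?p" for c u
      using that re_scale e.fibre_scale by (auto simp: image_iff) metis
  qed
  have "span ?B \<subseteq> re ` fibre E ?p" using sf by (intro span_minimal sub) auto
  then obtain a where a: "a \<in> fibre E ?p" "re a = z" using z(1) by blast
  define y0 where "y0 = y - z"
  have y0: "y0 \<in> fibre E' ?p" using y re_in[OF a(1)] a(2) by (simp add: y0_def f.fibre_diff)
  have perp: "g' ?p y0 (re b) = 0" if b: "b \<in> fibre E ?p" for b
  proof -
    have "re b = (\<Sum>i\<in>bindex E. coef E s ?p b i *\<^sub>R re (s i ?p))"
      using re_lincomb[of "bindex E" "\<lambda>i. s i ?p" "coef E s ?p b"] sf e.coef_expand[OF vs b] by simp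
    then have "g' ?p y0 (re b) = (\<Sum>i\<in>bindex E. coef E s ?p b i * g' ?p y0 (re (s i ?p)))"
      using f.g_sum_right[OF _ y0, of "bindex E" "\<lambda>i. re (s i ?p)" "coef E s ?p b"] sf re_in by simp
    then show ?thesis using z(2) by (simp add: y0_def)
  qed
  have "(y0, 0) \<in> cfibre E' ?p" using y0 f.fibre_zero by (simp add: f.cfibre_iff)
  then obtain uv where uv: "uv \<in> cfibre E ?p" "A ?p uv = (y0, 0)"
    using bij_betw_imp_surj_on[OF A_bij[of ?p]] by (metis imageE)
  have "cbilinear (g ?p) uv (b, snd x b) = 0" if b: "b \<in> fibre E ?p" for b
  proof -
    have Jb: "snd x b \<in> fibre E ?p" by (rule e.End_in[OF J b])
    have "cbilinear (g ?p) uv (b, snd x b) = cbilinear (g' ?p) (y0, 0) (re b, re (snd x b))"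
      using A_orth[OF uv(1) graph_in[OF b]] by (simp add: uv(2) A_graph[OF b])
    also have "\<dots> = 0"
      using perp[OF b] perp[OF Jb] f.g_zero(1)[OF re_in[OF b]] f.g_zero(1)[OF re_in[OF Jb]]
      by (simp add: cbilinear_def complex_eq_iff)
    finally show ?thesis .
  qed
  then have "snd uv = snd x (fst uv)" using graph_maximal[of "fst uv" "snd uv"] uv(1) by simp
  then have "A ?p uv = (re (fst uv), re (snd x (fst uv)))"
    using A_graph[of "fst uv"] uv(1) by (metis e.cfibre_iff prod.collapse)
  then have "y0 = re (fst uv)" "0 = re (snd x (fst uv))" using uv(2) by auto
  then have "g' ?p y0 y0 = 0"
    using re_isotropic[of "fst uv" "fst uv"] uv(1) f.g_zero(1)[OF f.fibre_zero]
    by (metis e.cfibre_iff prod.collapse)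
  then have "y0 = 0" by (rule f.g_definite[OF y0])
  then show ?thesis using that a by (simp add: y0_def)
qed

text \<open>As \<open>re\<close> is bijective, \<open>J' = re \<circ> J \<circ> re\<inverse>\<close> has the required graph.\<close>
lemma image_exists: "\<exists>x'. x' \<in> twistor E' g' \<and> fst x' = fst x \<and> E01 E' x' = A (fst x) ` E01 E x"
proof -
  let ?p = "fst x"
  note J = e.twistorD(1)[OF x] and J_in = e.End_in[OF e.twistorD(1)[OF x]]
  have "\<forall>y\<in>fibre E' ?p. \<exists>a. a \<in> fibre E ?p \<and> re a = y" using re_surj by metis
  then obtain r where r: "\<And>y. y \<in> fibre E' ?p \<Longrightarrow> r y \<in> fibre E ?p \<and> re (r y) = y"
    using bchoice[of "fibre E' ?p" "\<lambda>y a. a \<in> fibre E ?p \<and> re a = y"] by blast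
  have re_eq: "a = b" if "a \<in> fibre E ?p" "b \<in> fibre E ?p" "re a = re b" for a b
  proof -
    have "re (a + (-1) *\<^sub>R b) = 0"
      using that by (simp only: re_add[OF that(1) e.fibre_scale[OF that(2)]] re_scale[OF that(2)]) simp
    then have "a + (-1) *\<^sub>R b = 0" by (rule re_inj[OF e.fibre_add[OF that(1) e.fibre_scale[OF that(2)]]])
    then show ?thesis by simp
  qed
  have r_re: "r (re a) = a" if "a \<in> fibre E ?p" for a
    using r[OF re_in[OF that]] that by (intro re_eq) auto
  define J' where "J' y = (if y \<in> fibre E' ?p then re (snd x (r y)) else 0)" for y
  have J'_re: "J' (re a) = re (snd x a)" if "a \<in> fibre E ?p" for a
    using re_in[OF that] by (simp add: J'_def r_re[OF that])
  have r_add: "r (y + y') = r y + r y'" if "y \<in> fibre E' ?p" "y' \<in> fibre E' ?p" for y y'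
    using r[OF that(1)] r[OF that(2)] r[OF f.fibre_add[OF that]]
    by (intro re_eq) (auto simp: re_add e.fibre_add)
  have r_scale: "r (c *\<^sub>R y) = c *\<^sub>R r y" if "y \<in> fibre E' ?p" for y c
    using r[OF that] r[OF f.fibre_scale[OF that]]
    by (intro re_eq) (auto simp: re_scale e.fibre_scale)
  have "J' \<in> End_fibre E' ?p"
    using r re_in J_in
    by (auto simp: End_fibre_def J'_def r_add r_scale re_add re_scale e.End_add[OF J] e.End_scale[OF J] f.fibre_add f.fibre_scale)
  moreover have "J' (J' y) = - y" if y: "y \<in> fibre E' ?p" for y
  proof -
    have ry: "r y \<in> fibre E ?p" "re (r y) = y" using r[OF y] by auto
    have "J' (J' y) = re (snd x (snd x (r y)))"
      using J'_re[OF ry(1)] J'_re[OF J_in[OF ry(1)]] ry(2) by simp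
    also have "\<dots> = - y"
      using re_scale[OF ry(1), of "-1"] ry(2) by (simp add: e.twistorD(2)[OF x ry(1)])
    finally show ?thesis .
  qed
  moreover have "g' ?p (J' y) (J' y') = g' ?p y y'" if y: "y \<in> fibre E' ?p" "y' \<in> fibre E' ?p" for y y'
    using re_isotropic[of "r y" "r y'"] r[OF y(1)] r[OF y(2)] by (simp add: J'_def y)
  ultimately have tw: "(?p, J') \<in> twistor E' g'" by (simp add: twistor_def)
  have "E01 E' (?p, J') = A ?p ` E01 E x"
  proof -
    have "fibre E' ?p = re ` fibre E ?p"
      using r re_in by (auto simp: image_iff) metis
    then have "E01 E' (?p, J') = (\<lambda>a. (re a, J' (re a))) ` fibre E ?p"
      by (simp add: f.E01_graph[OF tw] image_image)
    also have "\<dots> = (\<lambda>a. A ?p (a, snd x a)) ` fibre E ?p"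
      by (intro image_cong refl) (simp add: J'_re A_graph)
    finally show ?thesis by (simp add: e.E01_graph[OF x] image_image)
  qed
  then show ?thesis using tw by (intro exI[of _ "(?p, J')"]) auto
qed

lemma image_unique: "\<exists>!x'. x' \<in> twistor E' g' \<and> fst x' = fst x \<and> E01 E' x' = A (fst x) ` E01 E x"
  using image_exists f.twistor_eqI by (metis (no_types, lifting))

lemma induced_map:
  shows "induced_twistor_map E E' g' A x \<in> twistor E' g'"
    and "fst (induced_twistor_map E E' g' A x) = fst x"
    and "E01 E' (induced_twistor_map E E' g' A x) = A (fst x) ` E01 E x"
  using theI'[OF image_unique] unfolding induced_twistor_map_def by blast+

lemma induced_map_re:
  assumes "a \<in> fibre E (fst x)"
  shows "snd (induced_twistor_map E E' g' A x) (re a) = re (snd x a)"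
proof -
  have "A (fst x) (a, snd x a) \<in> E01 E' (induced_twistor_map E E' g' A x)"
    using assms by (simp add: induced_map(3) e.E01_graph[OF x])
  then show ?thesis
    using assms by (auto simp: A_graph f.E01_graph[OF induced_map(1)])
qed

end

lemma induced_map_inverse:
  assumes "x \<in> twistor E g"
  shows "induced_twistor_map E' E g (\<lambda>p. inv_into (cfibre E p) (A p)) (induced_twistor_map E E' g' A x) = x"
proof -
  interpret inv: metric_iso M E' g' E g "\<lambda>p. inv_into (cfibre E p) (A p)" by (rule inverse_iso)
  let ?x' = "induced_twistor_map E E' g' A x"
  note 1 = induced_map[OF assms] and 2 = inv.induced_map[OF induced_map(1)[OF assms]]
  have sub: "E01 E x \<subseteq> cfibre E (fst x)" using e.E01_graph[OF assms] graph_in[OF assms] by auto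
  show ?thesis
  proof (rule e.twistor_eqI[OF 2(1) assms])
    have "inv_into (cfibre E (fst x)) (A (fst x)) ` A (fst x) ` E01 E x = E01 E x"
      using sub A_bij[of "fst x"] by (intro inv_into_image_cancel) (auto simp: bij_betw_def)
    then show "E01 E (induced_twistor_map E' E g (\<lambda>p. inv_into (cfibre E p) (A p)) ?x') = E01 E x"
      using 1 2 by simp
  qed (use 1 2 in simp)
qed

lemma induced_map_inverse':
  assumes "y \<in> twistor E' g'"
  shows "induced_twistor_map E E' g' A (induced_twistor_map E' E g (\<lambda>p. inv_into (cfibre E p) (A p)) y) = y"
proof -
  interpret inv: metric_iso M E' g' E g "\<lambda>p. inv_into (cfibre E p) (A p)" by (rule inverse_iso)
  let ?x = "induced_twistor_map E' E g (\<lambda>p. inv_into (cfibre E p) (A p)) y"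
  note 1 = inv.induced_map[OF assms] and 2 = induced_map[OF inv.induced_map(1)[OF assms]]
  have sub: "E01 E' y \<subseteq> cfibre E' (fst y)" using f.E01_graph[OF assms] inv.graph_in[OF assms] by auto
  show ?thesis
  proof (rule f.twistor_eqI[OF 2(1) assms])
    have "A (fst y) ` inv_into (cfibre E (fst y)) (A (fst y)) ` E01 E' y = E01 E' y"
      using sub A_bij[of "fst y"] by (intro image_inv_into_cancel) (auto simp: bij_betw_def)
    then show "E01 E' (induced_twistor_map E E' g' A ?x) = E01 E' y"
      using 1 2 by simp
  qed (use 1 2 in simp)
qed

lemma induced_map_bij:
  "bij_betw (induced_twistor_map E E' g' A) (twistor E g) (twistor E' g')"
  "y \<in> twistor E' g' \<Longrightarrow> inv_into (twistor E g) (induced_twistor_map E E' g' A) y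
      = induced_twistor_map E' E g (\<lambda>p. inv_into (cfibre E p) (A p)) y"
proof -
  interpret inv: metric_iso M E' g' E g "\<lambda>p. inv_into (cfibre E p) (A p)" by (rule inverse_iso)
  show bij: "bij_betw (induced_twistor_map E E' g' A) (twistor E g) (twistor E' g')"
    by (rule bij_betw_byWitness[where f'="induced_twistor_map E' E g (\<lambda>p. inv_into (cfibre E p) (A p))"])
      (use induced_map_inverse induced_map_inverse' induced_map(1) inv.induced_map(1) in auto)
  show "inv_into (twistor E g) (induced_twistor_map E E' g' A) y
      = induced_twistor_map E' E g (\<lambda>p. inv_into (cfibre E p) (A p)) y" if "y \<in> twistor E' g'"
    using bij induced_map_inverse'[OF that] inv.induced_map(1)[OF that]
    by (intro inv_into_f_eq) (auto simp: bij_betw_def)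
qed

end

section \<open>Smoothness of the induced map\<close>

context metric_pair
begin

lemma fibred_map_germ:
  assumes F: "\<And>y. y \<in> twistor E g \<Longrightarrow> F y \<in> twistor E' g' \<and> fst (F y) = fst y"
    and uz: "(U, z) \<in> atlas M" and vs: "(V, s) \<in> frames E" and x: "x \<in> e.tdom U V"
    and entry: "\<And>k l. k \<in> bindex E' \<Longrightarrow> l \<in> bindex E' \<Longrightarrow>
      germ_smooth (e.tdom U V) (e.tchart z s) x (\<lambda>y. frame_matrix E' s' (fst y) (snd (F y)) $ k $ l)"
    and b: "b \<in> Basis"
  shows "germ_smooth (e.tdom U V) (e.tchart z s) x (\<lambda>y. f.tchart z s' (F y) \<bullet> b)"
  using b
proof (rule f.tchart_Basis[where z=z and s=s'])
  have p: "fst x \<in> U" using x by (simp add: e.tdom_def)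
  have Fy: "fst (F y) = fst y" if "y \<in> e.tdom U V" for y using F that by (simp add: e.tdom_def)
  {
    fix a assume "\<And>y. f.tchart z s' y \<bullet> b = z (fst y) \<bullet> a"
    then have eq: "f.tchart z s' (F y) \<bullet> b = z (fst y) \<bullet> a" if "y \<in> e.tdom U V" for y using Fy[OF that] by simp
    have "germ_smooth U z (fst x) (\<lambda>q. z q \<bullet> a)" by (rule germ_smooth_component)
    from e.germ_pullback[OF uz vs this] show ?thesis
      by (rule germ_smooth_cong[where W=UNIV, rotated 3]) (use eq in auto)
  next
    fix i j assume "\<And>y. f.tchart z s' y \<bullet> b = f.fmat s' y $ i $ j"
    then have eq: "f.tchart z s' (F y) \<bullet> b = frame_matrix E' s' (fst y) (snd (F y)) $ i $ j" if "y \<in> e.tdom U V" for y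
      using Fy[OF that] by simp
    have "germ_smooth (e.tdom U V) (e.tchart z s) x (\<lambda>y. frame_matrix E' s' (fst y) (snd (F y)) $ i $ j)"
    proof (cases "i \<in> bindex E' \<and> j \<in> bindex E'")
      case False
      then show ?thesis using germ_smooth_const[of _ _ _ 0] by (auto simp: frame_matrix_def)
    qed (use entry in blast)
    then show ?thesis
      by (rule germ_smooth_cong[where W=UNIV, rotated 3]) (use eq in auto)
  }
qed

text \<open>
  The coordinates of the target, composed with \<open>F\<close>, play the role of a chart on the source; a change of chart
  then reduces smoothness of \<open>F\<close> to smoothness of the matrix entries of \<open>F\<close>.
\<close>
lemma fibred_map_smooth:
  assumes F: "\<And>y. y \<in> twistor E g \<Longrightarrow> F y \<in> twistor E' g' \<and> fst (F y) = fst y"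
    and entry: "\<And>U z V s V' s' x k l. (U, z) \<in> atlas M \<Longrightarrow> (V, s) \<in> frames E \<Longrightarrow> (V', s') \<in> frames E' \<Longrightarrow>
      x \<in> e.tdom U V \<Longrightarrow> fst x \<in> V' \<Longrightarrow> k \<in> bindex E' \<Longrightarrow> l \<in> bindex E' \<Longrightarrow>
      germ_smooth (e.tdom U V) (e.tchart z s) x (\<lambda>y. frame_matrix E' s' (fst y) (snd (F y)) $ k $ l)"
  shows "smooth_map (twistor E g) (twistor_smooth_near M E g) (twistor E' g') (twistor_smooth_near M E' g') F"
  unfolding smooth_map_def
proof (intro conjI ballI allI impI)
  show "F ` twistor E g \<subseteq> twistor E' g'" using F by auto
  fix x h assume x: "x \<in> twistor E g" and h: "twistor_smooth_near M E' g' (F x) h"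
  obtain U z V s where uz: "(U, z) \<in> atlas M" and vs: "(V, s) \<in> frames E" and xt: "x \<in> e.tdom U V"
    using e.tdom_exists[OF x] by blast
  obtain V' s' where vs': "(V', s') \<in> frames E'" "fst x \<in> V'" by (rule f.frame_exists)
  have p: "fst x \<in> U" "fst x \<in> V" using xt by (auto simp: e.tdom_def)
  have Fx: "F x \<in> f.tdom U V'" using F[OF x] p vs' by (simp add: f.tdom_def)
  have hF: "germ_smooth (f.tdom U V') (f.tchart z s') (F x) h"
    using h f.twistor_smooth_iff[OF uz vs'(1) Fx] by simp
  obtain W G where G: "open W" "f.tchart z s' (F x) \<in> W" "smooth_on W G"
      "\<And>y. y \<in> f.tdom U V' \<Longrightarrow> f.tchart z s' y \<in> W \<Longrightarrow> h y = G (f.tchart z s' y)"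
    using germ_smoothE[OF hF] by blast
  have germ: "germ_smooth {y \<in> e.tdom U V. fst y \<in> V'} (\<lambda>y. f.tchart z s' (F y)) x (h \<circ> F)"
  proof (rule germ_smoothI[where c="\<lambda>y. f.tchart z s' (F y)" and x=x, OF G(1-3)])
    fix y assume y: "y \<in> {y \<in> e.tdom U V. fst y \<in> V'}" "f.tchart z s' (F y) \<in> W"
    then have "F y \<in> f.tdom U V'" using F by (auto simp: e.tdom_def f.tdom_def)
    then show "(h \<circ> F) y = G (f.tchart z s' (F y))" using G(4) y by simp
  qed
  obtain W0 where W0: "open W0" "e.tchart z s x \<in> W0" "\<forall>y\<in>e.tdom U V. e.tchart z s y \<in> W0 \<longrightarrow> fst y \<in> V'"
    using e.tdom_nbhd[OF uz vs p(1) f.frame_open[OF vs'(1)] vs'(2)] by blast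
  have "germ_smooth (e.tdom U V) (e.tchart z s) x (h \<circ> F)"
    by (rule germ_smooth_change_chart[OF xt germ fibred_map_germ[OF F uz vs xt entry[OF uz vs vs'(1) xt vs'(2)]] W0(1,2)])
      (use W0(3) in auto)
  then show "twistor_smooth_near M E g x (h \<circ> F)" using e.twistor_smooth_iff[OF uz vs xt] by simp
qed

lemma fibred_map_curve:
  assumes F: "\<And>y. y \<in> twistor E g \<Longrightarrow> F y \<in> twistor E' g' \<and> fst (F y) = fst y"
    and entry: "\<And>U z V s V' s' x k l. (U, z) \<in> atlas M \<Longrightarrow> (V, s) \<in> frames E \<Longrightarrow> (V', s') \<in> frames E' \<Longrightarrow>
      x \<in> e.tdom U V \<Longrightarrow> fst x \<in> V' \<Longrightarrow> k \<in> bindex E' \<Longrightarrow> l \<in> bindex E' \<Longrightarrow>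
      germ_smooth (e.tdom U V) (e.tchart z s) x (\<lambda>y. frame_matrix E' s' (fst y) (snd (F y)) $ k $ l)"
    and \<Gamma>: "twistor_curve M E g S \<Gamma>" and S: "open S"
  shows "twistor_curve M E' g' S (\<lambda>t. F (\<Gamma> t))"
proof (rule f.twistor_curveI_local)
  show "F (\<Gamma> t) \<in> twistor E' g'" if "t \<in> S" for t using F e.twistor_curve_in[OF \<Gamma> that] by blast
  fix t assume t: "t \<in> S"
  note tw = e.twistor_curve_in[OF \<Gamma>]
  obtain U z V s where uz: "(U, z) \<in> atlas M" and vs: "(V, s) \<in> frames E" and xt: "\<Gamma> t \<in> e.tdom U V"
    using e.tdom_exists[OF tw[OF t]] by blast
  obtain V' s' where vs': "(V', s') \<in> frames E'" "fst (\<Gamma> t) \<in> V'" by (rule f.frame_exists)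
  let ?T = "{t\<in>S. fst (\<Gamma> t) \<in> U \<inter> V}"
  have T: "open ?T" "smooth_on ?T (\<lambda>t. e.tchart z s (\<Gamma> t))"
    using e.twistor_curve_chart[OF \<Gamma> S uz vs] by auto
  have tT: "t \<in> ?T" using xt t by (auto simp: e.tdom_def)
  have TY: "\<Gamma> r \<in> e.tdom U V" if "r \<in> ?T" for r using that tw by (auto simp: e.tdom_def)
  have "\<exists>T'. open T' \<and> t \<in> T' \<and> T' \<subseteq> ?T \<and> smooth_on T' (\<lambda>r. f.tchart z s' (F (\<Gamma> r)))"
    by (rule germ_smooth_along_curve_vec[where c="e.tchart z s" and \<Gamma>=\<Gamma> and h="\<lambda>y. f.tchart z s' (F y)",
        OF fibred_map_germ[OF F uz vs xt entry[OF uz vs vs'(1) xt vs'(2)]] T(1) tT T(2) TY])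
  then obtain T' where T': "open T'" "t \<in> T'" "T' \<subseteq> ?T" "smooth_on T' (\<lambda>r. f.tchart z s' (F (\<Gamma> r)))" by blast
  let ?T'' = "T' \<inter> {t\<in>S. fst (\<Gamma> t) \<in> V'}"
  have o: "open ?T''"
    by (intro open_Int T'(1) e.curve_preimage_open[OF e.twistor_curve_base[OF \<Gamma>] S f.frame_open[OF vs'(1)]])
  have "F (\<Gamma> r) \<in> f.tdom U V'" if "r \<in> ?T''" for r
  proof -
    have "r \<in> ?T" "fst (\<Gamma> r) \<in> V'" "r \<in> S" using that T'(3) by auto
    then show ?thesis using F[OF tw] by (simp add: f.tdom_def)
  qed
  moreover have "smooth_on ?T'' (\<lambda>r. f.tchart z s' (F (\<Gamma> r)))" by (rule smooth_on_subset[OF T'(4)]) auto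
  moreover have "t \<in> ?T''" using T'(2) t vs'(2) by simp
  ultimately show "\<exists>U z V s T. (U, z) \<in> atlas M \<and> (V, s) \<in> frames E' \<and> open T \<and> t \<in> T \<and>
        (\<forall>r\<in>T. F (\<Gamma> r) \<in> f.tdom U V) \<and> smooth_on T (\<lambda>r. f.tchart z s (F (\<Gamma> r)))"
    using uz vs'(1) o by blast
qed

end

locale smooth_metric_iso = metric_iso M E g E' g' A
  for M :: "('m::{t2_space,second_countable_topology}, 'n::finite) cmanifold"
    and E :: "('m, 'v::real_vector, 'k::finite) vbundle" and g :: "'m \<Rightarrow> 'v \<Rightarrow> 'v \<Rightarrow> real"
    and E' :: "('m, 'w::real_vector, 'l::finite) vbundle" and g' :: "'m \<Rightarrow> 'w \<Rightarrow> 'w \<Rightarrow> real"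
    and A :: "'m \<Rightarrow> 'v \<times> 'v \<Rightarrow> 'w \<times> 'w" +
  assumes A_smooth: "smooth_csection_near M E p \<sigma> \<Longrightarrow> smooth_csection_near M E' p (\<lambda>q. A q (\<sigma> q))"
begin

abbreviation "F \<equiv> induced_twistor_map E E' g' A"

definition reA :: "('k \<Rightarrow> 'm \<Rightarrow> 'v) \<Rightarrow> 'k \<Rightarrow> 'm \<Rightarrow> 'w" where
  "reA s j q = fst (A q (s j q, 0))"

definition imA :: "('k \<Rightarrow> 'm \<Rightarrow> 'v) \<Rightarrow> 'k \<Rightarrow> 'm \<Rightarrow> 'w" where
  "imA s j q = snd (A q (s j q, 0))"

lemma A_frame: "A q (s j q, 0) = (reA s j q, imA s j q)"
  by (simp add: reA_def imA_def)

context
  fixes V s assumes vs: "(V, s) \<in> frames E"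
begin

lemma A_frame_sections:
  assumes "p \<in> V" "j \<in> bindex E"
  shows "smooth_section_near M E' p (reA s j)" "smooth_section_near M E' p (imA s j)"
proof -
  have "smooth_csection_near M E p (\<lambda>q. (s j q, 0))"
    using e.section_frame[OF vs assms] e.section_zero by (simp add: smooth_csection_near_def)
  from A_smooth[OF this] show "smooth_section_near M E' p (reA s j)" "smooth_section_near M E' p (imA s j)"
    unfolding smooth_csection_near_def by (simp_all add: reA_def[abs_def] imA_def[abs_def])
qed

lemma A_frame_in:
  assumes "p \<in> V" "j \<in> bindex E"
  shows "reA s j p \<in> fibre E' p" "imA s j p \<in> fibre E' p"
  using f.section_fibre[OF A_frame_sections(1)[OF assms]] f.section_fibre[OF A_frame_sections(2)[OF assms]] by auto

lemma A_graph_frame: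
  assumes x: "x \<in> twistor E g" and p: "fst x \<in> V" and j: "j \<in> bindex E"
  shows "re x (s j (fst x)) = reA s j (fst x) - (\<Sum>i\<in>bindex E. e.fmat s x $ i $ j *\<^sub>R imA s i (fst x))"
    and "re x (snd x (s j (fst x))) = imA s j (fst x) + (\<Sum>i\<in>bindex E. e.fmat s x $ i $ j *\<^sub>R reA s i (fst x))"
proof -
  let ?p = "fst x"
  let ?M = "frame_matrix E s ?p (snd x)"
  have sf: "s i ?p \<in> fibre E ?p" if "i \<in> bindex E" for i by (rule e.frame_in_fibre[OF vs p that])
  have c: "(s i ?p, 0) \<in> cfibre E ?p" if "i \<in> bindex E" for i by (simp add: e.cfibre_iff sf[OF that] e.fibre_zero)
  have "(snd x (s j ?p), 0) = (\<Sum>i\<in>bindex E. ?M $ i $ j *\<^sub>R (s i ?p, 0))"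
    unfolding e.matrix_frame[OF vs p e.twistorD(1)[OF x] j] by (simp add: prod_eq_iff fst_sum snd_sum)
  then have "A ?p (snd x (s j ?p), 0) = A ?p (\<Sum>i\<in>bindex E. ?M $ i $ j *\<^sub>R (s i ?p, 0))" by (rule arg_cong)
  also have "\<dots> = (\<Sum>i\<in>bindex E. ?M $ i $ j *\<^sub>R A ?p (s i ?p, 0))" by (rule A_lincomb) (rule c)
  finally have "A ?p (snd x (s j ?p), 0) = (\<Sum>i\<in>bindex E. ?M $ i $ j *\<^sub>R (reA s i ?p, imA s i ?p))"
    unfolding A_frame .
  then have "A ?p (s j ?p, snd x (s j ?p)) = (reA s j ?p, imA s j ?p) + imul (\<Sum>i\<in>bindex E. ?M $ i $ j *\<^sub>R (reA s i ?p, imA s i ?p))"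
    using A_pair[OF sf[OF j] e.End_in[OF e.twistorD(1)[OF x] sf[OF j]]] by (simp add: A_frame)
  then show "re x (s j ?p) = reA s j ?p - (\<Sum>i\<in>bindex E. ?M $ i $ j *\<^sub>R imA s i ?p)"
    and "re x (snd x (s j ?p)) = imA s j ?p + (\<Sum>i\<in>bindex E. ?M $ i $ j *\<^sub>R reA s i ?p)"
    using A_graph[OF x sf[OF j]] by (auto simp: imul_def prod_eq_iff fst_sum snd_sum)
qed

context
  fixes V' s' assumes vs': "(V', s') \<in> frames E'"
begin

definition re_coef :: "'m \<times> ('v \<Rightarrow> 'v) \<Rightarrow> 'k \<Rightarrow> 'l \<Rightarrow> real" where
  "re_coef y j k = coef E' s' (fst y) (reA s j (fst y)) k
     - (\<Sum>i\<in>bindex E. e.fmat s y $ i $ j * coef E' s' (fst y) (imA s i (fst y)) k)"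

definition im_coef :: "'m \<times> ('v \<Rightarrow> 'v) \<Rightarrow> 'k \<Rightarrow> 'l \<Rightarrow> real" where
  "im_coef y j k = coef E' s' (fst y) (imA s j (fst y)) k
     + (\<Sum>i\<in>bindex E. e.fmat s y $ i $ j * coef E' s' (fst y) (reA s i (fst y)) k)"

lemma coef_A_graph:
  assumes y: "y \<in> twistor E g" and p: "fst y \<in> V" "fst y \<in> V'" and j: "j \<in> bindex E"
  shows "coef E' s' (fst y) (re y (s j (fst y))) k = re_coef y j k"
    and "coef E' s' (fst y) (re y (snd y (s j (fst y)))) k = im_coef y j k"
proof -
  note A_in' = A_frame_in[OF p(1)]
  have "coef E' s' (fst y) (reA s j (fst y) + (-1) *\<^sub>R (\<Sum>i\<in>bindex E. e.fmat s y $ i $ j *\<^sub>R imA s i (fst y))) k = re_coef y j k"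
    using A_in' j
    by (simp only: f.coef_add[OF vs' p(2)] f.coef_scale[OF vs' p(2)] f.coef_lincomb[OF vs' p(2)] f.fibre_sum f.fibre_scale re_coef_def)
  then show "coef E' s' (fst y) (re y (s j (fst y))) k = re_coef y j k"
    by (simp add: A_graph_frame[OF y p(1) j])
  show "coef E' s' (fst y) (re y (snd y (s j (fst y)))) k = im_coef y j k"
    unfolding A_graph_frame[OF y p(1) j] im_coef_def using A_in' j
    by (simp add: f.coef_add[OF vs' p(2)] f.coef_lincomb[OF vs' p(2)] f.fibre_sum f.fibre_scale)
qed

text \<open>
  The relation \<open>J' (re a) = re (J a)\<close> is linear in the entries of \<open>J'\<close> for given \<open>J\<close>, and also linear in those of
  \<open>J\<close> for given \<open>J'\<close>. Thus the induced map and its inverse are both found by solving linear systems.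
\<close>
lemma induced_matrix_relation:
  assumes y: "y \<in> twistor E g" and p: "fst y \<in> V" "fst y \<in> V'" and j: "j \<in> bindex E" and l: "l \<in> bindex E'"
  shows "(\<Sum>k\<in>bindex E'. frame_matrix E' s' (fst y) (snd (F y)) $ l $ k * re_coef y j k) = im_coef y j l"
proof -
  have sf: "s j (fst y) \<in> fibre E (fst y)" by (rule e.frame_in_fibre[OF vs p(1) j])
  have J': "snd (F y) \<in> End_fibre E' (fst y)"
    using f.twistorD(1)[OF induced_map(1)[OF y]] by (simp add: induced_map(2)[OF y])
  have "coef E' s' (fst y) (snd (F y) (re y (s j (fst y)))) l = im_coef y j l"
    by (simp add: induced_map_re[OF y sf] coef_A_graph[OF y p j])
  then show ?thesis
    by (simp add: f.matrix_coef[OF vs' p(2) J' re_in[OF y sf] l] coef_A_graph[OF y p j])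
qed

lemma coef_A_smooth:
  assumes "p \<in> V" "p \<in> V'" "j \<in> bindex E" "k \<in> bindex E'"
  shows "smooth_near M p (\<lambda>q. coef E' s' q (reA s j q) k)" "smooth_near M p (\<lambda>q. coef E' s' q (imA s j q) k)"
  using A_frame_sections[OF assms(1,3)] assms(4) unfolding f.section_iff[OF vs' assms(2)] by auto

text \<open>
  The family \<open>r\<close> stands for the linear map sending \<open>s'\<^sub>k\<close> to \<open>r k\<close>. The vectors \<open>re s\<^sub>j\<close> on which it vanishes
  span the fibre, because \<open>re\<close> is onto.
\<close>
lemma re_span:
  fixes r :: "'l \<Rightarrow> 'b::real_vector"
  assumes y: "y \<in> twistor E g" and p: "fst y \<in> V" "fst y \<in> V'"
    and zero: "\<And>j. j \<in> bindex E \<Longrightarrow> (\<Sum>k\<in>bindex E'. re_coef y j k *\<^sub>R r k) = 0" and k: "k \<in> bindex E'"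
  shows "r k = 0"
proof -
  have "s' k (fst y) \<in> fibre E' (fst y)" by (rule f.frame_in_fibre[OF vs' p(2) k])
  then obtain a where a: "a \<in> fibre E (fst y)" "re y a = s' k (fst y)" using re_surj[OF y] by metis
  have sf: "s j (fst y) \<in> fibre E (fst y)" if "j \<in> bindex E" for j by (rule e.frame_in_fibre[OF vs p(1) that])
  have exp: "s' k (fst y) = (\<Sum>j\<in>bindex E. coef E s (fst y) a j *\<^sub>R re y (s j (fst y)))"
    using re_lincomb[OF y sf, of "bindex E" "\<lambda>j. j" "coef E s (fst y) a"] e.coef_expand[OF vs p(1) a(1)] a(2) by simp
  have "r k = (\<Sum>l\<in>bindex E'. coef E' s' (fst y) (s' k (fst y)) l *\<^sub>R r l)"
  proof -
    have "(\<Sum>l\<in>bindex E'. coef E' s' (fst y) (s' k (fst y)) l *\<^sub>R r l) = (\<Sum>l\<in>bindex E'. if l = k then r l else 0)"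
      using k by (intro sum.cong) (auto simp: f.coef_frame[OF vs' p(2)])
    then show ?thesis using k by simp
  qed
  also have "\<dots> = (\<Sum>l\<in>bindex E'. \<Sum>j\<in>bindex E. (coef E s (fst y) a j * re_coef y j l) *\<^sub>R r l)"
  proof (intro sum.cong refl)
    fix l
    have "coef E' s' (fst y) (s' k (fst y)) l = (\<Sum>j\<in>bindex E. coef E s (fst y) a j * re_coef y j l)"
      unfolding exp using f.coef_lincomb[OF vs' p(2), of "bindex E" "\<lambda>j. re y (s j (fst y))"] re_in[OF y sf]
      by (simp add: coef_A_graph[OF y p])
    then show "coef E' s' (fst y) (s' k (fst y)) l *\<^sub>R r l = (\<Sum>j\<in>bindex E. (coef E s (fst y) a j * re_coef y j l) *\<^sub>R r l)"
      by (simp add: scaleR_sum_left)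
  qed
  also have "\<dots> = (\<Sum>j\<in>bindex E. coef E s (fst y) a j *\<^sub>R (\<Sum>l\<in>bindex E'. re_coef y j l *\<^sub>R r l))"
    by (subst sum.swap) (simp add: scaleR_sum_right)
  also have "\<dots> = 0" by (simp add: zero)
  finally show ?thesis .
qed

lemma induced_entry_smooth:
  assumes uz: "(U, z) \<in> atlas M" and x: "x \<in> e.tdom U V" "fst x \<in> V'" and lk: "l \<in> bindex E'" "k \<in> bindex E'"
  shows "germ_smooth (e.tdom U V) (e.tchart z s) x (\<lambda>y. frame_matrix E' s' (fst y) (snd (F y)) $ l $ k)"
proof -
  have p: "fst x \<in> U" "fst x \<in> V" using x by (auto simp: e.tdom_def)
  obtain W0 where W0: "open W0" "e.tchart z s x \<in> W0" "\<forall>y\<in>e.tdom U V. e.tchart z s y \<in> W0 \<longrightarrow> fst y \<in> V'"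
    using e.tdom_nbhd[OF uz vs p(1) f.frame_open[OF vs'] x(2)] by blast
  let ?Y = "{y\<in>e.tdom U V. e.tchart z s y \<in> W0}"
  have xY: "x \<in> ?Y" using x W0 by simp
  have Y: "y \<in> twistor E g" "fst y \<in> V" "fst y \<in> V'" if "y \<in> ?Y" for y
    using that bspec[OF W0(3), of y] by (auto simp: e.tdom_def)
  have pull: "germ_smooth ?Y (e.tchart z s) x (\<lambda>y. h (fst y))" if "smooth_near M (fst x) h" for h
    by (rule germ_smooth_subset[OF e.germ_pullback[OF uz vs that[unfolded e.smooth_near_iff[OF uz p(1)]]]]) auto
  have entry: "germ_smooth ?Y (e.tchart z s) x (\<lambda>y. e.fmat s y $ i $ j)" for i j
    by (rule germ_smooth_subset[OF e.germ_entry[OF uz vs]]) auto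
  have re_s: "germ_smooth ?Y (e.tchart z s) x (\<lambda>y. re_coef y j k)" if "j \<in> bindex E" "k \<in> bindex E'" for j k
    unfolding re_coef_def
    by (intro germ_smooth_diff germ_smooth_sum germ_smooth_mult xY entry pull[OF coef_A_smooth(1)[OF p(2) x(2)]]
        pull[OF coef_A_smooth(2)[OF p(2) x(2)]] that)
  have im_s: "germ_smooth ?Y (e.tchart z s) x (\<lambda>y. im_coef y j k)" if "j \<in> bindex E" "k \<in> bindex E'" for j k
    unfolding im_coef_def
    by (intro germ_smooth_add germ_smooth_sum germ_smooth_mult xY entry pull[OF coef_A_smooth(1)[OF p(2) x(2)]]
        pull[OF coef_A_smooth(2)[OF p(2) x(2)]] that)
  have "germ_smooth ?Y (e.tchart z s) x (\<lambda>y. frame_matrix E' s' (fst y) (snd (F y)) $ l $ k)"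
  proof (rule germ_smooth_solve[where R=re_coef and t="\<lambda>y j. im_coef y j l" and L="bindex E" and K="bindex E'"
        and u="\<lambda>y k. frame_matrix E' s' (fst y) (snd (F y)) $ l $ k" and k=k, OF xY re_s im_s])
    show "(\<Sum>k\<in>bindex E'. re_coef y j k * frame_matrix E' s' (fst y) (snd (F y)) $ l $ k) = im_coef y j l"
      if "y \<in> ?Y" "j \<in> bindex E" for y j
      using induced_matrix_relation[OF Y[OF that(1)] that(2) lk(1)] by (simp add: mult.commute)
    show "a k = 0" if "y \<in> ?Y" "\<And>j. j \<in> bindex E \<Longrightarrow> (\<Sum>k\<in>bindex E'. re_coef y j k * a k) = 0" "k \<in> bindex E'" for y a k
      using re_span[OF Y[OF that(1)], of a k] that(2,3) by simp
  qed (use lk in auto)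
  then show ?thesis using germ_smooth_restrict[where c="e.tchart z s" and x=x, OF W0(1,2)] by simp
qed

text \<open>
  The same relation, solved for \<open>J\<close> instead of \<open>J'\<close>: \<open>(P + J' Q) J = J' P - Q\<close> where \<open>A = P + \<i> Q\<close>. The factor
  \<open>P + J' Q\<close> is injective, because its kernel consists of the \<open>a\<close> with \<open>\<i> A a \<in> E'\<^sup>0\<^sup>,\<^sup>1\<close>, that is
  \<open>\<i> a \<in> E\<^sup>0\<^sup>,\<^sup>1\<close>.
\<close>
lemma inverse_entry_smooth:
  assumes uz: "(U, z) \<in> atlas M" and x: "x \<in> f.tdom U V'" "fst x \<in> V" and ij: "i \<in> bindex E" "j \<in> bindex E"
    and G: "\<And>y. y \<in> twistor E' g' \<Longrightarrow> G y \<in> twistor E g \<and> F (G y) = y"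
  shows "germ_smooth (f.tdom U V') (f.tchart z s') x (\<lambda>y. frame_matrix E s (fst y) (snd (G y)) $ i $ j)"
proof -
  have p: "fst x \<in> U" "fst x \<in> V'" using x by (auto simp: f.tdom_def)
  obtain W0 where W0: "open W0" "f.tchart z s' x \<in> W0" "\<forall>y\<in>f.tdom U V'. f.tchart z s' y \<in> W0 \<longrightarrow> fst y \<in> V"
    using f.tdom_nbhd[OF uz vs' p(1) e.frame_open[OF vs] x(2)] by blast
  let ?Y = "{y\<in>f.tdom U V'. f.tchart z s' y \<in> W0}"
  have xY: "x \<in> ?Y" using x W0 by simp
  have Y: "y \<in> twistor E' g'" "fst y \<in> V'" "fst y \<in> V" if "y \<in> ?Y" for y
    using that bspec[OF W0(3), of y] by (auto simp: f.tdom_def)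
  have pull: "germ_smooth ?Y (f.tchart z s') x (\<lambda>y. h (fst y))" if "smooth_near M (fst x) h" for h
    by (rule germ_smooth_subset[OF f.germ_pullback[OF uz vs' that[unfolded e.smooth_near_iff[OF uz p(1)]]]]) auto
  have entry: "germ_smooth ?Y (f.tchart z s') x (\<lambda>y. f.fmat s' y $ k $ l)" for k l
    by (rule germ_smooth_subset[OF f.germ_entry[OF uz vs']]) auto
  let ?M = "\<lambda>y. f.fmat s' y"
  let ?P = "\<lambda>y j k. coef E' s' (fst y) (reA s j (fst y)) k" and ?Q = "\<lambda>y j k. coef E' s' (fst y) (imA s j (fst y)) k"
  let ?R = "\<lambda>y l i. ?P y i l + (\<Sum>k\<in>bindex E'. ?M y $ l $ k * ?Q y i k)"
  let ?t = "\<lambda>y l. (\<Sum>k\<in>bindex E'. ?M y $ l $ k * ?P y j k) - ?Q y j l"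
  have R_s: "germ_smooth ?Y (f.tchart z s') x (\<lambda>y. ?R y l i)" if "l \<in> bindex E'" "i \<in> bindex E" for l i
    by (intro germ_smooth_add germ_smooth_sum germ_smooth_mult xY entry pull[OF coef_A_smooth(1)[OF x(2) p(2)]]
        pull[OF coef_A_smooth(2)[OF x(2) p(2)]] that)
  have t_s: "germ_smooth ?Y (f.tchart z s') x (\<lambda>y. ?t y l)" if "l \<in> bindex E'" for l
    by (intro germ_smooth_diff germ_smooth_sum germ_smooth_mult xY entry pull[OF coef_A_smooth(1)[OF x(2) p(2)]]
        pull[OF coef_A_smooth(2)[OF x(2) p(2)]] that ij)
  have fstG: "fst (G y) = fst y" if "y \<in> ?Y" for y
    using G[OF Y(1)[OF that]] induced_map(2)[of "G y"] by simp
  have "germ_smooth ?Y (f.tchart z s') x (\<lambda>y. frame_matrix E s (fst y) (snd (G y)) $ i $ j)"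
  proof (rule germ_smooth_solve[where R="?R" and t="?t" and L="bindex E'" and K="bindex E"
        and u="\<lambda>y i. frame_matrix E s (fst y) (snd (G y)) $ i $ j" and k=i, OF xY R_s t_s])
    show "(\<Sum>i\<in>bindex E. ?R y l i * frame_matrix E s (fst y) (snd (G y)) $ i $ j) = ?t y l"
      if y: "y \<in> ?Y" and l: "l \<in> bindex E'" for y l
    proof -
      let ?N = "frame_matrix E s (fst y) (snd (G y))"
      have Gy: "G y \<in> twistor E g" "F (G y) = y" using G[OF Y(1)[OF y]] by auto
      have "(\<Sum>k\<in>bindex E'. ?M y $ l $ k * (?P y j k - (\<Sum>i\<in>bindex E. ?N $ i $ j * ?Q y i k)))
          = ?Q y j l + (\<Sum>i\<in>bindex E. ?N $ i $ j * ?P y i l)"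
        using induced_matrix_relation[OF Gy(1) _ _ ij(2) l] Y[OF y] unfolding re_coef_def im_coef_def Gy(2)
        by (simp add: fstG[OF y])
      moreover have "(\<Sum>k\<in>bindex E'. ?M y $ l $ k * (\<Sum>i\<in>bindex E. ?N $ i $ j * ?Q y i k))
          = (\<Sum>i\<in>bindex E. ?N $ i $ j * (\<Sum>k\<in>bindex E'. ?M y $ l $ k * ?Q y i k))"
        unfolding sum_distrib_left by (subst sum.swap) (simp add: mult_ac)
      ultimately show ?thesis
        by (simp add: right_diff_distrib sum_subtractf distrib_right sum.distrib mult.commute[of "?N $ _ $ _"])
    qed
    show "a i = 0" if y: "y \<in> ?Y" and z: "\<And>l. l \<in> bindex E' \<Longrightarrow> (\<Sum>i\<in>bindex E. ?R y l i * a i) = 0" and i: "i \<in> bindex E" for y a i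
    proof -
      let ?q = "fst y"
      note tw = Y(1)[OF y] and qV' = Y(2)[OF y] and qV = Y(3)[OF y]
      have Gy: "G y \<in> twistor E g" "F (G y) = y" "fst (G y) = ?q" using G[OF tw] fstG[OF y] by auto
      have J': "snd y \<in> End_fibre E' ?q" by (rule f.twistorD(1)[OF tw])
      note A_in' = A_frame_in[OF qV]
      let ?v = "\<Sum>i\<in>bindex E. a i *\<^sub>R s i ?q" and ?Pa = "\<Sum>i\<in>bindex E. a i *\<^sub>R reA s i ?q" and ?Qa = "\<Sum>i\<in>bindex E. a i *\<^sub>R imA s i ?q"
      have sf: "s i ?q \<in> fibre E ?q" if "i \<in> bindex E" for i by (rule e.frame_in_fibre[OF vs qV that])
      have v: "?v \<in> fibre E ?q" using sf by (intro e.fibre_sum e.fibre_scale) auto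
      have PQ: "?Pa \<in> fibre E' ?q" "?Qa \<in> fibre E' ?q" using A_in' by (auto intro!: f.fibre_sum f.fibre_scale)
      have "?Pa + snd y ?Qa = 0"
      proof (rule f.fibre_eqI[OF vs' qV'])
        show "?Pa + snd y ?Qa \<in> fibre E' ?q" "0 \<in> fibre E' ?q"
          using PQ f.End_in[OF J'] f.fibre_add f.fibre_zero by auto
        fix l assume l: "l \<in> bindex E'"
        have "coef E' s' ?q (?Pa + snd y ?Qa) l = (\<Sum>i\<in>bindex E. a i * ?P y i l) + (\<Sum>k\<in>bindex E'. ?M y $ l $ k * (\<Sum>i\<in>bindex E. a i * ?Q y i k))"
          using PQ A_in' f.End_in[OF J' PQ(2)] l
          by (simp add: f.coef_add[OF vs' qV'] f.coef_lincomb[OF vs' qV'] f.matrix_coef[OF vs' qV' J'])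
        also have "(\<Sum>k\<in>bindex E'. ?M y $ l $ k * (\<Sum>i\<in>bindex E. a i * ?Q y i k)) = (\<Sum>i\<in>bindex E. a i * (\<Sum>k\<in>bindex E'. ?M y $ l $ k * ?Q y i k))"
          unfolding sum_distrib_left by (subst sum.swap) (simp add: mult_ac)
        finally show "coef E' s' ?q (?Pa + snd y ?Qa) l = coef E' s' ?q 0 l"
          using z[OF l] by (simp add: f.coef_zero[OF vs'] distrib_left sum.distrib mult.commute[of _ "a _"])
      qed
      then have J'Q: "snd y (- ?Qa) = ?Pa" using f.End_neg[OF J' PQ(2)] by (simp add: add_eq_0_iff2)
      have "A ?q (0, ?v) = (- ?Qa, ?Pa)"
      proof -
        have "(?v, 0) = (\<Sum>i\<in>bindex E. a i *\<^sub>R (s i ?q, 0))" by (simp add: prod_eq_iff fst_sum snd_sum)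
        then have "A ?q (?v, 0) = A ?q (\<Sum>i\<in>bindex E. a i *\<^sub>R (s i ?q, 0))" by (rule arg_cong)
        also have "\<dots> = (\<Sum>i\<in>bindex E. a i *\<^sub>R A ?q (s i ?q, 0))"
          by (rule A_lincomb) (simp add: e.cfibre_iff e.fibre_zero sf)
        finally have "A ?q (?v, 0) = (\<Sum>i\<in>bindex E. a i *\<^sub>R (reA s i ?q, imA s i ?q))" unfolding A_frame .
        then show ?thesis using A_snd[OF v] by (simp add: imul_def prod_eq_iff fst_sum snd_sum)
      qed
      also have "\<dots> \<in> E01 E' (F (G y))"
        unfolding Gy(2) f.E01_graph[OF tw] by (rule image_eqI[of _ _ "- ?Qa"]) (use J'Q f.fibre_neg[OF PQ(2)] in auto)
      finally have "A ?q (0, ?v) \<in> A ?q ` E01 E (G y)" using induced_map(3)[OF Gy(1)] Gy(3) by simp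
      then obtain b where b: "b \<in> fibre E ?q" "A ?q (0, ?v) = A ?q (b, snd (G y) b)"
        unfolding e.E01_graph[OF Gy(1)] Gy(3) by auto
      have "(0, ?v) = (b, snd (G y) b)"
        using b(2) v b(1) graph_in[OF Gy(1)] Gy(3) by (intro A_inj[of _ ?q]) (auto simp: e.cfibre_iff e.fibre_zero)
      then have "?v = 0" using e.End_zero[OF e.twistorD(1)[OF Gy(1)]] by simp
      then show "a i = 0" by (rule e.frame_linear_indep[OF vs qV _ i])
    qed
  qed (use ij in auto)
  then show ?thesis using germ_smooth_restrict[where c="f.tchart z s'" and x=x, OF W0(1,2)] by simp
qed

end
end

lemma induced_map_fibred: "y \<in> twistor E g \<Longrightarrow> F y \<in> twistor E' g' \<and> fst (F y) = fst y"
  using induced_map by blast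

lemma induced_map_smooth:
  "smooth_map (twistor E g) (twistor_smooth_near M E g) (twistor E' g') (twistor_smooth_near M E' g') F"
  by (rule fibred_map_smooth[OF induced_map_fibred induced_entry_smooth])

lemma inverse_map_smooth:
  "smooth_map (twistor E' g') (twistor_smooth_near M E' g') (twistor E g) (twistor_smooth_near M E g)
     (inv_into (twistor E g) F)"
proof -
  interpret inv: metric_pair M E' g' E g ..
  have G: "inv_into (twistor E g) F y \<in> twistor E g \<and> F (inv_into (twistor E g) F y) = y" if "y \<in> twistor E' g'" for y
    using induced_map_bij(1) that by (metis bij_betw_def f_inv_into_f inv_into_into)
  show ?thesis
  proof (rule inv.fibred_map_smooth)
    show "inv_into (twistor E g) F y \<in> twistor E g \<and> fst (inv_into (twistor E g) F y) = fst y" if "y \<in> twistor E' g'" for y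
      using G[OF that] induced_map(2)[of "inv_into (twistor E g) F y"] by simp
  qed (rule inverse_entry_smooth; (assumption | rule G))
qed

end

section \<open>The differential of the induced map\<close>

locale holomorphic_iso = e: conn_bundle M E g D + f: conn_bundle M E' g' D' + smooth_metric_iso M E g E' g' A
  for M :: "('m::{t2_space,second_countable_topology}, 'n::finite) cmanifold"
    and E :: "('m, 'v::real_vector, 'k::finite) vbundle" and g :: "'m \<Rightarrow> 'v \<Rightarrow> 'v \<Rightarrow> real"
    and D :: "('m, 'v) connection"
    and E' :: "('m, 'w::real_vector, 'l::finite) vbundle" and g' :: "'m \<Rightarrow> 'w \<Rightarrow> 'w \<Rightarrow> real"
    and D' :: "('m, 'w) connection"
    and A :: "'m \<Rightarrow> 'v \<times> 'v \<Rightarrow> 'w \<times> 'w" +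
  assumes A_conn: "v \<in> tangent M p \<Longrightarrow> smooth_csection_near M E p \<sigma> \<Longrightarrow>
    conn01 M D' p v (\<lambda>q. A q (\<sigma> q)) = A p (conn01 M D p v \<sigma>)"
begin

text \<open>The value on \<open>s\<^sub>j\<close> of the tensor \<open>\<theta>(w) = \<nabla>'\<^sub>w A - A \<nabla>\<^sub>w\<close>.\<close>
definition theta :: "('k \<Rightarrow> 'm \<Rightarrow> 'v) \<Rightarrow> 'm \<Rightarrow> 'm tvec \<Rightarrow> 'k \<Rightarrow> 'w \<times> 'w" where
  "theta s p w j = (D' p w (reA s j), D' p w (imA s j)) - A p (D p w (s j), 0)"

lemma theta_in:
  assumes "(V, s) \<in> frames E" "p \<in> V" "w \<in> tangent M p" "j \<in> bindex E"
  shows "theta s p w j \<in> cfibre E' p"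
proof -
  have "(D' p w (reA s j), D' p w (imA s j)) \<in> cfibre E' p"
    using f.conn_in[OF assms(3) A_frame_sections(1)[OF assms(1,2,4)]]
      f.conn_in[OF assms(3) A_frame_sections(2)[OF assms(1,2,4)]] by (simp add: f.cfibre_iff)
  moreover have "A p (D p w (s j), 0) \<in> cfibre E' p"
    using e.frame_conn_in[OF assms(3,1,2,4)] e.fibre_zero by (intro A_in) (simp add: e.cfibre_iff)
  ultimately show ?thesis unfolding theta_def by (rule f.cfibre_diff)
qed

text \<open>
  As \<open>A\<close> intertwines the Dolbeault operators, the \<open>(0,1)\<close>-part of \<open>\<theta>\<close> vanishes, so \<open>\<theta>\<close> is complex
  linear in \<open>w\<close>.
\<close>
lemma theta_cstruct:
  assumes vs: "(V, s) \<in> frames E" "p \<in> V" and w: "w \<in> tangent M p" and j: "j \<in> bindex E"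
  shows "theta s p (cstruct M p w) j = imul (theta s p w j)"
proof -
  let ?Iw = "cstruct M p w"
  let ?c = "\<lambda>w. (D' p w (reA s j), D' p w (imA s j))" and ?a = "\<lambda>w. (D p w (s j), 0 :: 'v)"
  have Iw: "?Iw \<in> tangent M p" by (rule e.cstruct(1)[OF w])
  have "smooth_csection_near M E p (\<lambda>q. (s j q, 0))"
    using e.section_frame[OF vs j] e.section_zero by (simp add: smooth_csection_near_def)
  from A_conn[OF w this]
  have "(1/2) *\<^sub>R (?c w + imul (?c ?Iw)) = A p ((1/2) *\<^sub>R (?a w + imul (?a ?Iw)))"
    by (simp add: conn01_def cconn_def reA_def[abs_def] imA_def[abs_def] e.conn_zero_section[OF w] e.conn_zero_section[OF Iw])
  also have "\<dots> = (1/2) *\<^sub>R (A p (?a w) + imul (A p (?a ?Iw)))"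
  proof -
    have "?a w \<in> cfibre E p" "?a ?Iw \<in> cfibre E p"
      using e.frame_conn_in[OF w vs j] e.frame_conn_in[OF Iw vs j] e.fibre_zero by (auto simp: e.cfibre_iff)
    then show ?thesis by (simp only: A_scale A_add A_imul e.cfibre_add e.cfibre_imul)
  qed
  finally have "?c w + imul (?c ?Iw) = A p (?a w) + imul (A p (?a ?Iw))" by simp
  then have "theta s p w j = - imul (theta s p ?Iw j)"
    by (simp only: theta_def imul_simps) (simp add: algebra_simps)
  then show ?thesis by (simp only: imul_simps) simp
qed

lemma theta_zero:
  assumes "(V, s) \<in> frames E" "p \<in> V" "j \<in> bindex E"
  shows "theta s p (\<lambda>f. 0) j = 0"
  using e.conn_zero_vector[OF e.section_frame[OF assms]] f.conn_zero_vector[OF A_frame_sections(1)[OF assms]]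
    f.conn_zero_vector[OF A_frame_sections(2)[OF assms]] A_zero
  by (simp add: theta_def zero_prod_def)

context
  fixes x V s V' s'
  assumes x: "x \<in> twistor E g" and vs: "(V, s) \<in> frames E" and vs': "(V', s') \<in> frames E'"
    and p: "fst x \<in> V" "fst x \<in> V'"
begin

text \<open>
  The projection to the quotient by \<open>E'\<^sup>0\<^sup>,\<^sup>1\<close>: modulo this subspace \<open>y\<close> equals \<open>\<i> proj10 y\<close>, and \<open>\<i>\<close> becomes
  \<open>J'\<close>.
\<close>
definition proj10 :: "'w \<times> 'w \<Rightarrow> 'w" where
  "proj10 y = snd y - snd (F x) (fst y)"

lemma J'_End: "snd (F x) \<in> End_fibre E' (fst x)"
  using f.twistorD(1)[OF induced_map(1)[OF x]] by (simp add: induced_map(2)[OF x])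

lemma proj10_add: "y \<in> cfibre E' (fst x) \<Longrightarrow> y' \<in> cfibre E' (fst x) \<Longrightarrow> proj10 (y + y') = proj10 y + proj10 y'"
  by (cases y; cases y') (simp add: proj10_def f.cfibre_iff f.End_add[OF J'_End])

lemma proj10_imul:
  assumes "y \<in> cfibre E' (fst x)"
  shows "proj10 (imul y) = snd (F x) (proj10 y)"
proof -
  obtain a b where y: "y = (a, b)" and ab: "a \<in> fibre E' (fst x)" "b \<in> fibre E' (fst x)"
    using assms by (auto simp: cfibre_def)
  have "snd (F x) (snd (F x) a) = - a"
    using f.twistorD(2)[OF induced_map(1)[OF x]] ab induced_map(2)[OF x] by simp
  then show ?thesis
    using ab by (simp add: y proj10_def imul_def f.End_neg[OF J'_End] f.End_diff[OF J'_End] f.End_in[OF J'_End])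
qed

lemma proj10_graph: "a \<in> fibre E (fst x) \<Longrightarrow> proj10 (A (fst x) (a, snd x a)) = 0"
  by (simp add: proj10_def A_graph[OF x] induced_map_re[OF x])

text \<open>
  Differentiating \<open>J' (re s\<^sub>j) = re (J s\<^sub>j)\<close> along a curve. With \<open>l\<^sub>j = s\<^sub>j + \<i> J s\<^sub>j\<close>, a section of
  \<open>E\<^sup>0\<^sup>,\<^sup>1\<close>, the result reads \<open>(\<nabla>'J') (re s\<^sub>j) = proj10 (\<nabla>' (A l\<^sub>j))\<close>.
\<close>
lemma derivative_of_relation:
  assumes \<Gamma>: "twistor_curve M E g {-\<epsilon><..<\<epsilon>} \<Gamma>" "\<epsilon> > 0" "\<Gamma> 0 = x" and j: "j \<in> bindex E"
  defines "w \<equiv> velocity (smooth_near M) (\<lambda>t. fst (\<Gamma> t)) 0"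
    and "N \<equiv> vector_derivative (\<lambda>r. e.fmat s (\<Gamma> r)) (at 0)"
    and "N' \<equiv> vector_derivative (\<lambda>r. f.fmat s' (F (\<Gamma> r))) (at 0)"
  shows "(\<Sum>k\<in>bindex E'. re_coef s s' x j k *\<^sub>R f.covd s' (F x) w N' k)
    = proj10 ((D' (fst x) w (reA s j), D' (fst x) w (imA s j))
       + imul (\<Sum>i\<in>bindex E. N $ i $ j *\<^sub>R (reA s i (fst x), imA s i (fst x))
           + e.fmat s x $ i $ j *\<^sub>R (D' (fst x) w (reA s i), D' (fst x) w (imA s i))))"
proof -
  let ?S = "{-\<epsilon><..<\<epsilon>}" and ?\<gamma> = "\<lambda>t. fst (\<Gamma> t)" and ?p = "fst x"
  let ?I = "bindex E" and ?I' = "bindex E'"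
  have S: "open ?S" "0 \<in> ?S" using \<Gamma>(2) by auto
  note \<gamma> = e.twistor_curve_base[OF \<Gamma>(1)] and tw = e.twistor_curve_in[OF \<Gamma>(1)]
  have \<gamma>0: "?\<gamma> 0 = ?p" by (simp add: \<Gamma>(3))
  have w: "w \<in> tangent M ?p" unfolding w_def using e.velocity_in_tangent[OF \<gamma> S] by (simp add: \<gamma>0)
  have F\<Gamma>: "twistor_curve M E' g' ?S (\<lambda>t. F (\<Gamma> t))"
    by (rule fibred_map_curve[OF induced_map_fibred induced_entry_smooth \<Gamma>(1) S(1)])
  let ?M = "frame_matrix E s ?p (snd x)" and ?M' = "frame_matrix E' s' ?p (snd (F x))"
  have fF: "fst (F (\<Gamma> t)) = ?\<gamma> t" if "t \<in> ?S" for t using induced_map(2)[OF tw[OF that]] .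
  have dM: "((\<lambda>t. frame_matrix E s (?\<gamma> t) (snd (\<Gamma> t)) $ i $ l) has_real_derivative N $ i $ l) (at 0)" for i l
    unfolding N_def by (rule has_vector_derivative_entry[OF e.twistor_curve_matrix[OF \<Gamma>(1) S vs]]) (simp add: \<gamma>0 p)
  have dM': "((\<lambda>t. f.fmat s' (F (\<Gamma> t)) $ i $ l) has_real_derivative N' $ i $ l) (at 0)" for i l
    unfolding N'_def by (rule has_vector_derivative_entry[OF f.twistor_curve_matrix[OF F\<Gamma> S vs']]) (simp add: \<Gamma>(3) induced_map(2)[OF x] p)
  define P where "P i k q = coef E' s' q (reA s i q) k" for i k q
  define Q where "Q i k q = coef E' s' q (imA s i q) k" for i k q
  have dP: "((\<lambda>t. P i k (?\<gamma> t)) has_real_derivative w (P i k)) (at 0)"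
    and dQ: "((\<lambda>t. Q i k (?\<gamma> t)) has_real_derivative w (Q i k)) (at 0)" if "i \<in> ?I" "k \<in> ?I'" for i k
    using e.curve_derivative[OF \<gamma> S, of "P i k"] e.curve_derivative[OF \<gamma> S, of "Q i k"]
      coef_A_smooth[OF vs vs' p that] unfolding w_def \<gamma>0 P_def[abs_def] Q_def[abs_def] by auto
  define \<beta> where "\<beta> k = re_coef s s' x j k" for k
  define \<delta> where "\<delta> k = im_coef s s' x j k" for k
  define \<beta>' where "\<beta>' k = w (P j k) - (\<Sum>i\<in>?I. N $ i $ j * Q i k ?p + w (Q i k) * ?M $ i $ j)" for k
  define \<delta>' where "\<delta>' k = w (Q j k) + (\<Sum>i\<in>?I. N $ i $ j * P i k ?p + w (P i k) * ?M $ i $ j)" for k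
  have d\<beta>: "((\<lambda>t. re_coef s s' (\<Gamma> t) j k) has_real_derivative \<beta>' k) (at 0)" if k: "k \<in> ?I'" for k
  proof -
    have "((\<lambda>t. P j k (?\<gamma> t) - (\<Sum>i\<in>?I. frame_matrix E s (?\<gamma> t) (snd (\<Gamma> t)) $ i $ j * Q i k (?\<gamma> t)))
        has_real_derivative w (P j k) - (\<Sum>i\<in>?I. N $ i $ j * Q i k (?\<gamma> 0) + w (Q i k) * frame_matrix E s (?\<gamma> 0) (snd (\<Gamma> 0)) $ i $ j)) (at 0)"
      by (intro DERIV_diff DERIV_sum DERIV_mult dM dP dQ j k)
    then show ?thesis unfolding \<beta>'_def re_coef_def[OF vs vs'] P_def Q_def by (simp add: \<Gamma>(3))
  qed
  have d\<delta>: "((\<lambda>t. im_coef s s' (\<Gamma> t) j k) has_real_derivative \<delta>' k) (at 0)" if k: "k \<in> ?I'" for k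
  proof -
    have "((\<lambda>t. Q j k (?\<gamma> t) + (\<Sum>i\<in>?I. frame_matrix E s (?\<gamma> t) (snd (\<Gamma> t)) $ i $ j * P i k (?\<gamma> t)))
        has_real_derivative w (Q j k) + (\<Sum>i\<in>?I. N $ i $ j * P i k (?\<gamma> 0) + w (P i k) * frame_matrix E s (?\<gamma> 0) (snd (\<Gamma> 0)) $ i $ j)) (at 0)"
      by (intro DERIV_add DERIV_sum DERIV_mult dM dP dQ j k)
    then show ?thesis unfolding \<delta>'_def im_coef_def[OF vs vs'] P_def Q_def by (simp add: \<Gamma>(3))
  qed
  have rel: "(\<Sum>k\<in>?I'. ?M' $ l $ k * \<beta> k) = \<delta> l" if l: "l \<in> ?I'" for l
    unfolding \<beta>_def \<delta>_def by (rule induced_matrix_relation[OF vs vs' x p j l])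
  have rel': "(\<Sum>k\<in>?I'. N' $ l $ k * \<beta> k + \<beta>' k * ?M' $ l $ k) = \<delta>' l" if l: "l \<in> ?I'" for l
  proof -
    have "((\<lambda>t. \<Sum>k\<in>?I'. f.fmat s' (F (\<Gamma> t)) $ l $ k * re_coef s s' (\<Gamma> t) j k)
        has_real_derivative (\<Sum>k\<in>?I'. N' $ l $ k * re_coef s s' (\<Gamma> 0) j k
          + \<beta>' k * f.fmat s' (F (\<Gamma> 0)) $ l $ k)) (at 0)"
      by (intro DERIV_sum DERIV_mult dM' d\<beta>)
    moreover have "((\<lambda>t. \<Sum>k\<in>?I'. f.fmat s' (F (\<Gamma> t)) $ l $ k * re_coef s s' (\<Gamma> t) j k)
        has_real_derivative \<delta>' l) (at 0)"
    proof (rule has_field_derivative_transform_within_open[OF d\<delta>[OF l]])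
      show "open {t\<in>?S. ?\<gamma> t \<in> V \<inter> V'}"
        by (rule e.curve_preimage_open[OF \<gamma> S(1) open_Int[OF e.frame_open[OF vs] f.frame_open[OF vs']]])
      show "0 \<in> {t\<in>?S. ?\<gamma> t \<in> V \<inter> V'}" using S(2) p by (simp add: \<gamma>0)
      fix t assume "t \<in> {t\<in>?S. ?\<gamma> t \<in> V \<inter> V'}"
      then show "im_coef s s' (\<Gamma> t) j l = (\<Sum>k\<in>?I'. f.fmat s' (F (\<Gamma> t)) $ l $ k * re_coef s s' (\<Gamma> t) j k)"
        using induced_matrix_relation[OF vs vs' tw _ _ j l, of t] fF by simp
    qed
    ultimately show ?thesis unfolding \<beta>_def \<Gamma>(3) induced_map(2)[OF x] by (rule DERIV_unique)
  qed
  let ?s = "\<lambda>k. s' k ?p" and ?D = "\<lambda>k. D' ?p w (s' k)" and ?J = "snd (F x)"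
  have sf: "?s k \<in> fibre E' ?p" if "k \<in> ?I'" for k by (rule f.frame_in_fibre[OF vs' p(2) that])
  have Df: "?D k \<in> fibre E' ?p" if "k \<in> ?I'" for k by (rule f.frame_conn_in[OF w vs' p(2) that])
  have Js: "?J (?s k) = (\<Sum>l\<in>?I'. ?M' $ l $ k *\<^sub>R ?s l)" if "k \<in> ?I'" for k
    by (rule f.matrix_frame[OF vs' p(2) J'_End that])
  define bv where "bv = (\<Sum>k\<in>?I'. \<beta>' k *\<^sub>R ?s k) + (\<Sum>k\<in>?I'. \<beta> k *\<^sub>R ?D k)"
  define dv where "dv = (\<Sum>k\<in>?I'. \<delta>' k *\<^sub>R ?s k) + (\<Sum>k\<in>?I'. \<delta> k *\<^sub>R ?D k)"
  have Jb: "?J bv = (\<Sum>l\<in>?I'. (\<Sum>k\<in>?I'. \<beta>' k * ?M' $ l $ k) *\<^sub>R ?s l) + (\<Sum>k\<in>?I'. \<beta> k *\<^sub>R ?J (?D k))"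
  proof -
    have "?J bv = (\<Sum>k\<in>?I'. \<beta>' k *\<^sub>R ?J (?s k)) + (\<Sum>k\<in>?I'. \<beta> k *\<^sub>R ?J (?D k))"
      unfolding bv_def using sf Df
      by (simp add: f.End_add[OF J'_End] f.End_lincomb[OF J'_End] f.fibre_sum f.fibre_scale)
    also have "(\<Sum>k\<in>?I'. \<beta>' k *\<^sub>R ?J (?s k)) = (\<Sum>k\<in>?I'. \<Sum>l\<in>?I'. (\<beta>' k * ?M' $ l $ k) *\<^sub>R ?s l)"
      by (simp add: Js scaleR_sum_right)
    also have "\<dots> = (\<Sum>l\<in>?I'. (\<Sum>k\<in>?I'. \<beta>' k * ?M' $ l $ k) *\<^sub>R ?s l)"
      by (subst sum.swap) (simp add: scaleR_sum_left)
    finally show ?thesis .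
  qed
  have "(\<Sum>k\<in>?I'. \<beta> k *\<^sub>R f.covd s' (F x) w N' k)
      = (\<Sum>k\<in>?I'. \<Sum>l\<in>?I'. (N' $ l $ k * \<beta> k) *\<^sub>R ?s l) + (\<Sum>k\<in>?I'. \<Sum>l\<in>?I'. (?M' $ l $ k * \<beta> k) *\<^sub>R ?D l)
        - (\<Sum>k\<in>?I'. \<beta> k *\<^sub>R ?J (?D k))"
    by (simp add: f.covd_def induced_map(2)[OF x] scaleR_add_right scaleR_diff_right scaleR_sum_right
        sum.distrib sum_subtractf mult.commute)
  also have "(\<Sum>k\<in>?I'. \<Sum>l\<in>?I'. (N' $ l $ k * \<beta> k) *\<^sub>R ?s l) = (\<Sum>l\<in>?I'. (\<delta>' l - (\<Sum>k\<in>?I'. \<beta>' k * ?M' $ l $ k)) *\<^sub>R ?s l)"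
    by (subst sum.swap) (simp add: rel'[symmetric] sum.distrib scaleR_sum_left)
  also have "(\<Sum>k\<in>?I'. \<Sum>l\<in>?I'. (?M' $ l $ k * \<beta> k) *\<^sub>R ?D l) = (\<Sum>l\<in>?I'. \<delta> l *\<^sub>R ?D l)"
    by (subst sum.swap) (simp add: rel[symmetric] scaleR_sum_left)
  finally have 1: "(\<Sum>k\<in>?I'. \<beta> k *\<^sub>R f.covd s' (F x) w N' k) = dv - ?J bv"
    unfolding dv_def Jb by (simp add: scaleR_diff_left sum_subtractf)
  have expP: "reA s i ?p = (\<Sum>k\<in>?I'. P i k ?p *\<^sub>R ?s k)" and expQ: "imA s i ?p = (\<Sum>k\<in>?I'. Q i k ?p *\<^sub>R ?s k)" if "i \<in> ?I" for i
    using f.coef_expand[OF vs' p(2)] A_frame_in[OF vs p(1) that] by (simp_all add: P_def Q_def)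
  have DP: "D' ?p w (reA s i) = (\<Sum>k\<in>?I'. w (P i k) *\<^sub>R ?s k) + (\<Sum>k\<in>?I'. P i k ?p *\<^sub>R ?D k)"
    and DQ: "D' ?p w (imA s i) = (\<Sum>k\<in>?I'. w (Q i k) *\<^sub>R ?s k) + (\<Sum>k\<in>?I'. Q i k ?p *\<^sub>R ?D k)" if "i \<in> ?I" for i
    using f.conn_expand[OF w vs' p(2)] A_frame_sections[OF vs p(1) that]
    by (simp_all add: P_def[abs_def] Q_def[abs_def] sum.distrib)
  have swap: "(\<Sum>i\<in>?I. a i *\<^sub>R (\<Sum>k\<in>?I'. b i k *\<^sub>R (h k :: 'w))) = (\<Sum>k\<in>?I'. (\<Sum>i\<in>?I. a i * b i k) *\<^sub>R h k)" for a b h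
    by (simp add: scaleR_sum_right scaleR_sum_left) (rule sum.swap)
  have b2: "bv = D' ?p w (reA s j) - (\<Sum>i\<in>?I. N $ i $ j *\<^sub>R imA s i ?p + ?M $ i $ j *\<^sub>R D' ?p w (imA s i))"
  proof -
    have "(\<Sum>i\<in>?I. N $ i $ j *\<^sub>R imA s i ?p + ?M $ i $ j *\<^sub>R D' ?p w (imA s i))
        = (\<Sum>k\<in>?I'. (\<Sum>i\<in>?I. N $ i $ j * Q i k ?p) *\<^sub>R ?s k) + ((\<Sum>k\<in>?I'. (\<Sum>i\<in>?I. ?M $ i $ j * w (Q i k)) *\<^sub>R ?s k)
          + (\<Sum>k\<in>?I'. (\<Sum>i\<in>?I. ?M $ i $ j * Q i k ?p) *\<^sub>R ?D k))"
      unfolding swap[symmetric] by (simp add: expQ DQ sum.distrib scaleR_add_right)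
    then show ?thesis
      unfolding bv_def \<beta>'_def \<beta>_def re_coef_def[OF vs vs'] DP[OF j]
      by (simp add: P_def[symmetric] Q_def[symmetric] scaleR_diff_left scaleR_add_left sum.distrib sum_subtractf mult.commute)
  qed
  have d2: "dv = D' ?p w (imA s j) + (\<Sum>i\<in>?I. N $ i $ j *\<^sub>R reA s i ?p + ?M $ i $ j *\<^sub>R D' ?p w (reA s i))"
  proof -
    have "(\<Sum>i\<in>?I. N $ i $ j *\<^sub>R reA s i ?p + ?M $ i $ j *\<^sub>R D' ?p w (reA s i))
        = (\<Sum>k\<in>?I'. (\<Sum>i\<in>?I. N $ i $ j * P i k ?p) *\<^sub>R ?s k) + ((\<Sum>k\<in>?I'. (\<Sum>i\<in>?I. ?M $ i $ j * w (P i k)) *\<^sub>R ?s k)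
          + (\<Sum>k\<in>?I'. (\<Sum>i\<in>?I. ?M $ i $ j * P i k ?p) *\<^sub>R ?D k))"
      unfolding swap[symmetric] by (simp add: expP DP sum.distrib scaleR_add_right)
    then show ?thesis
      unfolding dv_def \<delta>'_def \<delta>_def im_coef_def[OF vs vs'] DQ[OF j]
      by (simp add: P_def[symmetric] Q_def[symmetric] scaleR_add_left sum.distrib mult.commute)
  qed
  have "(D' ?p w (reA s j), D' ?p w (imA s j)) + imul (\<Sum>i\<in>?I. N $ i $ j *\<^sub>R (reA s i ?p, imA s i ?p)
           + ?M $ i $ j *\<^sub>R (D' ?p w (reA s i), D' ?p w (imA s i))) = (bv, dv)"
    unfolding b2 d2 by (simp add: imul_def prod_eq_iff fst_sum snd_sum)
  then show ?thesis using 1 by (simp add: proj10_def \<beta>_def)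
qed

text \<open>
  The vertical part of the image vector splits into the contribution of \<open>\<theta>(w)\<close> and that of the vertical part.
  Both terms on the right are complex linear: the first through \<open>\<theta>\<close>, the second because \<open>J\<close>
  acts as \<open>\<i>\<close> modulo \<open>E\<^sup>0\<^sup>,\<^sup>1\<close>.
\<close>
lemma differential_formula:
  assumes v: "v \<in> twistor_tangent M E g x" and data: "e.tw_data V s x v w N"
  shows "pushforward (twistor_smooth_near M E' g') F x v \<in> twistor_tangent M E' g' (F x)"
    and "\<exists>N'. f.tw_data V' s' (F x) (pushforward (twistor_smooth_near M E' g') F x v) w N' \<and>
      (\<forall>j\<in>bindex E. (\<Sum>k\<in>bindex E'. re_coef s s' x j k *\<^sub>R f.covd s' (F x) w N' k)
        = proj10 (theta s (fst x) w j + (\<Sum>i\<in>bindex E. e.fmat s x $ i $ j *\<^sub>R imul (theta s (fst x) w i)))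
          + proj10 (A (fst x) (0, e.covd s x w N j)))"
proof -
  obtain \<Gamma> \<epsilon> where \<Gamma>: "\<epsilon> > 0" "twistor_curve M E g {-\<epsilon><..<\<epsilon>} \<Gamma>" "\<Gamma> 0 = x" "v = velocity (twistor_smooth_near M E g) \<Gamma> 0"
    using e.twistor_tangentE[OF v] by metis
  let ?S = "{-\<epsilon><..<\<epsilon>}" and ?p = "fst x"
  have S: "open ?S" "0 \<in> ?S" using \<Gamma>(1) by auto
  have F\<Gamma>: "twistor_curve M E' g' ?S (\<lambda>t. F (\<Gamma> t))"
    by (rule fibred_map_curve[OF induced_map_fibred induced_entry_smooth \<Gamma>(2) S(1)])
  have push: "pushforward (twistor_smooth_near M E' g') F x v = velocity (twistor_smooth_near M E' g') (\<lambda>t. F (\<Gamma> t)) 0"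
    using induced_map_smooth x unfolding pushforward_def velocity_def \<Gamma>(3,4)
    by (auto simp: smooth_map_def o_def fun_eq_iff \<Gamma>(3))
  show "pushforward (twistor_smooth_near M E' g') F x v \<in> twistor_tangent M E' g' (F x)"
    unfolding push by (rule f.twistor_tangentI[OF F\<Gamma> \<Gamma>(1)]) (simp add: \<Gamma>(3))
  have wN: "w = velocity (smooth_near M) (\<lambda>t. fst (\<Gamma> t)) 0"
    "N = vector_derivative (\<lambda>r. e.fmat s (\<Gamma> r)) (at 0)"
    using e.tw_data_unique[OF data] e.tw_data_curve0[OF \<Gamma>(2,1,3) vs p(1)] by (auto simp: \<Gamma>(4))
  have w: "w \<in> tangent M ?p" using data by (simp add: e.tw_data_def)
  define N' where "N' = vector_derivative (\<lambda>r. f.fmat s' (F (\<Gamma> r))) (at 0)"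
  have w': "velocity (smooth_near M) (\<lambda>t. fst (F (\<Gamma> t))) 0 = w"
  proof -
    have ev: "((\<lambda>t. h (fst (F (\<Gamma> t)))) has_real_derivative d) (at 0) \<longleftrightarrow> ((\<lambda>t. h (fst (\<Gamma> t))) has_real_derivative d) (at 0)" for h d
    proof (rule DERIV_cong_ev)
      show "\<forall>\<^sub>F t in nhds 0. h (fst (F (\<Gamma> t))) = h (fst (\<Gamma> t))"
        using eventually_nhds_in_open[OF S]
        by eventually_elim (simp add: induced_map(2)[OF e.twistor_curve_in[OF \<Gamma>(2)]])
    qed auto
    show ?thesis
    proof
      fix h :: "'m \<Rightarrow> real"
      show "velocity (smooth_near M) (\<lambda>t. fst (F (\<Gamma> t))) 0 h = w h"
        unfolding wN(1) velocity_def deriv_def by (simp add: ev[of h] \<Gamma>(3) induced_map(2)[OF x])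
    qed
  qed
  have data': "f.tw_data V' s' (F x) (pushforward (twistor_smooth_near M E' g') F x v) w N'"
    using f.tw_data_curve0[OF F\<Gamma> \<Gamma>(1) _ vs', of "F x"] p(2) unfolding push w' N'_def
    by (simp add: \<Gamma>(3) induced_map(2)[OF x])
  have "(\<Sum>k\<in>bindex E'. re_coef s s' x j k *\<^sub>R f.covd s' (F x) w N' k)
        = proj10 (theta s ?p w j + (\<Sum>i\<in>bindex E. frame_matrix E s ?p (snd x) $ i $ j *\<^sub>R imul (theta s ?p w i)))
          + proj10 (A ?p (0, e.covd s x w N j))" if j: "j \<in> bindex E" for j
  proof -
    let ?I = "bindex E" and ?M = "frame_matrix E s ?p (snd x)"
    let ?D = "\<lambda>i. D ?p w (s i)" and ?c = "\<lambda>i. (D' ?p w (reA s i), D' ?p w (imA s i))"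
    let ?u = "(\<Sum>i\<in>?I. N $ i $ j *\<^sub>R s i ?p) + (\<Sum>i\<in>?I. ?M $ i $ j *\<^sub>R ?D i)"
    let ?T = "theta s ?p w j + (\<Sum>i\<in>?I. ?M $ i $ j *\<^sub>R imul (theta s ?p w i))"
    note J = e.twistorD(1)[OF x]
    have sf: "s i ?p \<in> fibre E ?p" if "i \<in> ?I" for i by (rule e.frame_in_fibre[OF vs p(1) that])
    have Df: "?D i \<in> fibre E ?p" if "i \<in> ?I" for i by (rule e.frame_conn_in[OF w vs p(1) that])
    have JD: "snd x (?D j) \<in> fibre E ?p" by (rule e.End_in[OF J Df[OF j]])
    have cov: "e.covd s x w N j \<in> fibre E ?p" by (rule e.covd_in[OF x vs p(1) w j])
    have u: "?u \<in> fibre E ?p" using sf Df by (intro e.fibre_add e.fibre_sum e.fibre_scale) auto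
    have c: "?c i = theta s ?p w i + A ?p (?D i, 0)" for i by (simp add: theta_def)
    have Au: "A ?p (?u, 0) = (\<Sum>i\<in>?I. N $ i $ j *\<^sub>R (reA s i ?p, imA s i ?p)) + (\<Sum>i\<in>?I. ?M $ i $ j *\<^sub>R A ?p (?D i, 0))"
    proof -
      have cs: "(s i ?p, 0) \<in> cfibre E ?p" "(?D i, 0) \<in> cfibre E ?p" if "i \<in> ?I" for i
        using sf[OF that] Df[OF that] e.fibre_zero by (auto simp: e.cfibre_iff)
      have "(?u, 0) = (\<Sum>i\<in>?I. N $ i $ j *\<^sub>R (s i ?p, 0)) + (\<Sum>i\<in>?I. ?M $ i $ j *\<^sub>R (?D i, 0 :: 'v))"
        by (simp add: prod_eq_iff fst_sum snd_sum)
      then have "A ?p (?u, 0) = A ?p ((\<Sum>i\<in>?I. N $ i $ j *\<^sub>R (s i ?p, 0)) + (\<Sum>i\<in>?I. ?M $ i $ j *\<^sub>R (?D i, 0)))"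
        by (rule arg_cong)
      also have "\<dots> = A ?p (\<Sum>i\<in>?I. N $ i $ j *\<^sub>R (s i ?p, 0)) + A ?p (\<Sum>i\<in>?I. ?M $ i $ j *\<^sub>R (?D i, 0))"
        by (rule A_add; intro e.cfibre_sum e.cfibre_scale cs)
      also have "A ?p (\<Sum>i\<in>?I. N $ i $ j *\<^sub>R (s i ?p, 0)) = (\<Sum>i\<in>?I. N $ i $ j *\<^sub>R A ?p (s i ?p, 0))"
        by (rule A_lincomb) (rule cs(1))
      also have "A ?p (\<Sum>i\<in>?I. ?M $ i $ j *\<^sub>R (?D i, 0)) = (\<Sum>i\<in>?I. ?M $ i $ j *\<^sub>R A ?p (?D i, 0))"
        by (rule A_lincomb) (rule cs(2))
      finally show ?thesis unfolding A_frame .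
    qed
    have "?c j + imul (\<Sum>i\<in>?I. N $ i $ j *\<^sub>R (reA s i ?p, imA s i ?p) + ?M $ i $ j *\<^sub>R ?c i)
        = ?T + (A ?p (?D j, 0) + imul (A ?p (?u, 0)))"
      unfolding Au c by (simp only: imul_simps imul_sum sum.distrib scaleR_add_right) (simp add: algebra_simps)
    also have "A ?p (?D j, 0) + imul (A ?p (?u, 0)) = A ?p (?D j, ?u)" by (rule A_pair[OF Df[OF j] u, symmetric])
    also have "(?D j, ?u) = (0, e.covd s x w N j) + (?D j, snd x (?D j))"
      by (simp add: e.covd_def prod_eq_iff)
    also have "A ?p \<dots> = A ?p (0, e.covd s x w N j) + A ?p (?D j, snd x (?D j))"
      using cov Df[OF j] JD e.fibre_zero by (intro A_add) (auto simp: e.cfibre_iff)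
    finally have eq: "?c j + imul (\<Sum>i\<in>?I. N $ i $ j *\<^sub>R (reA s i ?p, imA s i ?p) + ?M $ i $ j *\<^sub>R ?c i)
        = ?T + (A ?p (0, e.covd s x w N j) + A ?p (?D j, snd x (?D j)))" .
    have in_c: "?T \<in> cfibre E' ?p" "A ?p (0, e.covd s x w N j) \<in> cfibre E' ?p" "A ?p (?D j, snd x (?D j)) \<in> cfibre E' ?p"
    proof -
      show "?T \<in> cfibre E' ?p"
        by (intro f.cfibre_add f.cfibre_sum f.cfibre_scale f.cfibre_imul theta_in[OF vs p(1) w] j)
      show "A ?p (0, e.covd s x w N j) \<in> cfibre E' ?p" "A ?p (?D j, snd x (?D j)) \<in> cfibre E' ?p"
        using cov Df[OF j] JD e.fibre_zero by (auto intro!: A_in simp: e.cfibre_iff)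
    qed
    show ?thesis
      using derivative_of_relation[OF \<Gamma>(2,1,3) j, folded wN N'_def] unfolding eq
      by (simp add: proj10_add in_c f.cfibre_add proj10_graph[OF Df[OF j]])
  qed
  then show "\<exists>N'. f.tw_data V' s' (F x) (pushforward (twistor_smooth_near M E' g') F x v) w N' \<and>
      (\<forall>j\<in>bindex E. (\<Sum>k\<in>bindex E'. re_coef s s' x j k *\<^sub>R f.covd s' (F x) w N' k)
        = proj10 (theta s (fst x) w j + (\<Sum>i\<in>bindex E. e.fmat s x $ i $ j *\<^sub>R imul (theta s (fst x) w i)))
          + proj10 (A (fst x) (0, e.covd s x w N j)))"
    using data' by blast
qed

text \<open>
  With \<open>v = B + w\<^sup>\<nabla>\<close>, the vertical parts of the images of \<open>v\<close>, of \<open>JB\<close> and of \<open>(I w)\<^sup>\<nabla>\<close> are given by the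
  previous formula; the last two add up to \<open>J'\<close> times the first.
\<close>
lemma differential_complex_linear:
  assumes v: "v \<in> twistor_tangent M E g x"
  shows "pushforward (twistor_smooth_near M E' g') F x (twistor_cstruct M E g D x v)
    = twistor_cstruct M E' g' D' (F x) (pushforward (twistor_smooth_near M E' g') F x v)"
proof -
  let ?p = "fst x" and ?push = "pushforward (twistor_smooth_near M E' g') F x" and ?I = "bindex E" and ?I' = "bindex E'"
  let ?J = "snd x" and ?J' = "snd (F x)"
  have Fx: "F x \<in> twistor E' g'" "fst (F x) = ?p" using induced_map[OF x] by auto
  note J = e.twistorD(1)[OF x]
  define \<Theta> where "\<Theta> w j = theta s ?p w j + (\<Sum>i\<in>?I. frame_matrix E s ?p ?J $ i $ j *\<^sub>R imul (theta s ?p w i))" for w j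
  obtain B w N where B: "B \<in> vertical E g x" "e.tw_data V s x v w N" "\<And>j. j \<in> ?I \<Longrightarrow> e.covd s x w N j = B (s j ?p)"
    "twistor_cstruct M E g D x v = tadd (vertical_vector M E g x (?J \<circ> B)) (horizontal_lift M E g D x (cstruct M ?p w))"
    using e.twistor_cstruct_formula[OF x v vs p(1)] by metis
  have w: "w \<in> tangent M ?p" using B(2) by (simp add: e.tw_data_def)
  define Iw where "Iw = cstruct M ?p w"
  have Iw: "Iw \<in> tangent M ?p" unfolding Iw_def by (rule e.cstruct(1)[OF w])
  have sf: "s j ?p \<in> fibre E ?p" if "j \<in> ?I" for j by (rule e.frame_in_fibre[OF vs p(1) that])
  note B_End = e.verticalD(1)[OF B(1)]
  have Bs: "B (s j ?p) \<in> fibre E ?p" if "j \<in> ?I" for j by (rule e.End_in[OF B_End sf[OF that]])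
  have JB: "?J \<circ> B \<in> vertical E g x" by (rule e.vertical_compose[OF x B(1)])
  have \<Theta>_in: "\<Theta> u j \<in> cfibre E' ?p" if "u \<in> tangent M ?p" "j \<in> ?I" for u j
    unfolding \<Theta>_def by (intro f.cfibre_add f.cfibre_sum f.cfibre_scale f.cfibre_imul theta_in[OF vs p(1)] that)
  have \<Theta>I: "\<Theta> Iw j = imul (\<Theta> w j)" if "j \<in> ?I" for j
    unfolding \<Theta>_def Iw_def using that by (simp add: theta_cstruct[OF vs p(1) w] imul_simps imul_sum)
  have \<Theta>0: "\<Theta> (\<lambda>f. 0) j = 0" if "j \<in> ?I" for j
    unfolding \<Theta>_def using that by (simp add: theta_zero[OF vs p(1)] imul_simps)
  have A_in0: "A ?p (0, b) \<in> cfibre E' ?p" if "b \<in> fibre E ?p" for b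
    using that e.fibre_zero by (intro A_in) (simp add: e.cfibre_iff)
  \<comment> \<open>\<open>\<i> J b\<close> and \<open>\<i> (\<i> b)\<close> differ by \<open>b + \<i> J b\<close>, an element of \<open>E\<^sup>0\<^sup>,\<^sup>1\<close>.\<close>
  have AJ: "proj10 (A ?p (0, ?J b)) = ?J' (proj10 (A ?p (0, b)))" if b: "b \<in> fibre E ?p" for b
  proof -
    have c: "imul (0, b) \<in> cfibre E ?p" "(b, ?J b) \<in> cfibre E ?p"
      using b e.fibre_zero e.fibre_neg e.End_in[OF J b] by (auto simp: e.cfibre_iff imul_def)
    have "(0, ?J b) = imul (0, b) + (b, ?J b)" by (simp add: imul_def)
    then have "A ?p (0, ?J b) = A ?p (imul (0, b)) + A ?p (b, ?J b)" using A_add[OF c] by simp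
    also have "A ?p (imul (0, b)) = imul (A ?p (0, b))"
      using b e.fibre_zero by (intro A_imul) (simp add: e.cfibre_iff)
    finally have "proj10 (A ?p (0, ?J b)) = proj10 (imul (A ?p (0, b))) + proj10 (A ?p (b, ?J b))"
      using A_in0[OF b] A_in[OF c(2)] by (simp add: proj10_add f.cfibre_imul)
    then show ?thesis by (simp add: proj10_graph[OF b] proj10_imul[OF A_in0[OF b]])
  qed
  have proj_in: "proj10 y \<in> fibre E' ?p" if "y \<in> cfibre E' ?p" for y
    using that by (cases y) (simp add: proj10_def f.cfibre_iff f.fibre_diff f.End_in[OF J'_End])
  let ?\<beta> = "\<lambda>j k. re_coef s s' x j k"
  obtain N' where N': "f.tw_data V' s' (F x) (?push v) w N'"
      "\<And>j. j \<in> ?I \<Longrightarrow> (\<Sum>k\<in>?I'. ?\<beta> j k *\<^sub>R f.covd s' (F x) w N' k) = proj10 (\<Theta> w j) + proj10 (A ?p (0, B (s j ?p)))"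
    using differential_formula(2)[OF v B(2)] B(3) unfolding \<Theta>_def by auto
  obtain N1 where N1: "f.tw_data V' s' (F x) (?push (vertical_vector M E g x (?J \<circ> B))) (\<lambda>f. 0) N1"
      "\<And>j. j \<in> ?I \<Longrightarrow> (\<Sum>k\<in>?I'. ?\<beta> j k *\<^sub>R f.covd s' (F x) (\<lambda>f. 0) N1 k) = ?J' (proj10 (A ?p (0, B (s j ?p))))"
  proof -
    have "e.covd s x (\<lambda>f. 0) (frame_matrix E s ?p (?J \<circ> B)) j = ?J (B (s j ?p))" if "j \<in> ?I" for j
      using e.covd_zero_vector[OF x vs p(1) that] e.matrix_frame[OF vs p(1) e.verticalD(1)[OF JB] that] by simp
    moreover have "proj10 0 = 0" using f.End_zero[OF J'_End] by (simp add: proj10_def)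
    ultimately show ?thesis
      using that differential_formula(2)[OF e.vertical_vector_tangent[OF x JB] e.vertical_vector_data[OF x JB vs p(1)]]
        \<Theta>0 AJ Bs unfolding \<Theta>_def[symmetric] by auto
  qed
  obtain N2 where N2: "f.tw_data V' s' (F x) (?push (horizontal_lift M E g D x Iw)) Iw N2"
      "\<And>j. j \<in> ?I \<Longrightarrow> (\<Sum>k\<in>?I'. ?\<beta> j k *\<^sub>R f.covd s' (F x) Iw N2 k) = ?J' (proj10 (\<Theta> w j))"
  proof -
    obtain Nh where Nh: "e.tw_data V s x (horizontal_lift M E g D x Iw) Iw Nh" "\<forall>j\<in>?I. e.covd s x Iw Nh j = 0"
      using e.horizontal_lift_data[OF x Iw vs p(1)] by blast
    obtain N2 where N2: "f.tw_data V' s' (F x) (?push (horizontal_lift M E g D x Iw)) Iw N2"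
      "\<forall>j\<in>?I. (\<Sum>k\<in>?I'. ?\<beta> j k *\<^sub>R f.covd s' (F x) Iw N2 k) = proj10 (\<Theta> Iw j) + proj10 (A ?p (0, e.covd s x Iw Nh j))"
      using differential_formula(2)[OF e.horizontal_lift_tangent[OF x Iw] Nh(1)] unfolding \<Theta>_def[symmetric] by blast
    have "proj10 (A ?p (0, 0)) = 0"
      using A_zero[of ?p] f.End_zero[OF J'_End] by (simp add: proj10_def zero_prod_def)
    then have "(\<Sum>k\<in>?I'. ?\<beta> j k *\<^sub>R f.covd s' (F x) Iw N2 k) = ?J' (proj10 (\<Theta> w j))" if "j \<in> ?I" for j
      using bspec[OF N2(2) that] bspec[OF Nh(2) that] \<Theta>I[OF that] proj10_imul[OF \<Theta>_in[OF w that]] by simp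
    then show ?thesis by (rule that[OF N2(1)])
  qed
  have lhs: "f.tw_data V' s' (F x) (?push (twistor_cstruct M E g D x v)) Iw (N1 + N2)"
  proof -
    have "?push (tadd a b) = tadd (?push a) (?push b)" for a b
      by (auto simp: pushforward_def tadd_def)
    then show ?thesis using f.tw_data_tadd[OF N1(1) N2(1)] unfolding B(4) Iw_def by simp
  qed
  have p': "fst (F x) \<in> V'" using p(2) Fx(2) by simp
  obtain B' w' N'' where B': "B' \<in> vertical E' g' (F x)" "f.tw_data V' s' (F x) (?push v) w' N''"
    "\<And>k. k \<in> ?I' \<Longrightarrow> f.covd s' (F x) w' N'' k = B' (s' k (fst (F x)))"
    "twistor_cstruct M E' g' D' (F x) (?push v)
      = tadd (vertical_vector M E' g' (F x) (?J' \<circ> B')) (horizontal_lift M E' g' D' (F x) (cstruct M (fst (F x)) w'))"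
    using f.twistor_cstruct_formula[OF Fx(1) differential_formula(1)[OF v B(2)] vs' p'] by metis
  have eq: "w' = w" "N'' = N'" using f.tw_data_unique[OF B'(2) N'(1)] by auto
  have Iw': "Iw \<in> tangent M (fst (F x))" using Iw Fx(2) by simp
  obtain N3 where N3: "f.tw_data V' s' (F x) (horizontal_lift M E' g' D' (F x) Iw) Iw N3" "\<forall>k\<in>?I'. f.covd s' (F x) Iw N3 k = 0"
    using f.horizontal_lift_data[OF Fx(1) Iw' vs' p'] by blast
  have J'B': "?J' \<circ> B' \<in> vertical E' g' (F x)" by (rule f.vertical_compose[OF Fx(1) B'(1)])
  have rhs: "f.tw_data V' s' (F x) (twistor_cstruct M E' g' D' (F x) (?push v)) Iw (frame_matrix E' s' ?p (?J' \<circ> B') + N3)"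
    using f.tw_data_tadd[OF f.vertical_vector_data[OF Fx(1) J'B' vs' p'] N3(1)]
    unfolding B'(4) eq Fx(2) Iw_def[symmetric] .
  have s'f: "s' k ?p \<in> fibre E' ?p" if "k \<in> ?I'" for k by (rule f.frame_in_fibre[OF vs' p(2) that])
  have B'_End: "B' \<in> End_fibre E' ?p" using f.verticalD(1)[OF B'(1)] Fx(2) by simp
  have B's: "B' (s' k ?p) \<in> fibre E' ?p" if "k \<in> ?I'" for k by (rule f.End_in[OF B'_End s'f[OF that]])
  \<comment> \<open>Both sides have the same vertical part, tested on the spanning vectors \<open>re s\<^sub>j\<close>.\<close>
  have "f.covd s' (F x) Iw (N1 + N2) k - ?J' (B' (s' k ?p)) = 0" if "k \<in> ?I'" for k
  proof (rule re_span[OF vs vs' x p _ that, where r="\<lambda>k. f.covd s' (F x) Iw (N1 + N2) k - ?J' (B' (s' k ?p))"])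
    fix j assume j: "j \<in> ?I"
    have cov: "f.covd s' (F x) Iw (N1 + N2) k = f.covd s' (F x) (\<lambda>f. 0) N1 k + f.covd s' (F x) Iw N2 k" if "k \<in> ?I'" for k
      using f.covd_zero_vector[OF Fx(1) vs' p' that] by (simp add: f.covd_add)
    have "(\<Sum>k\<in>?I'. ?\<beta> j k *\<^sub>R ?J' (B' (s' k ?p))) = ?J' (\<Sum>k\<in>?I'. ?\<beta> j k *\<^sub>R B' (s' k ?p))"
      by (rule f.End_lincomb[OF J'_End B's, symmetric])
    also have "(\<Sum>k\<in>?I'. ?\<beta> j k *\<^sub>R B' (s' k ?p)) = proj10 (\<Theta> w j) + proj10 (A ?p (0, B (s j ?p)))"
      using N'(2)[OF j] B'(3) unfolding eq Fx(2) by simp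
    also have "?J' \<dots> = ?J' (proj10 (\<Theta> w j)) + ?J' (proj10 (A ?p (0, B (s j ?p))))"
      by (rule f.End_add[OF J'_End proj_in[OF \<Theta>_in[OF w j]] proj_in[OF A_in0[OF Bs[OF j]]]])
    finally have "(\<Sum>k\<in>?I'. ?\<beta> j k *\<^sub>R ?J' (B' (s' k ?p)))
        = (\<Sum>k\<in>?I'. ?\<beta> j k *\<^sub>R f.covd s' (F x) (\<lambda>f. 0) N1 k) + (\<Sum>k\<in>?I'. ?\<beta> j k *\<^sub>R f.covd s' (F x) Iw N2 k)"
      using N1(2)[OF j] N2(2)[OF j] by simp
    then show "(\<Sum>k\<in>?I'. ?\<beta> j k *\<^sub>R (f.covd s' (F x) Iw (N1 + N2) k - ?J' (B' (s' k ?p)))) = 0"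
      by (simp add: cov scaleR_diff_right scaleR_add_right sum.distrib sum_subtractf)
  qed
  then have covL: "f.covd s' (F x) Iw (N1 + N2) k = ?J' (B' (s' k ?p))" if "k \<in> ?I'" for k using that by simp
  have covR: "f.covd s' (F x) Iw (frame_matrix E' s' ?p (?J' \<circ> B') + N3) k = ?J' (B' (s' k ?p))" if k: "k \<in> ?I'" for k
    using N3(2) k f.matrix_frame[OF vs' p(2) f.End_compose[OF J'_End B'_End] k] by (simp add: f.covd_add Fx(2))
  have "N1 + N2 = frame_matrix E' s' ?p (?J' \<circ> B') + N3"
    by (rule f.covd_inject[OF vs' p', where w=Iw])
      (use covL covR f.tw_data_outside[OF lhs] f.tw_data_outside[OF rhs] in auto)
  then show ?thesis using f.tw_data_eqI[OF Fx(1) vs' p' lhs] rhs by simp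
qed

end

lemma induced_map_biholomorphism:
  "biholomorphism
     (twistor E g) (twistor_smooth_near M E g) (twistor_tangent M E g) (twistor_cstruct M E g D)
     (twistor E' g') (twistor_smooth_near M E' g') (twistor_cstruct M E' g' D') F"
  unfolding biholomorphism_def
proof (intro conjI ballI)
  fix x v assume x: "x \<in> twistor E g" and v: "v \<in> twistor_tangent M E g x"
  obtain V s where vs: "(V, s) \<in> frames E" "fst x \<in> V" by (rule e.frame_exists)
  obtain V' s' where vs': "(V', s') \<in> frames E'" "fst x \<in> V'" by (rule f.frame_exists)
  show "pushforward (twistor_smooth_near M E' g') F x (twistor_cstruct M E g D x v)
    = twistor_cstruct M E' g' D' (F x) (pushforward (twistor_smooth_near M E' g') F x v)"
    by (rule differential_complex_linear[OF x vs(1) vs'(1) vs(2) vs'(2) v])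
qed (rule induced_map_bij(1) induced_map_smooth inverse_map_smooth)+

end

theorem proposition5p13:
  fixes M :: "('m::{t2_space,second_countable_topology}, 'n::finite) cmanifold"
    and E :: "('m, 'v::real_vector, 'k::finite) vbundle"
    and E' :: "('m, 'w::real_vector, 'l::finite) vbundle"
    and g :: "'m \<Rightarrow> 'v \<Rightarrow> 'v \<Rightarrow> real" and g' :: "'m \<Rightarrow> 'w \<Rightarrow> 'w \<Rightarrow> real"
    and D :: "('m, 'v) connection" and D' :: "('m, 'w) connection"
    and A :: "'m \<Rightarrow> 'v \<times> 'v \<Rightarrow> 'w \<times> 'w"
  assumes "complex_manifold M"
    and "vector_bundle M E" and "even (bundle_rank E)"
    and "vector_bundle M E'" and "even (bundle_rank E')"
    and "fibre_metric M E g" and "fibre_metric M E' g'"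
    and "is_connection M E D" and "is_connection M E' D'"
    and "metric_connection M E g D" and "metric_connection M E' g' D'"
    and "curvature_11 M E D" and "curvature_11 M E' D'"
    and "holomorphic_bundle_iso M E D E' D' A"
    and "complex_orthogonal E g g' A"
  defines "F \<equiv> induced_twistor_map E E' g' A"
  shows "(\<forall>x\<in>twistor E g. \<exists>!x'. x' \<in> twistor E' g' \<and> fst x' = fst x \<and>
            E01 E' x' = A (fst x) ` E01 E x) \<and>
         (\<forall>x\<in>twistor E g. fst (F x) = fst x) \<and>
         biholomorphism
           (twistor E g) (twistor_smooth_near M E g) (twistor_tangent M E g) (twistor_cstruct M E g D)
           (twistor E' g') (twistor_smooth_near M E' g') (twistor_cstruct M E' g' D') F"
proof -
  interpret e: conn_bundle M E g D by unfold_locales (rule assms)+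
  interpret f: conn_bundle M E' g' D' by unfold_locales (rule assms)+
  interpret holomorphic_iso M E g D E' g' D' A
    by unfold_locales (use assms(14,15) in \<open>auto simp: holomorphic_bundle_iso_def complex_orthogonal_def\<close>)
  show ?thesis
    unfolding F_def using image_unique induced_map(2) induced_map_biholomorphism by blast
qed

end
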